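(* Let $X$ be a compact complex manifold, and let $(E,\Phi)$ be a rank-2 trace-free co-Higgs bundle on $X$. Then there is a line bundle $\lambda\in\mathrm{Pic}(X)$, a $\lambda$-twisted Higgs field $\phi_0\in H^0(X,\mathcal{E}nd_0(E)\otimes\lambda)$, and a $\lambda^{-1}$-twisted vector field $\xi\in H^0(X,\mathcal{T}_X\otimes\lambda^{-1})$ such that $\Phi=\phi_0\otimes\xi$. If $\phi_0$ is assumed to vanish only on a set of codimension $2$, then $\lambda$ is unique (up to isomorphism), and the pair $(\phi_0,\xi)$ with $\Phi=\phi_0\otimes\xi$ is determined up to the $\mathbb{C}^*$-action $t\cdot(\phi_0\otimes\xi)=(t\phi_0)\otimes(t^{-1}\xi)$.
   Context: $\mathcal{T}_X$ is the holomorphic tangent bundle and $\mathcal{E}nd_0(E)$ is the bundle of trace-free endomorphisms of $E$. A co-Higgs bundle on $X$ is a pair $(E,\Phi)$ where $E$ is a holomorphic vector bundle on $X$ and $\Phi\in H^0(X,\mathcal{E}nd(E)\otimes\mathcal{T}_X)$ satisfies $\Phi\wedge\Phi=0$ in $H^0(X,\mathcal{E}nd(E)\otimes\wedge^2\mathcal{T}_X)$, the wedge product being the commutator on the $\mathcal{E}nd(E)$ factor and the wedge product of vector fields on the $\mathcal{T}_X$ factor. It is trace-free if $\Phi\in H^0(X,\mathcal{E}nd_0(E)\otimes\mathcal{T}_X)$.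
   Formalization: In the uniqueness part X is assumed connected and Φ not identically zero; for Φ = 0 (ξ = 0, any nowhere vanishing φ₀) uniqueness fails, and on a disconnected X the scalar could differ between components. *)

theory Defs
  imports "HOL-Analysis.Analysis"
begin

section \<open>Holomorphic functions on \<open>\<complex>\<^sup>n\<close> and complex manifolds\<close>

text \<open>On an open set \<open>S\<close>: complex (Frechet) differentiability, that is, the real derivative exists
  and is complex linear.\<close>

definition holomorphic_Cn :: "(complex^'n \<Rightarrow> complex) \<Rightarrow> (complex^'n) set \<Rightarrow> bool" where
  "holomorphic_Cn f S \<longleftrightarrow>
     (\<forall>z\<in>S. \<exists>f'. (f has_derivative f') (at z) \<and> (\<forall>c v. f' (c *s v) = c * f' v))"

type_synonym ('a, 'n) chart = "'a set \<times> ('a \<Rightarrow> complex^'n)"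

definition chart_inv :: "('a, 'n) chart \<Rightarrow> complex^'n \<Rightarrow> 'a" where
  "chart_inv c = inv_into (fst c) (snd c)"

text \<open>The manifold is the whole type \<open>'a\<close> (a Hausdorff space) with a holomorphic atlas; its
  dimension is \<open>CARD('n)\<close>.\<close>

definition complex_manifold :: "('a::t2_space, 'n::finite) chart set \<Rightarrow> bool" where
  "complex_manifold A \<longleftrightarrow>
     (\<Union>c\<in>A. fst c) = UNIV \<and>
     (\<forall>c\<in>A. open (fst c) \<and> open (snd c ` fst c) \<and>
             homeomorphism (fst c) (snd c ` fst c) (snd c) (chart_inv c)) \<and>
     (\<forall>c\<in>A. \<forall>d\<in>A. \<forall>k.
        holomorphic_Cn (\<lambda>z. snd c (chart_inv d z) $ k) (snd d ` (fst c \<inter> fst d)))"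

definition holomorphic_fun ::
  "('a::t2_space, 'n::finite) chart set \<Rightarrow> 'a set \<Rightarrow> ('a \<Rightarrow> complex) \<Rightarrow> bool" where
  "holomorphic_fun A W f \<longleftrightarrow>
     (\<forall>c\<in>A. holomorphic_Cn (\<lambda>z. f (chart_inv c z)) (snd c ` (fst c \<inter> W)))"


section \<open>Codimension of analytic subsets\<close>

definition analytic_subset :: "('a::t2_space, 'n::finite) chart set \<Rightarrow> 'a set \<Rightarrow> bool" where
  "analytic_subset A Z \<longleftrightarrow>
     (\<forall>p. \<exists>W F. open W \<and> p \<in> W \<and> finite F \<and> (\<forall>f\<in>F. holomorphic_fun A W f) \<and>
                Z \<inter> W = {x\<in>W. \<forall>f\<in>F. f x = 0})"

text \<open>\<open>p\<close> is a regular point of \<open>Z\<close> at which \<open>Z\<close> has codimension \<open>r\<close>: near \<open>p\<close>, \<open>Z\<close> is cut out by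
  \<open>r\<close> holomorphic functions whose differentials at \<open>p\<close> are linearly independent.\<close>

definition regular_point ::
  "('a::t2_space, 'n::finite) chart set \<Rightarrow> 'a set \<Rightarrow> nat \<Rightarrow> 'a \<Rightarrow> bool" where
  "regular_point A Z r p \<longleftrightarrow> p \<in> Z \<and>
     (\<exists>W (f :: nat \<Rightarrow> 'a \<Rightarrow> complex). open W \<and> p \<in> W \<and>
        (\<forall>j<r. holomorphic_fun A W (f j)) \<and>
        Z \<inter> W = {x\<in>W. \<forall>j<r. f j x = 0} \<and>
        (\<exists>c\<in>A. p \<in> fst c \<and>
           (\<forall>a. (\<forall>v. (\<Sum>j<r. a j * frechet_derivative (\<lambda>z. f j (chart_inv c z)) (at (snd c p)) v) = 0)
                 \<longrightarrow> (\<forall>j<r. a j = 0))))"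

text \<open>The dimension of an analytic set is the largest dimension of the set at a regular point, so
  its codimension is the smallest codimension at a regular point. The empty set has codimension
  at least \<open>r\<close> for every \<open>r\<close>.\<close>

definition codim_at_least ::
  "('a::t2_space, 'n::finite) chart set \<Rightarrow> nat \<Rightarrow> 'a set \<Rightarrow> bool" where
  "codim_at_least A r Z \<longleftrightarrow>
     analytic_subset A Z \<and> (\<forall>p s. regular_point A Z s p \<longrightarrow> r \<le> s)"


section \<open>Holomorphic vector bundles and their sections\<close>

text \<open>A bundle of rank \<open>CARD('r)\<close> is given by an open cover and a holomorphic cocycle of transition
  matrices. \<open>vb_trans V i j\<close> turns coordinates in the frame \<open>j\<close> into coordinates in the frame \<open>i\<close>.\<close>

record ('i, 'a, 'r) vbundle =
  vb_index :: "'i set"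
  vb_open :: "'i \<Rightarrow> 'a set"
  vb_trans :: "'i \<Rightarrow> 'i \<Rightarrow> 'a \<Rightarrow> complex^'r^'r"

definition vector_bundle ::
  "('a::t2_space, 'n::finite) chart set \<Rightarrow> ('i, 'a, 'r::finite) vbundle \<Rightarrow> bool" where
  "vector_bundle A V \<longleftrightarrow>
     (\<Union>i\<in>vb_index V. vb_open V i) = UNIV \<and>
     (\<forall>i\<in>vb_index V. open (vb_open V i)) \<and>
     (\<forall>i\<in>vb_index V. \<forall>j\<in>vb_index V. \<forall>a b.
        holomorphic_fun A (vb_open V i \<inter> vb_open V j) (\<lambda>x. vb_trans V i j x $ a $ b)) \<and>
     (\<forall>i\<in>vb_index V. \<forall>x\<in>vb_open V i. vb_trans V i i x = mat 1) \<and>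
     (\<forall>i\<in>vb_index V. \<forall>j\<in>vb_index V. \<forall>k\<in>vb_index V.
        \<forall>x\<in>vb_open V i \<inter> vb_open V j \<inter> vb_open V k.
          vb_trans V i j x ** vb_trans V j k x = vb_trans V i k x)"

text \<open>\<open>H\<^sup>0(X,V)\<close>. A section is a compatible family of holomorphic coordinate vectors; the values of
  \<open>s i\<close> outside \<open>vb_open V i\<close> carry no meaning.\<close>

definition H0 ::
  "('a::t2_space, 'n::finite) chart set \<Rightarrow> ('i, 'a, 'r::finite) vbundle \<Rightarrow>
     ('i \<Rightarrow> 'a \<Rightarrow> complex^'r) set" where
  "H0 A V = {s.
     (\<forall>i\<in>vb_index V. \<forall>a. holomorphic_fun A (vb_open V i) (\<lambda>x. s i x $ a)) \<and>
     (\<forall>i\<in>vb_index V. \<forall>j\<in>vb_index V. \<forall>x\<in>vb_open V i \<inter> vb_open V j.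
        s i x = vb_trans V i j x *v s j x)}"

definition zero_set ::
  "('i, 'a, 'r::finite) vbundle \<Rightarrow> ('i \<Rightarrow> 'a \<Rightarrow> complex^'r) \<Rightarrow> 'a set" where
  "zero_set V s = {x. \<forall>i\<in>vb_index V. x \<in> vb_open V i \<longrightarrow> s i x = 0}"

text \<open>An isomorphism \<open>V \<rightarrow> W\<close>: \<open>f j i\<close> is its matrix from the frame \<open>i\<close> of \<open>V\<close> to the frame \<open>j\<close>
  of \<open>W\<close>.\<close>

definition bundle_iso ::
  "('a::t2_space, 'n::finite) chart set \<Rightarrow> ('i, 'a, 'r::finite) vbundle \<Rightarrow>
     ('j, 'a, 'r) vbundle \<Rightarrow> ('j \<Rightarrow> 'i \<Rightarrow> 'a \<Rightarrow> complex^'r^'r) \<Rightarrow> bool" where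
  "bundle_iso A V W f \<longleftrightarrow>
     (\<forall>i\<in>vb_index V. \<forall>j\<in>vb_index W.
        (\<forall>a b. holomorphic_fun A (vb_open V i \<inter> vb_open W j) (\<lambda>x. f j i x $ a $ b)) \<and>
        (\<forall>x\<in>vb_open V i \<inter> vb_open W j. invertible (f j i x))) \<and>
     (\<forall>i\<in>vb_index V. \<forall>i'\<in>vb_index V. \<forall>j\<in>vb_index W. \<forall>j'\<in>vb_index W.
        \<forall>x\<in>vb_open V i \<inter> vb_open V i' \<inter> vb_open W j \<inter> vb_open W j'.
          f j i x = vb_trans W j j' x ** f j' i' x ** vb_trans V i' i x)"

text \<open>The holomorphic tangent bundle: the cover consists of the chart domains, the frame of a chart
  is its coordinate frame, and the transition matrices are the complex Jacobians of the coordinate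
  changes.\<close>

definition tangent_bundle ::
  "('a::t2_space, 'n::finite) chart set \<Rightarrow> (('a, 'n) chart, 'a, 'n) vbundle" where
  "tangent_bundle A = \<lparr>
     vb_index = A,
     vb_open = fst,
     vb_trans = (\<lambda>c d x. jacobian (\<lambda>z. snd c (chart_inv d z)) (at (snd d x))) \<rparr>"

definition dual_bundle :: "('i, 'a, 'r::finite) vbundle \<Rightarrow> ('i, 'a, 'r) vbundle" where
  "dual_bundle V = \<lparr>
     vb_index = vb_index V,
     vb_open = vb_open V,
     vb_trans = (\<lambda>i j x. transpose (vb_trans V j i x)) \<rparr>"

definition tensor_bundle ::
  "('i, 'a, 'r::finite) vbundle \<Rightarrow> ('j, 'a, 's::finite) vbundle \<Rightarrow> ('i \<times> 'j, 'a, 'r \<times> 's) vbundle"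
  where
  "tensor_bundle V W = \<lparr>
     vb_index = vb_index V \<times> vb_index W,
     vb_open = (\<lambda>(i, j). vb_open V i \<inter> vb_open W j),
     vb_trans = (\<lambda>(i, j) (i', j') x. \<chi> p q.
        vb_trans V i i' x $ fst p $ fst q * vb_trans W j j' x $ snd p $ snd q) \<rparr>"

text \<open>The coordinate \<open>(a, b)\<close> of an endomorphism is its matrix entry in row \<open>a\<close> and column \<open>b\<close>; the
  transition map is conjugation \<open>M \<mapsto> g M g\<inverse>\<close> by the transition matrix \<open>g\<close> of the bundle.\<close>

definition End_bundle :: "('i, 'a, 'r::finite) vbundle \<Rightarrow> ('i, 'a, 'r \<times> 'r) vbundle" where
  "End_bundle V = \<lparr>
     vb_index = vb_index V,
     vb_open = vb_open V,
     vb_trans = (\<lambda>i j x. \<chi> p q.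
        vb_trans V i j x $ fst p $ fst q * vb_trans V j i x $ snd q $ snd p) \<rparr>"


section \<open>Co-Higgs bundles\<close>

text \<open>The matrix coefficient of the \<open>k\<close>-th frame vector of \<open>W\<close> in an element of \<open>End(V) \<otimes> W\<close>.\<close>

definition end_coeff :: "complex^(('r::finite \<times> 'r) \<times> 'k::finite) \<Rightarrow> 'k \<Rightarrow> complex^'r^'r" where
  "end_coeff u k = (\<chi> a b. u $ ((a, b), k))"

text \<open>For \<open>V = End(E) \<otimes> W\<close>, the sections of the subbundle \<open>End\<^sub>0(E) \<otimes> W\<close>.\<close>

definition H0_tracefree ::
  "('a::t2_space, 'n::finite) chart set \<Rightarrow> ('i, 'a, ('r::finite \<times> 'r) \<times> 'k::finite) vbundle \<Rightarrow>
     ('i \<Rightarrow> 'a \<Rightarrow> complex^(('r \<times> 'r) \<times> 'k)) set" where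
  "H0_tracefree A V =
     {s \<in> H0 A V. \<forall>i\<in>vb_index V. \<forall>x\<in>vb_open V i. \<forall>k. trace (end_coeff (s i x) k) = 0}"

text \<open>For \<open>u = \<Sum>\<^sub>k u\<^sub>k \<partial>\<^sub>k\<close> and \<open>v = \<Sum>\<^sub>m v\<^sub>m \<partial>\<^sub>m\<close>, the product \<open>u \<and> v = \<Sum>\<^sub>k\<^sub>m [u\<^sub>k, v\<^sub>m] \<partial>\<^sub>k \<and> \<partial>\<^sub>m\<close> has
  the coefficient \<open>[u\<^sub>k, v\<^sub>m] - [u\<^sub>m, v\<^sub>k]\<close> at \<open>\<partial>\<^sub>k \<and> \<partial>\<^sub>m\<close> (\<open>k < m\<close> for some ordering of the
  coordinates); it is antisymmetric in \<open>k\<close> and \<open>m\<close>.\<close>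

definition commutator :: "complex^'r^'r \<Rightarrow> complex^'r^'r \<Rightarrow> complex^'r::finite^'r" where
  "commutator M N = M ** N - N ** M"

definition wedge_coeff ::
  "complex^(('r::finite \<times> 'r) \<times> 'k::finite) \<Rightarrow> complex^(('r \<times> 'r) \<times> 'k) \<Rightarrow>
     'k \<Rightarrow> 'k \<Rightarrow> complex^'r^'r" where
  "wedge_coeff u v k m =
     commutator (end_coeff u k) (end_coeff v m) - commutator (end_coeff u m) (end_coeff v k)"

definition co_Higgs_bundle ::
  "('a::t2_space, 'n::finite) chart set \<Rightarrow> ('i, 'a, 'r::finite) vbundle \<Rightarrow>
     ('i \<times> ('a, 'n) chart \<Rightarrow> 'a \<Rightarrow> complex^(('r \<times> 'r) \<times> 'n)) \<Rightarrow> bool" where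
  "co_Higgs_bundle A E \<Phi> \<longleftrightarrow>
     vector_bundle A E \<and>
     \<Phi> \<in> H0 A (tensor_bundle (End_bundle E) (tangent_bundle A)) \<and>
     (\<forall>i\<in>vb_index E. \<forall>c\<in>A. \<forall>x\<in>vb_open E i \<inter> fst c. \<forall>k m.
        wedge_coeff (\<Phi> (i, c) x) (\<Phi> (i, c) x) k m = 0)"

definition tracefree_co_Higgs_bundle ::
  "('a::t2_space, 'n::finite) chart set \<Rightarrow> ('i, 'a, 'r::finite) vbundle \<Rightarrow>
     ('i \<times> ('a, 'n) chart \<Rightarrow> 'a \<Rightarrow> complex^(('r \<times> 'r) \<times> 'n)) \<Rightarrow> bool" where
  "tracefree_co_Higgs_bundle A E \<Phi> \<longleftrightarrow>
     co_Higgs_bundle A E \<Phi> \<and>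
     \<Phi> \<in> H0_tracefree A (tensor_bundle (End_bundle E) (tangent_bundle A))"


section \<open>Decompositions \<open>\<Phi> = \<phi> \<otimes> \<xi>\<close>\<close>

text \<open>A line bundle is a vector bundle whose rank type is \<open>1\<close>.

  The map \<open>(P \<otimes> L) \<times> (Q \<otimes> L\<inverse>) \<rightarrow> P \<otimes> Q\<close> given by the tensor product and the pairing of \<open>L\<close>
  with its dual, in coordinates with respect to a frame of \<open>L\<close> and its dual frame.\<close>

definition contract_tensor ::
  "complex^('p::finite \<times> 1) \<Rightarrow> complex^('q::finite \<times> 1) \<Rightarrow> complex^('p \<times> 'q)" where
  "contract_tensor u w = (\<chi> p. u $ (fst p, 1) * w $ (snd p, 1))"

definition decomposition ::
  "('a::t2_space, 'n::finite) chart set \<Rightarrow> ('i, 'a, 'r::finite) vbundle \<Rightarrow>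
     ('i \<times> ('a, 'n) chart \<Rightarrow> 'a \<Rightarrow> complex^(('r \<times> 'r) \<times> 'n)) \<Rightarrow>
     ('l, 'a, 1) vbundle \<Rightarrow>
     ('i \<times> 'l \<Rightarrow> 'a \<Rightarrow> complex^(('r \<times> 'r) \<times> 1)) \<Rightarrow>
     (('a, 'n) chart \<times> 'l \<Rightarrow> 'a \<Rightarrow> complex^('n \<times> 1)) \<Rightarrow> bool" where
  "decomposition A E \<Phi> L \<phi> \<xi> \<longleftrightarrow>
     vector_bundle A L \<and>
     \<phi> \<in> H0_tracefree A (tensor_bundle (End_bundle E) L) \<and>
     \<xi> \<in> H0 A (tensor_bundle (tangent_bundle A) (dual_bundle L)) \<and>
     (\<forall>i\<in>vb_index E. \<forall>c\<in>A. \<forall>l\<in>vb_index L. \<forall>x\<in>vb_open E i \<inter> fst c \<inter> vb_open L l.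
        \<Phi> (i, c) x = contract_tensor (\<phi> (i, l) x) (\<xi> (c, l) x))"

text \<open>Transported along an isomorphism \<open>\<psi> : L \<rightarrow> L'\<close> of line bundles (with the induced
  isomorphism \<open>\<psi>\<inverse>\<close> of the dual bundles), \<open>(\<phi>, \<xi>)\<close> becomes a pair with respect to \<open>L'\<close>; the
  predicate says that \<open>(\<phi>', \<xi>')\<close> is \<open>t\<close> times this pair under the action
  \<open>t \<cdot> (\<phi>, \<xi>) = (t \<phi>, t\<inverse> \<xi>)\<close>.\<close>

definition related_by_scaling ::
  "('a::t2_space, 'n::finite) chart set \<Rightarrow> ('i, 'a, 'r::finite) vbundle \<Rightarrow>
     ('l, 'a, 1) vbundle \<Rightarrow>
     ('i \<times> 'l \<Rightarrow> 'a \<Rightarrow> complex^(('r \<times> 'r) \<times> 1)) \<Rightarrow>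
     (('a, 'n) chart \<times> 'l \<Rightarrow> 'a \<Rightarrow> complex^('n \<times> 1)) \<Rightarrow>
     ('m, 'a, 1) vbundle \<Rightarrow>
     ('i \<times> 'm \<Rightarrow> 'a \<Rightarrow> complex^(('r \<times> 'r) \<times> 1)) \<Rightarrow>
     (('a, 'n) chart \<times> 'm \<Rightarrow> 'a \<Rightarrow> complex^('n \<times> 1)) \<Rightarrow>
     ('m \<Rightarrow> 'l \<Rightarrow> 'a \<Rightarrow> complex^1^1) \<Rightarrow> complex \<Rightarrow> bool" where
  "related_by_scaling A E L \<phi> \<xi> L' \<phi>' \<xi>' \<psi> t \<longleftrightarrow>
     (\<forall>l\<in>vb_index L. \<forall>m\<in>vb_index L'.
        (\<forall>i\<in>vb_index E. \<forall>x\<in>vb_open E i \<inter> vb_open L l \<inter> vb_open L' m.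
           \<phi>' (i, m) x = (t * \<psi> m l x $ 1 $ 1) *s \<phi> (i, l) x) \<and>
        (\<forall>c\<in>A. \<forall>x\<in>fst c \<inter> vb_open L l \<inter> vb_open L' m.
           \<xi>' (c, m) x = (inverse t * inverse (\<psi> m l x $ 1 $ 1)) *s \<xi> (c, l) x))"

end

theory Submission
  imports Defs "HOL-Complex_Analysis.Complex_Analysis" "HOL-Computational_Algebra.Fundamental_Theorem_Algebra"
begin

text \<open>Commuting trace-free matrices of size two are proportional. Hence the contractions of \<open>\<Phi>\<close> with
  vector fields span at each point a space of dimension at most one, and wherever \<open>\<Phi>\<close> does not
  vanish identically it is proportional to any nonzero column \<open>v\<close> of its matrix of components.
  Locally \<open>v\<close> is a multiple of a primitive family \<open>\<phi>\<close>, one that divides holomorphically every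
  section parallel to it; two primitive families differ by a unit, and these units are the cocycle
  of \<open>\<lambda>\<close>.

  Dividing out the common factor needs no unique factorisation of germs. Restricted to the discs of
  a family transversal to the zero set of an entry \<open>v\<^sub>0\<close>, the quotients \<open>v\<^sub>i / v\<^sub>0\<close> are meromorphic,
  and a polynomial \<open>q\<close> clears their poles exactly when the moments of \<open>q v\<^sub>i / v\<^sub>0\<close> over the boundary
  circles vanish. This is a linear system over the ring of holomorphic functions of the parameter;
  its solution of least degree has bounded roots, hence is monic with holomorphic coefficients after
  Riemann extension, and \<open>q v / v\<^sub>0\<close> is primitive.

  For uniqueness, a family whose common zeros have codimension two is primitive: a common factor that
  is not a unit would have a zero set with a regular point of codimension one. The ratio of two
  decompositions is then a nowhere vanishing section of \<open>Hom(\<lambda>, \<lambda>')\<close>, and two such sections differ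
  by a holomorphic function, which is constant on a compact connected manifold.\<close>

text \<open>Division in several variables is never attacked directly. Each point is the centre of a
  disc, the quotient there is a Cauchy integral over a circle free of zeros, and this integral is
  holomorphic in the centre whether or not the division succeeds. So divisibility need only be
  verified on a dense set of discs. This freedom is essential, because the clearing polynomial is of
  least possible degree only at generic parameters. There, a root that lies outside the disc, or at
  which all cleared entries vanish, could be cancelled; hence the roots are bounded and the cleared
  entries have no common zero. A second obstacle is the degree: every single disc has a clearing
  polynomial, and Baire's theorem turns this into a relation valid for all discs. For uniqueness,
  unless there is a regular point of codimension one, the discs that miss the common zeros are
  dense, and on these quotients exist locally. In the existence part the manifold may be
  disconnected, so the field may vanish on an open set; trivial data are inserted there.\<close>

no_notation fps_nth (infixl \<open>$\<close> 75)

section \<open>Holomorphic functions of several variables\<close>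

lemma norm_vector_scalar_mult: "norm (c *s v) = cmod c * norm (v::complex^'n)"
  by (simp add: norm_vec_def norm_mult L2_set_right_distrib)

lemma continuous_on_vector_scalar_mult [continuous_intros]:
  fixes g :: "'b::topological_space \<Rightarrow> complex^'n"
  assumes "continuous_on S f" "continuous_on S g"
  shows "continuous_on S (\<lambda>x. f x *s g x)"
  unfolding vector_scalar_mult_def by (intro continuous_intros assms)

lemma scaleR_eq_vector_scalar_mult: "r *\<^sub>R v = complex_of_real r *s (v::complex^'n)"
  unfolding vec_eq_iff by (simp add: scaleR_conv_of_real[where 'a=complex])

text \<open>By Osgood's lemma this is holomorphy in the sense of \<open>holomorphic_Cn\<close> on open sets, see
  \<open>holomorphic_Cn_iff_hol\<close>.\<close>

definition hol :: "(complex^'n \<Rightarrow> complex) \<Rightarrow> (complex^'n) set \<Rightarrow> bool" where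
  "hol f S \<longleftrightarrow> continuous_on S f \<and> (\<forall>a v. (\<lambda>t. f (a + t *s v)) holomorphic_on {t. a + t *s v \<in> S})"

lemma hol_continuous: "hol f S \<Longrightarrow> continuous_on S f"
  by (simp add: hol_def)

lemma hol_line:
  assumes "hol f S" "\<And>t. t \<in> T \<Longrightarrow> a + t *s v \<in> S"
  shows "(\<lambda>t. f (a + t *s v)) holomorphic_on T"
  by (rule holomorphic_on_subset[of _ "{t. a + t *s v \<in> S}"]) (use assms in \<open>auto simp: hol_def\<close>)

lemma hol_subset: "hol f S \<Longrightarrow> T \<subseteq> S \<Longrightarrow> hol f T"
  unfolding hol_def by (auto intro: continuous_on_subset holomorphic_on_subset)

lemma hol_cong:
  assumes "hol f S" "\<And>x. x \<in> S \<Longrightarrow> f x = g x"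
  shows "hol g S"
  unfolding hol_def
proof (intro conjI allI)
  show "continuous_on S g"
    using hol_continuous[OF assms(1)] continuous_on_cong[of S S f g] assms(2) by simp
  show "(\<lambda>t. g (a + t *s v)) holomorphic_on {t. a + t *s v \<in> S}" for a v
    by (rule holomorphic_transform[of "\<lambda>t. f (a + t *s v)"]) (use assms in \<open>auto simp: hol_def\<close>)
qed

lemma hol_const [intro, simp]: "hol (\<lambda>_. c) S"
  by (simp add: hol_def)

lemma hol_add [intro]: "hol f S \<Longrightarrow> hol g S \<Longrightarrow> hol (\<lambda>x. f x + g x) S"
  by (auto simp: hol_def intro!: continuous_intros holomorphic_intros)

lemma hol_diff [intro]: "hol f S \<Longrightarrow> hol g S \<Longrightarrow> hol (\<lambda>x. f x - g x) S"
  by (auto simp: hol_def intro!: continuous_intros holomorphic_intros)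

lemma hol_mult [intro]: "hol f S \<Longrightarrow> hol g S \<Longrightarrow> hol (\<lambda>x. f x * g x) S"
  by (auto simp: hol_def intro!: continuous_intros holomorphic_intros)

lemma hol_divide [intro]:
  "hol f S \<Longrightarrow> hol g S \<Longrightarrow> (\<And>x. x \<in> S \<Longrightarrow> g x \<noteq> 0) \<Longrightarrow> hol (\<lambda>x. f x / g x) S"
  by (auto simp: hol_def intro!: continuous_intros holomorphic_intros)

lemma hol_power [intro]: "hol f S \<Longrightarrow> hol (\<lambda>x. f x ^ k) S"
  by (auto simp: hol_def intro!: continuous_intros holomorphic_intros)

lemma hol_sum [intro]: "(\<And>i. i \<in> I \<Longrightarrow> hol (f i) S) \<Longrightarrow> hol (\<lambda>x. \<Sum>i\<in>I. f i x) S"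
  by (induction I rule: infinite_finite_induct) auto

lemma continuous_line: "continuous_on T (\<lambda>t. a + t *s (v::complex^'n))"
  by (intro continuous_intros)

lemma open_line: "open S \<Longrightarrow> open {t. a + t *s (v::complex^'n) \<in> S}"
  using open_vimage[of S "\<lambda>t. a + t *s v"] continuous_line[of UNIV a v] by (simp add: vimage_def)

lemma convex_line: "convex S \<Longrightarrow> convex {t. a + t *s (v::complex^'n) \<in> S}"
proof (rule convexI)
  fix x y :: complex and u w :: real
  assume S: "convex S" and h: "x \<in> {t. a + t *s v \<in> S}" "y \<in> {t. a + t *s v \<in> S}" "0 \<le> u" "0 \<le> w" "u + w = 1"
  have w: "w = 1 - u" using h(5) by simp
  have "a + (u *\<^sub>R x + w *\<^sub>R y) *s v = u *\<^sub>R (a + x *s v) + w *\<^sub>R (a + y *s v)"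
    unfolding w vec_eq_iff by (simp add: scaleR_conv_of_real[where 'a=complex] algebra_simps)
  then show "u *\<^sub>R x + w *\<^sub>R y \<in> {t. a + t *s v \<in> S}"
    using convexD[OF S _ _ h(3-5)] h(1,2) by simp
qed

lemma hol_translate: 
  assumes "hol f S" "\<And>z. z \<in> T \<Longrightarrow> z + c \<in> S"
  shows "hol (\<lambda>z. f (z + c)) T"
  unfolding hol_def
proof (intro conjI allI)
  show "continuous_on T (\<lambda>z. f (z + c))"
    by (rule continuous_on_compose2[OF hol_continuous[OF assms(1)]]) (auto intro!: continuous_intros assms(2))
  fix a v
  have "(\<lambda>t. f ((a + c) + t *s v)) holomorphic_on {t. a + t *s v \<in> T}"
    by (rule hol_line[OF assms(1)]) (use assms(2) in \<open>force simp: algebra_simps\<close>)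
  then show "(\<lambda>t. f (a + t *s v + c)) holomorphic_on {t. a + t *s v \<in> T}"
    by (simp add: algebra_simps)
qed

lemma hol_local:
  assumes "open S" "\<And>x. x \<in> S \<Longrightarrow> \<exists>T. open T \<and> x \<in> T \<and> hol f T"
  shows "hol f S"
  unfolding hol_def
proof (intro conjI allI)
  show "continuous_on S f"
  proof (intro continuous_at_imp_continuous_on ballI)
    fix x assume "x \<in> S"
    then obtain T where "open T" "x \<in> T" "hol f T" using assms(2) by blast
    then show "isCont f x" using continuous_on_eq_continuous_at hol_continuous by blast
  qed
  fix a v
  show "(\<lambda>t. f (a + t *s v)) holomorphic_on {t. a + t *s v \<in> S}"
    unfolding holomorphic_on_def
  proof
    fix t assume "t \<in> {t. a + t *s v \<in> S}"
    then obtain T where T: "open T" "a + t *s v \<in> T" "hol f T" using assms(2) by blast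
    then have "(\<lambda>t. f (a + t *s v)) holomorphic_on {t. a + t *s v \<in> T}" by (simp add: hol_def)
    then have "(\<lambda>t. f (a + t *s v)) field_differentiable (at t)"
      using open_line[OF T(1)] T(2) holomorphic_on_imp_differentiable_at by blast
    then show "(\<lambda>t. f (a + t *s v)) field_differentiable at t within {t. a + t *s v \<in> S}"
      by (rule field_differentiable_at_within)
  qed
qed

section \<open>Contour integrals over a circle depending on a parameter\<close>

lemma continuous_on_contour_integral_param:
  fixes F :: "'b::topological_space \<Rightarrow> complex \<Rightarrow> complex"
  assumes r: "0 < r" and F: "continuous_on (B \<times> sphere 0 r) (\<lambda>p. F (fst p) (snd p))"
  shows "continuous_on B (\<lambda>z. contour_integral (circlepath 0 r) (F z))"
proof -
  have c: "continuous_on (B \<times> {0..1}) (\<lambda>p. F (fst p) (circlepath 0 r (snd p)))"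
  proof (rule continuous_on_compose2[OF F, where f="\<lambda>p. (fst p, circlepath 0 r (snd p))", simplified])
    show "continuous_on (B \<times> {0..1}) (\<lambda>p. (fst p, circlepath 0 r (snd p)))"
      unfolding circlepath_def part_circlepath_def linepath_def by (intro continuous_intros)
    show "(\<lambda>p. (fst p, circlepath 0 r (snd p))) ` (B \<times> {0..1}) \<subseteq> B \<times> sphere 0 r"
      using r path_image_circlepath_nonneg[of r 0] by (force simp: path_image_def)
  qed
  have "continuous_on B (\<lambda>z. integral (cbox 0 1) (\<lambda>x. F z (circlepath 0 r x) * vector_derivative (circlepath 0 r) (at x)))"
    by (rule integral_continuous_on_param)
      (use c in \<open>auto simp: vector_derivative_circlepath split_def intro!: continuous_intros\<close>)
  then show ?thesis by (simp add: contour_integral_integral)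
qed

text \<open>Morera's theorem: integrating over a triangle of parameters and exchanging the order of
  integration leaves, for each \<open>t\<close> on the circle, the integral of \<open>F s t\<close>
  over the triangle, which vanishes by Cauchy.\<close>

lemma holomorphic_on_contour_integral_param:
  fixes F :: "complex \<Rightarrow> complex \<Rightarrow> complex"
  assumes r: "0 < r" and S: "open S" and F: "continuous_on (S \<times> sphere 0 r) (\<lambda>p. F (fst p) (snd p))"
   and h: "\<And>t. t \<in> sphere 0 r \<Longrightarrow> (\<lambda>s. F s t) holomorphic_on S"
  shows "(\<lambda>s. contour_integral (circlepath 0 r) (F s)) holomorphic_on S"
proof -
  let ?I = "\<lambda>s. contour_integral (circlepath 0 r) (F s)"
  have "?I analytic_on S"
  proof (rule Morera_triangle[OF continuous_on_contour_integral_param[OF r F] S], rule impI)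
    fix a b c :: complex assume abc: "convex hull {a,b,c} \<subseteq> S"
    have seg: "closed_segment a b \<subseteq> S" "closed_segment b c \<subseteq> S" "closed_segment c a \<subseteq> S"
      by (rule order_trans[OF _ abc], rule segments_subset_convex_hull)+
    \<comment> \<open>The exchange is made on each side of the triangle separately;
      \<open>ci\<close> is what allows the three resulting circle integrals to be added.\<close>
    have sw: "contour_integral (linepath x y) ?I = contour_integral (circlepath 0 r) (\<lambda>t. contour_integral (linepath x y) (\<lambda>s. F s t))"
      and ci: "(\<lambda>t. contour_integral (linepath x y) (\<lambda>s. F s t)) contour_integrable_on circlepath 0 r"
      if "closed_segment x y \<subseteq> S" for x y
    proof -
      have cF: "continuous_on (closed_segment x y \<times> sphere 0 r) (\<lambda>p. F (fst p) (snd p))"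
        by (rule continuous_on_subset[OF F]) (use that in auto)
      show "contour_integral (linepath x y) ?I = contour_integral (circlepath 0 r) (\<lambda>t. contour_integral (linepath x y) (\<lambda>s. F s t))"

      proof (rule contour_integral_swap)
        show "continuous_on (path_image (linepath x y) \<times> path_image (circlepath 0 r)) (\<lambda>(y1, y2). F y1 y2)"
          using cF r by (simp add: split_def path_image_circlepath_nonneg)
        show "continuous_on {0..1} (\<lambda>t. vector_derivative (circlepath 0 r) (at t))"
          unfolding vector_derivative_circlepath by (intro continuous_intros)
      qed (auto simp: vector_derivative_linepath_at)
      have "continuous_on (sphere 0 r) (\<lambda>t. integral (cbox 0 1) (\<lambda>u. F (linepath x y u) t * (y - x)))"
      proof (rule integral_continuous_on_param)
        have "continuous_on (sphere 0 r \<times> cbox 0 1) (\<lambda>p. F (linepath x y (snd p)) (fst p))"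
        proof (rule continuous_on_compose2[OF cF, where f="\<lambda>p. (linepath x y (snd p), fst p)", unfolded fst_conv snd_conv])
          show "continuous_on (sphere 0 r \<times> cbox 0 1) (\<lambda>p. (linepath x y (snd p), fst p))"
            unfolding linepath_def by (intro continuous_intros)
          show "(\<lambda>p. (linepath x y (snd p), fst p)) ` (sphere 0 r \<times> cbox 0 1) \<subseteq> closed_segment x y \<times> sphere 0 r"
            by (auto simp: linepath_in_path)
        qed
        then show "continuous_on (sphere 0 r \<times> cbox 0 1) (\<lambda>(t, u). F (linepath x y u) t * (y - x))"
          unfolding split_def by (intro continuous_intros)
      qed
      then have "continuous_on (sphere 0 r) (\<lambda>t. contour_integral (linepath x y) (\<lambda>s. F s t))"
        by (simp add: contour_integral_integral)
      then show "(\<lambda>t. contour_integral (linepath x y) (\<lambda>s. F s t)) contour_integrable_on circlepath 0 r"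
        using r by (intro contour_integrable_continuous_circlepath) (auto simp: path_image_circlepath_nonneg)
    qed
    have z: "contour_integral (linepath a b) (\<lambda>s. F s t) + contour_integral (linepath b c) (\<lambda>s. F s t) +
        contour_integral (linepath c a) (\<lambda>s. F s t) = 0" if "t \<in> sphere 0 r" for t
    proof -
      have "((\<lambda>s. F s t) has_contour_integral 0) (linepath a b +++ linepath b c +++ linepath c a)"
        by (rule Cauchy_theorem_triangle) (rule holomorphic_on_subset[OF h[OF that] abc])
      then show ?thesis by (rule has_chain_integral_chain_integral3)
    qed
    have "contour_integral (linepath a b) ?I + contour_integral (linepath b c) ?I + contour_integral (linepath c a) ?I
       = contour_integral (circlepath 0 r) (\<lambda>t. contour_integral (linepath a b) (\<lambda>s. F s t) + contour_integral (linepath b c) (\<lambda>s. F s t) +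
        contour_integral (linepath c a) (\<lambda>s. F s t))"
      
      by (simp only: sw[OF seg(1)] sw[OF seg(2)] sw[OF seg(3)] 
         contour_integral_add[OF contour_integrable_add[OF ci[OF seg(1)] ci[OF seg(2)]] ci[OF seg(3)]]
         contour_integral_add[OF ci[OF seg(1)] ci[OF seg(2)]])
    also have "\<dots> = contour_integral (circlepath 0 r) (\<lambda>t. 0)"
      by (rule contour_integral_eq) (use z r in \<open>auto simp: path_image_circlepath_nonneg\<close>)
    finally show "contour_integral (linepath a b) ?I + contour_integral (linepath b c) ?I + contour_integral (linepath c a) ?I = 0"
      by simp
  qed
  then show ?thesis by (rule analytic_imp_holomorphic)
qed

text \<open>Since \<open>hol\<close> tests holomorphy on complex lines, restricting the parameter to
  a line reduces this to one variable.\<close>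

lemma hol_contour_integral_param:
  assumes r: "0 < r" and B: "open B" and F: "continuous_on (B \<times> sphere 0 r) (\<lambda>p. F (fst p) (snd p))"
   and h: "\<And>t. t \<in> sphere 0 r \<Longrightarrow> hol (\<lambda>z. F z t) B"
  shows "hol (\<lambda>z. contour_integral (circlepath 0 r) (F z)) B"
  unfolding hol_def
proof (intro conjI allI)
  show "continuous_on B (\<lambda>z. contour_integral (circlepath 0 r) (F z))"
    by (rule continuous_on_contour_integral_param[OF r F])
  fix a v
  show "(\<lambda>s. contour_integral (circlepath 0 r) (F (a + s *s v))) holomorphic_on {s. a + s *s v \<in> B}"
  proof (rule holomorphic_on_contour_integral_param[OF r open_line[OF B]])
    show "continuous_on ({s. a + s *s v \<in> B} \<times> sphere 0 r) (\<lambda>p. F (a + fst p *s v) (snd p))"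
      by (rule continuous_on_compose2[OF F, where f="\<lambda>p. (a + fst p *s v, snd p)", simplified])
        (auto intro!: continuous_intros)
    show "(\<lambda>s. F (a + s *s v) t) holomorphic_on {s. a + s *s v \<in> B}" if "t \<in> sphere 0 r" for t
      using h[OF that] by (auto simp: hol_def)
  qed
qed

section \<open>Directional derivatives and the identity theorem\<close>

definition dirD :: "complex^'n \<Rightarrow> (complex^'n \<Rightarrow> complex) \<Rightarrow> complex^'n \<Rightarrow> complex" where
  "dirD e f x = deriv (\<lambda>t. f (x + t *s e)) 0"

lemma line_room:
  fixes x e :: "complex^'n"
  assumes "open S" "x \<in> S"
  obtains \<delta> r where "0 < \<delta>" "0 < r" "\<And>y t. y \<in> ball x \<delta> \<Longrightarrow> t \<in> cball 0 r \<Longrightarrow> y + t *s e \<in> S"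
proof -
  obtain d where d: "d > 0" "ball x d \<subseteq> S" using assms open_contains_ball by blast
  \<comment> \<open>The \<open>+ 1\<close> covers \<open>e = 0\<close>. Displacements
    \<open>t *s e\<close> use up at most \<open>d / 2\<close>; the other half is left for moving the
    base point.\<close>
  define r where "r = d / (2 * (norm e + 1))"
  have ne: "norm e + 1 > 0" using norm_ge_zero[of e] by linarith
  have r: "r > 0" "r * norm e \<le> d/2" 
  proof -
    show "r > 0" using d ne by (simp add: r_def)
    have "r * (norm e + 1) = d/2" using ne unfolding r_def by (simp only: times_divide_eq_left) (simp add: divide_simps)
    then show "r * norm e \<le> d/2" using \<open>r > 0\<close> by (simp add: distrib_left)
  qed
  have "y + t *s e \<in> S" if "y \<in> ball x (d/2)" "t \<in> cball 0 r" for y t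
  proof -
    have "norm (t *s e) \<le> d/2"
      using that(2) r(2) mult_right_mono[of "cmod t" r "norm e"] by (simp add: norm_vector_scalar_mult)
    moreover have "dist x (y + t *s e) \<le> dist x y + norm (t *s e)"
      using dist_triangle[of x "y + t *s e" y] by (simp add: dist_norm)
    ultimately have "dist x (y + t *s e) < d" using that(1) by simp
    then show ?thesis using d(2) by auto
  qed
  then show ?thesis using that[of "d/2" r] d(1) r(1) by simp
qed

text \<open>Cauchy's formula for the first derivative writes \<open>dirD e f\<close> near each point
  as a contour integral of \<open>f (y + t *s e) / t^2\<close>, which is holomorphic in
  \<open>y\<close>.\<close>

lemma hol_dirD:
  assumes "open S" "hol f S"
  shows "hol (dirD e f) S"
proof (rule hol_local[OF assms(1)])
  fix x assume "x \<in> S"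
  then obtain \<delta> r where dr: "0 < \<delta>" "0 < r" "\<And>y t. y \<in> ball x \<delta> \<Longrightarrow> t \<in> cball 0 r \<Longrightarrow> y + t *s e \<in> S"
    using line_room[OF assms(1)] by metis
  have "hol (\<lambda>y. contour_integral (circlepath 0 r) (\<lambda>t. f (y + t *s e) / t^2)) (ball x \<delta>)"
  proof (rule hol_contour_integral_param[OF dr(2) open_ball])
    show "continuous_on (ball x \<delta> \<times> sphere 0 r) (\<lambda>p. f (fst p + snd p *s e) / (snd p)^2)"
      using dr by (intro continuous_intros continuous_on_compose2[OF hol_continuous[OF assms(2)]]) auto
    show "hol (\<lambda>z. f (z + t *s e) / t\<^sup>2) (ball x \<delta>)" if "t \<in> sphere 0 r" for t
      using that dr by (intro hol_divide hol_const hol_translate[OF assms(2)]) auto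
  qed
  then have "hol (\<lambda>y. contour_integral (circlepath 0 r) (\<lambda>t. f (y + t *s e) / t^2) * (1 / (2*pi*\<i>))) (ball x \<delta>)"
    by (intro hol_mult hol_const)
  moreover have "contour_integral (circlepath 0 r) (\<lambda>t. f (y + t *s e) / t^2) * (1/ (2*pi*\<i>)) = dirD e f y"
    if "y \<in> ball x \<delta>" for y
  proof -
    have hl: "(\<lambda>t. f (y + t *s e)) holomorphic_on cball 0 r" using dr(3)[OF that]
      by (intro hol_line[OF assms(2)])
    have "((\<lambda>t. f (y + t *s e)) has_field_derivative (1 / (2 * of_real pi * \<i>) * 
        contour_integral (circlepath 0 r) (\<lambda>u. f (y + u *s e) / (u - 0)^2))) (at 0)"
      by (rule Cauchy_derivative_integral_circlepath(2))
        (use hl dr(2) in \<open>auto intro: holomorphic_on_imp_continuous_on holomorphic_on_subset\<close>)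
    from DERIV_imp_deriv[OF this] show ?thesis by (simp add: dirD_def)
  qed
  ultimately have "hol (dirD e f) (ball x \<delta>)" by (rule hol_cong)
  then show "\<exists>T. open T \<and> x \<in> T \<and> hol (dirD e f) T" using dr(1) by (intro exI[of _ "ball x \<delta>"]) auto
qed

lemma deriv_line:
  shows "deriv (\<lambda>t. f (x + t *s e)) t = dirD e f (x + t *s e)"
proof -
  have "dirD e f (x + t *s e) = deriv (\<lambda>s. f (x + (t + s) *s e)) 0"
    by (simp add: dirD_def algebra_simps vector_sadd_rdistrib add.assoc)
  also have "\<dots> = deriv (\<lambda>t. f (x + t *s e)) (t + 0)"
    using deriv_shift_0[of "\<lambda>t. f (x + t *s e)" t] by (simp add: o_def)
  finally show ?thesis by simp
qed

lemma higher_deriv_line: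
  "(deriv ^^ k) (\<lambda>t. f (x + t *s e)) = (\<lambda>t. (dirD e ^^ k) f (x + t *s e))"
proof (induction k)
  case (Suc k)
  then show ?case by (simp only: funpow.simps o_apply Suc deriv_line)
qed simp

lemma hol_dirD_funpow: "open S \<Longrightarrow> hol f S \<Longrightarrow> hol ((dirD e ^^ k) f) S"
  by (induction k) (auto intro: hol_dirD)

text \<open>A point of \<open>V\<close> and \<open>y\<close> span a complex line whose trace on
  \<open>B\<close> is convex, hence connected, so the one-variable identity theorem on that line
  suffices.\<close>

lemma hol_zero_on_convex:
  assumes "open B" "convex B" "hol f B" "open V" "V \<noteq> {}" "V \<subseteq> B" "\<And>x. x \<in> V \<Longrightarrow> f x = 0" "y \<in> B"
  shows "f y = 0"
proof -
  obtain x where x: "x \<in> V" using assms(5) by auto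
  let ?T = "{t. x + t *s (y - x) \<in> B}"
  have "(\<lambda>t. f (x + t *s (y - x))) 1 = 0"
  proof (rule analytic_continuation_open[of "{t. x + t *s (y - x) \<in> V}" ?T "\<lambda>t. f (x + t *s (y - x))" "\<lambda>_. 0"])
    show "open {t. x + t *s (y - x) \<in> V}" "open ?T" by (rule open_line; fact)+
    show "connected ?T" by (rule convex_connected[OF convex_line[OF assms(2)]])
    show "(\<lambda>t. f (x + t *s (y - x))) holomorphic_on ?T" by (rule hol_line[OF assms(3)]) simp
    have "0 \<in> {t. x + t *s (y - x) \<in> V}" using x by simp
    then show "{t. x + t *s (y - x) \<in> V} \<noteq> {}" by blast
  qed (use assms in auto)
  then show ?thesis by simp
qed

lemma open_nonzero:
  fixes f :: "complex^'n \<Rightarrow> complex"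
  assumes "open B" "hol f B"
  shows "open {x \<in> B. f x \<noteq> 0}"
  using continuous_open_preimage[OF hol_continuous[OF assms(2)] assms(1), of "-{0}"]
  by (simp add: vimage_def Int_def open_Compl)

lemma hol_nonzero_dense:
  assumes "open B" "convex B" "hol f B" "x0 \<in> B" "f x0 \<noteq> 0" "open V" "V \<noteq> {}" "V \<subseteq> B"
  shows "\<exists>x\<in>V. f x \<noteq> 0"
  using hol_zero_on_convex[OF assms(1-3,6-8), of x0] assms(4,5) by blast

text \<open>Holomorphic functions on a convex open set have no zero divisors. This is what makes
  elimination over them possible later.\<close>

lemma hol_mult_nonzero:
  assumes "open B" "convex B" "hol f B" "hol g B" "x0 \<in> B" "f x0 \<noteq> 0" "y0 \<in> B" "g y0 \<noteq> 0"
  shows "\<exists>x\<in>B. f x * g x \<noteq> 0"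
proof -
  obtain x where "x \<in> {x \<in> B. f x \<noteq> 0}" "g x \<noteq> 0"
    using hol_nonzero_dense[OF assms(1,2,4,7,8) open_nonzero[OF assms(1,3)]] assms(5,6) by blast
  then show ?thesis by auto
qed

section \<open>Taylor estimates and Osgood's lemma\<close>

lemma dirD_zero [simp]: "dirD 0 f x = 0"
  by (simp add: dirD_def)

lemma line_has_field_derivative:
  assumes "open S" "hol f S" "x \<in> S"
  shows "((\<lambda>t. f (x + t *s e)) has_field_derivative dirD e f x) (at 0)"
proof -
  have "(\<lambda>t. f (x + t *s e)) holomorphic_on {t. x + t *s e \<in> S}" by (rule hol_line[OF assms(2)]) simp
  from holomorphic_derivI[OF this open_line[OF assms(1)], of 0] show ?thesis
    using assms(3) by (simp add: dirD_def)
qed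

lemma dirD_scale:
  assumes "open S" "hol f S" "x \<in> S"
  shows "dirD (c *s e) f x = c * dirD e f x"
proof -
  have "((\<lambda>t. f (x + (c * t) *s e)) has_field_derivative dirD e f x * c) (at 0)"
    by (rule DERIV_chain2[where f="\<lambda>t. f (x + t *s e)" and g="\<lambda>t. c * t"])
      (use line_has_field_derivative[OF assms] in \<open>auto intro!: derivative_eq_intros\<close>)
  moreover have "((\<lambda>t. f (x + t *s (c *s e))) has_field_derivative dirD (c *s e) f x) (at 0)"
    by (rule line_has_field_derivative[OF assms])
  ultimately show ?thesis by (simp add: mult.commute DERIV_unique)
qed

text \<open>On the line through \<open>x\<close> in direction \<open>v\<close>, the parameters with
  \<open>cmod t \<le> \<rho>\<close> stay in the ball. Cauchy's inequality on discs of radius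
  \<open>\<rho> / 2\<close> bounds the second derivative by \<open>2 * M / (\<rho> / 2)^2\<close>,
  the source of the factor 8. The point \<open>t = 1\<close> is within reach because
  \<open>norm v \<le> d / 2\<close> means \<open>\<rho> \<ge> 2\<close>.\<close>

lemma dirD_taylor:
  assumes "hol f S" "open S" "cball x d \<subseteq> S" "\<And>y. y \<in> cball x d \<Longrightarrow> cmod (f y) \<le> M" "norm v \<le> d / 2" "0 < d"
  shows "cmod (f (x + v) - f x - dirD v f x) \<le> 8 * M / d^2 * norm v ^ 2"
proof (cases "v = 0")
  case False
  define \<rho> where "\<rho> = d / norm v"
  have \<rho>: "\<rho> \<ge> 2" "\<rho> > 0" using assms(5,6) False by (auto simp: \<rho>_def field_simps)
  define g where "g = (\<lambda>t. f (x + t *s v))"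
  have inS: "x + t *s v \<in> cball x d" if "cmod t \<le> \<rho>" for t
    using that False by (simp add: dist_norm norm_vector_scalar_mult \<rho>_def pos_le_divide_eq)
  have hg: "g holomorphic_on {t. x + t *s v \<in> S}" unfolding g_def by (rule hol_line[OF assms(1)]) simp
  have oT: "open {t. x + t *s v \<in> S}" by (rule open_line[OF assms(2)])
  have b2: "cmod ((deriv ^^ 2) g t) \<le> 8 * M / \<rho>^2" if "t \<in> cball 0 (\<rho>/2)" for t
  proof -
    have in2: "cmod s \<le> \<rho>" if "s \<in> cball t (\<rho>/2)" for s
      using that \<open>t \<in> _\<close> norm_triangle_sub[of s t] by (auto simp: dist_norm norm_minus_commute)
    have sub: "cball t (\<rho>/2) \<subseteq> {t. x + t *s v \<in> S}" using in2 inS assms(3) by blast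
    have "cmod ((deriv ^^ 2) g t) \<le> fact 2 * M / (\<rho>/2)^2"
    proof (rule Cauchy_inequality)
      show "g holomorphic_on ball t (\<rho>/2)" using hg sub by (meson ball_subset_cball holomorphic_on_subset)
      show "continuous_on (cball t (\<rho>/2)) g" using hg sub by (meson holomorphic_on_imp_continuous_on continuous_on_subset)
      show "0 < \<rho>/2" using \<rho> by simp
      show "cmod (g s) \<le> M" if "cmod (t - s) = \<rho>/2" for s
        unfolding g_def by (rule assms(4)[OF inS[OF in2]]) (use that in \<open>simp add: dist_norm\<close>)
    qed
    then show ?thesis by (simp add: power_divide)
  qed
  have "cmod ((deriv ^^ 0) g 1 - (\<Sum>i\<le>1. (deriv ^^ i) g 0 * (1 - 0) ^ i / fact i)) \<le> (8 * M / \<rho>^2) * cmod (1 - 0) ^ Suc 1 / fact 1"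
  proof (rule complex_Taylor[of "cball 0 (\<rho>/2)"])
    fix i and t :: complex assume "t \<in> cball 0 (\<rho>/2)"
    then have t: "t \<in> {t. x + t *s v \<in> S}" using inS[of t] assms(3) \<rho>(2) by auto
    have "((deriv ^^ i) g has_field_derivative deriv ((deriv ^^ i) g) t) (at t)"
      by (rule holomorphic_derivI[OF holomorphic_higher_deriv[OF hg oT] oT t])
    then show "((deriv ^^ i) g has_field_derivative (deriv ^^ Suc i) g t) (at t within cball 0 (\<rho>/2))"
      by (simp add: has_field_derivative_at_within)
  qed (use b2 \<rho> in \<open>auto simp: numeral_2_eq_2\<close>)
  then have "cmod (g 1 - g 0 - deriv g 0) \<le> 8 * M / \<rho>^2" by (simp add: algebra_simps)
  then show ?thesis
    by (simp add: g_def dirD_def \<rho>_def power_divide)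
qed simp

text \<open>The heart of Osgood's lemma. Going from \<open>x\<close> to \<open>x + s (u + v)\<close>
  directly, or by way of \<open>x + s u\<close>, gives two first-order expansions with errors of
  order \<open>s^2\<close>. Dividing by \<open>s\<close> and letting it tend to 0 compares the
  derivatives, because \<open>dirD v f\<close> is continuous.\<close>

lemma dirD_add:
  assumes "open S" "hol f S" "x \<in> S"
  shows "dirD (u + v) f x = dirD u f x + dirD v f x"
proof -
  obtain d0 where d0: "d0 > 0" "cball x d0 \<subseteq> S" using assms open_contains_cball by blast
  define d where "d = d0 / 2"
  have d: "d > 0" and sub: "cball y d \<subseteq> cball x d0" if "y \<in> cball x d" for y
    using that d0 cball_subset_cball_iff[of y d x d0] by (auto simp: d_def dist_commute)
  have d: "d > 0" using d0 by (simp add: d_def)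
  have "compact (f ` cball x d0)"
    by (rule compact_continuous_image[OF continuous_on_subset[OF hol_continuous[OF assms(2)] d0(2)]]) simp
  then obtain M where M: "\<And>y. y \<in> cball x d0 \<Longrightarrow> cmod (f y) \<le> M"
    by (meson bounded_iff compact_imp_bounded image_eqI)
  define C where "C = 8 * M / d^2"
  have est: "cmod (f (y + w) - f y - dirD w f y) \<le> C * norm w ^ 2" if "y \<in> cball x d" "norm w \<le> d/2" for y w
    unfolding C_def by (rule dirD_taylor[OF assms(2,1)]) (use sub[OF that(1)] M d0 d that in auto)
  define A where "A = (\<lambda>s. dirD v f (x + complex_of_real s *s u))"
  define K where "K = C * (norm (u+v))^2 + C * norm v^2 + C * norm u^2"
  have cont: "(A \<longlongrightarrow> dirD v f x) (at_right 0)"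
  proof -
    have "isCont (dirD v f) x"
      using hol_continuous[OF hol_dirD[OF assms(1,2)]] assms(1,3) continuous_on_eq_continuous_at by blast
    moreover have "((\<lambda>s. x + complex_of_real s *s u) \<longlongrightarrow> x + complex_of_real 0 *s u) (at_right 0)"
    proof -
      have "continuous_on UNIV (\<lambda>s. x + complex_of_real s *s u)" by (intro continuous_intros)
      then have "isCont (\<lambda>s. x + complex_of_real s *s u) 0" by (simp add: continuous_on_eq_continuous_at)
      then show ?thesis unfolding isCont_def using filterlim_at_split by blast
    qed
    ultimately show ?thesis unfolding A_def by (intro isCont_tendsto_compose[where g="dirD v f"]) auto
  qed
  have "eventually (\<lambda>s. cmod (A s - (dirD (u + v) f x - dirD u f x)) \<le> K * s) (at_right 0)"
  proof -
    \<comment> \<open>Chosen so that for \<open>s < \<epsilon>\<close> the displacements along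
      \<open>u\<close>, \<open>v\<close> and \<open>u + v\<close> have length at most
      \<open>d / 2\<close>, the range of \<open>est\<close>.\<close>
    define \<epsilon> where "\<epsilon> = d / (2 * (1 + norm u + norm v))"
    have den: "1 + norm u + norm v > 0" using norm_ge_zero[of u] norm_ge_zero[of v] by linarith
    have \<epsilon>: "\<epsilon> > 0" using d den by (simp add: \<epsilon>_def)
    have "cmod (A s - (dirD (u + v) f x - dirD u f x)) \<le> K * s" if s: "0 < s" "s < \<epsilon>" for s
    proof -
      have sb: "s * norm w \<le> d/2" if "norm w \<le> norm u + norm v" for w :: "complex^'n"
      proof -
        have "s * norm w \<le> \<epsilon> * (1 + norm u + norm v)" using s that den by (intro mult_mono) auto
        also have "\<dots> = d/2" using den unfolding \<epsilon>_def by (simp add: divide_simps)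
        finally show ?thesis .
      qed
      let ?s = "complex_of_real s"
      have n: "norm (?s *s w) = s * norm w" for w :: "complex^'n" using s by (simp add: norm_vector_scalar_mult)
      have e1: "cmod (f (x + ?s *s (u + v)) - f x - dirD (?s *s (u + v)) f x) \<le> C * norm (?s *s (u+v)) ^ 2"
        by (rule est) (use d sb[of "u + v"] in \<open>auto simp only: n norm_triangle_ineq\<close>, simp)
      have e2: "cmod (f ((x + ?s *s u) + ?s *s v) - f (x + ?s *s u) - dirD (?s *s v) f (x + ?s *s u)) \<le> C * norm (?s *s v) ^ 2"
        by (rule est) (use d sb[of v] sb[of u] in \<open>auto simp: n dist_norm\<close>)
      have e3: "cmod (f (x + ?s *s u) - f x - dirD (?s *s u) f x) \<le> C * norm (?s *s u) ^ 2"
        by (rule est) (use d sb[of u] in \<open>auto simp: n\<close>)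
      have xs: "x + ?s *s u \<in> S" using sb[of u] n[of u] d0 d by (auto simp: dist_norm subset_iff d_def)
      have tri: "cmod (X - Y - Z) \<le> a + b + c" if "cmod X \<le> a" "cmod Y \<le> b" "cmod Z \<le> c" for X Y Z a b c
        using that norm_triangle_ineq4[of "X - Y" Z] norm_triangle_ineq4[of X Y] by linarith
      \<comment> \<open>In this combination of the three remainders the values of \<open>f\<close>
        telescope, leaving \<open>s\<close> times the difference to be estimated.\<close>
      let ?E = "(f (x + ?s *s (u + v)) - f x - dirD (?s *s (u + v)) f x) - 
        (f ((x + ?s *s u) + ?s *s v) - f (x + ?s *s u) - dirD (?s *s v) f (x + ?s *s u)) - (f (x + ?s *s u) - f x - dirD (?s *s u) f x)"
      have "?E = ?s * (A s - (dirD (u + v) f x - dirD u f x))"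
        unfolding A_def dirD_scale[OF assms] dirD_scale[OF assms(1,2) xs] by (simp add: algebra_simps)
      moreover have "cmod ?E \<le> C * norm (?s *s (u+v)) ^ 2 + C * norm (?s *s v) ^ 2 + C * norm (?s *s u) ^ 2"
        by (rule tri[OF e1 e2 e3])
      moreover have "\<dots> = K * s * s" unfolding n K_def by (simp add: power2_eq_square algebra_simps)
      ultimately have "s * cmod (A s - (dirD (u + v) f x - dirD u f x)) \<le> s * (K * s)"
        using s by (simp add: norm_mult mult.commute)
      then show ?thesis using s by simp
    qed
    then show ?thesis unfolding eventually_at_right_field using \<epsilon> by blast
  qed
  moreover have "((\<lambda>s. K * s) \<longlongrightarrow> 0) (at_right 0)"
    by (intro tendsto_mult_right_zero tendsto_ident_at)
  ultimately have "((\<lambda>s. A s - (dirD (u + v) f x - dirD u f x)) \<longlongrightarrow> 0) (at_right 0)"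
    by (rule Lim_null_comparison)
  then have "(A \<longlongrightarrow> dirD (u + v) f x - dirD u f x) (at_right 0)" by (simp add: LIM_zero_iff)
  then have "dirD v f x = dirD (u + v) f x - dirD u f x"
    using tendsto_unique[OF _ cont] by simp
  then show ?thesis by simp
qed

text \<open>\<open>dirD_add\<close> and \<open>dirD_scale\<close> make the candidate derivative
  linear, and the remainder bound of \<open>dirD_taylor\<close> is the same for all
  directions.\<close>

lemma hol_has_derivative:
  fixes f :: "complex^'n \<Rightarrow> complex"
  assumes "open S" "hol f S" "x \<in> S"
  shows "(f has_derivative (\<lambda>v. dirD v f x)) (at x)"
  unfolding has_derivative_at
proof
  have "linear (\<lambda>v. dirD v f x)"
  proof (rule linearI)
    show "dirD (u + v) f x = dirD u f x + dirD v f x" for u v by (rule dirD_add[OF assms])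
    show "dirD (r *\<^sub>R v) f x = r *\<^sub>R dirD v f x" for r v
      unfolding scaleR_eq_vector_scalar_mult dirD_scale[OF assms] by (simp add: scaleR_conv_of_real)
  qed
  then show "bounded_linear (\<lambda>v. dirD v f x)" by (simp add: linear_conv_bounded_linear)
  obtain d where d: "d > 0" "cball x d \<subseteq> S" using assms open_contains_cball by blast
  have "compact (f ` cball x d)"
    by (rule compact_continuous_image[OF continuous_on_subset[OF hol_continuous[OF assms(2)] d(2)]]) simp
  then obtain M where M: "\<And>y. y \<in> cball x d \<Longrightarrow> cmod (f y) \<le> M"
    by (meson bounded_iff compact_imp_bounded image_eqI)
  have "eventually (\<lambda>h. norm (norm (f (x + h) - f x - dirD h f x) / norm h) \<le> 8 * M / d^2 * norm h) (at 0)"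
    unfolding eventually_at
  proof (intro exI conjI ballI impI)
    show "d/2 > 0" using d by simp
    fix h :: "complex^'n" assume h: "h \<noteq> 0 \<and> dist h 0 < d/2"
    have "cmod (f (x + h) - f x - dirD h f x) \<le> 8 * M / d^2 * norm h ^ 2"
      by (rule dirD_taylor[OF assms(2,1) d(2) M]) (use h d in auto)
    then show "norm (norm (f (x + h) - f x - dirD h f x) / norm h) \<le> 8 * M / d^2 * norm h"
      using h by (simp add: pos_divide_le_eq power2_eq_square mult.assoc)
  qed
  moreover have "((\<lambda>h::complex^'n. 8 * M / d^2 * norm h) \<longlongrightarrow> 0) (at 0)"
    by (intro tendsto_mult_right_zero tendsto_norm_zero tendsto_ident_at)
  ultimately show "(\<lambda>h. norm (f (x + h) - f x - dirD h f x) / norm h) \<midarrow>0\<rightarrow> 0"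
    by (rule Lim_null_comparison)
qed

text \<open>The bridge between pointwise complex differentiability, in which the manifold is
  formulated, and holomorphy on lines, to which one-variable theory applies. From left to right it
  is the chain rule along lines.\<close>

lemma holomorphic_Cn_iff_hol:
  assumes "open S"
  shows "holomorphic_Cn f S \<longleftrightarrow> hol f S"
proof
  assume f: "hol f S"
  show "holomorphic_Cn f S"
    unfolding holomorphic_Cn_def
  proof
    fix z assume z: "z \<in> S"
    show "\<exists>f'. (f has_derivative f') (at z) \<and> (\<forall>c v. f' (c *s v) = c * f' v)"
      using hol_has_derivative[OF assms f z] dirD_scale[OF assms f z] by blast
  qed
next
  assume f: "holomorphic_Cn f S"
  show "hol f S"
    unfolding hol_def
  proof (intro conjI allI)
    show "continuous_on S f"
    proof (rule continuous_at_imp_continuous_on, rule ballI)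
      fix x assume "x \<in> S"
      then show "isCont f x" using f has_derivative_continuous unfolding holomorphic_Cn_def by blast
    qed
    fix a v
    show "(\<lambda>t. f (a + t *s v)) holomorphic_on {t. a + t *s v \<in> S}"
      unfolding holomorphic_on_open[OF open_line[OF assms]]
    proof
      fix t assume "t \<in> {t. a + t *s v \<in> S}"
      then obtain f' where f': "(f has_derivative f') (at (a + t *s v))" "\<And>c v. f' (c *s v) = c * f' v"
        using f unfolding holomorphic_Cn_def by blast
      have bl: "bounded_linear (\<lambda>s. s *s v)"
        unfolding linear_conv_bounded_linear[symmetric]

      proof (rule linearI)
        show "(r *\<^sub>R s) *s v = r *\<^sub>R (s *s v)" for r s
          unfolding scaleR_eq_vector_scalar_mult by (simp add: scaleR_conv_of_real)
      qed simp
      have "((\<lambda>t. a + t *s v) has_derivative (\<lambda>s. s *s v)) (at t)"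
        using has_derivative_add[OF has_derivative_const bounded_linear_imp_has_derivative[OF bl]] by simp
      from has_derivative_compose[OF this f'(1)]
      have "((\<lambda>t. f (a + t *s v)) has_derivative (\<lambda>s. f' (s *s v))) (at t)" .
      then have "((\<lambda>t. f (a + t *s v)) has_field_derivative f' v) (at t)"
        unfolding has_field_derivative_def f'(2) by (simp add: mult_commute_abs)
      then show "\<exists>f'. ((\<lambda>t. f (a + t *s v)) has_field_derivative f') (at t)" by blast
    qed
  qed
qed

section \<open>Moments and division by polynomials along discs\<close>

text \<open>Local quotients of \<open>b\<close> by \<open>a\<close> are unique: the set where two
  continuous ones differ is open and all \<open>a k\<close> vanish on it. Hence they glue.
  \<open>P\<close> stands for the regularity that the quotients carry, so that one lemma serves
  functions of one variable, of several, and on a manifold; the index \<open>k\<close> lets one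
  quotient serve a whole family.\<close>

lemma glue_factor:
  fixes a b :: "'k \<Rightarrow> 'x::topological_space \<Rightarrow> complex"
  assumes dense: "\<And>V. open V \<Longrightarrow> V \<noteq> {} \<Longrightarrow> V \<subseteq> S \<Longrightarrow> \<exists>x\<in>V. \<exists>k. a k x \<noteq> 0"
    and loc: "\<And>p. p \<in> S \<Longrightarrow> \<exists>N q. open N \<and> p \<in> N \<and> N \<subseteq> S \<and> continuous_on N q \<and> P N q \<and> (\<forall>x\<in>N. \<forall>k. b k x = q x * a k x)"
  obtains q where "\<And>x k. x \<in> S \<Longrightarrow> b k x = q x * a k x"
    "\<And>p. p \<in> S \<Longrightarrow> \<exists>N q'. open N \<and> p \<in> N \<and> N \<subseteq> S \<and> P N q' \<and> (\<forall>x\<in>N. q x = q' x)"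
proof -
  have "\<exists>N q. \<forall>p\<in>S. open (N p) \<and> p \<in> N p \<and> N p \<subseteq> S \<and> continuous_on (N p) (q p) \<and> P (N p) (q p) \<and> (\<forall>x\<in>N p. \<forall>k. b k x = q p x * a k x)"
    using loc by metis
  then obtain N q where all: "\<forall>p\<in>S. open (N p) \<and> p \<in> N p \<and> N p \<subseteq> S \<and> continuous_on (N p) (q p) \<and> P (N p) (q p) \<and> (\<forall>x\<in>N p. \<forall>k. b k x = q p x * a k x)"
    by blast
  then have N: "\<And>p. p \<in> S \<Longrightarrow> open (N p)" "\<And>p. p \<in> S \<Longrightarrow> p \<in> N p" "\<And>p. p \<in> S \<Longrightarrow> N p \<subseteq> S"
    "\<And>p. p \<in> S \<Longrightarrow> continuous_on (N p) (q p)" "\<And>p. p \<in> S \<Longrightarrow> P (N p) (q p)"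
    by blast+
  have q: "b k x = q p x * a k x" if "p \<in> S" "x \<in> N p" for p x k
    using all that by blast
  have eq: "q x x = q p x" if p: "p \<in> S" and x: "x \<in> N p" for p x
  proof (rule ccontr)
    assume ne: "q x x \<noteq> q p x"
    have xS: "x \<in> S" using N(3) p x by blast
    let ?I = "N x \<inter> N p"
    have oI: "open ?I" using N(1) p xS by blast
    have "continuous_on ?I (\<lambda>y. q x y - q p y)"
      by (intro continuous_intros continuous_on_subset[OF N(4)[OF xS]] continuous_on_subset[OF N(4)[OF p]]) auto
    then have "open (?I \<inter> (\<lambda>y. q x y - q p y) -` (-{0}))"
      by (rule continuous_open_preimage[OF _ oI]) auto
    moreover have "x \<in> ?I \<inter> (\<lambda>y. q x y - q p y) -` (-{0})" using ne x N(2)[OF xS] by simp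
    moreover have "?I \<inter> (\<lambda>y. q x y - q p y) -` (-{0}) \<subseteq> S" using N(3)[OF p] by blast
    ultimately obtain y k where "y \<in> ?I \<inter> (\<lambda>y. q x y - q p y) -` (-{0})" and ay: "a k y \<noteq> 0"
      using dense[of "?I \<inter> (\<lambda>y. q x y - q p y) -` (-{0})"] by blast
    then have y: "y \<in> ?I" "q x y \<noteq> q p y" by auto
    then show False using q[OF xS, of y k] q[OF p, of y k] ay by simp
  qed
  show ?thesis
  \<comment> \<open>The global quotient at \<open>x\<close> is the one chosen around
    \<open>x\<close>, evaluated at \<open>x\<close>; by \<open>eq\<close> it agrees with every other
    choice.\<close>
  proof (rule that[of "\<lambda>x. q x x"])
    show "b k x = q x x * a k x" if "x \<in> S" for x k using q[OF that N(2)[OF that]] .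
    show "\<exists>N q'. open N \<and> p \<in> N \<and> N \<subseteq> S \<and> P N q' \<and> (\<forall>x\<in>N. q x x = q' x)" if "p \<in> S" for p
      using N(1,2,3,5)[OF that] eq[OF that] by blast
  qed
qed

section \<open>Division of holomorphic functions in one variable\<close>

lemma divides_glue:
  assumes "open D" "connected D" "u holomorphic_on D" "t0 \<in> D" "u t0 \<noteq> 0"
   and loc: "\<And>\<alpha>. \<alpha> \<in> D \<Longrightarrow> \<exists>N g. open N \<and> \<alpha> \<in> N \<and> N \<subseteq> D \<and> g holomorphic_on N \<and> (\<forall>t\<in>N. f t = g t * u t)"
  shows "\<exists>g. g holomorphic_on D \<and> (\<forall>t\<in>D. f t = g t * u t)"
proof -
  obtain q where q: "\<And>x k. x \<in> D \<Longrightarrow> f x = q x * u x"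
   "\<And>p. p \<in> D \<Longrightarrow> \<exists>N q'. open N \<and> p \<in> N \<and> N \<subseteq> D \<and> q' holomorphic_on N \<and> (\<forall>x\<in>N. q x = q' x)"
  proof (rule glue_factor[of D "\<lambda>_::unit. u" "\<lambda>N q. q holomorphic_on N" "\<lambda>_::unit. f"])
    show "\<exists>x\<in>V. \<exists>k::unit. u x \<noteq> 0" if V: "open V" "V \<noteq> {}" "V \<subseteq> D" for V
    proof (rule ccontr)
      assume "\<not> ?thesis"
      then have "u z = 0" if "z \<in> V" for z using that by blast
      then have "u t0 = 0"
        using analytic_continuation_open[of V D u "\<lambda>_. 0" t0] V assms(1-4) by simp
      then show False using assms by simp
    qed
    show "\<exists>N q. open N \<and> p \<in> N \<and> N \<subseteq> D \<and> continuous_on N q \<and> q holomorphic_on N \<and> (\<forall>x\<in>N. \<forall>k::unit. f x = q x * u x)"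
      if "p \<in> D" for p using loc[OF that] holomorphic_on_imp_continuous_on by blast
  qed auto
  have "q holomorphic_on D"
    unfolding holomorphic_on_open[OF assms(1)]
  proof
    fix p assume "p \<in> D"
    then obtain N q' where N: "open N" "p \<in> N" "q' holomorphic_on N" "\<forall>x\<in>N. q x = q' x" using q(2) by blast
    then have "q holomorphic_on N" using holomorphic_cong by metis
    then show "\<exists>f'. (q has_field_derivative f') (at p)" using N(1,2) holomorphic_derivI by blast
  qed
  then show ?thesis using q(1) by blast
qed

lemma punctured_nonzero:
  assumes "open D" "connected D" "u holomorphic_on D" "t0 \<in> D" "u t0 \<noteq> 0" "\<alpha> \<in> D"
  obtains \<epsilon> where "\<epsilon> > 0" "ball \<alpha> \<epsilon> \<subseteq> D" "\<And>t. t \<in> ball \<alpha> \<epsilon> - {\<alpha>} \<Longrightarrow> u t \<noteq> 0"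
proof (cases "u \<alpha> = 0")
  case True
  then show ?thesis using isolated_zeros[OF assms(3,1,2,6) True assms(4,5)] that by metis
next
  case False
  have "open (D \<inter> u -` (-{0}))"
    by (rule continuous_open_preimage[OF holomorphic_on_imp_continuous_on[OF assms(3)] assms(1)]) auto
  then obtain \<epsilon> where "\<epsilon> > 0" "ball \<alpha> \<epsilon> \<subseteq> D \<inter> u -` (-{0})"
    using False assms(6) open_contains_ball by (metis (no_types, lifting) ComplI IntI singletonD vimageI)
  then show ?thesis using that[of \<epsilon>] by blast
qed

text \<open>Riemann's theorem on removable singularities: \<open>f / u\<close> is bounded near each
  zero of \<open>u\<close>, and at the zero itself the bound forces \<open>f\<close> to vanish
  too.\<close>

lemma divides_bounded:
  assumes "open D" "connected D" "u holomorphic_on D" "f holomorphic_on D" "t0 \<in> D" "u t0 \<noteq> 0"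
   and le: "\<And>t. t \<in> D \<Longrightarrow> cmod (f t) \<le> C * cmod (u t)"
  shows "\<exists>g. g holomorphic_on D \<and> (\<forall>t\<in>D. f t = g t * u t)"
proof (rule divides_glue[OF assms(1-3,5,6)])
  fix \<alpha> assume a: "\<alpha> \<in> D"
  obtain \<epsilon> where e: "\<epsilon> > 0" "ball \<alpha> \<epsilon> \<subseteq> D" "\<And>t. t \<in> ball \<alpha> \<epsilon> - {\<alpha>} \<Longrightarrow> u t \<noteq> 0"
    using punctured_nonzero[OF assms(1-3,5,6) a] by blast
  have hf: "f holomorphic_on ball \<alpha> \<epsilon>" and hu: "u holomorphic_on ball \<alpha> \<epsilon>"
    using assms(3,4) e(2) holomorphic_on_subset by blast+
  show "\<exists>N g. open N \<and> \<alpha> \<in> N \<and> N \<subseteq> D \<and> g holomorphic_on N \<and> (\<forall>t\<in>N. f t = g t * u t)"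
  proof (cases "u \<alpha> = 0")
    case False
    then have "u t \<noteq> 0" if "t \<in> ball \<alpha> \<epsilon>" for t using e(3) that by blast
    then show ?thesis
      by (intro exI[of _ "ball \<alpha> \<epsilon>"] exI[of _ "\<lambda>t. f t / u t"]) (use e hf hu in \<open>auto intro!: holomorphic_intros\<close>)
  next
    case True
    have "(\<lambda>t. f t / u t) holomorphic_on ball \<alpha> \<epsilon> - {\<alpha>}"
      using e(3) by (intro holomorphic_intros holomorphic_on_subset[OF hf] holomorphic_on_subset[OF hu]) auto
    moreover have "eventually (\<lambda>t. cmod (f t / u t) \<le> C) (at \<alpha>)"
      unfolding eventually_at
    proof (intro exI[of _ \<epsilon>] conjI ballI impI)
      fix t assume "t \<noteq> \<alpha> \<and> dist t \<alpha> < \<epsilon>"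
      then have "t \<in> ball \<alpha> \<epsilon> - {\<alpha>}" by (auto simp: dist_commute)
      then show "cmod (f t / u t) \<le> C" using e(3)[of t] le[of t] e(2)
        by (auto simp: norm_divide pos_divide_le_eq)
    qed (use e in auto)
    ultimately obtain g where g: "g holomorphic_on ball \<alpha> \<epsilon>" "\<forall>z\<in>ball \<alpha> \<epsilon> - {\<alpha>}. g z = f z / u z"
      using holomorphic_on_extend_bounded[of "\<lambda>t. f t / u t" "ball \<alpha> \<epsilon>" \<alpha>] e(1) by auto
    have "f t = g t * u t" if "t \<in> ball \<alpha> \<epsilon>" for t
    proof (cases "t = \<alpha>")
      case True
      then show ?thesis using le[OF a] \<open>u \<alpha> = 0\<close> by simp
    next
      case False
      then show ?thesis using g(2) e(3)[of t] that by auto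
    qed
    then show ?thesis using e g by (intro exI[of _ "ball \<alpha> \<epsilon>"] exI[of _ g]) auto
  qed
qed

text \<open>Induction on the number of distinct zeros, each removed with its full multiplicity; the
  list \<open>as\<close> repeats a zero as often as its order.\<close>

lemma factor_finite_zeros:
  assumes "open D" "connected D" "u holomorphic_on D" "t0 \<in> D" "u t0 \<noteq> 0" "finite {t\<in>D. u t = 0}"
  shows "\<exists>as v. v holomorphic_on D \<and> (\<forall>t\<in>D. v t \<noteq> 0) \<and> set as \<subseteq> {t\<in>D. u t = 0} \<and> 
     (\<forall>t\<in>D. u t = poly (\<Prod>a\<leftarrow>as. [:-a, 1:]) t * v t)"
  using assms(3,5,6)
proof (induction "card {t\<in>D. u t = 0}" arbitrary: u rule: less_induct)
  case (less u)
  show ?case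
  proof (cases "{t\<in>D. u t = 0} = {}")
    case True
    then show ?thesis using less.prems by (intro exI[of _ "[]"] exI[of _ u]) auto
  next
    case False
    then obtain \<xi> where \<xi>: "\<xi> \<in> D" "u \<xi> = 0" by auto
    have nc: "\<not> u constant_on D" using \<xi> assms(4) less.prems(2) unfolding constant_on_def by metis
    obtain g r n where g: "0 < n" "0 < r" "ball \<xi> r \<subseteq> D" "g holomorphic_on ball \<xi> r"
      "\<And>w. w \<in> ball \<xi> r \<Longrightarrow> u w = (w - \<xi>)^n * g w" "\<And>w. w \<in> ball \<xi> r \<Longrightarrow> g w \<noteq> 0"
      using holomorphic_factor_zero_nonconstant[OF less.prems(1) assms(1,2) \<xi> nc] by metis
    \<comment> \<open>Away from \<open>\<xi>\<close> the quotient is explicit, near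
      \<open>\<xi>\<close> it is the nonvanishing cofactor \<open>g\<close>; the two agree on the
      punctured ball.\<close>
    define G where "G t = (if t = \<xi> then g \<xi> else u t / (t - \<xi>)^n)" for t
    have Gg: "G t = g t" if "t \<in> ball \<xi> r" for t using g(5)[OF that] by (simp add: G_def)
    have "G holomorphic_on ball \<xi> r" by (rule holomorphic_transform[OF g(4)]) (simp add: Gg)
    moreover have "G holomorphic_on D - {\<xi>}"
    proof (rule holomorphic_transform)
      show "(\<lambda>t. u t / (t - \<xi>)^n) holomorphic_on D - {\<xi>}"
        by (intro holomorphic_intros holomorphic_on_subset[OF less.prems(1)]) auto
    qed (simp add: G_def)
    ultimately have "G holomorphic_on ball \<xi> r \<union> (D - {\<xi>})"
      using assms(1) by (intro holomorphic_on_Un) (auto simp: open_delete)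
    moreover have "ball \<xi> r \<union> (D - {\<xi>}) = D" using g(2,3) \<xi>(1) by (auto simp: subset_iff)
    ultimately have hG: "G holomorphic_on D" by simp
    have uG: "u t = (t - \<xi>)^n * G t" if "t \<in> D" for t using \<xi>(2) g(1) by (simp add: G_def)
    have G\<xi>: "G \<xi> \<noteq> 0" using g(2,6) by (simp add: G_def)
    have zs: "{t\<in>D. G t = 0} = {t\<in>D. u t = 0} - {\<xi>}" using uG G\<xi> \<xi> g(1) by auto
    have c: "card {t\<in>D. G t = 0} < card {t\<in>D. u t = 0}"
      unfolding zs using less.prems(3) \<xi> by (intro psubset_card_mono) auto
    have G0: "G t0 \<noteq> 0" using uG[OF assms(4)] less.prems(2) by auto
    have "finite {t\<in>D. G t = 0}" unfolding zs using less.prems(3) by simp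
    from less.hyps[OF c hG G0 this] obtain as v where v: "v holomorphic_on D" "\<forall>t\<in>D. v t \<noteq> 0" "set as \<subseteq> {t\<in>D. G t = 0}"
      "\<forall>t\<in>D. G t = poly (\<Prod>a\<leftarrow>as. [:-a, 1:]) t * v t"
      by blast
    have "poly (\<Prod>a\<leftarrow>replicate n \<xi> @ as. [:-a, 1:]) t = (t - \<xi>)^n * poly (\<Prod>a\<leftarrow>as. [:-a, 1:]) t" for t
      by (simp add: prod_list_replicate)
    moreover have "set (replicate n \<xi> @ as) \<subseteq> {t\<in>D. u t = 0}" using v(3) zs \<xi> by auto
    ultimately show ?thesis using v uG
      by (intro exI[of _ "replicate n \<xi> @ as"] exI[of _ v]) (auto simp: mult.assoc)
  qed
qed

section \<open>Vanishing moments as a test for divisibility\<close>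

lemma poly_prod_linear_eq_0_iff: "poly (\<Prod>a\<leftarrow>as. [:-a, 1:]) (t::complex) = 0 \<longleftrightarrow> t \<in> set as"
  by (induction as) auto

text \<open>The linear factors are split off one at a time. Testing with the product of the
  remaining factors leaves the Cauchy integral of \<open>F\<close> at \<open>a\<close>, so
  \<open>F a = 0\<close>, and the quotient by \<open>t - a\<close> inherits the vanishing
  moments.\<close>

lemma moments_imp_divides_linear_factors:
  assumes "0 < r" "r < R" "set as \<subseteq> ball 0 r" "F holomorphic_on ball 0 R"
    and "\<And>p. contour_integral (circlepath 0 r) (\<lambda>t. poly p t * F t / poly (\<Prod>a\<leftarrow>as. [:-a, 1:]) t) = 0"
  shows "\<exists>G. G holomorphic_on ball 0 R \<and> (\<forall>t\<in>ball 0 R. F t = poly (\<Prod>a\<leftarrow>as. [:-a, 1:]) t * G t)"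
  using assms(3-5)
proof (induction as arbitrary: F)
  case Nil
  then show ?case by auto
next
  case (Cons a as)
  let ?W = "\<Prod>a\<leftarrow>as. [:-a, 1:]"
  have W0: "poly ?W t \<noteq> 0" and ta: "t \<noteq> a" if "t \<in> sphere 0 r" for t
    using Cons.prems(1) that by (auto simp: poly_prod_linear_eq_0_iff)
  have pi: "path_image (circlepath 0 r) = sphere 0 r" using assms(1) by (simp add: path_image_circlepath_nonneg)
  have a: "a \<in> ball 0 r" using Cons.prems(1) by simp
  have Wc: "poly (\<Prod>a\<leftarrow>a#as. [:-a, 1:]) t = (t - a) * poly ?W t" for t by (simp add: algebra_simps)
  have "contour_integral (circlepath 0 r) (\<lambda>t. F t / (t - a)) = 
        contour_integral (circlepath 0 r) (\<lambda>t. poly ?W t * F t / poly (\<Prod>a\<leftarrow>a#as. [:-a, 1:]) t)"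

    unfolding Wc using W0 pi by (intro contour_integral_eq) simp
  also have "\<dots> = 0" by (rule Cons.prems(3))
  finally have "contour_integral (circlepath 0 r) (\<lambda>t. F t / (t - a)) = 0" .
  moreover have "((\<lambda>t. F t / (t - a)) has_contour_integral 2 * of_real pi * \<i> * F a) (circlepath 0 r)"
    by (rule Cauchy_integral_circlepath_simple)
      (use a assms(2) Cons.prems(2) in \<open>auto intro: holomorphic_on_subset simp: dist_norm\<close>)
  ultimately have Fa: "F a = 0" using contour_integral_unique by fastforce
  define F1 where "F1 z = (if z = a then deriv F a else (F z - F a) / (z - a))" for z
  have F1: "F1 holomorphic_on ball 0 R"
    unfolding F1_def by (rule pole_lemma[OF Cons.prems(2)]) (use a assms(2) in auto)
  have FF: "F t = (t - a) * F1 t" for t using Fa by (simp add: F1_def)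
  have "contour_integral (circlepath 0 r) (\<lambda>t. poly p t * F1 t / poly ?W t) = 0" for p
  proof -
    have "contour_integral (circlepath 0 r) (\<lambda>t. poly p t * F1 t / poly ?W t) =
       contour_integral (circlepath 0 r) (\<lambda>t. poly p t * F t / poly (\<Prod>a\<leftarrow>a#as. [:-a, 1:]) t)"

      unfolding Wc FF using W0 ta pi by (intro contour_integral_eq) simp
    then show ?thesis using Cons.prems(3) by simp
  qed
  then obtain G where G: "G holomorphic_on ball 0 R" "\<forall>t\<in>ball 0 R. F1 t = poly ?W t * G t"
    using Cons.IH[OF _ F1] Cons.prems(1) by auto
  then show ?case by (intro exI[of _ G]) (auto simp: FF algebra_simps)
qed

text \<open>All zeros lie in a compact part of the disc, so there are finitely many and
  \<open>factor_finite_zeros\<close> applies.\<close>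

lemma zeros_factor_disc:
  assumes "0 < r" "r < R" "u holomorphic_on ball 0 R" "\<And>t. r \<le> cmod t \<Longrightarrow> cmod t < R \<Longrightarrow> u t \<noteq> 0"
  shows "\<exists>as v. v holomorphic_on ball 0 R \<and> (\<forall>t\<in>ball 0 R. v t \<noteq> 0) \<and> set as \<subseteq> ball 0 r \<and>
     (\<forall>t\<in>ball 0 R. u t = poly (\<Prod>a\<leftarrow>as. [:-a, 1:]) t * v t)"
proof -
  have ur: "u (of_real r) \<noteq> 0" using assms(1,2,4) by simp
  have eq: "{t\<in>ball 0 R. u t = 0} = {t\<in>cball 0 r. u t = 0}" using assms(2,4) by force
  have "finite {t\<in>ball 0 R. u t = 0}"
  proof (cases "u constant_on ball 0 R")
    case True
    then have "u t \<noteq> 0" if "t \<in> ball 0 R" for t 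
      using ur that assms(1,2) unfolding constant_on_def by (metis abs_of_pos mem_ball_0 norm_of_real)
    then have "{t\<in>ball 0 R. u t = 0} = {}" by blast
    then show ?thesis by (simp only: finite.emptyI)
  next
    case False
    show ?thesis unfolding eq
      by (rule holomorphic_compact_finite_zeros[OF assms(3)]) (use False assms(2) in auto)
  qed
  then obtain as v where "v holomorphic_on ball 0 R" "\<forall>t\<in>ball 0 R. v t \<noteq> 0" "set as \<subseteq> {t\<in>ball 0 R. u t = 0}"
     "\<forall>t\<in>ball 0 R. u t = poly (\<Prod>a\<leftarrow>as. [:-a, 1:]) t * v t"
    using factor_finite_zeros[OF open_ball connected_ball assms(3), of "of_real r"] ur assms(1,2) by auto
  moreover have "{t\<in>ball 0 R. u t = 0} \<subseteq> ball 0 r" using assms(4) by force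
  ultimately show ?thesis by blast
qed

text \<open>Writing \<open>u\<close> as a polynomial times a unit \<open>v\<close> reduces this to
  linear factors and the function \<open>f / v\<close>; by linearity the powers \<open>t ^ j\<close>
  test as much as all polynomials do.\<close>

lemma moments_imp_divides:
  assumes "0 < r" "r < R" "u holomorphic_on ball 0 R" "\<And>t. r \<le> cmod t \<Longrightarrow> cmod t < R \<Longrightarrow> u t \<noteq> 0"
    and f: "f holomorphic_on ball 0 R"
    and m: "\<And>j. contour_integral (circlepath 0 r) (\<lambda>t. t ^ j * f t / u t) = 0"
  shows "\<exists>G. G holomorphic_on ball 0 R \<and> (\<forall>t\<in>ball 0 R. f t = u t * G t)"
proof -
  obtain as v where "v holomorphic_on ball 0 R" "\<forall>t\<in>ball 0 R. v t \<noteq> 0" "set as \<subseteq> ball 0 r"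
     "\<forall>t\<in>ball 0 R. u t = poly (\<Prod>a\<leftarrow>as. [:-a, 1:]) t * v t"
    using zeros_factor_disc[OF assms(1-4)] by blast
  then have v: "v holomorphic_on ball 0 R" "\<And>t. t \<in> ball 0 R \<Longrightarrow> v t \<noteq> 0" "set as \<subseteq> ball 0 r"
     "\<And>t. t \<in> ball 0 R \<Longrightarrow> u t = poly (\<Prod>a\<leftarrow>as. [:-a, 1:]) t * v t" by auto
  have pi: "path_image (circlepath 0 r) = sphere 0 r" using assms(1) by (simp add: path_image_circlepath_nonneg)
  have hF: "(\<lambda>t. f t / v t) holomorphic_on ball 0 R" using f v by (intro holomorphic_intros) auto
  have "contour_integral (circlepath 0 r) (\<lambda>t. poly p t * (f t / v t) / poly (\<Prod>a\<leftarrow>as. [:-a, 1:]) t) = 0" for p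
  proof -
    have int: "(\<lambda>t. t ^ j * f t / u t) contour_integrable_on circlepath 0 r" for j
    proof (rule contour_integrable_continuous_circlepath)
      have "f holomorphic_on sphere 0 r" "u holomorphic_on sphere 0 r"
        using f assms(2,3) by (auto intro: holomorphic_on_subset)
      then show "continuous_on (path_image (circlepath 0 r)) (\<lambda>t. t ^ j * f t / u t)"
        unfolding pi using assms by (intro continuous_intros holomorphic_on_imp_continuous_on) auto
    qed
    have "contour_integral (circlepath 0 r) (\<lambda>t. poly p t * (f t / v t) / poly (\<Prod>a\<leftarrow>as. [:-a, 1:]) t) =
       contour_integral (circlepath 0 r) (\<lambda>t. \<Sum>i\<le>degree p. coeff p i * (t ^ i * f t / u t))"
    proof (rule contour_integral_eq)
      fix t assume "t \<in> path_image (circlepath 0 r)"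
      then have t: "t \<in> ball 0 R" using pi assms(2) by auto
      show "poly p t * (f t / v t) / poly (\<Prod>a\<leftarrow>as. [:-a, 1:]) t = (\<Sum>i\<le>degree p. coeff p i * (t ^ i * f t / u t))"
        unfolding v(4)[OF t] poly_altdef[of p] by (simp add: sum_distrib_left sum_distrib_right sum_divide_distrib mult_ac)
    qed
    also have "\<dots> = (\<Sum>i\<le>degree p. contour_integral (circlepath 0 r) (\<lambda>t. coeff p i * (t ^ i * f t / u t)))"
      by (intro contour_integral_sum contour_integrable_lmul[OF int]) simp
    also have "\<dots> = 0" by (simp only: contour_integral_lmul[OF int] m mult_zero_right sum.neutral_const)
    finally show ?thesis .
  qed
  from moments_imp_divides_linear_factors[OF assms(1,2) v(3) hF this]
  obtain G where G: "G holomorphic_on ball 0 R" "\<forall>t\<in>ball 0 R. f t / v t = poly (\<Prod>a\<leftarrow>as. [:-a, 1:]) t * G t" by blast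
  have "f t = u t * G t" if "t \<in> ball 0 R" for t

  proof -
    have "f t / v t = poly (\<Prod>a\<leftarrow>as. [:-a, 1:]) t * G t" using G(2) that by blast
    then show ?thesis using v(2)[OF that] v(4)[OF that] by (simp add: divide_eq_eq mult_ac)
  qed
  then show ?thesis using G by blast
qed

lemma divides_imp_moments:
  assumes "0 < r" "r < R" "G holomorphic_on ball 0 R" "\<And>t. cmod t = r \<Longrightarrow> h t = G t"
  shows "contour_integral (circlepath 0 r) h = 0"
proof -
  have "contour_integral (circlepath 0 r) h = contour_integral (circlepath 0 r) G"
    by (rule contour_integral_eq) (use assms(1,4) in \<open>auto simp: path_image_circlepath_nonneg\<close>)
  also have "(G has_contour_integral 0) (circlepath 0 r)"
    by (rule Cauchy_theorem_disc_simple[OF assms(3)]) (use assms(1,2) in \<open>auto simp: path_image_circlepath_nonneg\<close>)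
  then have "contour_integral (circlepath 0 r) G = 0" by (rule contour_integral_unique)
  finally show ?thesis .
qed

section \<open>Discs transversal to a zero set\<close>

lemma line_tube:
  fixes z0 e :: "complex^'n"
  assumes "open U" "compact K" "\<And>t. t \<in> K \<Longrightarrow> z0 + t *s e \<in> U"
  obtains \<delta> where "\<delta> > 0" "\<And>y t. y \<in> ball z0 \<delta> \<Longrightarrow> t \<in> K \<Longrightarrow> y + t *s e \<in> U"
proof -
  have c: "continuous_on UNIV (\<lambda>p. fst p + snd p *s e)" by (intro continuous_intros)
  have "open ((\<lambda>p. fst p + snd p *s e) -` U)" by (rule open_vimage[OF assms(1) c])
  moreover have "{z0} \<times> K \<subseteq> (\<lambda>p. fst p + snd p *s e) -` U" using assms(3) by auto
  ultimately obtain X where X: "z0 \<in> X" "open X" "X \<times> K \<subseteq> (\<lambda>p. fst p + snd p *s e) -` U"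
    using Elementary_Topology.tube_lemma[OF assms(2)] by blast
  then obtain \<delta> where d: "\<delta> > 0" "ball z0 \<delta> \<subseteq> X" using open_contains_ball by blast
  have "y + t *s e \<in> U" if "y \<in> ball z0 \<delta>" "t \<in> K" for y t
  proof -
    have "(y, t) \<in> X \<times> K" using d(2) that by blast
    then have "(y, t) \<in> (\<lambda>p. fst p + snd p *s e) -` U" using X(3) by blast
    then show ?thesis by simp
  qed
  then show ?thesis using that d(1) by blast
qed

text \<open>By compactness, discs parallel to a good one stay in \<open>S\<close> and keep the
  closed annulus from \<open>\<rho> / 2\<close> to \<open>\<rho>\<close> free of zeros. The zeros of
  \<open>a\<close> on all of them are thus enclosed by the circle of radius
  \<open>\<rho> / 2\<close>, over which one integrates.\<close>

lemma line_box:
  assumes "open S" "hol a S" "0 < \<rho>" "\<And>t. cmod t \<le> \<rho> \<Longrightarrow> z0 + t *s e \<in> S"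
    "\<And>t. 0 < cmod t \<Longrightarrow> cmod t \<le> \<rho> \<Longrightarrow> a (z0 + t *s e) \<noteq> 0"
  obtains \<delta> where "\<delta> > 0" "\<And>y t. y \<in> ball z0 \<delta> \<Longrightarrow> cmod t \<le> \<rho> \<Longrightarrow> y + t *s e \<in> S"
    "\<And>y t. y \<in> ball z0 \<delta> \<Longrightarrow> \<rho> / 2 \<le> cmod t \<Longrightarrow> cmod t \<le> \<rho> \<Longrightarrow> a (y + t *s e) \<noteq> 0"
proof -
  obtain \<delta>1 where d1: "\<delta>1 > 0" "\<And>y t. y \<in> ball z0 \<delta>1 \<Longrightarrow> t \<in> cball 0 \<rho> \<Longrightarrow> y + t *s e \<in> S"
    by (rule line_tube[OF assms(1), of "cball 0 \<rho>" z0 e]) (use assms(4) in auto)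
  let ?K = "cball (0::complex) \<rho> - ball 0 (\<rho>/2)"
  obtain \<delta>2 where d2: "\<delta>2 > 0" "\<And>y t. y \<in> ball z0 \<delta>2 \<Longrightarrow> t \<in> ?K \<Longrightarrow> y + t *s e \<in> {x\<in>S. a x \<noteq> 0}"
  proof (rule line_tube[OF open_nonzero[OF assms(1,2)], of ?K z0 e])
    show "compact ?K" by (intro compact_diff) auto
    fix t assume "t \<in> ?K"
    then have "0 < cmod t" "cmod t \<le> \<rho>" using assms(3) by auto
    then show "z0 + t *s e \<in> {x\<in>S. a x \<noteq> 0}" using assms(4,5) by blast
  qed (rule that)
  show ?thesis
    by (rule that[of "min \<delta>1 \<delta>2"]) (use d1 d2 in auto)
qed

text \<open>On the line joining \<open>z0\<close> to a nearby point where \<open>a\<close> is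
  nonzero, \<open>a\<close> does not vanish identically, so a zero at \<open>z0\<close> is isolated
  on that line.\<close>

lemma exists_nonzero_direction:
  fixes z0 :: "complex^'n"
  assumes "open S" "hol a S" "z0 \<in> S" "\<And>V. open V \<Longrightarrow> z0 \<in> V \<Longrightarrow> V \<subseteq> S \<Longrightarrow> \<exists>x\<in>V. a x \<noteq> 0"
  obtains \<rho> e where "0 < \<rho>" "\<And>t. cmod t \<le> \<rho> \<Longrightarrow> z0 + t *s e \<in> S" "\<And>t. 0 < cmod t \<Longrightarrow> cmod t \<le> \<rho> \<Longrightarrow> a (z0 + t *s e) \<noteq> 0"
proof -
  obtain d where d: "d > 0" "ball z0 d \<subseteq> S" using assms(1,3) open_contains_ball by blast
  obtain z1 where z1: "z1 \<in> ball z0 d" "a z1 \<noteq> 0" using assms(4)[of "ball z0 d"] d by auto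
  let ?e = "z1 - z0"
  let ?D = "{t. z0 + t *s ?e \<in> ball z0 d}"
  have hD: "(\<lambda>t. a (z0 + t *s ?e)) holomorphic_on ?D"
    using hol_line[OF assms(2), of ?D z0 ?e] d(2) by blast
  have D0: "0 \<in> ?D" using d(1) by simp
  have D1: "1 \<in> ?D" "a (z0 + 1 *s ?e) \<noteq> 0" using z1 by auto
  obtain \<epsilon> where e: "\<epsilon> > 0" "ball 0 \<epsilon> \<subseteq> ?D" "\<And>t. t \<in> ball 0 \<epsilon> - {0} \<Longrightarrow> a (z0 + t *s ?e) \<noteq> 0"
    using punctured_nonzero[OF open_line[OF open_ball] convex_connected[OF convex_line[OF convex_ball]] hD D1 D0] by blast
  have in_ball: "t \<in> ball 0 \<epsilon>" if "cmod t \<le> \<epsilon> / 2" for t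
  proof -
    have "cmod t < \<epsilon>" using that e(1) by linarith
    then show ?thesis by simp
  qed
  show ?thesis
  proof (rule that[of "\<epsilon>/2" ?e])
    show "\<epsilon> / 2 > 0" using e(1) by simp
    show "z0 + t *s ?e \<in> S" if "cmod t \<le> \<epsilon> / 2" for t 
      using in_ball[OF that] e(2) d(2) by blast
    show "a (z0 + t *s ?e) \<noteq> 0" if "0 < cmod t" "cmod t \<le> \<epsilon> / 2" for t
      using e(3)[of t] in_ball[OF that(2)] that(1) by auto
  qed
qed

section \<open>Division along families of discs\<close>

lemma hol_eq_zero_dense:
  assumes "open B" "hol f B" "\<And>V. open V \<Longrightarrow> V \<noteq> {} \<Longrightarrow> V \<subseteq> B \<Longrightarrow> \<exists>z\<in>V. f z = 0" "x \<in> B"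
  shows "f x = 0"
proof (rule ccontr)
  assume "f x \<noteq> 0"
  then obtain z where "z \<in> {x \<in> B. f x \<noteq> 0}" "f z = 0"
    using assms(3)[OF open_nonzero[OF assms(1,2)]] assms(4) by blast
  then show False by simp
qed

text \<open>The Cauchy integral of \<open>F / G\<close> over the circle is holomorphic in
  \<open>z\<close> whether or not \<open>G\<close> divides \<open>F\<close> on the disc. Where
  division succeeds it is the quotient at \<open>t = 0\<close>, and
  \<open>F z 0 = q z * G z 0\<close> extends from a dense set. General families \<open>G z t\<close>
  are allowed because the divisor will be a polynomial in \<open>t\<close> with coefficients
  depending on \<open>z\<close>.\<close>

lemma division_along_disc:
  fixes F G :: "complex^'n \<Rightarrow> complex \<Rightarrow> complex"
  assumes B: "open B" and r: "0 < r" "r < R"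
    and cF: "continuous_on (B \<times> sphere 0 r) (\<lambda>p. F (fst p) (snd p))"
    and cG: "continuous_on (B \<times> sphere 0 r) (\<lambda>p. G (fst p) (snd p))"
    and hF: "\<And>t. t \<in> sphere 0 r \<Longrightarrow> hol (\<lambda>z. F z t) B" and hG: "\<And>t. t \<in> sphere 0 r \<Longrightarrow> hol (\<lambda>z. G z t) B"
    and h0: "hol (\<lambda>z. F z 0) B" "hol (\<lambda>z. G z 0) B"
    and nz: "\<And>z t. z \<in> B \<Longrightarrow> t \<in> sphere 0 r \<Longrightarrow> G z t \<noteq> 0"
    and dense: "\<And>V. open V \<Longrightarrow> V \<noteq> {} \<Longrightarrow> V \<subseteq> B \<Longrightarrow>
      \<exists>z\<in>V. \<exists>g. g holomorphic_on ball 0 R \<and> (\<forall>t\<in>ball 0 R. F z t = g t * G z t)"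
  shows "\<exists>q. hol q B \<and> (\<forall>z\<in>B. F z 0 = q z * G z 0)"
proof -
  define q where "q z = contour_integral (circlepath 0 r) (\<lambda>t. F z t / G z t / t) * (1 / (2 * pi * \<i>))" for z
  have hq: "hol q B"
    unfolding q_def
  proof (intro hol_mult hol_const hol_contour_integral_param[OF r(1) B])
    show "continuous_on (B \<times> sphere 0 r) (\<lambda>p. F (fst p) (snd p) / G (fst p) (snd p) / snd p)"
      using nz r(1) by (intro continuous_intros cF cG) auto
    show "hol (\<lambda>z. F z t / G z t / t) B" if "t \<in> sphere 0 r" for t
      using nz that r(1) by (intro hol_divide hol_const hF hG) auto
  qed
  have good: "F z 0 = q z * G z 0" if z: "z \<in> B" and g: "g holomorphic_on ball 0 R" "\<forall>t\<in>ball 0 R. F z t = g t * G z t" for z g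
  proof -
    have "((\<lambda>t. g t / (t - 0)) has_contour_integral (2 * of_real pi * \<i> * g 0)) (circlepath 0 r)"
      by (rule Cauchy_integral_circlepath_simple[OF holomorphic_on_subset[OF g(1)]]) (use r in auto)
    then have "((\<lambda>t. F z t / G z t / t) has_contour_integral (2 * of_real pi * \<i> * g 0)) (circlepath 0 r)"
    proof (rule has_contour_integral_eq)
      fix t assume "t \<in> path_image (circlepath 0 r)"
      then have "t \<in> sphere 0 r" using r(1) by (simp add: path_image_circlepath_nonneg)
      moreover from this have "t \<in> ball 0 R" using r by auto
      ultimately show "g t / (t - 0) = F z t / G z t / t" using g(2) nz[OF z] by auto
    qed
    then have "q z = g 0" unfolding q_def by (simp add: contour_integral_unique)
    then show ?thesis using g(2) r by auto
  qed
  have "F z 0 - q z * G z 0 = 0" if "z \<in> B" for z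
  proof (rule hol_eq_zero_dense[OF B _ _ that])
    show "hol (\<lambda>z. F z 0 - q z * G z 0) B" by (intro hol_diff hol_mult h0 hq)
    show "\<exists>z\<in>V. F z 0 - q z * G z 0 = 0" if V: "open V" "V \<noteq> {}" "V \<subseteq> B" for V
    proof -
      obtain z g where "z \<in> V" "g holomorphic_on ball 0 R" "\<forall>t\<in>ball 0 R. F z t = g t * G z t"
        using dense[OF V] by blast
      then have "F z 0 = q z * G z 0" using good V(3) by blast
      then show ?thesis using \<open>z \<in> V\<close> by auto
    qed
  qed
  then show ?thesis using hq by auto
qed

lemma line_pair_continuous:
  assumes "hol f S" "\<And>y t. y \<in> B \<Longrightarrow> t \<in> T \<Longrightarrow> y + t *s e \<in> S"
  shows "continuous_on (B \<times> T) (\<lambda>p. f (fst p + snd p *s e))"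
proof (rule continuous_on_compose2[OF hol_continuous[OF assms(1)]])
  show "continuous_on (B \<times> T) (\<lambda>p. fst p + snd p *s e)" by (intro continuous_intros)
qed (use assms(2) in auto)

lemma division_along_lines:
  assumes B: "open B" and r: "0 < r" "r < R"
    and hf: "hol f S" and hg: "hol g S" and S: "\<And>y t. y \<in> B \<Longrightarrow> t \<in> ball 0 R \<Longrightarrow> y + t *s e \<in> S"
    and nz: "\<And>z t. z \<in> B \<Longrightarrow> t \<in> sphere 0 r \<Longrightarrow> g (z + t *s e) \<noteq> 0"
    and dense: "\<And>V. open V \<Longrightarrow> V \<noteq> {} \<Longrightarrow> V \<subseteq> B \<Longrightarrow>
      \<exists>z\<in>V. \<exists>h. h holomorphic_on ball 0 R \<and> (\<forall>t\<in>ball 0 R. f (z + t *s e) = h t * g (z + t *s e))"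
  shows "\<exists>q. hol q B \<and> (\<forall>z\<in>B. f z = q z * g z)"
proof -
  have sub: "sphere 0 r \<subseteq> ball 0 R" using r by auto
  have S0: "z + 0 *s e \<in> S" if "z \<in> B" for z using S[OF that, of 0] r by simp
  have "\<exists>q. hol q B \<and> (\<forall>z\<in>B. f (z + 0 *s e) = q z * g (z + 0 *s e))"
  proof (rule division_along_disc[OF B r _ _ _ _ _ _ nz dense])
    have S': "y + t *s e \<in> S" if "y \<in> B" "t \<in> sphere 0 r" for y t using S[OF that(1)] that(2) sub by blast
    show "continuous_on (B \<times> sphere 0 r) (\<lambda>p. f (fst p + snd p *s e))"
      "continuous_on (B \<times> sphere 0 r) (\<lambda>p. g (fst p + snd p *s e))"
      using S' by (intro line_pair_continuous[OF hf] line_pair_continuous[OF hg]; blast)+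
    show "hol (\<lambda>z. f (z + t *s e)) B" "hol (\<lambda>z. g (z + t *s e)) B" if "t \<in> sphere 0 r" for t
      using S' that by (intro hol_translate[OF hf] hol_translate[OF hg]; blast)+
    show "hol (\<lambda>z. f (z + 0 *s e)) B" "hol (\<lambda>z. g (z + 0 *s e)) B"
      using S0 by (intro hol_translate[OF hf] hol_translate[OF hg]; blast)+
  qed
  then show ?thesis by simp
qed

text \<open>Riemann extension in several variables, for the quotient \<open>b / a\<close>: on each
  transversal disc the bound gives divisibility by \<open>divides_bounded\<close>, and
  \<open>division_along_lines\<close> turns this into a local holomorphic quotient.\<close>

lemma hol_divide_bounded:
  assumes "open B" "convex B" "hol a B" "hol b B" "x0 \<in> B" "a x0 \<noteq> 0" "\<And>x. x \<in> B \<Longrightarrow> cmod (b x) \<le> C * cmod (a x)"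
  shows "\<exists>q. hol q B \<and> (\<forall>x\<in>B. b x = q x * a x)"
proof -
  have den: "\<exists>x\<in>V. a x \<noteq> 0" if "open V" "V \<noteq> {}" "V \<subseteq> B" for V
    by (rule hol_nonzero_dense[OF assms(1-3,5,6) that])
  obtain q where q: "\<And>x k. x \<in> B \<Longrightarrow> b x = q x * a x"
   "\<And>p. p \<in> B \<Longrightarrow> \<exists>N q'. open N \<and> p \<in> N \<and> N \<subseteq> B \<and> hol q' N \<and> (\<forall>x\<in>N. q x = q' x)"
  proof (rule glue_factor[of B "\<lambda>_::unit. a" "\<lambda>N q. hol q N" "\<lambda>_::unit. b"])
    show "\<exists>x\<in>V. \<exists>k::unit. a x \<noteq> 0" if V: "open V" "V \<noteq> {}" "V \<subseteq> B" for V
      using den[OF V] by blast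
    fix p assume p: "p \<in> B"
    obtain e \<rho> where e: "0 < \<rho>" "\<And>t. cmod t \<le> \<rho> \<Longrightarrow> p + t *s e \<in> B" "\<And>t. 0 < cmod t \<Longrightarrow> cmod t \<le> \<rho> \<Longrightarrow> a (p + t *s e) \<noteq> 0"
    proof (rule exists_nonzero_direction[OF assms(1,3) p])
      show "\<exists>x\<in>V. a x \<noteq> 0" if "open V" "p \<in> V" "V \<subseteq> B" for V using den[OF that(1) _ that(3)] that(2) by blast
    qed (rule that)
    obtain \<delta> where d: "\<delta> > 0" "\<And>y t. y \<in> ball p \<delta> \<Longrightarrow> cmod t \<le> \<rho> \<Longrightarrow> y + t *s e \<in> B"
      "\<And>y t. y \<in> ball p \<delta> \<Longrightarrow> \<rho> / 2 \<le> cmod t \<Longrightarrow> cmod t \<le> \<rho> \<Longrightarrow> a (y + t *s e) \<noteq> 0"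
      by (rule line_box[OF assms(1,3) e]) (assumption+, rule that)
    have sB: "y + t *s e \<in> B" if "y \<in> ball p \<delta>" "t \<in> ball 0 \<rho>" for y t using d(2)[OF that(1), of t] that(2) by simp
    have "\<exists>q. hol q (ball p \<delta>) \<and> (\<forall>z\<in>ball p \<delta>. b z = q z * a z)"
    proof (rule division_along_lines[OF open_ball, of "\<rho>/2" \<rho> b B a])
      show "a (z + t *s e) \<noteq> 0" if "z \<in> ball p \<delta>" "t \<in> sphere 0 (\<rho>/2)" for z t
        using d(3)[OF that(1), of t] that(2) e(1) by simp
      fix V assume V: "V \<noteq> {}" "V \<subseteq> ball p \<delta>"
      then obtain z where z: "z \<in> V" by blast
      then have zd: "z \<in> ball p \<delta>" using V by blast
      have "\<exists>h. h holomorphic_on ball 0 \<rho> \<and> (\<forall>t\<in>ball 0 \<rho>. b (z + t *s e) = h t * a (z + t *s e))"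
      proof (rule divides_bounded[OF open_ball connected_ball, of "\<lambda>t. a (z + t *s e)" 0 \<rho> "\<lambda>t. b (z + t *s e)" "of_real (\<rho>/2)" C])
        show "(\<lambda>t. a (z + t *s e)) holomorphic_on ball 0 \<rho>" "(\<lambda>t. b (z + t *s e)) holomorphic_on ball 0 \<rho>"
          using sB[OF zd] by (auto intro!: hol_line assms(3,4))
        show "a (z + of_real (\<rho>/2) *s e) \<noteq> 0" by (rule d(3)[OF zd]) (use e(1) in auto)
        show "complex_of_real (\<rho> / 2) \<in> ball 0 \<rho>" using e(1) by simp
        show "cmod (b (z + t *s e)) \<le> C * cmod (a (z + t *s e))" if "t \<in> ball 0 \<rho>" for t
          by (rule assms(7)[OF sB[OF zd that]])
      qed
      then show "\<exists>z\<in>V. \<exists>h. h holomorphic_on ball 0 \<rho> \<and> (\<forall>t\<in>ball 0 \<rho>. b (z + t *s e) = h t * a (z + t *s e))"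
        using z by blast
    qed (use e(1) assms(3,4) sB in auto)
    then obtain q where q: "hol q (ball p \<delta>)" "\<forall>z\<in>ball p \<delta>. b z = q z * a z" by blast
    have "ball p \<delta> \<subseteq> B"
    proof
      fix y assume "y \<in> ball p \<delta>"
      then show "y \<in> B" using d(2)[of y 0] e(1) by simp
    qed
    then show "\<exists>N q. open N \<and> p \<in> N \<and> N \<subseteq> B \<and> continuous_on N q \<and> hol q N \<and> (\<forall>x\<in>N. \<forall>k::unit. b x = q x * a x)"
      using q d(1) hol_continuous[OF q(1)] by (intro exI[of _ "ball p \<delta>"] exI[of _ q]) auto
  qed auto
  have "hol q B"
  proof (rule hol_local[OF assms(1)])
    fix p assume "p \<in> B"
    from q(2)[OF this] obtain N q' where N: "open N" "p \<in> N" "hol q' N" "\<forall>x\<in>N. q x = q' x" by (elim exE conjE)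
    have "hol q N" by (rule hol_cong[OF N(3)]) (use N(4) in simp)
    then show "\<exists>T. open T \<and> p \<in> T \<and> hol q T" using N(1,2) by (intro exI[of _ N] conjI)
  qed
  then show ?thesis using q(1) by (intro exI[of _ q] conjI ballI)
qed

text \<open>Fraction-free Gaussian elimination over the integral domain of holomorphic functions on a
  convex open set.\<close>

lemma relation_or_generic_independence:
  fixes c :: "nat \<Rightarrow> 'j \<Rightarrow> complex^'n \<Rightarrow> complex"
  assumes B: "open B" "convex B" "B \<noteq> {}" and c: "\<And>k j. hol (c k j) B"
  shows "(\<exists>a. (\<forall>k<r. hol (a k) B) \<and> (\<exists>k<r. \<exists>z\<in>B. a k z \<noteq> 0) \<and> (\<forall>z\<in>B. \<forall>j. (\<Sum>k<r. a k z * c k j z) = 0)) \<or>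
    (\<exists>\<Delta>. hol \<Delta> B \<and> (\<exists>z\<in>B. \<Delta> z \<noteq> 0) \<and> (\<forall>z\<in>B. \<Delta> z \<noteq> 0 \<longrightarrow>
       (\<forall>b. (\<forall>j. (\<Sum>k<r. b k * c k j z) = 0) \<longrightarrow> (\<forall>k<r. b k = 0))))"
  using c
proof (induction r arbitrary: c)
  case 0
  show ?case using B(3) by (intro disjI2 exI[of _ "\<lambda>_. 1"]) auto
next
  case (Suc r c)
  show ?case
  proof (cases "\<forall>j. \<forall>z\<in>B. c r j z = 0")
    case True
    then show ?thesis using B(3)
      by (intro disjI1 exI[of _ "\<lambda>k z. if k = r then 1 else 0"]) (auto simp: if_distrib sum.delta cong: if_cong)
  next
    case False
    then obtain j0 z0 where z0: "z0 \<in> B" "c r j0 z0 \<noteq> 0" by blast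
    \<comment> \<open>One elimination step with the pivot \<open>c r j0\<close>: cross-multiplying
      instead of dividing keeps the entries holomorphic, and the entries at \<open>j0\<close> become
      zero.\<close>
    define c' where "c' = (\<lambda>k j z. c r j0 z * c k j z - c k j0 z * c r j z)"
    have "hol (c' k j) B" for k j unfolding c'_def by (intro hol_diff hol_mult Suc.prems)
    from Suc.IH[of c', OF this] show ?thesis
    proof
      assume "\<exists>a. (\<forall>k<r. hol (a k) B) \<and> (\<exists>k<r. \<exists>z\<in>B. a k z \<noteq> 0) \<and> (\<forall>z\<in>B. \<forall>j. (\<Sum>k<r. a k z * c' k j z) = 0)"
      then obtain a where a: "\<forall>k<r. hol (a k) B" "\<exists>k<r. \<exists>z\<in>B. a k z \<noteq> 0" "\<forall>z\<in>B. \<forall>j. (\<Sum>k<r. a k z * c' k j z) = 0"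
        by blast
      obtain k z where kz: "k < r" "z \<in> B" "a k z \<noteq> 0" using a(2) by blast
      \<comment> \<open>A relation among the reduced rows becomes one among the original rows after
        multiplication by the pivot; the coefficient of row \<open>r\<close> collects the multiples
        subtracted during elimination.\<close>
      define a' where "a' = (\<lambda>k z. if k = r then - (\<Sum>i<r. a i z * c i j0 z) else a k z * c r j0 z)"
      have "hol (a' i) B" if "i < Suc r" for i
      proof (cases "i = r")
        case True
        have "hol (\<lambda>z. 0 - (\<Sum>i<r. a i z * c i j0 z)) B"
          using a(1) by (intro hol_diff hol_const hol_sum hol_mult Suc.prems) auto
        then show ?thesis using True by (simp add: a'_def)
      next
        case False
        then have "hol (\<lambda>z. a i z * c r j0 z) B" using a(1) that by (intro hol_mult Suc.prems) auto
        then show ?thesis using False by (simp add: a'_def)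
      qed
      moreover have "\<exists>k<Suc r. \<exists>z\<in>B. a' k z \<noteq> 0"
      proof -
        have ak: "hol (a k) B" using a(1) kz(1) by blast
        obtain y where "y \<in> B" "a k y * c r j0 y \<noteq> 0"
          using hol_mult_nonzero[OF B(1,2) ak Suc.prems kz(2,3) z0] by blast
        then show ?thesis using kz(1) unfolding a'_def
          by (intro exI[of _ k]) auto
      qed
      moreover have "(\<Sum>k<Suc r. a' k z * c k j z) = 0" if "z \<in> B" for z j
      proof -
        have "(\<Sum>k<Suc r. a' k z * c k j z) = (\<Sum>k<r. a k z * c r j0 z * c k j z) - (\<Sum>i<r. a i z * c i j0 z) * c r j z"
          by (simp add: a'_def)
        also have "\<dots> = (\<Sum>k<r. a k z * c' k j z)"
          by (simp add: c'_def sum_distrib_left sum_distrib_right sum_subtractf algebra_simps)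
        finally show ?thesis using a(3) that by simp
      qed
      ultimately show ?thesis by (intro disjI1 exI[of _ a']) auto
    next
      assume "\<exists>\<Delta>. hol \<Delta> B \<and> (\<exists>z\<in>B. \<Delta> z \<noteq> 0) \<and> (\<forall>z\<in>B. \<Delta> z \<noteq> 0 \<longrightarrow>
         (\<forall>b. (\<forall>j. (\<Sum>k<r. b k * c' k j z) = 0) \<longrightarrow> (\<forall>k<r. b k = 0)))"
      then obtain \<Delta> where \<Delta>: "hol \<Delta> B" "\<exists>z\<in>B. \<Delta> z \<noteq> 0" and
        ind: "\<forall>z\<in>B. \<Delta> z \<noteq> 0 \<longrightarrow> (\<forall>b. (\<forall>j. (\<Sum>k<r. b k * c' k j z) = 0) \<longrightarrow> (\<forall>k<r. b k = 0))"
        by blast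
      have "b k = 0" if z: "z \<in> B" "\<Delta> z * c r j0 z \<noteq> 0" and b: "\<forall>j. (\<Sum>k<Suc r. b k * c k j z) = 0" and k: "k < Suc r" for z b k
      proof -
        have s: "(\<Sum>k<r. b k * c k j z) = - b r * c r j z" for j
          using b by (simp add: eq_neg_iff_add_eq_0)
        have "(\<Sum>k<r. b k * c' k j z) = 0" for j
        proof -
          have "(\<Sum>k<r. b k * c' k j z) = c r j0 z * (\<Sum>k<r. b k * c k j z) - (\<Sum>k<r. b k * c k j0 z) * c r j z"
            by (simp add: c'_def sum_distrib_left sum_distrib_right sum_subtractf algebra_simps)
          then show ?thesis by (simp add: s)
        qed
        then have b0: "\<forall>k<r. b k = 0" using ind z by auto
        then have "b r * c r j0 z = 0" using s[of j0] by simp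
        then have "b r = 0" using z(2) by simp
        then show ?thesis using b0 k less_Suc_eq by auto
      qed
      moreover have "\<exists>z\<in>B. \<Delta> z * c r j0 z \<noteq> 0"
        using \<Delta>(2) hol_mult_nonzero[OF B(1,2) \<Delta>(1) Suc.prems _ _ z0] by blast
      moreover have "hol (\<lambda>z. \<Delta> z * c r j0 z) B" by (intro hol_mult \<Delta> Suc.prems)
      ultimately show ?thesis by (intro disjI2 exI[of _ "\<lambda>z. \<Delta> z * c r j0 z"]) blast
    qed
  qed
qed

section \<open>Clearing poles along a family of discs\<close>

text \<open>Expanding \<open>q\<close> makes the moments of \<open>q f / u\<close> linear in its
  coefficients. The matrix of this system depends on \<open>k + j\<close> only and consists of the
  moments of \<open>f / u\<close>; its kernel is formed by the polynomials of degree below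
  \<open>d\<close> that clear the poles.\<close>

lemma moment_relation_iff:
  assumes "0 < r" "r < R" "u holomorphic_on ball 0 R" "\<And>t. r \<le> cmod t \<Longrightarrow> cmod t < R \<Longrightarrow> u t \<noteq> 0"
    and f: "f holomorphic_on ball 0 R" and q: "\<And>k. k \<ge> d \<Longrightarrow> coeff q k = 0"
  shows "(\<forall>j. (\<Sum>k<d. coeff q k * contour_integral (circlepath 0 r) (\<lambda>t. t ^ (k + j) * f t / u t)) = 0) \<longleftrightarrow>
    (\<exists>G. G holomorphic_on ball 0 R \<and> (\<forall>t\<in>ball 0 R. poly q t * f t = u t * G t))"
proof -
  have pi: "path_image (circlepath 0 r) = sphere 0 r" using assms(1) by (simp add: path_image_circlepath_nonneg)
  have int: "(\<lambda>t. t ^ j * f t / u t) contour_integrable_on circlepath 0 r" for j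
  proof (rule contour_integrable_continuous_circlepath)
    have "f holomorphic_on sphere 0 r" "u holomorphic_on sphere 0 r"
      using f assms(2,3) by (auto intro: holomorphic_on_subset)
    then show "continuous_on (path_image (circlepath 0 r)) (\<lambda>t. t ^ j * f t / u t)"
      unfolding pi using assms(1,2,4) by (intro continuous_intros holomorphic_on_imp_continuous_on) auto
  qed
  have pq: "poly q t = (\<Sum>k<d. coeff q k * t ^ k)" for t
  proof (cases "d \<le> degree q")
    case True
    then have "q = 0" using q[of "degree q"] by simp
    then show ?thesis by simp
  next
    case False
    have "(\<Sum>k\<le>degree q. coeff q k * t ^ k) = (\<Sum>k<d. coeff q k * t ^ k)"
      by (rule sum.mono_neutral_left) (use False in \<open>auto simp: coeff_eq_0\<close>)
    then show ?thesis by (simp add: poly_altdef)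
  qed
  have eq: "(\<Sum>k<d. coeff q k * contour_integral (circlepath 0 r) (\<lambda>t. t ^ (k + j) * f t / u t)) =
      contour_integral (circlepath 0 r) (\<lambda>t. t ^ j * (poly q t * f t) / u t)" for j
  proof -
    have "contour_integral (circlepath 0 r) (\<lambda>t. t ^ j * (poly q t * f t) / u t) =
      contour_integral (circlepath 0 r) (\<lambda>t. \<Sum>k<d. coeff q k * (t ^ (k + j) * f t / u t))"
      by (rule contour_integral_eq)
        (simp add: pq sum_distrib_left sum_distrib_right sum_divide_distrib power_add mult_ac)
    also have "\<dots> = (\<Sum>k<d. contour_integral (circlepath 0 r) (\<lambda>t. coeff q k * (t ^ (k + j) * f t / u t)))"
      by (intro contour_integral_sum contour_integrable_lmul[OF int]) simp
    finally show ?thesis by (simp only: contour_integral_lmul[OF int])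
  qed
  show ?thesis
    unfolding eq
  proof
    assume "\<forall>j. contour_integral (circlepath 0 r) (\<lambda>t. t ^ j * (poly q t * f t) / u t) = 0"
    then show "\<exists>G. G holomorphic_on ball 0 R \<and> (\<forall>t\<in>ball 0 R. poly q t * f t = u t * G t)"
      by (intro moments_imp_divides[OF assms(1-4)] holomorphic_intros f) auto
  next
    assume "\<exists>G. G holomorphic_on ball 0 R \<and> (\<forall>t\<in>ball 0 R. poly q t * f t = u t * G t)"
    then obtain G where G: "G holomorphic_on ball 0 R" "\<forall>t\<in>ball 0 R. poly q t * f t = u t * G t" by blast
    have "contour_integral (circlepath 0 r) (\<lambda>t. t ^ j * (poly q t * f t) / u t) = 0" for j
    proof (rule divides_imp_moments[OF assms(1,2)])
      show "(\<lambda>t. t ^ j * G t) holomorphic_on ball 0 R" by (intro holomorphic_intros G)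
      fix t :: complex assume "cmod t = r"
      then show "t ^ j * (poly q t * f t) / u t = t ^ j * G t"
        using G(2) assms(2) assms(4)[of t] by simp
    qed
    then show "\<forall>j. contour_integral (circlepath 0 r) (\<lambda>t. t ^ j * (poly q t * f t) / u t) = 0" by blast
  qed
qed

text \<open>The roots are split off one by one: multiplication by \<open>t - \<alpha>\<close> with
  \<open>cmod \<alpha> \<le> r\<close> enlarges the coefficients by a factor of at most
  \<open>1 + r\<close>.\<close>

lemma coeff_bound_of_roots:
  fixes q :: "complex poly"
  assumes "q \<noteq> 0" "\<And>t. poly q t = 0 \<Longrightarrow> cmod t \<le> r"
  shows "\<forall>k. cmod (coeff q k) \<le> cmod (lead_coeff q) * (1 + r) ^ degree q"
  using assms
proof (induction "degree q" arbitrary: q)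
  case 0
  then obtain c where "q = [:c:]" using degree_0_id by metis
  then show ?case by (auto simp: coeff_pCons split: nat.split)
next
  case (Suc n q)
  obtain \<alpha> where \<alpha>: "poly q \<alpha> = 0"
    using alg_closed_imp_poly_has_root[of q] Suc.hyps(2) by auto
  then obtain q1 where q1: "q = [:-\<alpha>, 1:] * q1" by (metis dvdE poly_eq_0_iff_dvd)
  have q10: "q1 \<noteq> 0" using q1 Suc.prems(1) by auto
  have deg: "degree q = Suc (degree q1)" unfolding q1 using q10 by (subst degree_mult_eq) auto
  have lc: "lead_coeff q = lead_coeff q1" unfolding q1 lead_coeff_mult by simp
  have r\<alpha>: "cmod \<alpha> \<le> r" by (rule Suc.prems(2)[OF \<alpha>])
  have r0: "r \<ge> 0" using r\<alpha> norm_ge_zero[of \<alpha>] by linarith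
  have "n = degree q1" using deg Suc.hyps(2) by simp
  moreover have "cmod t \<le> r" if "poly q1 t = 0" for t by (rule Suc.prems(2)) (simp add: q1 that)
  ultimately have IH: "cmod (coeff q1 j) \<le> cmod (lead_coeff q1) * (1 + r) ^ degree q1" for j
    using Suc.hyps(1)[of q1] q10 by blast
  let ?M = "cmod (lead_coeff q1) * (1 + r) ^ degree q1"
  show ?case
  proof
    fix k
    have ck: "coeff q k = (if k = 0 then 0 else coeff q1 (k - 1)) - \<alpha> * coeff q1 k"
      unfolding q1 by (cases k) (simp_all add: mult_pCons_left)
    have "cmod (coeff q k) \<le> cmod (if k = 0 then 0 else coeff q1 (k - 1)) + cmod \<alpha> * cmod (coeff q1 k)"
      unfolding ck by (metis norm_triangle_ineq4 norm_mult)
    also have "\<dots> \<le> ?M + r * ?M"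
      using IH[of k] IH[of "k - 1"] r\<alpha> r0 by (intro add_mono mult_mono) (auto intro: mult_nonneg_nonneg)
    also have "\<dots> = cmod (lead_coeff q) * (1 + r) ^ degree q" unfolding lc unfolding deg by (simp add: algebra_simps)
    finally show "cmod (coeff q k) \<le> cmod (lead_coeff q) * (1 + r) ^ degree q" .
  qed
qed

lemma divides_remove_root:
  assumes u: "u holomorphic_on ball 0 R" and f: "f holomorphic_on ball 0 R" and G: "G holomorphic_on ball 0 R"
    and R: "0 < R"
    and eq: "\<And>t. t \<in> ball 0 R \<Longrightarrow> poly ([:-\<alpha>, 1:] * q1) t * f t = u t * G t"
    and "\<alpha> \<in> ball 0 R \<Longrightarrow> G \<alpha> = 0"
  shows "\<exists>H. H holomorphic_on ball 0 R \<and> (\<forall>t\<in>ball 0 R. poly q1 t * f t = u t * H t)"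
proof -
  define H where "H t = (if t = \<alpha> then deriv G \<alpha> else (G t - G \<alpha>) / (t - \<alpha>))" for t
  define H' where "H' t = (if \<alpha> \<in> ball 0 R then H t else G t / (t - \<alpha>))" for t
  have H': "H' holomorphic_on ball 0 R"
  proof (cases "\<alpha> \<in> ball 0 R")
    case True
    then have "H holomorphic_on ball 0 R"
      unfolding H_def by (intro pole_lemma[OF G]) simp
    moreover have "H' = H" using True by (auto simp: H'_def)
    ultimately show ?thesis by simp
  next
    case False
    then have "(\<lambda>t. G t / (t - \<alpha>)) holomorphic_on ball 0 R" by (intro holomorphic_intros G) auto
    moreover have "H' = (\<lambda>t. G t / (t - \<alpha>))" using False by (auto simp: H'_def)
    ultimately show ?thesis by simp
  qed
  have off: "poly q1 t * f t - u t * H' t = 0" if t: "t \<in> ball 0 R - {\<alpha>}" for t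
  proof -
    have "(t - \<alpha>) * H' t = G t" using t assms(6) by (auto simp: H'_def H_def)
    moreover have "(t - \<alpha>) * (poly q1 t * f t) = u t * G t" using eq[of t] t by (simp add: algebra_simps)
    moreover have "(t - \<alpha>) * (poly q1 t * f t - u t * H' t) = (t - \<alpha>) * (poly q1 t * f t) - u t * ((t - \<alpha>) * H' t)"
      by (simp add: algebra_simps)
    ultimately have "(t - \<alpha>) * (poly q1 t * f t - u t * H' t) = 0" by (simp only: diff_self)
    then show ?thesis using t by simp
  qed
  \<comment> \<open>Cancelling \<open>t - \<alpha>\<close> gives the identity off
    \<open>\<alpha>\<close>; the identity theorem supplies it at \<open>\<alpha>\<close>.\<close>
  have "poly q1 t * f t - u t * H' t = 0" if t: "t \<in> ball 0 R" for t
  proof (rule analytic_continuation_open[of "ball 0 R - {\<alpha>}" "ball 0 R" "\<lambda>t. poly q1 t * f t - u t * H' t" "\<lambda>_. 0"])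
    show "ball 0 R - {\<alpha>} \<noteq> {}"
    proof
      assume "ball 0 R - {\<alpha>} = {}"
      then have "ball 0 R \<subseteq> {\<alpha>}" by blast
      moreover have "0 \<in> ball (0::complex) R" "complex_of_real (R/2) \<in> ball 0 R" using R by auto
      ultimately have "complex_of_real (R/2) = 0" by blast
      then show False using R by simp
    qed
    show "(\<lambda>t. poly q1 t * f t - u t * H' t) holomorphic_on ball 0 R" by (intro holomorphic_intros f u H')
  qed (use off t in auto)
  then show ?thesis using H' by auto
qed

text \<open>The discs are parametrised by an open set of full dimension, so that every point of
  \<open>B\<close> is the centre of its own disc and evaluation at \<open>t = 0\<close> returns
  functions on \<open>B\<close>.\<close>

locale disc_family =
  fixes B S :: "(complex^'n) set" and v :: "'k \<Rightarrow> complex^'n \<Rightarrow> complex" and k0 :: 'k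
    and e :: "complex^'n" and r R :: real
  assumes B: "open B" "convex B" "B \<noteq> {}" and r: "0 < r" "r < R"
    and S: "\<And>y t. y \<in> B \<Longrightarrow> t \<in> ball 0 R \<Longrightarrow> y + t *s e \<in> S"
    and v: "\<And>k. hol (v k) S"
    and nz: "\<And>y t. y \<in> B \<Longrightarrow> r \<le> cmod t \<Longrightarrow> cmod t < R \<Longrightarrow> v k0 (y + t *s e) \<noteq> 0"
begin

text \<open>The index pair combines an entry with the power of a test monomial, so that the
  conditions on all entries form a single linear system.\<close>

definition moment :: "nat \<Rightarrow> 'k \<times> nat \<Rightarrow> complex^'n \<Rightarrow> complex" where
  "moment k p z = contour_integral (circlepath 0 r) (\<lambda>t. t ^ (k + snd p) * v (fst p) (z + t *s e) / v k0 (z + t *s e))"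

text \<open>The entries of \<open>v\<close>, multiplied by \<open>q / v k0\<close>, have no poles on the disc through \<open>z\<close>.\<close>

definition clears :: "complex^'n \<Rightarrow> complex poly \<Rightarrow> bool" where
  "clears z q \<longleftrightarrow> (\<forall>i. \<exists>G. G holomorphic_on ball 0 R \<and>
     (\<forall>t\<in>ball 0 R. poly q t * v i (z + t *s e) = v k0 (z + t *s e) * G t))"

lemma B_subset: "B \<subseteq> S"
proof
  fix y assume "y \<in> B"
  then show "y \<in> S" using S[of y 0] r by simp
qed

lemma v_line: "z \<in> B \<Longrightarrow> (\<lambda>t. v i (z + t *s e)) holomorphic_on ball 0 R"
  using S by (intro hol_line[OF v]) auto

lemma sphere_S: "y \<in> B \<Longrightarrow> t \<in> sphere 0 r \<Longrightarrow> y + t *s e \<in> S"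
  using S r by simp

lemma hol_moment_integral:
  assumes "continuous_on (B \<times> sphere 0 r) (\<lambda>p. w (fst p) (snd p))" "\<And>t. t \<in> sphere 0 r \<Longrightarrow> hol (\<lambda>z. w z t) B"
  shows "hol (\<lambda>z. contour_integral (circlepath 0 r) (\<lambda>t. w z t * v i (z + t *s e) / v k0 (z + t *s e))) B"
proof (rule hol_contour_integral_param[OF r(1) B(1)])
  have nz': "v k0 (z + t *s e) \<noteq> 0" if "z \<in> B" "t \<in> sphere 0 r" for z t using nz[OF that(1), of t] that(2) r by simp
  have c: "continuous_on (B \<times> sphere 0 r) (\<lambda>p. v i (fst p + snd p *s e))" for i
    by (rule line_pair_continuous[OF v sphere_S])
  show "continuous_on (B \<times> sphere 0 r) (\<lambda>p. w (fst p) (snd p) * v i (fst p + snd p *s e) / v k0 (fst p + snd p *s e))"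
    using nz' by (intro continuous_intros assms(1) c) auto
  show "hol (\<lambda>z. w z t * v i (z + t *s e) / v k0 (z + t *s e)) B" if "t \<in> sphere 0 r" for t
    using nz' that sphere_S by (intro hol_divide hol_mult assms(2) hol_translate[OF v]) auto
qed

lemma hol_moment: "hol (moment k p) B"
  unfolding moment_def[abs_def]
  by (rule hol_moment_integral[where w="\<lambda>z t. t ^ (k + snd p)"]) (auto intro!: continuous_intros)

lemma clears_iff:
  assumes "z \<in> B" "\<And>k. k \<ge> d \<Longrightarrow> coeff q k = 0"
  shows "clears z q \<longleftrightarrow> (\<forall>p. (\<Sum>k<d. coeff q k * moment k p z) = 0)"
  unfolding clears_def moment_def split_paired_All fst_conv snd_conv
  using moment_relation_iff[OF r v_line[OF assms(1)] nz[OF assms(1)] v_line[OF assms(1)] assms(2)] by simp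

text \<open>On a single disc the zeros of \<open>v k0\<close> are finitely many; taken with
  multiplicity they are the roots of a polynomial that clears all entries at once.\<close>

lemma exists_clearing:
  assumes z: "z \<in> B"
  obtains q where "q \<noteq> 0" "clears z q"
proof -
  obtain as g where g: "g holomorphic_on ball 0 R" "\<forall>t\<in>ball 0 R. g t \<noteq> 0"
     "\<forall>t\<in>ball 0 R. v k0 (z + t *s e) = poly (\<Prod>a\<leftarrow>as. [:-a, 1:]) t * g t"
    using zeros_factor_disc[OF r v_line[OF z] nz[OF z]] by blast
  have "clears z (\<Prod>a\<leftarrow>as. [:-a, 1:])"
    unfolding clears_def
  proof
    fix i
    have "(\<lambda>t. v i (z + t *s e) / g t) holomorphic_on ball 0 R"
      using g(2) by (intro holomorphic_intros v_line[OF z] g(1)) auto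
    then show "\<exists>G. G holomorphic_on ball 0 R \<and> (\<forall>t\<in>ball 0 R. poly (\<Prod>a\<leftarrow>as. [:-a, 1:]) t * v i (z + t *s e) = v k0 (z + t *s e) * G t)"
      using g(2,3) by (intro exI[of _ "\<lambda>t. v i (z + t *s e) / g t"]) auto
  qed
  moreover have "(\<Prod>a\<leftarrow>as. [:-a, 1:]) \<noteq> (0 :: complex poly)" by (auto simp: prod_list_zero_iff)
  ultimately show ?thesis using that by blast
qed

text \<open>A polynomial in \<open>t\<close> of degree less than \<open>d\<close>, with coefficients
  holomorphic in \<open>z\<close> and not all identically zero, that clears the poles on every
  disc.\<close>

definition relation :: "nat \<Rightarrow> (nat \<Rightarrow> complex^'n \<Rightarrow> complex) \<Rightarrow> bool" where
  "relation d a \<longleftrightarrow> (\<forall>k<d. hol (a k) B) \<and> (\<exists>k<d. \<exists>z\<in>B. a k z \<noteq> 0) \<and>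
     (\<forall>z\<in>B. \<forall>p. (\<Sum>k<d. a k z * moment k p z) = 0)"

text \<open>\<open>\<Delta>\<close> plays the part of a nonvanishing minor of the moment matrix:
  where it is nonzero, the first \<open>d\<close> rows are independent.\<close>

definition generic :: "nat \<Rightarrow> (complex^'n \<Rightarrow> complex) \<Rightarrow> bool" where
  "generic d \<Delta> \<longleftrightarrow> hol \<Delta> B \<and> (\<exists>z\<in>B. \<Delta> z \<noteq> 0) \<and>
     (\<forall>z\<in>B. \<Delta> z \<noteq> 0 \<longrightarrow> (\<forall>q. clears z q \<longrightarrow> (\<forall>k\<ge>d. coeff q k = 0) \<longrightarrow> q = 0))"

lemma relation_or_generic: "(\<exists>a. relation d a) \<or> (\<exists>\<Delta>. generic d \<Delta>)"
  using relation_or_generic_independence[OF B hol_moment, of d]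
proof
  assume "\<exists>a. (\<forall>k<d. hol (a k) B) \<and> (\<exists>k<d. \<exists>z\<in>B. a k z \<noteq> 0) \<and> (\<forall>z\<in>B. \<forall>j. (\<Sum>k<d. a k z * moment k j z) = 0)"
  then show ?thesis by (simp only: relation_def simp_thms)
next
  assume "\<exists>\<Delta>. hol \<Delta> B \<and> (\<exists>z\<in>B. \<Delta> z \<noteq> 0) \<and> (\<forall>z\<in>B. \<Delta> z \<noteq> 0 \<longrightarrow>
       (\<forall>b. (\<forall>p. (\<Sum>k<d. b k * moment k p z) = 0) \<longrightarrow> (\<forall>k<d. b k = 0)))"
  then obtain \<Delta> where \<Delta>: "hol \<Delta> B" "\<exists>z\<in>B. \<Delta> z \<noteq> 0" and ind: "\<forall>z\<in>B. \<Delta> z \<noteq> 0 \<longrightarrow>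
       (\<forall>b. (\<forall>p. (\<Sum>k<d. b k * moment k p z) = 0) \<longrightarrow> (\<forall>k<d. b k = 0))"
    by (elim exE conjE)
  have "q = 0" if z: "z \<in> B" "\<Delta> z \<noteq> 0" and c: "clears z q" and k: "\<forall>k\<ge>d. coeff q k = 0" for z q
  proof (rule poly_eqI)
    fix k
    have "\<forall>p. (\<Sum>k<d. coeff q k * moment k p z) = 0" using clears_iff[OF z(1), of d q] k c by simp
    then have "\<forall>k<d. coeff q k = 0" using ind z by (auto dest!: spec[of _ "coeff q"])
    then show "coeff q k = coeff 0 k" using k by (cases "k < d") auto
  qed
  then have "generic d \<Delta>" unfolding generic_def using \<Delta> by (intro conjI ballI allI impI)
  then show ?thesis by (intro disjI2 exI)
qed

text \<open>If there were no relation of any length, the sets where \<open>\<Delta> d\<close> is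
  nonzero would be open and dense for every \<open>d\<close>. By Baire they would have a common
  point, at which no nonzero polynomial of any degree clears the poles, against
  \<open>exists_clearing\<close>.\<close>

lemma exists_relation: "\<exists>d a. relation d a"
proof (rule ccontr)
  assume no: "\<not> ?thesis"
  then have "\<exists>\<Delta>. generic d \<Delta>" for d using relation_or_generic[of d] by (simp only: not_ex simp_thms)
  then obtain \<Delta> where gen: "\<And>d. generic d (\<Delta> d)" by metis
  then have \<Delta>: "\<And>d. hol (\<Delta> d) B" "\<And>d. \<exists>z\<in>B. \<Delta> d z \<noteq> 0" by (simp_all add: generic_def)
  have q0: "q = 0" if "z \<in> B" "\<Delta> d z \<noteq> 0" "clears z q" "\<forall>k\<ge>d. coeff q k = 0" for d z q
    using gen[of d] that by (simp add: generic_def)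
  obtain z0 where "z0 \<in> B" using B(3) by blast
  then obtain \<epsilon> where \<epsilon>: "\<epsilon> > 0" "cball z0 \<epsilon> \<subseteq> B" using B(1) open_contains_cball by blast
  \<comment> \<open>Baire's theorem asks for a closed set, so it is applied in a closed ball inside
    the open set \<open>B\<close>.\<close>
  let ?K = "cball z0 \<epsilon>"
  let ?U = "\<lambda>d. ?K \<inter> {z \<in> B. \<Delta> d z \<noteq> 0}"
  have "?K \<subseteq> closure (\<Inter> (range ?U))"
  proof (rule Baire)
    fix T assume "T \<in> range ?U"
    then obtain d where T: "T = ?U d" by blast
    have o: "open {z \<in> B. \<Delta> d z \<noteq> 0}" by (rule open_nonzero[OF B(1) \<Delta>(1)])
    have "?K \<subseteq> closure T"
    proof
      fix x assume x: "x \<in> ?K"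
      show "x \<in> closure T"
        unfolding closure_iff_nhds_not_empty
      proof (intro allI impI)
        fix A V assume V: "V \<subseteq> A" "open V" "x \<in> V"
        have "x \<in> closure (ball z0 \<epsilon>)" using x \<epsilon>(1) by (simp add: closure_ball)
        then have ne: "V \<inter> ball z0 \<epsilon> \<noteq> {}" using V(2,3) open_Int_closure_eq_empty[of V "ball z0 \<epsilon>"] by blast
        have sub: "V \<inter> ball z0 \<epsilon> \<subseteq> B" using \<epsilon>(2) ball_subset_cball[of z0 \<epsilon>] by blast
        obtain y where y: "y \<in> B" "\<Delta> d y \<noteq> 0" using \<Delta>(2) by blast
        have "open (V \<inter> ball z0 \<epsilon>)" using V(2) by (rule open_Int) simp
        from hol_nonzero_dense[OF B(1,2) \<Delta>(1) y this ne sub] obtain z where "z \<in> V \<inter> ball z0 \<epsilon>" "\<Delta> d z \<noteq> 0"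
          by blast
        then have "z \<in> T \<inter> A" using V(1) sub ball_subset_cball[of z0 \<epsilon>] unfolding T by blast
        then show "T \<inter> A \<noteq> {}" by blast
      qed
    qed
    then show "openin (top_of_set ?K) T \<and> ?K \<subseteq> closure T"
      unfolding openin_open using o T by blast
  qed auto
  moreover have "z0 \<in> ?K" using \<epsilon>(1) by simp
  ultimately have "\<Inter> (range ?U) \<noteq> {}" by (metis closure_empty empty_iff subsetD)
  then obtain z where z: "\<And>d. z \<in> ?U d" by blast
  obtain q where q: "q \<noteq> 0" "clears z q" using exists_clearing[of z] z by blast
  have "q = 0"
    by (rule q0[of z "Suc (degree q)"]) (use z q in \<open>auto simp: coeff_eq_0\<close>)
  then show False using q(1) by blast
qed

end

section \<open>The monic clearing polynomial of least degree\<close>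

context disc_family begin

text \<open>The shortest relation is taken. There is none of length \<open>m\<close>, so generic
  parameters exist for that length; and the top coefficient is not identically zero, since dropping
  it would leave a relation of length \<open>m\<close>.\<close>

lemma minimal_relation:
  obtains m a \<Delta> where "relation (Suc m) a" "generic m \<Delta>" "\<exists>z\<in>B. a m z \<noteq> 0"
proof -
  define d where "d = (LEAST d. \<exists>a. relation d a)"
  have "\<exists>a. relation d a" unfolding d_def by (rule LeastI_ex[OF exists_relation])
  then obtain a where a: "relation d a" by blast
  then have "d \<noteq> 0" by (auto simp: relation_def)
  then obtain m where m: "d = Suc m" using not0_implies_Suc by blast
  have nm: "\<not> relation m a'" for a'
  proof
    assume "relation m a'"
    then have "d \<le> m" unfolding d_def by (intro Least_le) blast
    then show False using m by simp
  qed
  then obtain \<Delta> where "generic m \<Delta>" using relation_or_generic[of m] by blast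
  moreover have "\<exists>z\<in>B. a m z \<noteq> 0"
  proof (rule ccontr)
    assume "\<not> ?thesis"
    then have z: "a m z = 0" if "z \<in> B" for z using that by blast
    have "relation m a"
      unfolding relation_def
    proof (intro conjI)
      show "\<forall>k<m. hol (a k) B" using a m by (simp add: relation_def)
      obtain k z' where k: "k < Suc m" "z' \<in> B" "a k z' \<noteq> 0" using a m unfolding relation_def by blast
      then have "k \<noteq> m" using z by metis
      then show "\<exists>k<m. \<exists>z\<in>B. a k z \<noteq> 0" using k less_Suc_eq by blast
      show "\<forall>z\<in>B. \<forall>p. (\<Sum>k<m. a k z * moment k p z) = 0"
      proof (intro ballI allI)
        fix z p assume "z \<in> B"
        then have "(\<Sum>k<Suc m. a k z * moment k p z) = 0" using a m unfolding relation_def by blast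
        then show "(\<Sum>k<m. a k z * moment k p z) = 0" using z[OF \<open>z \<in> B\<close>] by simp
      qed
    qed
    then show False using nm by blast
  qed
  ultimately show ?thesis using that a m by blast
qed

lemma generic_root:
  assumes gen: "generic m \<Delta>" and z: "z \<in> B" "\<Delta> z \<noteq> 0" and q: "degree q = m" "q \<noteq> 0"
    and G: "\<And>i. G i holomorphic_on ball 0 R"
      "\<And>i t. t \<in> ball 0 R \<Longrightarrow> poly q t * v i (z + t *s e) = v k0 (z + t *s e) * G i t"
    and \<alpha>: "poly q \<alpha> = 0"
  shows "\<alpha> \<in> ball 0 R \<and> (\<exists>i. G i \<alpha> \<noteq> 0)"
proof (rule ccontr)
  assume "\<not> ?thesis"
  then have G0: "G i \<alpha> = 0" if "\<alpha> \<in> ball 0 R" for i using that by blast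
  obtain q1 where q1: "q = [:-\<alpha>, 1:] * q1" using \<alpha> by (metis dvdE poly_eq_0_iff_dvd)
  have q10: "q1 \<noteq> 0" using q1 q(2) by auto
  have deg: "degree q = Suc (degree q1)" unfolding q1 using q10 by (subst degree_mult_eq) auto
  have "clears z q1"
    unfolding clears_def
  proof
    fix i
    show "\<exists>G. G holomorphic_on ball 0 R \<and> (\<forall>t\<in>ball 0 R. poly q1 t * v i (z + t *s e) = v k0 (z + t *s e) * G t)"
    proof (rule divides_remove_root[OF v_line[OF z(1)] v_line[OF z(1)] G(1)[of i]])
      show "0 < R" using r by simp
      show "poly ([:-\<alpha>, 1:] * q1) t * v i (z + t *s e) = v k0 (z + t *s e) * G i t" if "t \<in> ball 0 R" for t
        using G(2)[OF that, of i] q1 by simp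
    qed (rule G0)
  qed
  moreover have "\<forall>k\<ge>m. coeff q1 k = 0" using deg q(1) by (auto intro: coeff_eq_0)
  ultimately have "q1 = 0" using gen z unfolding generic_def by blast
  then show False using q10 by blast
qed

lemma generic_root_bound:
  assumes gen: "generic m \<Delta>" and z: "z \<in> B" "\<Delta> z \<noteq> 0" and q: "degree q = m" "q \<noteq> 0" "clears z q"
    and \<alpha>: "poly q \<alpha> = 0"
  shows "cmod \<alpha> < r" "v k0 (z + \<alpha> *s e) = 0"
proof -
  obtain G where G: "\<And>i. G i holomorphic_on ball 0 R"
      "\<And>i t. t \<in> ball 0 R \<Longrightarrow> poly q t * v i (z + t *s e) = v k0 (z + t *s e) * G i t"
    using q(3) unfolding clears_def by metis
  from generic_root[OF gen z q(1,2) G \<alpha>] obtain i where a: "\<alpha> \<in> ball 0 R" "G i \<alpha> \<noteq> 0" by blast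
  show v0: "v k0 (z + \<alpha> *s e) = 0" using G(2)[OF a(1), of i] a(2) \<alpha> by simp
  show "cmod \<alpha> < r"
  proof (rule ccontr)
    assume "\<not> cmod \<alpha> < r"
    then show False using nz[OF z(1), of \<alpha>] a(1) v0 by simp
  qed
qed

text \<open>The leading coefficient of the shortest relation is divided out. Where it and
  \<open>\<Delta>\<close> are nonzero the roots lie within \<open>r\<close>, so every coefficient is
  at most \<open>(1 + r) ^ m\<close> times the leading one; the estimate extends by continuity, and
  \<open>hol_divide_bounded\<close> provides holomorphic quotients.\<close>

lemma monic_clearing_family:
  obtains m Q \<Delta> where "generic m \<Delta>" "\<And>k. hol (\<lambda>z. coeff (Q z) k) B" "\<And>z. degree (Q z) = m"
    "\<And>z. coeff (Q z) m = 1" "\<And>z. z \<in> B \<Longrightarrow> clears z (Q z)"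
proof -
  obtain m a \<Delta> where rel: "relation (Suc m) a" and gen: "generic m \<Delta>" and am: "\<exists>z\<in>B. a m z \<noteq> 0"
    using minimal_relation by blast
  have ha: "hol (a k) B" if "k \<le> m" for k using rel that unfolding relation_def by auto
  have h\<Delta>: "hol \<Delta> B" and \<Delta>0: "\<exists>z\<in>B. \<Delta> z \<noteq> 0" using gen unfolding generic_def by blast+
  define p where "p z = (\<Sum>k\<le>m. monom (a k z) k)" for z
  have cp: "coeff (p z) k = (if k \<le> m then a k z else 0)" for z k
    by (simp add: p_def coeff_sum)
  have clp: "clears z (p z)" if "z \<in> B" for z
  proof -
    have "(\<Sum>k<Suc m. coeff (p z) k * moment k q z) = 0" for q
    proof -
      have "(\<Sum>k<Suc m. coeff (p z) k * moment k q z) = (\<Sum>k<Suc m. a k z * moment k q z)"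
        by (rule sum.cong) (auto simp: cp)
      also have "\<dots> = 0" using rel that unfolding relation_def by blast
      finally show ?thesis .
    qed
    then show ?thesis using clears_iff[OF that, of "Suc m" "p z"] by (simp add: cp del: sum.lessThan_Suc)
  qed
  obtain z1 where z1: "z1 \<in> B" "a m z1 \<noteq> 0" using am by blast
  have den: "\<exists>z\<in>V. \<Delta> z \<noteq> 0 \<and> a m z \<noteq> 0" if V: "open V" "V \<noteq> {}" "V \<subseteq> B" for V
  proof -
    obtain z2 where z2: "z2 \<in> B" "\<Delta> z2 \<noteq> 0" using \<Delta>0 by blast
    obtain y where y: "y \<in> B" "\<Delta> y * a m y \<noteq> 0" using hol_mult_nonzero[OF B(1,2) h\<Delta> ha[OF order_refl] z2 z1] by blast
    have "hol (\<lambda>z. \<Delta> z * a m z) B" using h\<Delta> ha[OF order_refl] by (rule hol_mult)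
    from hol_nonzero_dense[OF B(1,2) this y V] show ?thesis by auto
  qed
  \<comment> \<open>A strict failure of the bound is an open condition, so it would also occur at a
    point where \<open>\<Delta>\<close> and \<open>a m\<close> are nonzero, and there the root bound
    excludes it.\<close>
  have bd: "cmod (a k z) \<le> (1 + r) ^ m * cmod (a m z)" if k: "k \<le> m" and z: "z \<in> B" for k z
  proof (rule ccontr)
    assume ne: "\<not> ?thesis"
    let ?f = "\<lambda>z. cmod (a k z) - (1 + r) ^ m * cmod (a m z)"
    have "continuous_on B ?f"
      by (intro continuous_intros hol_continuous ha k order_refl)
    then have "open (B \<inter> ?f -` {0<..})" by (rule continuous_open_preimage[OF _ B(1)]) auto
    moreover have "z \<in> B \<inter> ?f -` {0<..}" using ne z by simp
    ultimately obtain y where y: "y \<in> B \<inter> ?f -` {0<..}" "\<Delta> y \<noteq> 0" "a m y \<noteq> 0"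
      using den[of "B \<inter> ?f -` {0<..}"] by blast
    then have yB: "y \<in> B" by blast
    have "degree (p y) = m"
    proof (rule antisym)
      show "degree (p y) \<le> m" by (rule degree_le) (simp add: cp)
      show "m \<le> degree (p y)" by (rule le_degree) (simp add: cp y)
    qed
    moreover have p0: "p y \<noteq> 0" using y(3) cp[of y m] by auto
    ultimately have "cmod t \<le> r" if "poly (p y) t = 0" for t
      using generic_root_bound(1)[OF gen yB y(2) _ p0 clp[OF yB] that] by simp
    then have "cmod (coeff (p y) k) \<le> cmod (lead_coeff (p y)) * (1 + r) ^ degree (p y)"
      using coeff_bound_of_roots[OF p0, of r] by blast
    then show False using y(1) k \<open>degree (p y) = m\<close> by (simp add: cp mult.commute)
  qed
  have "\<exists>q. hol q B \<and> (\<forall>x\<in>B. a k x = q x * a m x)" if "k \<le> m" for k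
    by (rule hol_divide_bounded[OF B(1,2) ha[OF order_refl] ha[OF that] z1 bd[OF that]])
  then obtain q where q: "\<And>k. k \<le> m \<Longrightarrow> hol (q k) B" "\<And>k x. k \<le> m \<Longrightarrow> x \<in> B \<Longrightarrow> a k x = q k x * a m x"
    by metis
  define Q where "Q z = monom 1 m + (\<Sum>k<m. monom (q k z) k)" for z
  have cQ: "coeff (Q z) k = (if k = m then 1 else if k < m then q k z else 0)" for z k
    by (simp add: Q_def coeff_sum)
  show ?thesis
  proof (rule that[OF gen, of Q])
    show "hol (\<lambda>z. coeff (Q z) k) B" for k
      using q(1)[of k] by (cases "k = m"; cases "k < m") (auto simp: cQ)
    show "degree (Q z) = m" for z
    proof (rule antisym)
      show "degree (Q z) \<le> m" by (rule degree_le) (simp add: cQ)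
      show "m \<le> degree (Q z)" by (rule le_degree) (simp add: cQ)
    qed
    show "coeff (Q z) m = 1" for z by (simp add: cQ)
    show "clears z (Q z)" if z: "z \<in> B" for z
    proof -
      have "(\<Sum>k<Suc m. coeff (Q z) k * moment k p z) = 0" for p
      \<comment> \<open>The relation can be divided by \<open>a m\<close> where that is nonzero; the
        moment equations of the monic polynomial extend from there by density.\<close>
      proof (rule hol_eq_zero_dense[OF B(1) _ _ z])
        show "hol (\<lambda>z. \<Sum>k<Suc m. coeff (Q z) k * moment k p z) B"
        proof (intro hol_sum hol_mult hol_moment)
          show "hol (\<lambda>z. coeff (Q z) k) B" if "k \<in> {..<Suc m}" for k
            using q(1)[of k] by (cases "k = m"; cases "k < m") (auto simp: cQ)
        qed
        fix V :: "(complex^'n) set" assume V: "open V" "V \<noteq> {}" "V \<subseteq> B"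
        obtain y where y: "y \<in> V" "a m y \<noteq> 0" using den[OF V] by blast
        then have yB: "y \<in> B" using V by blast
        have "a m y * (\<Sum>k<Suc m. coeff (Q y) k * moment k p y) = (\<Sum>k<Suc m. a k y * moment k p y)"
          unfolding sum_distrib_left
        proof (rule sum.cong[OF refl])
          fix k assume k: "k \<in> {..<Suc m}"
          show "a m y * (coeff (Q y) k * moment k p y) = a k y * moment k p y"
          proof (cases "k = m")
            case False
            then have km: "k < m" using k by simp
            have "a k y = q k y * a m y" using q(2)[OF _ yB, of k] km by simp
            then show ?thesis using km by (simp add: cQ)
          qed (simp add: cQ)
        qed
        also have "\<dots> = 0" using rel yB unfolding relation_def by blast
        finally have "(\<Sum>k<Suc m. coeff (Q y) k * moment k p y) = 0" using y(2) by (simp only: mult_eq_0_iff) simp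
        then show "\<exists>z\<in>V. (\<Sum>k<Suc m. coeff (Q z) k * moment k p z) = 0" using y(1) by blast
      qed
      then show ?thesis using clears_iff[OF z, of "Suc m" "Q z"] by (simp add: cQ del: sum.lessThan_Suc)
    qed
  qed
qed

end

text \<open>\<open>\<phi>\<close> generates all families parallel to \<open>v\<close>. Multipliers
  are asked for near each point only, which is what division along small discs yields; they are
  glued on the manifold.\<close>

definition local_generator :: "('k \<Rightarrow> complex^'n \<Rightarrow> complex) \<Rightarrow> ('k \<Rightarrow> complex^'n \<Rightarrow> complex) \<Rightarrow> (complex^'n) set \<Rightarrow> bool" where
  "local_generator \<phi> v B \<longleftrightarrow> (\<forall>V \<psi>. open V \<and> V \<subseteq> B \<and> (\<forall>k. hol (\<psi> k) V) \<and>
      (\<forall>y\<in>V. \<forall>j k. \<psi> j y * v k y = \<psi> k y * v j y) \<longrightarrow>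
      (\<forall>x\<in>V. \<exists>W g. open W \<and> x \<in> W \<and> W \<subseteq> V \<and> hol g W \<and> (\<forall>y\<in>W. \<forall>k. \<psi> k y = g y * \<phi> k y)))"

section \<open>Primitive families on a family of discs\<close>

context disc_family begin

text \<open>\<open>\<phi> i z\<close> is the value at the centre of the cleared entry
  \<open>Q z * v i / v k0\<close>, so \<open>\<phi> k0 z\<close> is \<open>poly (Q z) 0\<close>. For
  a family \<open>\<psi>\<close> parallel to \<open>v\<close> it suffices to divide
  \<open>\<psi> k0\<close> by \<open>Q\<close> along generic discs: near each point of such a disc
  some cleared entry \<open>G z i\<close> is nonzero, and \<open>\<psi> i / G z i\<close> is the
  quotient.\<close>

theorem primitive_on_disc_family:
  assumes v0: "\<exists>z\<in>B. v k0 z \<noteq> 0"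
  obtains \<phi> where "\<And>i. hol (\<phi> i) B" "\<exists>z\<in>B. \<phi> k0 z \<noteq> 0"
    "\<And>z i j. z \<in> B \<Longrightarrow> \<phi> i z * v j z = \<phi> j z * v i z"
    "local_generator \<phi> v B"
proof -
  obtain m Q \<Delta> where gen: "generic m \<Delta>" and hQ: "\<And>k. hol (\<lambda>z. coeff (Q z) k) B" and dQ: "\<And>z. degree (Q z) = m"
    and mQ: "\<And>z. coeff (Q z) m = 1" and cQ: "\<And>z. z \<in> B \<Longrightarrow> clears z (Q z)"
    by (rule monic_clearing_family) (rule that)
  have Q0: "Q z \<noteq> 0" for z using mQ[of z] by auto
  have h\<Delta>: "hol \<Delta> B" and \<Delta>0: "\<exists>z\<in>B. \<Delta> z \<noteq> 0" using gen unfolding generic_def by blast+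
  have den\<Delta>: "\<exists>z\<in>V. \<Delta> z \<noteq> 0" if V: "open V" "V \<noteq> {}" "V \<subseteq> B" for V
    using hol_nonzero_dense[OF B(1,2) h\<Delta> _ _ V] \<Delta>0 by blast
  have hv: "hol (v i) B" for i by (rule hol_subset[OF v B_subset])
  have denv: "\<exists>z\<in>V. v k0 z \<noteq> 0" if V: "open V" "V \<noteq> {}" "V \<subseteq> B" for V
    using hol_nonzero_dense[OF B(1,2) hv _ _ V] v0 by blast
  \<comment> \<open>\<open>v k0\<close> is nonzero on a dense set, so identities may be checked
    where it can be cancelled.\<close>
  have zero: "f z = 0" if "open V" "V \<subseteq> B" "hol f V" "\<And>z. z \<in> V \<Longrightarrow> v k0 z \<noteq> 0 \<Longrightarrow> f z = 0" "z \<in> V" for f V z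
  proof (rule hol_eq_zero_dense[OF that(1,3) _ that(5)])
    fix U assume "open U" "U \<noteq> {}" "U \<subseteq> V"
    then show "\<exists>z\<in>U. f z = 0" using denv[of U] that(2,4) by blast
  qed
  have pQ: "poly (Q z) t = (\<Sum>k\<le>m. coeff (Q z) k * t ^ k)" for z t
    by (simp add: poly_altdef dQ)
  have contQ: "continuous_on (B \<times> T) (\<lambda>p. poly (Q (fst p)) (snd p))" for T
    unfolding pQ
    by (intro continuous_intros continuous_on_compose2[OF hol_continuous[OF hQ]]) auto
  have holQ: "hol (\<lambda>z. poly (Q z) t) B" for t
    unfolding pQ by (intro hol_sum hol_mult hol_const hQ)
  have "\<exists>G. (\<forall>i. G i holomorphic_on ball 0 R) \<and>
      (\<forall>i. \<forall>t\<in>ball 0 R. poly (Q z) t * v i (z + t *s e) = v k0 (z + t *s e) * G i t)" if "z \<in> B" for z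
    using cQ[OF that] unfolding clears_def by metis
  then obtain G where G: "\<And>z i. z \<in> B \<Longrightarrow> G z i holomorphic_on ball 0 R"
      "\<And>z i t. z \<in> B \<Longrightarrow> t \<in> ball 0 R \<Longrightarrow> poly (Q z) t * v i (z + t *s e) = v k0 (z + t *s e) * G z i t"
    by metis
  \<comment> \<open>The centre value of the cleared entry as a Cauchy integral over the circle free
    of zeros of \<open>v k0\<close>. In this form it is holomorphic in \<open>z\<close>, although
    \<open>G\<close> was chosen separately for each \<open>z\<close>.\<close>
  define \<phi> where "\<phi> i z = contour_integral (circlepath 0 r) (\<lambda>t. (poly (Q z) t / t) * v i (z + t *s e) / v k0 (z + t *s e)) * (1 / (2 * pi * \<i>))" for i z
  have nzs: "v k0 (z + t *s e) \<noteq> 0" if "z \<in> B" "t \<in> sphere 0 r" for z t using nz[OF that(1), of t] that(2) r by simp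
  have h\<phi>: "hol (\<phi> i) B" for i
    unfolding \<phi>_def[abs_def]
  proof (intro hol_mult hol_const hol_moment_integral[where w="\<lambda>z t. poly (Q z) t / t"])
    show "continuous_on (B \<times> sphere 0 r) (\<lambda>p. poly (Q (fst p)) (snd p) / snd p)"
      using r by (intro continuous_intros contQ) auto
    show "hol (\<lambda>z. poly (Q z) t / t) B" if "t \<in> sphere 0 r" for t
      using that r by (intro hol_divide holQ hol_const) auto
  qed
  have \<phi>G: "\<phi> i z = G z i 0" if z: "z \<in> B" for i z
  proof -
    have "((\<lambda>t. G z i t / (t - 0)) has_contour_integral (2 * of_real pi * \<i> * G z i 0)) (circlepath 0 r)"
      by (rule Cauchy_integral_circlepath_simple[OF holomorphic_on_subset[OF G(1)[OF z]]]) (use r in auto)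
    then have "((\<lambda>t. (poly (Q z) t / t) * v i (z + t *s e) / v k0 (z + t *s e)) has_contour_integral (2 * of_real pi * \<i> * G z i 0)) (circlepath 0 r)"
    proof (rule has_contour_integral_eq)
      fix t assume "t \<in> path_image (circlepath 0 r)"
      then have t: "t \<in> sphere 0 r" using r(1) by (simp add: path_image_circlepath_nonneg)
      then have "t \<in> ball 0 R" using r by auto
      from G(2)[OF z this, of i] have e: "G z i t = poly (Q z) t * v i (z + t *s e) / v k0 (z + t *s e)"
        using nzs[OF z t] by simp
      then show "G z i t / (t - 0) = (poly (Q z) t / t) * v i (z + t *s e) / v k0 (z + t *s e)" unfolding e by simp
    qed
    then show ?thesis unfolding \<phi>_def by (simp add: contour_integral_unique)
  qed
  have R0: "0 \<in> ball (0::complex) R" using r by simp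
  have QG: "poly (Q z) 0 * v i z = v k0 z * \<phi> i z" if z: "z \<in> B" for z i
    using G(2)[OF z R0, of i] \<phi>G[OF z] by simp
  have \<phi>k0: "\<phi> k0 z = poly (Q z) 0" if z: "z \<in> B" for z
  proof -
    have "\<phi> k0 z - poly (Q z) 0 = 0"
    proof (rule zero[OF B(1) order_refl _ _ z])
      show "hol (\<lambda>z. \<phi> k0 z - poly (Q z) 0) B" by (intro hol_diff h\<phi> holQ)
      show "\<phi> k0 z - poly (Q z) 0 = 0" if "z \<in> B" "v k0 z \<noteq> 0" for z using QG[OF that(1), of k0] that(2) by simp
    qed
    then show ?thesis by simp
  qed
  have \<phi>v: "\<phi> k0 z * v i z = v k0 z * \<phi> i z" if "z \<in> B" for z i using QG[OF that] \<phi>k0[OF that] by simp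
  show ?thesis
  proof (rule that[of \<phi>])
    show "hol (\<phi> i) B" for i by (rule h\<phi>)
    obtain z where z: "z \<in> B" "v k0 z * \<Delta> z \<noteq> 0"
      using hol_mult_nonzero[OF B(1,2) hv h\<Delta>] v0 \<Delta>0 by metis
    \<comment> \<open>At a generic parameter every root of \<open>Q z\<close> sits at a zero of
      \<open>v k0\<close>, and \<open>z\<close> was chosen such that the centre is not one.\<close>
    have "poly (Q z) 0 \<noteq> 0"
      using generic_root_bound(2)[OF gen z(1) _ dQ Q0 cQ[OF z(1)], of 0] z(2) by auto
    then show "\<exists>z\<in>B. \<phi> k0 z \<noteq> 0" using z(1) \<phi>k0 by auto
    show "\<phi> i z * v j z = \<phi> j z * v i z" if z: "z \<in> B" for z i j
    proof -
      have "\<phi> i z * v j z - \<phi> j z * v i z = 0"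
      proof (rule zero[OF B(1) order_refl _ _ z])
        show "hol (\<lambda>z. \<phi> i z * v j z - \<phi> j z * v i z) B" by (intro hol_diff hol_mult h\<phi> hv)
        fix z assume z: "z \<in> B" "v k0 z \<noteq> 0"
        have "v k0 z * (\<phi> i z * v j z - \<phi> j z * v i z) = (v k0 z * \<phi> i z) * v j z - (v k0 z * \<phi> j z) * v i z"
          by (simp add: algebra_simps)
        also have "\<dots> = 0" by (simp add: \<phi>v[OF z(1), symmetric])
        finally show "\<phi> i z * v j z - \<phi> j z * v i z = 0" using z(2) by simp
      qed
      then show ?thesis by simp
    qed
    show "local_generator \<phi> v B"
      unfolding local_generator_def
    proof (intro allI impI ballI)
    fix V \<psi> x assume A: "open V \<and> V \<subseteq> B \<and> (\<forall>k. hol (\<psi> k) V) \<and> (\<forall>y\<in>V. \<forall>j k. \<psi> j y * v k y = \<psi> k y * v j y)"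
      and x: "x \<in> V"
    from A have V: "open V" "V \<subseteq> B" and h\<psi>: "hol (\<psi> k) V" for k by blast+
    have par: "\<psi> j y * v k y = \<psi> k y * v j y" if "y \<in> V" for y j k using A that by blast
    have xB: "x \<in> B" using x V by blast
    have hQx: "(\<lambda>t. poly (Q x) t) holomorphic_on UNIV" by (intro holomorphic_intros)
    obtain t1 where t1: "poly (Q x) t1 \<noteq> 0" using Q0[of x] poly_all_0_iff_0 by blast
    obtain \<epsilon>1 where e1: "\<epsilon>1 > 0" "ball 0 \<epsilon>1 \<subseteq> (UNIV :: complex set)" "\<And>t. t \<in> ball 0 \<epsilon>1 - {0} \<Longrightarrow> poly (Q x) t \<noteq> 0"
      by (rule punctured_nonzero[OF open_UNIV connected_UNIV hQx UNIV_I t1 UNIV_I, of 0]) (rule that)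
    obtain \<delta>2 \<epsilon>2 where d2: "0 < \<delta>2" "0 < \<epsilon>2" "\<And>y t. y \<in> ball x \<delta>2 \<Longrightarrow> t \<in> cball 0 \<epsilon>2 \<Longrightarrow> y + t *s e \<in> V"
      by (rule line_room[OF V(1) x]) (rule that)
    \<comment> \<open>Small enough for discs of this radius around points near \<open>x\<close> to
      lie in \<open>V\<close> and in the domain of \<open>G\<close>, and for \<open>Q x\<close> to
      have no zero on the punctured disc. By compactness the circle of radius
      \<open>\<epsilon> / 2\<close> is then free of zeros of \<open>Q\<close> for all parameters
      near \<open>x\<close>.\<close>
    define \<epsilon> where "\<epsilon> = min R (min \<epsilon>1 \<epsilon>2)"
    have \<epsilon>: "\<epsilon> > 0" "\<epsilon> \<le> R" "\<epsilon> \<le> \<epsilon>1" "\<epsilon> \<le> \<epsilon>2" using r e1(1) d2(2) by (auto simp: \<epsilon>_def)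
    have oW: "open ((B \<times> UNIV) \<inter> (\<lambda>p. poly (Q (fst p)) (snd p)) -` (-{0}))"
      by (rule continuous_open_preimage[OF contQ]) (auto intro: open_Times B(1))
    have "{x} \<times> sphere 0 (\<epsilon>/2) \<subseteq> (B \<times> UNIV) \<inter> (\<lambda>p. poly (Q (fst p)) (snd p)) -` (-{0})"
    proof
      fix p :: "(complex^'n) \<times> complex" assume "p \<in> {x} \<times> sphere 0 (\<epsilon>/2)"
      then obtain t where p: "p = (x, t)" "cmod t = \<epsilon>/2" by auto
      then have "t \<in> ball 0 \<epsilon>1 - {0}" using \<epsilon> by auto
      from e1(3)[OF this] show "p \<in> (B \<times> UNIV) \<inter> (\<lambda>p. poly (Q (fst p)) (snd p)) -` (-{0})"
        using xB p(1) by simp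
    qed
    from Elementary_Topology.tube_lemma[OF compact_sphere oW this]
    obtain X where X: "x \<in> X" "open X" "X \<times> sphere 0 (\<epsilon>/2) \<subseteq> (B \<times> UNIV) \<inter> (\<lambda>p. poly (Q (fst p)) (snd p)) -` (-{0})"
      by blast
    define W where "W = X \<inter> ball x \<delta>2"
    have oW: "open W" and xW: "x \<in> W" using X d2(1) by (auto simp: W_def)
    have WV: "y + t *s e \<in> V" if "y \<in> W" "t \<in> ball 0 \<epsilon>" for y t
      using d2(3)[of y t] that \<epsilon> by (auto simp: W_def)
    have W_sub: "W \<subseteq> V"
    proof
      fix y assume "y \<in> W"
      then show "y \<in> V" using WV[of y 0] \<epsilon>(1) by simp
    qed
    have WB: "W \<subseteq> B" using W_sub V(2) by blast
    have sph: "sphere 0 (\<epsilon>/2) \<subseteq> ball (0::complex) \<epsilon>" using \<epsilon>(1) by auto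
    \<comment> \<open>The polynomial \<open>Q\<close> is the divisor along the discs; at the centre
      its value is \<open>\<phi> k0\<close>, the divisor that is wanted.\<close>
    have "\<exists>q. hol q W \<and> (\<forall>z\<in>W. \<psi> k0 (z + 0 *s e) = q z * poly (Q z) 0)"
    proof (rule division_along_disc[OF oW, of "\<epsilon>/2" \<epsilon> "\<lambda>z t. \<psi> k0 (z + t *s e)"])
      show "0 < \<epsilon>/2" "\<epsilon>/2 < \<epsilon>" using \<epsilon>(1) by auto
      show "continuous_on (W \<times> sphere 0 (\<epsilon>/2)) (\<lambda>p. \<psi> k0 (fst p + snd p *s e))"
        by (rule line_pair_continuous[OF h\<psi>]) (use WV sph in blast)
      show "continuous_on (W \<times> sphere 0 (\<epsilon>/2)) (\<lambda>p. poly (Q (fst p)) (snd p))"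
        by (rule continuous_on_subset[OF contQ[of "sphere 0 (\<epsilon>/2)"]]) (use WB in blast)
      show "hol (\<lambda>z. \<psi> k0 (z + t *s e)) W" if "t \<in> sphere 0 (\<epsilon>/2)" for t
        by (rule hol_translate[OF h\<psi>]) (use WV sph that in blast)
      show "hol (\<lambda>z. poly (Q z) t) W" if "t \<in> sphere 0 (\<epsilon>/2)" for t by (rule hol_subset[OF holQ WB])
      show "hol (\<lambda>z. poly (Q z) 0) W" by (rule hol_subset[OF holQ WB])
      show "hol (\<lambda>z. \<psi> k0 (z + 0 *s e)) W"
        by (rule hol_translate[OF h\<psi>]) (use W_sub in auto)
      show "poly (Q z) t \<noteq> 0" if "z \<in> W" "t \<in> sphere 0 (\<epsilon>/2)" for z t

      proof -
        have "(z, t) \<in> X \<times> sphere 0 (\<epsilon>/2)" using that by (simp add: W_def)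
        from subsetD[OF X(3) this] show ?thesis by simp
      qed
      fix U assume U: "open U" "U \<noteq> {}" "U \<subseteq> W"
      have "U \<subseteq> B" using U(3) WB by blast
      then obtain z where z: "z \<in> U" "\<Delta> z \<noteq> 0" using den\<Delta>[OF U(1,2)] by blast
      have zW: "z \<in> W" and zB: "z \<in> B" using z(1) U(3) WB by blast+
      have sub: "ball (0::complex) \<epsilon> \<subseteq> ball 0 R" using \<epsilon>(2) by auto
      have hz\<psi>: "(\<lambda>t. \<psi> i (z + t *s e)) holomorphic_on ball 0 \<epsilon>" for i
        by (rule hol_line[OF h\<psi>]) (rule WV[OF zW])
      have hGz: "G z i holomorphic_on ball 0 \<epsilon>" for i by (rule holomorphic_on_subset[OF G(1)[OF zB] sub])
      \<comment> \<open>Along the disc both families are parallel to \<open>v\<close>. The identity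
        first appears multiplied by \<open>v k0\<close>, which does not vanish identically there and
        can be cancelled.\<close>
      have cross: "\<psi> k0 (z + t *s e) * G z i t = \<psi> i (z + t *s e) * poly (Q z) t" if t: "t \<in> ball 0 \<epsilon>" for t i
      proof -
        let ?X = "\<lambda>t. \<psi> k0 (z + t *s e) * G z i t - \<psi> i (z + t *s e) * poly (Q z) t"
        have vX: "v k0 (z + s *s e) * ?X s = 0" if s: "s \<in> ball 0 \<epsilon>" for s
        proof -
          have sR: "s \<in> ball 0 R" using s sub by blast
          have "v k0 (z + s *s e) * ?X s = \<psi> k0 (z + s *s e) * (v k0 (z + s *s e) * G z i s) - poly (Q z) s * (\<psi> i (z + s *s e) * v k0 (z + s *s e))"
            by (simp add: algebra_simps)
          also have "\<dots> = \<psi> k0 (z + s *s e) * (poly (Q z) s * v i (z + s *s e)) - poly (Q z) s * (\<psi> k0 (z + s *s e) * v i (z + s *s e))"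
            by (simp only: G(2)[OF zB sR] par[OF WV[OF zW s], of i k0])
          finally show ?thesis by (simp add: algebra_simps)
        qed
        have hX: "?X holomorphic_on ball 0 \<epsilon>" by (intro holomorphic_intros hz\<psi> hGz)
        have "?X t = 0"
        proof (rule ccontr)
          assume ne: "?X t \<noteq> 0"
          have o: "open (ball 0 \<epsilon> \<inter> ?X -` (-{0}))"
            by (rule continuous_open_preimage[OF holomorphic_on_imp_continuous_on[OF hX]]) auto
          have "v k0 (z + of_real r *s e) = 0"
          proof (rule analytic_continuation_open[OF o, of "ball 0 R" "\<lambda>t. v k0 (z + t *s e)" "\<lambda>_. 0" "of_real r"])
            show "ball 0 \<epsilon> \<inter> ?X -` (-{0}) \<noteq> {}" using t ne by blast
            show "ball 0 \<epsilon> \<inter> ?X -` (-{0}) \<subseteq> ball 0 R" using sub by blast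
            show "v k0 (z + s *s e) = 0" if "s \<in> ball 0 \<epsilon> \<inter> ?X -` (-{0})" for s using vX[of s] that by auto
          qed (use v_line[OF zB] r in auto)
          then show False using nz[OF zB, of "of_real r"] r by simp
        qed
        then show ?thesis by simp
      qed
      have "\<exists>h. h holomorphic_on ball 0 \<epsilon> \<and> (\<forall>t\<in>ball 0 \<epsilon>. \<psi> k0 (z + t *s e) = h t * poly (Q z) t)"
      proof (cases "\<exists>t\<in>ball 0 \<epsilon>. poly (Q z) t \<noteq> 0")
        case False
        then have "ball 0 \<epsilon> \<subseteq> {t. poly (Q z) t = 0}" by blast
        moreover have "finite {t. poly (Q z) t = 0}" by (rule poly_roots_finite[OF Q0])
        ultimately have "finite (ball (0::complex) \<epsilon>)" by (rule finite_subset)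
        then have "ball (0::complex) \<epsilon> = {}" by (rule finite_imp_not_open) simp
        then show ?thesis using \<epsilon>(1) by simp
      next
        case True
        then obtain t2 where t2: "t2 \<in> ball 0 \<epsilon>" "poly (Q z) t2 \<noteq> 0" by blast
        show ?thesis
        proof (rule divides_glue[of "ball 0 \<epsilon>" "poly (Q z)" t2, OF open_ball connected_ball _ t2])
          show "poly (Q z) holomorphic_on ball 0 \<epsilon>" by (intro holomorphic_intros)
          fix \<alpha> assume \<alpha>: "\<alpha> \<in> ball (0::complex) \<epsilon>"
          \<comment> \<open>At a root of \<open>Q z\<close> this is minimality, through
            \<open>generic_root\<close>; elsewhere \<open>i = k0\<close> works because
            \<open>G z k0\<close> is \<open>Q z\<close> itself.\<close>
          obtain i where i: "G z i \<alpha> \<noteq> 0"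
          proof (cases "poly (Q z) \<alpha> = 0")
            case True
            then show ?thesis using generic_root[OF gen zB z(2) dQ Q0 G(1)[OF zB] G(2)[OF zB] True] that by blast
          next
            case False
            have "G z k0 \<alpha> - poly (Q z) \<alpha> = 0"
            proof (rule ccontr)
              let ?Y = "\<lambda>t. G z k0 t - poly (Q z) t"
              assume ne: "?Y \<alpha> \<noteq> 0"
              have hY: "?Y holomorphic_on ball 0 R" by (intro holomorphic_intros G(1)[OF zB])
              have o: "open (ball 0 R \<inter> ?Y -` (-{0}))"
                by (rule continuous_open_preimage[OF holomorphic_on_imp_continuous_on[OF hY]]) auto
              have "v k0 (z + of_real r *s e) = 0"
              proof (rule analytic_continuation_open[OF o, of "ball 0 R" "\<lambda>t. v k0 (z + t *s e)" "\<lambda>_. 0" "of_real r"])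
                show "ball 0 R \<inter> ?Y -` (-{0}) \<noteq> {}" using \<alpha> sub ne by blast
                show "v k0 (z + s *s e) = 0" if "s \<in> ball 0 R \<inter> ?Y -` (-{0})" for s
                  using G(2)[OF zB, of s k0] that by auto
              qed (use v_line[OF zB] r in auto)
              then show False using nz[OF zB, of "of_real r"] r by simp
            qed
            then show ?thesis using False that[of k0] by auto
          qed
          have o: "open (ball 0 \<epsilon> \<inter> G z i -` (-{0}))"
            by (rule continuous_open_preimage[OF holomorphic_on_imp_continuous_on[OF hGz]]) auto
          show "\<exists>N g. open N \<and> \<alpha> \<in> N \<and> N \<subseteq> ball 0 \<epsilon> \<and> g holomorphic_on N \<and>
             (\<forall>t\<in>N. \<psi> k0 (z + t *s e) = g t * poly (Q z) t)"
          proof (intro exI conjI ballI)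
            show "open (ball 0 \<epsilon> \<inter> G z i -` (-{0}))" by (rule o)
            show "(\<lambda>t. \<psi> i (z + t *s e) / G z i t) holomorphic_on ball 0 \<epsilon> \<inter> G z i -` (-{0})"
              by (intro holomorphic_intros holomorphic_on_subset[OF hz\<psi>] holomorphic_on_subset[OF hGz]) auto
            show "\<psi> k0 (z + t *s e) = \<psi> i (z + t *s e) / G z i t * poly (Q z) t" if "t \<in> ball 0 \<epsilon> \<inter> G z i -` (-{0})" for t
              using cross[of t i] that by (simp add: nonzero_eq_divide_eq)
          qed (use \<alpha> i in auto)
        qed
      qed
      then show "\<exists>z\<in>U. \<exists>h. h holomorphic_on ball 0 \<epsilon> \<and> (\<forall>t\<in>ball 0 \<epsilon>. \<psi> k0 (z + t *s e) = h t * poly (Q z) t)"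
        using z(1) by blast
    qed
    then obtain q where hq: "hol q W" and q0: "\<forall>z\<in>W. \<psi> k0 (z + 0 *s e) = q z * poly (Q z) 0" by blast
    have q: "hol q W" "\<psi> k0 z = q z * \<phi> k0 z" if "z \<in> W" for z
      using hq q0 that \<phi>k0[of z] WB by auto
    \<comment> \<open>The multiplier found for the entry \<open>k0\<close> serves all entries, by
      parallelism where \<open>v k0\<close> is nonzero.\<close>
    have "\<psi> k y = q y * \<phi> k y" if y: "y \<in> W" for y k
    proof -
      have "\<psi> k y - q y * \<phi> k y = 0"
      proof (rule zero[OF oW WB _ _ y])
        show "hol (\<lambda>y. \<psi> k y - q y * \<phi> k y) W"
          by (intro hol_diff hol_mult hq hol_subset[OF h\<phi> WB] hol_subset[OF h\<psi> W_sub])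
        fix y assume y: "y \<in> W" "v k0 y \<noteq> 0"
        have yV: "y \<in> V" and yB: "y \<in> B" using y W_sub WB by blast+
        have "v k0 y * (\<psi> k y - q y * \<phi> k y) = \<psi> k y * v k0 y - q y * (v k0 y * \<phi> k y)" by (simp add: algebra_simps)
        also have "\<dots> = \<psi> k0 y * v k y - q y * (\<phi> k0 y * v k y)" by (simp only: par[OF yV, of k k0] \<phi>v[OF yB])
        also have "\<dots> = 0" using q(2)[OF y(1)] by simp
        finally show "\<psi> k y - q y * \<phi> k y = 0" using y(2) by simp
      qed
      then show ?thesis by simp
    qed
    then show "\<exists>W g. open W \<and> x \<in> W \<and> W \<subseteq> V \<and> hol g W \<and> (\<forall>y\<in>W. \<forall>k. \<psi> k y = g y * \<phi> k y)"
      using oW xW W_sub hq by blast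
    qed
  qed
qed

end

section \<open>Regular points of analytic sets\<close>

text \<open>As \<open>v k0\<close> does not vanish identically near \<open>p\<close>, some direction
  has at most an isolated zero at \<open>p\<close>; the nearby parallel discs form a
  \<open>disc_family\<close>.\<close>

theorem local_primitive:
  fixes v :: "'k \<Rightarrow> complex^'n \<Rightarrow> complex"
  assumes "open S" and v: "\<And>k. hol (v k) S" and p: "p \<in> S"
    and ne: "\<And>V. open V \<Longrightarrow> p \<in> V \<Longrightarrow> V \<subseteq> S \<Longrightarrow> \<exists>x\<in>V. v k0 x \<noteq> 0"
  obtains \<delta> \<phi> where "0 < \<delta>" "ball p \<delta> \<subseteq> S" "\<And>i. hol (\<phi> i) (ball p \<delta>)" "\<exists>z\<in>ball p \<delta>. \<phi> k0 z \<noteq> 0"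
    "\<And>z i j. z \<in> ball p \<delta> \<Longrightarrow> \<phi> i z * v j z = \<phi> j z * v i z"
    "local_generator \<phi> v (ball p \<delta>)"
proof -
  obtain \<rho> e where e: "0 < \<rho>" "\<And>t. cmod t \<le> \<rho> \<Longrightarrow> p + t *s e \<in> S"
      "\<And>t. 0 < cmod t \<Longrightarrow> cmod t \<le> \<rho> \<Longrightarrow> v k0 (p + t *s e) \<noteq> 0"
    by (rule exists_nonzero_direction[OF assms(1) v p ne]) (assumption+, rule that)
  obtain \<delta> where d: "\<delta> > 0" "\<And>y t. y \<in> ball p \<delta> \<Longrightarrow> cmod t \<le> \<rho> \<Longrightarrow> y + t *s e \<in> S"
    "\<And>y t. y \<in> ball p \<delta> \<Longrightarrow> \<rho> / 2 \<le> cmod t \<Longrightarrow> cmod t \<le> \<rho> \<Longrightarrow> v k0 (y + t *s e) \<noteq> 0"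
    by (rule line_box[OF assms(1) v e]) (assumption+, rule that)
  interpret disc_family "ball p \<delta>" S v k0 e "\<rho>/2" \<rho>
    by unfold_locales (use d(1) e(1) d(2,3) v in auto)
  have "\<exists>z\<in>ball p \<delta>. v k0 z \<noteq> 0" using ne[of "ball p \<delta>"] d(1) B_subset by simp
  then show ?thesis
    by (rule primitive_on_disc_family) (rule that[OF d(1) B_subset])
qed

text \<open>A finite form of Baire's theorem: either the first piece covers \<open>U\<close>, or the
  search continues in the nonempty open set \<open>U - C i\<close>, which the other pieces
  cover.\<close>

lemma finite_closed_cover_interior:
  fixes U :: "'a::topological_space set"
  assumes "finite I" "open U" "U \<noteq> {}" "U \<subseteq> (\<Union>i\<in>I. C i)" "\<And>i. i \<in> I \<Longrightarrow> open (U - C i)"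
  shows "\<exists>i\<in>I. \<exists>V. open V \<and> V \<noteq> {} \<and> V \<subseteq> U \<and> V \<subseteq> C i"
  using assms
proof (induction I arbitrary: U rule: finite_induct)
  case (insert i I U)
  show ?case
  proof (cases "U - C i = {}")
    case True
    then show ?thesis using insert.prems by blast
  next
    case False
    have "open (U - C i - C j)" if "j \<in> I" for j
    proof -
      have "U - C i - C j = (U - C i) \<inter> (U - C j)" by blast
      then show ?thesis using insert.prems(4) that by auto
    qed
    then have "\<exists>j\<in>I. \<exists>V. open V \<and> V \<noteq> {} \<and> V \<subseteq> U - C i \<and> V \<subseteq> C j"
      using insert.IH[of "U - C i"] insert.prems False by blast
    then show ?thesis by blast
  qed
qed simp

text \<open>Near \<open>x0\<close> the derivative along \<open>e\<close> stays within half its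
  modulus of its value at \<open>x0\<close>. The deviation of \<open>h\<close> from the linear
  function with that slope therefore varies too slowly to make up for a difference of
  parameters.\<close>

lemma injective_along_lines:
  fixes x0 :: "complex^'n"
  assumes S: "open S" and h: "hol h S" and x0: "x0 \<in> S" and d: "dirD e h x0 \<noteq> 0"
  obtains \<eta> \<epsilon> where "\<eta> > 0" "\<epsilon> > 0"
    "\<And>y t. y \<in> ball x0 \<eta> \<Longrightarrow> t \<in> cball 0 \<epsilon> \<Longrightarrow> y + t *s e \<in> S"
    "\<And>y t t'. y \<in> ball x0 \<eta> \<Longrightarrow> t \<in> cball 0 \<epsilon> \<Longrightarrow> t' \<in> cball 0 \<epsilon> \<Longrightarrow> h (y + t *s e) = h (y + t' *s e) \<Longrightarrow> t = t'"
proof -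
  let ?c = "dirD e h x0"
  have hd: "hol (\<lambda>x. dirD e h x - ?c) S" by (intro hol_diff hol_const hol_dirD S h)
  have "open (S \<inter> (\<lambda>x. dirD e h x - ?c) -` ball 0 (cmod ?c / 2))"
    by (rule continuous_open_preimage[OF hol_continuous[OF hd] S]) simp
  moreover have "x0 \<in> S \<inter> (\<lambda>x. dirD e h x - ?c) -` ball 0 (cmod ?c / 2)" using x0 d by simp
  ultimately obtain \<eta> \<epsilon> where n: "0 < \<eta>" "0 < \<epsilon>"
    "\<And>y t. y \<in> ball x0 \<eta> \<Longrightarrow> t \<in> cball 0 \<epsilon> \<Longrightarrow> y + t *s e \<in> S \<inter> (\<lambda>x. dirD e h x - ?c) -` ball 0 (cmod ?c / 2)"
    by (rule line_room) (rule that)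
  show ?thesis
  proof (rule that[OF n(1,2)])
    show "y + t *s e \<in> S" if "y \<in> ball x0 \<eta>" "t \<in> cball 0 \<epsilon>" for y t using n(3)[OF that] by blast
    fix y t t' assume y: "y \<in> ball x0 \<eta>" and t: "t \<in> cball 0 \<epsilon>" "t' \<in> cball 0 \<epsilon>" and eq: "h (y + t *s e) = h (y + t' *s e)"
    have "cmod ((h (y + t *s e) - ?c * t) - (h (y + t' *s e) - ?c * t')) \<le> cmod ?c / 2 * cmod (t - t')"
    proof (rule field_differentiable_bound[OF convex_cball[of 0 \<epsilon>] _ _ t(1,2)])
      fix s assume s: "s \<in> cball (0::complex) \<epsilon>"
      have hl: "(\<lambda>t. h (y + t *s e)) holomorphic_on {t. y + t *s e \<in> S}" by (rule hol_line[OF h]) simp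
      have "y + s *s e \<in> S" using n(3)[OF y s] by blast
      then have "((\<lambda>t. h (y + t *s e)) has_field_derivative deriv (\<lambda>t. h (y + t *s e)) s) (at s)"
        by (intro holomorphic_derivI[OF hl open_line[OF S]]) simp
      then have "((\<lambda>t. h (y + t *s e) - ?c * t) has_field_derivative dirD e h (y + s *s e) - ?c) (at s)"
        unfolding deriv_line by (auto intro!: derivative_eq_intros)
      then show "((\<lambda>t. h (y + t *s e) - ?c * t) has_field_derivative dirD e h (y + s *s e) - ?c) (at s within cball 0 \<epsilon>)"
        by (rule has_field_derivative_at_within)
      show "cmod (dirD e h (y + s *s e) - ?c) \<le> cmod ?c / 2" using n(3)[OF y s] by simp
    qed
    moreover have "(h (y + t *s e) - ?c * t) - (h (y + t' *s e) - ?c * t') = - ?c * (t - t')"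
      unfolding eq by (simp add: algebra_simps)
    ultimately have "cmod ?c * cmod (t - t') \<le> cmod ?c / 2 * cmod (t - t')" by (simp add: norm_mult)
    then have "cmod ?c * cmod (t - t') \<le> 0" by linarith
    then show "t = t'" using d by (auto simp: mult_le_0_iff)
  qed
qed

text \<open>Over an open set of lines, the points of \<open>Z\<close> at which \<open>f\<close> has a fixed order \<open>k\<close> along the
  lines form finitely many graphs contained in the zero set of the derivative of order \<open>k - 1\<close>; one
  of these graphs is contained in \<open>Z\<close> over a smaller open set.\<close>

lemma regular_point_on_lines:
  fixes Z S :: "(complex^'n) set"
  assumes S: "open S" and f: "hol f S" and Z: "Z \<subseteq> S" "open (S - Z)" and fZ: "\<And>x. x \<in> Z \<Longrightarrow> f x = 0"
    and B: "open B" "B \<noteq> {}" and r: "0 < r" "r < R"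
    and BS: "\<And>y t. y \<in> B \<Longrightarrow> t \<in> ball 0 R \<Longrightarrow> y + t *s e \<in> S"
    and nz: "\<And>y. y \<in> B \<Longrightarrow> \<exists>t\<in>ball 0 R. f (y + t *s e) \<noteq> 0"
    and meet: "\<And>y. y \<in> B \<Longrightarrow> \<exists>t\<in>cball 0 r. y + t *s e \<in> Z"
  obtains q h U where "open U" "q \<in> U" "U \<subseteq> S" "q \<in> Z" "hol h U" "dirD e h q \<noteq> 0" "Z \<inter> U = {x\<in>U. h x = 0}"
proof -
  define D where "D = (\<lambda>j. (dirD e ^^ j) f)"
  have hD: "hol (D j) S" for j unfolding D_def by (rule hol_dirD_funpow[OF S f])
  have DS: "dirD e (D j) = D (Suc j)" for j by (simp add: D_def)
  \<comment> \<open>The points of \<open>Z\<close> at which \<open>f\<close> has order at least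
    \<open>k\<close> along \<open>e\<close>.\<close>
  define Zk where "Zk k = {x\<in>Z. \<forall>j<k. D j x = 0}" for k
  have ZkZ: "Zk k \<subseteq> Z" for k by (auto simp: Zk_def)
  have Zk_mono: "Zk k \<subseteq> Zk j" if "j \<le> k" for j k using that by (auto simp: Zk_def)
  have Zk_open: "open (S - Zk k)" for k
  proof -
    have "S - Zk k = (S - Z) \<union> (\<Union>j<k. {x\<in>S. D j x \<noteq> 0})" using Z(1) by (auto simp: Zk_def)
    moreover have "open (\<Union>j<k. {x\<in>S. D j x \<noteq> 0})" by (intro open_UN ballI open_nonzero[OF S hD])
    ultimately show ?thesis using Z(2) by (simp only: open_Un)
  qed
  have crS: "y + t *s e \<in> S" if "y \<in> B" "t \<in> cball 0 r" for y t using BS[OF that(1), of t] that(2) r by simp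
  define E where "E k = {y\<in>B. \<exists>t\<in>cball 0 r. y + t *s e \<in> Zk k}" for k
  have lines_open: "open (V - {y\<in>V. \<exists>t\<in>K. y + t *s e \<in> Zk k})"
    if V: "open V" "V \<subseteq> B" and K: "compact K" "K \<subseteq> cball 0 r" for V K k
  proof (rule openI)
    fix y assume y: "y \<in> V - {y\<in>V. \<exists>t\<in>K. y + t *s e \<in> Zk k}"
    have yS: "y + t *s e \<in> S - Zk k" if "t \<in> K" for t using y that V(2) K(2) crS by blast
    obtain \<delta> where "\<delta> > 0" "\<And>y' t. y' \<in> ball y \<delta> \<Longrightarrow> t \<in> K \<Longrightarrow> y' + t *s e \<in> S - Zk k"
      by (rule line_tube[OF Zk_open K(1) yS]) (assumption, rule that)
    moreover obtain \<delta>' where "\<delta>' > 0" "ball y \<delta>' \<subseteq> V" using V(1) y open_contains_ball by blast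
    ultimately show "\<exists>T>0. ball y T \<subseteq> V - {y\<in>V. \<exists>t\<in>K. y + t *s e \<in> Zk k}"
      by (intro exI[of _ "min \<delta> \<delta>'"]) auto
  qed
  have E_open: "open (V - E k)" if V: "open V" "V \<subseteq> B" for V k
  proof -
    have "V - E k = V - {y\<in>V. \<exists>t\<in>cball 0 r. y + t *s e \<in> Zk k}" using V(2) by (auto simp: E_def)
    then show ?thesis using lines_open[OF V compact_cball order_refl] by simp
  qed
  have E0: "E 0 = B" using meet by (auto simp: E_def Zk_def)
  have E1: "E 1 = B" using meet fZ by (auto simp: E_def Zk_def D_def)
  have E_mono: "E k \<subseteq> E j" if "j \<le> k" for j k using Zk_mono[OF that] by (auto simp: E_def)
  obtain z0 where z0: "z0 \<in> B" using B(2) by blast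
  \<comment> \<open>On one line the order is bounded: points of arbitrarily large order would, by
    compactness of the disc, produce one of infinite order, and \<open>f\<close> would vanish on the
    whole disc.\<close>
  have "\<exists>K. z0 \<notin> E K"
  proof (rule ccontr)
    assume "\<not> ?thesis"
    then have all: "z0 \<in> E k" for k by blast
    define T where "T k = {t\<in>cball 0 r. z0 + t *s e \<in> Zk k}" for k
    have "\<Inter> (range T) \<noteq> {}"
    proof (rule compact_nest)
      show "T k \<noteq> {}" for k using all[of k] by (auto simp: E_def T_def)
      show "T k \<subseteq> T j" if "j \<le> k" for j k using Zk_mono[OF that] by (auto simp: T_def)
      show "compact (T k)" for k
      proof -
        have "T k = cball 0 r - {t. z0 + t *s e \<in> S - Zk k}" using crS[OF z0] by (auto simp: T_def)
        then show ?thesis using compact_diff[OF compact_cball open_line[OF Zk_open[of k]]] by metis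
      qed
    qed
    then obtain t where t: "\<And>k. t \<in> T k" by blast
    have tR: "t \<in> ball 0 R" using t[of 0] r by (simp add: T_def)
    have hl: "(\<lambda>t. f (z0 + t *s e)) holomorphic_on ball 0 R" by (rule hol_line[OF f]) (rule BS[OF z0])
    have "(deriv ^^ j) (\<lambda>t. f (z0 + t *s e)) t = 0" for j
      using t[of "Suc j"] by (simp add: higher_deriv_line T_def Zk_def D_def)
    then have "f (z0 + s *s e) = 0" if "s \<in> ball 0 R" for s
      using holomorphic_fun_eq_0_on_connected[OF hl open_ball connected_ball _ tR that] by simp
    then show False using nz[OF z0] by blast
  qed
  then obtain K where K: "z0 \<notin> E K" by blast
  define B1 where "B1 = B - E K"
  have B1: "open B1" "z0 \<in> B1" "B1 \<subseteq> B" using E_open[OF B(1) order_refl] K z0 by (auto simp: B1_def)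
  define P where "P k \<longleftrightarrow> (\<exists>V. open V \<and> V \<noteq> {} \<and> V \<subseteq> B1 \<and> V \<subseteq> E k)" for k
  have P1: "P 1" unfolding P_def E1 using B1 by blast
  have nPK: "\<not> P K" by (auto simp: P_def B1_def)
  have nP: "\<not> P k" if "K \<le> k" for k using nPK E_mono[OF that] by (auto simp: P_def)
  \<comment> \<open>This fixes an order \<open>k = Suc k'\<close> such that the lines meeting
    \<open>Zk k\<close> contain an open set, while those meeting \<open>Zk (Suc k)\<close> do
    not.\<close>
  have "\<exists>k'. P (Suc k') \<and> \<not> P (Suc (Suc k'))"
  proof (rule ccontr)
    assume c: "\<not> ?thesis"
    have "P (Suc j)" for j using P1 c by (induction j) auto
    then show False using nP[of "Suc K"] by simp
  qed
  then obtain k' where Pk: "P (Suc k')" "\<not> P (Suc (Suc k'))" by blast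
  define k where "k = Suc k'"
  obtain V where V: "open V" "V \<noteq> {}" "V \<subseteq> B1" "V \<subseteq> E k" using Pk(1) unfolding P_def k_def by blast
  \<comment> \<open>Over \<open>V2\<close> every line meets \<open>Zk k\<close>, and at all such
    points the order is exactly \<open>k\<close>.\<close>
  define V2 where "V2 = V - E (Suc k)"
  have V2: "open V2" "V2 \<subseteq> B" "V2 \<noteq> {}"
    using E_open[OF V(1), of "Suc k"] V B1(3) Pk(2) by (auto simp: V2_def P_def k_def)
  have V2k: "\<exists>t\<in>cball 0 r. z + t *s e \<in> Zk k" if "z \<in> V2" for z using that V(4) by (auto simp: V2_def E_def)
  have V2D: "D k (z + t *s e) \<noteq> 0" if "z \<in> V2" "t \<in> cball 0 r" "z + t *s e \<in> Zk k" for z t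
  proof
    assume "D k (z + t *s e) = 0"
    then have "z + t *s e \<in> Zk (Suc k)" using that(3) by (auto simp: Zk_def less_Suc_eq)
    then show False using that V2(2) by (auto simp: V2_def E_def)
  qed
  \<comment> \<open>The derivative of order \<open>k - 1\<close> has a simple zero where
    \<open>f\<close> has order \<open>k\<close>, which makes it the candidate for a local
    equation.\<close>
  define h where "h = D k'"
  have hh: "hol h S" unfolding h_def by (rule hD)
  have dh: "dirD e h = D k" by (simp add: h_def k_def DS)
  have hZ: "h x = 0" if "x \<in> Zk k" for x using that by (simp add: Zk_def h_def k_def)
  obtain z1 where z1: "z1 \<in> V2" using V2(3) by blast
  define T where "T = {t\<in>cball 0 r. z1 + t *s e \<in> Zk k}"
  have z1B: "z1 \<in> B" using z1 V2(2) by blast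
  have cT: "compact T"
  proof -
    have "T = cball 0 r - {t. z1 + t *s e \<in> S - Zk k}" using crS[OF z1B] by (auto simp: T_def)
    then show ?thesis using compact_diff[OF compact_cball open_line[OF Zk_open[of k]]] by metis
  qed
  have "\<exists>\<epsilon> \<eta>. 0 < \<epsilon> \<and> 0 < \<eta> \<and> (\<forall>y\<in>ball z1 \<eta>. \<forall>s\<in>cball t \<epsilon>. \<forall>s'\<in>cball t \<epsilon>. h (y + s *s e) = h (y + s' *s e) \<longrightarrow> s = s')"
    if t: "t \<in> T" for t
  proof -
    have tr: "t \<in> cball 0 r" and tZ: "z1 + t *s e \<in> Zk k" using t by (auto simp: T_def)
    have xS: "z1 + t *s e \<in> S" by (rule crS[OF z1B tr])
    have d0: "dirD e h (z1 + t *s e) \<noteq> 0" unfolding dh by (rule V2D[OF z1 tr tZ])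
    obtain \<eta> \<epsilon> where n: "\<eta> > 0" "\<epsilon> > 0"
      "\<And>y s. y \<in> ball (z1 + t *s e) \<eta> \<Longrightarrow> s \<in> cball 0 \<epsilon> \<Longrightarrow> y + s *s e \<in> S"
      "\<And>y s s'. y \<in> ball (z1 + t *s e) \<eta> \<Longrightarrow> s \<in> cball 0 \<epsilon> \<Longrightarrow> s' \<in> cball 0 \<epsilon> \<Longrightarrow> h (y + s *s e) = h (y + s' *s e) \<Longrightarrow> s = s'"
      by (rule injective_along_lines[OF S hh xS d0]) (rule that)
    have "s = s'" if y: "y \<in> ball z1 \<eta>" and s: "s \<in> cball t \<epsilon>" "s' \<in> cball t \<epsilon>" and eq: "h (y + s *s e) = h (y + s' *s e)" for y s s'
    proof -
      have sh: "y + t *s e + (s - t) *s e = y + s *s e" for s by (simp add: algebra_simps)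
      have "s - t = s' - t"
        by (rule n(4)[of "y + t *s e"]) (use y s eq in \<open>auto simp: sh dist_norm norm_minus_commute\<close>)
      then show ?thesis by simp
    qed
    then show ?thesis using n(1,2) by blast
  qed
  then obtain \<epsilon> \<eta> where en: "\<And>t. t \<in> T \<Longrightarrow> 0 < \<epsilon> t" "\<And>t. t \<in> T \<Longrightarrow> 0 < \<eta> t"
    and inj: "\<And>t y s s'. t \<in> T \<Longrightarrow> y \<in> ball z1 (\<eta> t) \<Longrightarrow> s \<in> cball t (\<epsilon> t) \<Longrightarrow> s' \<in> cball t (\<epsilon> t) \<Longrightarrow> h (y + s *s e) = h (y + s' *s e) \<Longrightarrow> s = s'"
    by metis
  have "T \<subseteq> (\<Union>t\<in>T. ball t (\<epsilon> t))" using en by force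
  \<comment> \<open>Finitely many discs of parameters, on each of which \<open>h\<close> is
    injective along nearby lines, catch every point of \<open>Zk k\<close> on those lines.\<close>
  then obtain I where I: "I \<subseteq> T" "finite I" "T \<subseteq> (\<Union>t\<in>I. ball t (\<epsilon> t))"
    using compactE_image[OF cT, of T "\<lambda>t. ball t (\<epsilon> t)"] by (metis open_ball)
  let ?K2 = "cball 0 r - (\<Union>t\<in>I. ball t (\<epsilon> t))"
  have cK2: "compact ?K2" by (intro compact_diff compact_cball open_UN ballI open_ball)
  have K2S: "z1 + t *s e \<in> S - Zk k" if "t \<in> ?K2" for t
    using that I(3) crS[OF z1B, of t] by (auto simp: T_def)
  obtain \<delta>1 where d1: "\<delta>1 > 0" "\<And>y t. y \<in> ball z1 \<delta>1 \<Longrightarrow> t \<in> ?K2 \<Longrightarrow> y + t *s e \<in> S - Zk k"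
    by (rule line_tube[OF Zk_open cK2 K2S]) (assumption, rule that)
  define V3 where "V3 = V2 \<inter> ball z1 \<delta>1 \<inter> (\<Inter>t\<in>I. ball z1 (\<eta> t))"
  have V3: "open V3" "V3 \<noteq> {}" "V3 \<subseteq> V2"
  proof -
    show "open V3" unfolding V3_def using V2(1) I(2) by (intro open_Int open_INT ballI open_ball) auto
    have "z1 \<in> V3" unfolding V3_def using z1 d1(1) I(1) en by auto
    then show "V3 \<noteq> {}" by blast
    show "V3 \<subseteq> V2" by (auto simp: V3_def)
  qed
  \<comment> \<open>The lines that meet \<open>Zk k\<close> inside the disc around \<open>i\<close>.
    For one \<open>i\<close> they fill an open set.\<close>
  let ?C = "\<lambda>i. {y\<in>V3. \<exists>t\<in>cball i (\<epsilon> i) \<inter> cball 0 r. y + t *s e \<in> Zk k}"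
  have "\<exists>i\<in>I. \<exists>V. open V \<and> V \<noteq> {} \<and> V \<subseteq> V3 \<and> V \<subseteq> ?C i"
  proof (rule finite_closed_cover_interior[OF I(2) V3(1,2)])
    show "V3 \<subseteq> (\<Union>i\<in>I. ?C i)"
    proof
      fix y assume y: "y \<in> V3"
      then have "y \<in> V2" using V3(3) by blast
      then obtain t where t: "t \<in> cball 0 r" "y + t *s e \<in> Zk k" using V2k by blast
      have "t \<notin> ?K2" using d1(2)[of y t] y t(2) by (auto simp: V3_def)
      then obtain i where i: "i \<in> I" "t \<in> ball i (\<epsilon> i)" using t(1) by blast
      then have "t \<in> cball i (\<epsilon> i) \<inter> cball 0 r" using t(1) ball_subset_cball by blast
      then show "y \<in> (\<Union>i\<in>I. ?C i)" using y t(2) i(1) by blast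
    qed
    show "open (V3 - ?C i)" if "i \<in> I" for i
      by (rule lines_open[OF V3(1) _ compact_Int[OF compact_cball compact_cball]]) (use V3(3) V2(2) in auto)
  qed
  then obtain i V4 where i: "i \<in> I" and V4: "open V4" "V4 \<noteq> {}" "V4 \<subseteq> V3" "V4 \<subseteq> ?C i" by blast
  obtain z2 where z2: "z2 \<in> V4" using V4(2) by blast
  obtain t2 where t2: "t2 \<in> cball i (\<epsilon> i)" "t2 \<in> cball 0 r" "z2 + t2 *s e \<in> Zk k" using z2 V4(4) by blast
  define q where "q = z2 + t2 *s e"
  define U0 where "U0 = S \<inter> {x. x - t2 *s e \<in> V4}"
  have U0: "open U0" "q \<in> U0" "U0 \<subseteq> S"
  proof -
    have "open ((\<lambda>x. x - t2 *s e) -` V4)" by (rule open_vimage[OF V4(1)]) (intro continuous_intros)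
    then show "open U0" using S unfolding U0_def vimage_def by blast
    show "q \<in> U0" using z2 t2(3) ZkZ Z(1) by (auto simp: U0_def q_def)
  qed (auto simp: U0_def)
  \<comment> \<open>The line through \<open>x\<close> carries a point of \<open>Zk k\<close> in the
    same disc. As \<open>h\<close> vanishes at both points, injectivity identifies them.\<close>
  have U0h: "x \<in> Zk k" if x: "x \<in> U0" "h x = 0" for x
  proof -
    let ?y = "x - t2 *s e"
    have y: "?y \<in> V4" using x(1) by (simp add: U0_def)
    then obtain t where t: "t \<in> cball i (\<epsilon> i)" "?y + t *s e \<in> Zk k" using V4(4) by blast
    have "?y \<in> ball z1 (\<eta> i)" using y V4(3) i by (auto simp: V3_def)
    moreover have "h (?y + t *s e) = h (?y + t2 *s e)" using hZ[OF t(2)] x(2) by simp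
    ultimately have "t = t2" using inj[of i ?y t t2] I(1) i t(1) t2(1) by blast
    then show ?thesis using t(2) by simp
  qed
  have U0D: "D k x \<noteq> 0" if x: "x \<in> U0" "h x = 0" for x
    using V2D[of "x - t2 *s e" t2] U0h[OF x] x(1) V4(3) V3(3) t2(2) by (auto simp: U0_def)
  have qZ: "q \<in> Zk k" using t2(3) by (simp add: q_def)
  \<comment> \<open>At each zero of \<open>h\<close> in \<open>U0\<close>, along the line,
    \<open>f\<close> has order \<open>k\<close> and \<open>h\<close> has order one, so
    \<open>f\<close> is a unit times \<open>h ^ k\<close>.\<close>
  have order: "\<exists>N g. open N \<and> \<alpha> \<in> N \<and> N \<subseteq> M \<and> g holomorphic_on N \<and> (\<forall>t\<in>N. f (x + t *s e) = g t * h (x + t *s e) ^ k) \<and> (\<forall>t\<in>N. g t \<noteq> 0)"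
    if M: "open M" "\<alpha> \<in> M" "\<And>t. t \<in> M \<Longrightarrow> x + t *s e \<in> U0" and h0: "h (x + \<alpha> *s e) = 0" for x \<alpha> M
  proof -
    have xa: "x + \<alpha> *s e \<in> U0" by (rule M(3)[OF M(2)])
    have hf: "(\<lambda>t. f (x + t *s e)) holomorphic_on M" using M(3) U0(3) by (intro hol_line[OF f]) blast
    have hlh: "(\<lambda>t. h (x + t *s e)) holomorphic_on M" using M(3) U0(3) by (intro hol_line[OF hh]) blast
    have zk: "x + \<alpha> *s e \<in> Zk k" and Dk: "D k (x + \<alpha> *s e) \<noteq> 0" using U0h[OF xa h0] U0D[OF xa h0] by blast+
    have f0: "f (x + \<alpha> *s e) = 0" using zk ZkZ fZ by blast
    obtain g r1 where g: "0 < r1" "g holomorphic_on ball \<alpha> r1"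
      "\<And>w. w \<in> ball \<alpha> r1 \<Longrightarrow> f (x + w *s e) - f (x + \<alpha> *s e) = (w - \<alpha>)^k * g w" "\<And>w. w \<in> ball \<alpha> r1 \<Longrightarrow> g w \<noteq> 0"
    proof (rule holomorphic_factor_order_of_zero[OF hf M(1,2), of k])
      show "0 < k" by (simp add: k_def)
      show "(deriv ^^ k) (\<lambda>t. f (x + t *s e)) \<alpha> \<noteq> 0" using Dk by (simp add: higher_deriv_line D_def)
      show "(deriv ^^ j) (\<lambda>t. f (x + t *s e)) \<alpha> = 0" if "0 < j" "j < k" for j
        using zk that by (simp add: higher_deriv_line Zk_def D_def)
    qed (rule that)
    obtain g' r2 where g': "0 < r2" "g' holomorphic_on ball \<alpha> r2"
      "\<And>w. w \<in> ball \<alpha> r2 \<Longrightarrow> h (x + w *s e) - h (x + \<alpha> *s e) = (w - \<alpha>)^1 * g' w" "\<And>w. w \<in> ball \<alpha> r2 \<Longrightarrow> g' w \<noteq> 0"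
    proof (rule holomorphic_factor_order_of_zero[OF hlh M(1,2), of 1])
      show "(deriv ^^ 1) (\<lambda>t. h (x + t *s e)) \<alpha> \<noteq> 0" using Dk by (simp add: deriv_line dh)
    qed (use that in auto)
    obtain r3 where r3: "0 < r3" "ball \<alpha> r3 \<subseteq> M" using M(1,2) open_contains_ball by blast
    let ?N = "ball \<alpha> (min r1 (min r2 r3))"
    show ?thesis
    proof (intro exI conjI ballI)
      show "open ?N" "\<alpha> \<in> ?N" using g(1) g'(1) r3(1) by auto
      show "?N \<subseteq> M" using r3(2) by auto
      show "(\<lambda>t. g t / g' t ^ k) holomorphic_on ?N"
        by (intro holomorphic_intros holomorphic_on_subset[OF g(2)] holomorphic_on_subset[OF g'(2)]) (use g'(4) in auto)
      fix t assume t: "t \<in> ?N"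
      then have t1: "t \<in> ball \<alpha> r1" and t2: "t \<in> ball \<alpha> r2" by auto
      have "f (x + t *s e) = (t - \<alpha>)^k * g t" using g(3)[OF t1] f0 by simp
      moreover have "h (x + t *s e) = (t - \<alpha>) * g' t" using g'(3)[OF t2] h0 by simp
      ultimately show "f (x + t *s e) = g t / g' t ^ k * h (x + t *s e) ^ k"
        using g'(4)[OF t2] by (simp add: power_mult_distrib)
      show "g t / g' t ^ k \<noteq> 0" using g(4)[OF t1] g'(4)[OF t2] by simp
    qed
  qed
  have qS: "q \<in> S" using U0 by blast
  have dq: "dirD e h q \<noteq> 0" unfolding dh by (rule U0D[OF U0(2) hZ[OF qZ]])
  obtain \<eta>' \<epsilon>' where n: "\<eta>' > 0" "\<epsilon>' > 0" "\<And>y t. y \<in> ball q \<eta>' \<Longrightarrow> t \<in> cball 0 \<epsilon>' \<Longrightarrow> y + t *s e \<in> U0"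
    "\<And>y t t'. y \<in> ball q \<eta>' \<Longrightarrow> t \<in> cball 0 \<epsilon>' \<Longrightarrow> t' \<in> cball 0 \<epsilon>' \<Longrightarrow> h (y + t *s e) = h (y + t' *s e) \<Longrightarrow> t = t'"
    by (rule injective_along_lines[OF U0(1) hol_subset[OF hh U0(3)] U0(2) dq]) (rule that)
  have hq0: "h (q + t *s e) \<noteq> 0" if "0 < cmod t" "cmod t \<le> \<epsilon>'" for t
  proof
    assume "h (q + t *s e) = 0"
    then have "h (q + t *s e) = h (q + 0 *s e)" using hZ[OF qZ] by simp
    moreover have "0 \<le> \<epsilon>'" using n(2) by linarith
    then have "0 \<in> cball (0::complex) \<epsilon>'" by simp
    moreover have "q \<in> ball q \<eta>'" "t \<in> cball 0 \<epsilon>'" using n(1) that by auto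
    ultimately have "t = 0" by (intro n(4)[of q t 0])
    then show False using that by simp
  qed
  obtain \<delta> where d: "\<delta> > 0" "\<And>y t. y \<in> ball q \<delta> \<Longrightarrow> cmod t \<le> \<epsilon>' \<Longrightarrow> y + t *s e \<in> U0"
    "\<And>y t. y \<in> ball q \<delta> \<Longrightarrow> \<epsilon>' / 2 \<le> cmod t \<Longrightarrow> cmod t \<le> \<epsilon>' \<Longrightarrow> h (y + t *s e) \<noteq> 0"
  proof (rule line_box[OF U0(1) hol_subset[OF hh U0(3)] n(2)])
    show "q + t *s e \<in> U0" if "cmod t \<le> \<epsilon>'" for t using n(3)[of q t] n(1) that by simp
  qed (use hq0 that in auto)
  have dU: "y + t *s e \<in> U0" if "y \<in> ball q \<delta>" "t \<in> ball 0 \<epsilon>'" for y t using d(2)[OF that(1), of t] that(2) by simp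
  \<comment> \<open>The factorisation \<open>f = u * h ^ k\<close> serves the inclusion of
    \<open>Z\<close> in the zeros of \<open>h\<close>: since \<open>f\<close> vanishes on
    \<open>Z\<close>, so does \<open>h\<close> wherever \<open>u\<close> is nonzero.\<close>
  have "\<exists>u. hol u (ball q \<delta>) \<and> (\<forall>x\<in>ball q \<delta>. f x = u x * h x ^ k)"
  proof (rule division_along_lines[OF open_ball, of "\<epsilon>'/2" \<epsilon>' f U0 "\<lambda>x. h x ^ k"])
    show "0 < \<epsilon>'/2" "\<epsilon>'/2 < \<epsilon>'" using n(2) by auto
    show "hol f U0" by (rule hol_subset[OF f U0(3)])
    show "hol (\<lambda>x. h x ^ k) U0" by (rule hol_power[OF hol_subset[OF hh U0(3)]])
    show "h (z + t *s e) ^ k \<noteq> 0" if "z \<in> ball q \<delta>" "t \<in> sphere 0 (\<epsilon>'/2)" for z t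
      using d(3)[OF that(1), of t] that(2) n(2) by simp
    show "y + t *s e \<in> U0" if "y \<in> ball q \<delta>" "t \<in> ball 0 \<epsilon>'" for y t by (rule dU[OF that])
    fix W assume W: "open W" "W \<noteq> {}" "W \<subseteq> ball q \<delta>"
    then obtain x where x: "x \<in> W" by blast
    then have xq: "x \<in> ball q \<delta>" using W(3) by blast
    have hf: "(\<lambda>t. f (x + t *s e)) holomorphic_on ball 0 \<epsilon>'" using dU[OF xq] U0(3) by (intro hol_line[OF f]) blast
    have hlh: "(\<lambda>t. h (x + t *s e)) holomorphic_on ball 0 \<epsilon>'" using dU[OF xq] U0(3) by (intro hol_line[OF hh]) blast
    have "\<exists>g. g holomorphic_on ball 0 \<epsilon>' \<and> (\<forall>t\<in>ball 0 \<epsilon>'. f (x + t *s e) = g t * h (x + t *s e) ^ k)"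
    proof (rule divides_glue[of "ball 0 \<epsilon>'" "\<lambda>t. h (x + t *s e) ^ k" "of_real (\<epsilon>'/2)"])
      show "(\<lambda>t. h (x + t *s e) ^ k) holomorphic_on ball 0 \<epsilon>'" by (intro holomorphic_intros hlh)
      show "h (x + of_real (\<epsilon>'/2) *s e) ^ k \<noteq> 0" using d(3)[OF xq, of "of_real (\<epsilon>'/2)"] n(2) by simp
      fix \<alpha> assume a: "\<alpha> \<in> ball (0::complex) \<epsilon>'"
      show "\<exists>N g. open N \<and> \<alpha> \<in> N \<and> N \<subseteq> ball 0 \<epsilon>' \<and> g holomorphic_on N \<and> (\<forall>t\<in>N. f (x + t *s e) = g t * h (x + t *s e) ^ k)"
      proof (cases "h (x + \<alpha> *s e) = 0")
        case True
        from order[OF open_ball a dU[OF xq] True] show ?thesis by blast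
      next
        case False
        let ?N = "ball 0 \<epsilon>' \<inter> (\<lambda>t. h (x + t *s e)) -` (-{0})"
        show ?thesis
        proof (intro exI conjI ballI)
          show "open ?N" by (rule continuous_open_preimage[OF holomorphic_on_imp_continuous_on[OF hlh]]) auto
          show "(\<lambda>t. f (x + t *s e) / h (x + t *s e) ^ k) holomorphic_on ?N"
            by (intro holomorphic_intros holomorphic_on_subset[OF hf] holomorphic_on_subset[OF hlh]) auto
        qed (use a False in auto)
      qed
    qed (use n(2) in auto)
    then show "\<exists>z\<in>W. \<exists>g. g holomorphic_on ball 0 \<epsilon>' \<and> (\<forall>t\<in>ball 0 \<epsilon>'. f (z + t *s e) = g t * h (z + t *s e) ^ k)"
      using x by blast
  qed
  then obtain u where u: "hol u (ball q \<delta>)" "\<And>x. x \<in> ball q \<delta> \<Longrightarrow> f x = u x * h x ^ k" by blast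
  \<comment> \<open>On the line through \<open>q\<close> the function \<open>u\<close> agrees with
    the unit \<open>g\<close> off \<open>t = 0\<close>, hence also at \<open>t = 0\<close> by
    continuity.\<close>
  have uq: "u q \<noteq> 0"
  proof -
    let ?M = "{t. q + t *s e \<in> ball q \<delta> \<inter> U0} \<inter> ball 0 \<epsilon>'"
    have oM: "open ?M" using U0(1) by (intro open_Int open_line open_ball) auto
    have M0: "0 \<in> ?M" using d(1) U0(2) n(2) by simp
    have hq': "h (q + 0 *s e) = 0" using hZ[OF qZ] by simp
    obtain N g where N: "open N" "0 \<in> N" "N \<subseteq> ?M" "g holomorphic_on N"
       "\<forall>t\<in>N. f (q + t *s e) = g t * h (q + t *s e) ^ k" "\<forall>t\<in>N. g t \<noteq> 0"
      using order[OF oM M0 _ hq'] by blast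
    have hu: "(\<lambda>t. u (q + t *s e)) holomorphic_on N" using N(3) by (intro hol_line[OF u(1)]) blast
    have ug: "u (q + t *s e) = g t" if "t \<in> N - {0}" for t
    proof -
      have "q + t *s e \<in> ball q \<delta>" using N(3) that by blast
      from u(2)[OF this] have "u (q + t *s e) * h (q + t *s e) ^ k = g t * h (q + t *s e) ^ k" using N(5) that by auto
      moreover have "h (q + t *s e) \<noteq> 0" using hq0[of t] that N(3) by auto
      ultimately show ?thesis by simp
    qed
    have "u (q + 0 *s e) = g 0"
    proof (rule ccontr)
      assume ne: "u (q + 0 *s e) \<noteq> g 0"
      let ?W = "N \<inter> (\<lambda>t. u (q + t *s e) - g t) -` (-{0})"
      have "open ?W"
        by (rule continuous_open_preimage[OF _ N(1)])
          (intro continuous_on_diff holomorphic_on_imp_continuous_on hu N(4), auto)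
      moreover have "?W = {0}" using ne N(2) ug by auto
      ultimately show False using finite_imp_not_open[of "{0::complex}"] by simp
    qed
    then show ?thesis using N(2,6) by auto
  qed
  define U where "U = U0 \<inter> {x\<in>ball q \<delta>. u x \<noteq> 0}"
  show ?thesis
  proof (rule that[of U q h])
    show "open U" unfolding U_def by (intro open_Int U0(1) open_nonzero open_ball u(1))
    show "q \<in> U" unfolding U_def using U0(2) d(1) uq by simp
    show "U \<subseteq> S" using U0(3) by (auto simp: U_def)
    then show "hol h U" by (rule hol_subset[OF hh])
    show "q \<in> Z" using qZ ZkZ by blast
    show "dirD e h q \<noteq> 0" by (rule dq)
    show "Z \<inter> U = {x\<in>U. h x = 0}"
    proof (intro set_eqI iffI)
      fix x assume x: "x \<in> Z \<inter> U"
      then have "u x * h x ^ k = 0" using u(2)[of x] fZ[of x] by (auto simp: U_def)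
      then show "x \<in> {x\<in>U. h x = 0}" using x by (auto simp: U_def)
    next
      fix x assume "x \<in> {x\<in>U. h x = 0}"
      then show "x \<in> Z \<inter> U" using U0h[of x] ZkZ by (auto simp: U_def)
    qed
  qed
qed

section \<open>Holomorphic functions on complex manifolds\<close>

lemma has_derivative_vec_componentwise:
  fixes G :: "'b::real_normed_vector \<Rightarrow> complex^'n"
  assumes "\<And>k. ((\<lambda>z. G z $ k) has_derivative g' k) (at z)"
  shows "(G has_derivative (\<lambda>v. \<chi> k. g' k v)) (at z)"
proof -
  have "((\<lambda>x. G x \<bullet> i) has_derivative (\<lambda>v. (\<chi> k. g' k v) \<bullet> i)) (at z within UNIV)"
    if i: "i \<in> Basis" for i :: "complex^'n"
  proof -
    obtain k u where i: "i = axis k u" using i by (auto simp: Basis_vec_def)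
    have "((\<lambda>x. G x $ k \<bullet> u) has_derivative (\<lambda>v. g' k v \<bullet> u)) (at z)"
      by (rule has_derivative_inner_left[OF assms])
    then show ?thesis by (simp add: i inner_axis)
  qed
  then show ?thesis using has_derivative_componentwise_within[of G _ z UNIV] by blast
qed

lemma holomorphic_Cn_compose:
  assumes F: "holomorphic_Cn F T" and G: "\<And>k. holomorphic_Cn (\<lambda>z. G z $ k) S" and sub: "G ` S \<subseteq> T"
  shows "holomorphic_Cn (\<lambda>z. F (G z)) S"
  unfolding holomorphic_Cn_def
proof
  fix z assume z: "z \<in> S"
  have "\<forall>k. \<exists>g'. ((\<lambda>z. G z $ k) has_derivative g') (at z) \<and> (\<forall>c v. g' (c *s v) = c * g' v)"
    using G z unfolding holomorphic_Cn_def by blast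
  then obtain g' where g': "\<And>k. ((\<lambda>z. G z $ k) has_derivative g' k) (at z)" "\<And>k c v. g' k (c *s v) = c * g' k v"
    by metis
  obtain f' where f': "(F has_derivative f') (at (G z))" "\<And>c v. f' (c *s v) = c * f' v"
    using F z sub unfolding holomorphic_Cn_def by blast
  have "((\<lambda>z. F (G z)) has_derivative (\<lambda>v. f' (\<chi> k. g' k v))) (at z)"
    by (rule has_derivative_compose[OF has_derivative_vec_componentwise[OF g'(1)] f'(1)])
  moreover have "f' (\<chi> k. g' k (c *s v)) = c * f' (\<chi> k. g' k v)" for c v
  proof -
    have "(\<chi> k. g' k (c *s v)) = c *s (\<chi> k. g' k v)" by (simp add: vec_eq_iff g'(2))
    then show ?thesis by (simp add: f'(2))
  qed
  ultimately show "\<exists>f'. ((\<lambda>z. F (G z)) has_derivative f') (at z) \<and> (\<forall>c v. f' (c *s v) = c * f' v)"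
    by blast
qed

locale complex_mfd =
  fixes A :: "('a::t2_space, 'n::finite) chart set"
  assumes mfd: "complex_manifold A"
begin

lemma chart_exists: "\<exists>c\<in>A. p \<in> fst c"
  using mfd unfolding complex_manifold_def by blast

lemma chart_open: "c \<in> A \<Longrightarrow> open (fst c)" "c \<in> A \<Longrightarrow> open (snd c ` fst c)"
  and chart_homeo: "c \<in> A \<Longrightarrow> homeomorphism (fst c) (snd c ` fst c) (snd c) (chart_inv c)"
  using mfd unfolding complex_manifold_def by blast+

lemma chart_inv_chart: "c \<in> A \<Longrightarrow> x \<in> fst c \<Longrightarrow> chart_inv c (snd c x) = x"
  using chart_homeo homeomorphism_apply1 by metis

lemma chart_chart_inv: "c \<in> A \<Longrightarrow> z \<in> snd c ` fst c \<Longrightarrow> snd c (chart_inv c z) = z"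
  by (metis chart_inv_chart imageE)

lemma open_chart_image:
  assumes "c \<in> A" "open W"
  shows "open (snd c ` (fst c \<inter> W))"
proof -
  have "openin (top_of_set (snd c ` fst c)) (snd c ` (fst c \<inter> W))"
    by (rule homeomorphism_imp_open_map[OF chart_homeo[OF assms(1)]]) (use assms in \<open>auto simp: openin_open\<close>)
  then show ?thesis using chart_open(2)[OF assms(1)] openin_open_trans by blast
qed

lemma open_chart_preimage:
  assumes "c \<in> A" "open T"
  shows "open {x \<in> fst c. snd c x \<in> T}"
proof -
  have "continuous_on (fst c) (snd c)" using chart_homeo[OF assms(1)] by (simp add: homeomorphism_def)
  then have "open (fst c \<inter> snd c -` T)"
    by (rule continuous_open_preimage[OF _ chart_open(1)[OF assms(1)] assms(2)])
  moreover have "{x \<in> fst c. snd c x \<in> T} = fst c \<inter> snd c -` T" by auto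
  ultimately show ?thesis by simp
qed

lemma holomorphic_fun_iff:
  assumes "open W"
  shows "holomorphic_fun A W f \<longleftrightarrow> (\<forall>c\<in>A. hol (\<lambda>z. f (chart_inv c z)) (snd c ` (fst c \<inter> W)))"
  unfolding holomorphic_fun_def using holomorphic_Cn_iff_hol[OF open_chart_image[OF _ assms]] by blast

lemma holf_hol: "holomorphic_fun A W f \<Longrightarrow> open W \<Longrightarrow> c \<in> A \<Longrightarrow> hol (\<lambda>z. f (chart_inv c z)) (snd c ` (fst c \<inter> W))"
  using holomorphic_fun_iff by blast

lemma holf_subset: "holomorphic_fun A W f \<Longrightarrow> V \<subseteq> W \<Longrightarrow> holomorphic_fun A V f"
  unfolding holomorphic_fun_def holomorphic_Cn_def by blast

lemma holf_cong:
  assumes "open W" "holomorphic_fun A W f" "\<And>x. x \<in> W \<Longrightarrow> f x = g x"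
  shows "holomorphic_fun A W g"
  unfolding holomorphic_fun_iff[OF assms(1)]
proof
  fix c assume c: "c \<in> A"
  show "hol (\<lambda>z. g (chart_inv c z)) (snd c ` (fst c \<inter> W))"
    by (rule hol_cong[OF holf_hol[OF assms(2,1) c]]) (use assms(3) chart_inv_chart[OF c] in auto)
qed

lemma holf_const: "open W \<Longrightarrow> holomorphic_fun A W (\<lambda>_. k)"
  by (simp add: holomorphic_fun_iff)

lemma holf_mult: "open W \<Longrightarrow> holomorphic_fun A W f \<Longrightarrow> holomorphic_fun A W g \<Longrightarrow> holomorphic_fun A W (\<lambda>x. f x * g x)"
  and holf_diff: "open W \<Longrightarrow> holomorphic_fun A W f \<Longrightarrow> holomorphic_fun A W g \<Longrightarrow> holomorphic_fun A W (\<lambda>x. f x - g x)"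
  by (auto simp: holomorphic_fun_iff)

lemma holf_sum: "open W \<Longrightarrow> (\<And>i. i \<in> I \<Longrightarrow> holomorphic_fun A W (f i)) \<Longrightarrow> holomorphic_fun A W (\<lambda>x. \<Sum>i\<in>I. f i x)"
  unfolding holomorphic_fun_iff by (intro ballI hol_sum) blast

lemma holf_divide:
  assumes "open W" "holomorphic_fun A W f" "holomorphic_fun A W g" "\<And>x. x \<in> W \<Longrightarrow> g x \<noteq> 0"
  shows "holomorphic_fun A W (\<lambda>x. f x / g x)"
  unfolding holomorphic_fun_iff[OF assms(1)]
proof
  fix c assume c: "c \<in> A"
  show "hol (\<lambda>z. f (chart_inv c z) / g (chart_inv c z)) (snd c ` (fst c \<inter> W))"
    by (rule hol_divide[OF holf_hol[OF assms(2,1) c] holf_hol[OF assms(3,1) c]])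
      (use assms(4) chart_inv_chart[OF c] in auto)
qed

lemma holf_local:
  assumes "open W" "\<And>p. p \<in> W \<Longrightarrow> \<exists>N g. open N \<and> p \<in> N \<and> N \<subseteq> W \<and> holomorphic_fun A N g \<and> (\<forall>x\<in>N. f x = g x)"
  shows "holomorphic_fun A W f"
  unfolding holomorphic_fun_iff[OF assms(1)]
proof
  fix c assume c: "c \<in> A"
  show "hol (\<lambda>z. f (chart_inv c z)) (snd c ` (fst c \<inter> W))"
  proof (rule hol_local[OF open_chart_image[OF c assms(1)]])
    fix z assume "z \<in> snd c ` (fst c \<inter> W)"
    then obtain p where p: "p \<in> fst c" "p \<in> W" "z = snd c p" by blast
    obtain N g where N: "open N" "p \<in> N" "N \<subseteq> W" "holomorphic_fun A N g" "\<forall>x\<in>N. f x = g x"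
      using assms(2)[OF p(2)] by blast
    have "holomorphic_fun A N f" by (rule holf_cong[OF N(1,4)]) (use N(5) in simp)
    then have "hol (\<lambda>z. f (chart_inv c z)) (snd c ` (fst c \<inter> N))" by (rule holf_hol[OF _ N(1) c])
    then show "\<exists>T. open T \<and> z \<in> T \<and> hol (\<lambda>z. f (chart_inv c z)) T"
      using open_chart_image[OF c N(1)] p N(2) by blast
  qed
qed

lemma holf_continuous:
  assumes "holomorphic_fun A W f" "open W"
  shows "continuous_on W f"
proof (rule continuous_at_imp_continuous_on, rule ballI)
  fix p assume p: "p \<in> W"
  obtain c where c: "c \<in> A" "p \<in> fst c" using chart_exists by blast
  have "continuous_on (fst c \<inter> W) (\<lambda>x. f (chart_inv c (snd c x)))"
  proof (rule continuous_on_compose2[OF hol_continuous[OF holf_hol[OF assms c(1)]]])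
    show "continuous_on (fst c \<inter> W) (snd c)"
      using chart_homeo[OF c(1)] by (auto simp: homeomorphism_def intro: continuous_on_subset)
  qed auto
  then have "continuous_on (fst c \<inter> W) f"
    by (rule continuous_on_eq) (use chart_inv_chart[OF c(1)] in auto)
  then show "isCont f p"
    using continuous_on_eq_continuous_at[of "fst c \<inter> W" f] chart_open(1)[OF c(1)] assms(2) p c(2) by blast
qed

text \<open>Holomorphy in one chart passes to all others because the coordinate changes are
  holomorphic.\<close>

lemma holf_from_chart:
  assumes c: "c \<in> A" and N: "open N" "N \<subseteq> fst c" and F: "hol F T" and T: "open T" "snd c ` N \<subseteq> T"
  shows "holomorphic_fun A N (\<lambda>x. F (snd c x))"
  unfolding holomorphic_fun_def
proof
  fix d assume d: "d \<in> A"
  show "holomorphic_Cn (\<lambda>z. F (snd c (chart_inv d z))) (snd d ` (fst d \<inter> N))"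
  proof (rule holomorphic_Cn_compose)
    show "holomorphic_Cn F T" using F holomorphic_Cn_iff_hol[OF T(1)] by blast
    show "holomorphic_Cn (\<lambda>z. snd c (chart_inv d z) $ k) (snd d ` (fst d \<inter> N))" for k
    proof -
      have "holomorphic_Cn (\<lambda>z. snd c (chart_inv d z) $ k) (snd d ` (fst c \<inter> fst d))"
        using mfd c d unfolding complex_manifold_def by blast
      moreover have "snd d ` (fst d \<inter> N) \<subseteq> snd d ` (fst c \<inter> fst d)" using N(2) by blast
      ultimately show ?thesis unfolding holomorphic_Cn_def by blast
    qed
    show "(\<lambda>z. snd c (chart_inv d z)) ` (snd d ` (fst d \<inter> N)) \<subseteq> T"
      using T(2) chart_inv_chart[OF d] by force
  qed
qed

lemma holf_zero_dense:
  assumes "open W" "holomorphic_fun A W f" "\<And>V. open V \<Longrightarrow> V \<noteq> {} \<Longrightarrow> V \<subseteq> W \<Longrightarrow> \<exists>x\<in>V. f x = 0" "x \<in> W"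
  shows "f x = 0"
proof (rule ccontr)
  assume ne: "f x \<noteq> 0"
  have "open (W \<inter> f -` (-{0}))"
    by (rule continuous_open_preimage[OF holf_continuous[OF assms(2,1)] assms(1)]) auto
  then obtain y where "y \<in> W \<inter> f -` (-{0})" "f y = 0"
    using assms(3)[of "W \<inter> f -` (-{0})"] assms(4) ne by blast
  then show False by simp
qed

lemma chart_ball:
  assumes "open N0" "p \<in> N0"
  obtains c \<delta> where "c \<in> A" "p \<in> fst c" "0 < \<delta>" "ball (snd c p) \<delta> \<subseteq> snd c ` (fst c \<inter> N0)"
proof -
  obtain c where c: "c \<in> A" "p \<in> fst c" using chart_exists by blast
  have "open (snd c ` (fst c \<inter> N0))" by (rule open_chart_image[OF c(1) assms(1)])
  then obtain \<delta> where "\<delta> > 0" "ball (snd c p) \<delta> \<subseteq> snd c ` (fst c \<inter> N0)"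
    using c(2) assms(2) open_contains_ball by blast
  then show ?thesis using that c by blast
qed

text \<open>A chart ball is convex, so the identity theorem applies on it: a member that is nonzero
  at one point is nonzero on a dense set, and a single index serves the whole neighbourhood.\<close>

lemma nonzero_dense_near:
  assumes N0: "open N0" "p \<in> N0" and f: "\<And>j. holomorphic_fun A N0 (f j)"
    and ne: "\<And>V. open V \<Longrightarrow> p \<in> V \<Longrightarrow> V \<subseteq> N0 \<Longrightarrow> \<exists>x\<in>V. \<exists>j. f j x \<noteq> 0"
  obtains N j where "open N" "p \<in> N" "N \<subseteq> N0" "\<And>V. open V \<Longrightarrow> V \<noteq> {} \<Longrightarrow> V \<subseteq> N \<Longrightarrow> \<exists>x\<in>V. f j x \<noteq> 0"
proof -
  obtain c \<delta> where c: "c \<in> A" "p \<in> fst c" "0 < \<delta>" "ball (snd c p) \<delta> \<subseteq> snd c ` (fst c \<inter> N0)"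
    by (rule chart_ball[OF N0]) (rule that)
  let ?B = "ball (snd c p) \<delta>"
  define N where "N = {x \<in> fst c. snd c x \<in> ?B}"
  have oN: "open N" unfolding N_def by (rule open_chart_preimage[OF c(1) open_ball])
  have NN0: "N \<subseteq> N0"
  proof
    fix x assume "x \<in> N"
    then have "x \<in> fst c" "snd c x \<in> snd c ` (fst c \<inter> N0)" using c(4) by (auto simp: N_def)
    then show "x \<in> N0" using chart_inv_chart[OF c(1)] by (metis IntE imageE)
  qed
  have pN: "p \<in> N" using c by (simp add: N_def)
  obtain x j where x: "x \<in> N" "f j x \<noteq> 0" using ne[OF oN pN NN0] by blast
  have hB: "hol (\<lambda>z. f j (chart_inv c z)) ?B" by (rule hol_subset[OF holf_hol[OF f N0(1) c(1)] c(4)])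
  show ?thesis
  proof (rule that[OF oN pN NN0, of j])
    fix V assume V: "open V" "V \<noteq> {}" "V \<subseteq> N"
    have Vc: "V \<subseteq> fst c" using V(3) by (auto simp: N_def)
    then have e: "fst c \<inter> V = V" by blast
    have "\<exists>z\<in>snd c ` V. f j (chart_inv c z) \<noteq> 0"
    proof (rule hol_nonzero_dense[OF open_ball convex_ball hB])
      show "snd c x \<in> ?B" using x(1) by (simp add: N_def)
      show "f j (chart_inv c (snd c x)) \<noteq> 0" using x chart_inv_chart[OF c(1)] by (simp add: N_def)
      show "open (snd c ` V)" using open_chart_image[OF c(1) V(1)] e by simp
      show "snd c ` V \<noteq> {}" "snd c ` V \<subseteq> ?B" using V(2,3) by (auto simp: N_def)
    qed
    then obtain x where x: "x \<in> V" "f j (chart_inv c (snd c x)) \<noteq> 0" by blast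
    then have "f j x \<noteq> 0" using chart_inv_chart[OF c(1), of x] Vc by auto
    then show "\<exists>x\<in>V. f j x \<noteq> 0" using x(1) by blast
  qed
qed

text \<open>The family has no common factor, expressed without germs: it divides every family
  parallel to it. Multipliers are unique because \<open>\<phi>\<close> vanishes on no open set, so
  asking for one on all of \<open>V\<close> amounts to asking locally, which is
  \<open>primitiveI\<close>.\<close>

definition primitive :: "'a set \<Rightarrow> ('k \<Rightarrow> 'a \<Rightarrow> complex) \<Rightarrow> bool" where
  "primitive N \<phi> \<longleftrightarrow> open N \<and> (\<forall>k. holomorphic_fun A N (\<phi> k)) \<and>
     (\<forall>V. open V \<longrightarrow> V \<noteq> {} \<longrightarrow> V \<subseteq> N \<longrightarrow> (\<exists>x\<in>V. \<exists>k. \<phi> k x \<noteq> 0)) \<and>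
     (\<forall>V \<psi>. open V \<longrightarrow> V \<subseteq> N \<longrightarrow> (\<forall>k. holomorphic_fun A V (\<psi> k)) \<longrightarrow>
        (\<forall>y\<in>V. \<forall>j k. \<psi> j y * \<phi> k y = \<psi> k y * \<phi> j y) \<longrightarrow>
        (\<exists>g. holomorphic_fun A V g \<and> (\<forall>y\<in>V. \<forall>k. \<psi> k y = g y * \<phi> k y)))"

lemma primitive_dense: "primitive N \<phi> \<Longrightarrow> open V \<Longrightarrow> V \<noteq> {} \<Longrightarrow> V \<subseteq> N \<Longrightarrow> \<exists>x\<in>V. \<exists>k. \<phi> k x \<noteq> 0"
  by (simp add: primitive_def)

lemma primitive_holf: "primitive N \<phi> \<Longrightarrow> holomorphic_fun A N (\<phi> k)" "primitive N \<phi> \<Longrightarrow> open N"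
  by (simp_all add: primitive_def)

lemma primitive_divides:
  assumes "primitive N \<phi>" "open V" "V \<subseteq> N" "\<And>k. holomorphic_fun A V (\<psi> k)"
    "\<And>y j k. y \<in> V \<Longrightarrow> \<psi> j y * \<phi> k y = \<psi> k y * \<phi> j y"
  obtains g where "holomorphic_fun A V g" "\<And>y k. y \<in> V \<Longrightarrow> \<psi> k y = g y * \<phi> k y"
proof -
  have "\<forall>V \<psi>. open V \<longrightarrow> V \<subseteq> N \<longrightarrow> (\<forall>k. holomorphic_fun A V (\<psi> k)) \<longrightarrow>
        (\<forall>y\<in>V. \<forall>j k. \<psi> j y * \<phi> k y = \<psi> k y * \<phi> j y) \<longrightarrow>
        (\<exists>g. holomorphic_fun A V g \<and> (\<forall>y\<in>V. \<forall>k. \<psi> k y = g y * \<phi> k y))"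
    using assms(1) unfolding primitive_def by (elim conjE)
  then have "\<exists>g. holomorphic_fun A V g \<and> (\<forall>y\<in>V. \<forall>k. \<psi> k y = g y * \<phi> k y)"
    by (elim allE[of _ V] allE[of _ \<psi>]) (use assms(2-5) in simp)
  then obtain g where "holomorphic_fun A V g" "\<forall>y\<in>V. \<forall>k. \<psi> k y = g y * \<phi> k y" by (elim exE conjE)
  then show ?thesis by (intro that[of g]) simp_all
qed

lemma primitiveI:
  assumes N: "open N" and h: "\<And>k. holomorphic_fun A N (\<phi> k)"
    and d: "\<And>V. open V \<Longrightarrow> V \<noteq> {} \<Longrightarrow> V \<subseteq> N \<Longrightarrow> \<exists>x\<in>V. \<exists>k. \<phi> k x \<noteq> 0"
    and loc: "\<And>V \<psi> p. open V \<Longrightarrow> V \<subseteq> N \<Longrightarrow> \<forall>k. holomorphic_fun A V (\<psi> k) \<Longrightarrow>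
        \<forall>y\<in>V. \<forall>j k. \<psi> j y * \<phi> k y = \<psi> k y * \<phi> j y \<Longrightarrow> p \<in> V \<Longrightarrow>
        \<exists>W g. open W \<and> p \<in> W \<and> W \<subseteq> V \<and> holomorphic_fun A W g \<and> (\<forall>y\<in>W. \<forall>k. \<psi> k y = g y * \<phi> k y)"
  shows "primitive N \<phi>"
  unfolding primitive_def
proof (intro conjI allI impI)
  fix V :: "'a set" and \<psi> :: "'b \<Rightarrow> 'a \<Rightarrow> complex"
  assume V: "open V" "V \<subseteq> N" and \<psi>: "\<forall>k. holomorphic_fun A V (\<psi> k)" "\<forall>y\<in>V. \<forall>j k. \<psi> j y * \<phi> k y = \<psi> k y * \<phi> j y"
  obtain q where q: "\<And>x k. x \<in> V \<Longrightarrow> \<psi> k x = q x * \<phi> k x"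
    "\<And>p. p \<in> V \<Longrightarrow> \<exists>W q'. open W \<and> p \<in> W \<and> W \<subseteq> V \<and> holomorphic_fun A W q' \<and> (\<forall>x\<in>W. q x = q' x)"
  proof (rule glue_factor[of V \<phi> "\<lambda>W q. holomorphic_fun A W q" \<psi>])
    show "\<exists>x\<in>U. \<exists>k. \<phi> k x \<noteq> 0" if "open U" "U \<noteq> {}" "U \<subseteq> V" for U
      by (rule d[OF that(1,2)]) (use that(3) V(2) in blast)
    fix p assume "p \<in> V"
    from loc[OF V \<psi> this] obtain W g where W: "open W" "p \<in> W" "W \<subseteq> V" "holomorphic_fun A W g" "\<forall>y\<in>W. \<forall>k. \<psi> k y = g y * \<phi> k y"
      by blast
    then show "\<exists>N q. open N \<and> p \<in> N \<and> N \<subseteq> V \<and> continuous_on N q \<and> holomorphic_fun A N q \<and> (\<forall>x\<in>N. \<forall>k. \<psi> k x = q x * \<phi> k x)"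
      using holf_continuous[OF W(4,1)] by (intro exI[of _ W] exI[of _ g]) simp
  qed (rule that)
  have "holomorphic_fun A V q" by (rule holf_local[OF V(1) q(2)])
  then show "\<exists>g. holomorphic_fun A V g \<and> (\<forall>y\<in>V. \<forall>k. \<psi> k y = g y * \<phi> k y)" using q(1) by blast
qed (use N h d in auto)

lemma primitive_subset:
  assumes "primitive N \<phi>" "open V" "V \<subseteq> N"
  shows "primitive V \<phi>"
proof -
  show ?thesis
    unfolding primitive_def
  proof (intro conjI allI impI)
    show "holomorphic_fun A V (\<phi> k)" for k by (rule holf_subset[OF primitive_holf(1)[OF assms(1)] assms(3)])
    show "\<exists>x\<in>U. \<exists>k. \<phi> k x \<noteq> 0" if "open U" "U \<noteq> {}" "U \<subseteq> V" for U
      by (rule primitive_dense[OF assms(1) that(1,2)]) (use that(3) assms(3) in blast)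
    fix U :: "'a set" and \<psi> :: "'b \<Rightarrow> 'a \<Rightarrow> complex"
    assume U: "open U" "U \<subseteq> V" "\<forall>k. holomorphic_fun A U (\<psi> k)" "\<forall>y\<in>U. \<forall>j k. \<psi> j y * \<phi> k y = \<psi> k y * \<phi> j y"
    have UN: "U \<subseteq> N" using U(2) assms(3) by blast
    obtain g where "holomorphic_fun A U g" "\<And>y k. y \<in> U \<Longrightarrow> \<psi> k y = g y * \<phi> k y"
      by (rule primitive_divides[OF assms(1) U(1) UN, of \<psi>]) (use U(3,4) that in auto)
    then show "\<exists>g. holomorphic_fun A U g \<and> (\<forall>y\<in>U. \<forall>k. \<psi> k y = g y * \<phi> k y)" by (intro exI[of _ g]) simp
  qed (rule assms(2))
qed

end

text \<open>The minors of the pair of images are linear combinations of the minors of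
  \<open>x\<close> and \<open>w\<close>; exchanging the two summation indices shows it.\<close>

lemma matrix_vector_mult_parallel:
  fixes M :: "complex^'k^'k" and x w :: "complex^'k"
  assumes "\<And>a b. x $ a * w $ b = x $ b * w $ a"
  shows "(M *v x) $ j * (M *v w) $ k = (M *v x) $ k * (M *v w) $ j"
proof -
  have e: "(M *v x) $ j * (M *v w) $ k = (\<Sum>a\<in>UNIV. \<Sum>b\<in>UNIV. M $ j $ a * M $ k $ b * (x $ a * w $ b))" for j k
    unfolding matrix_vector_mult_def vec_lambda_beta sum_product
    by (intro sum.cong refl) (simp add: mult_ac)
  have "(\<Sum>a\<in>UNIV. \<Sum>b\<in>UNIV. M $ j $ a * M $ k $ b * (x $ a * w $ b)) = 
      (\<Sum>a\<in>UNIV. \<Sum>b\<in>UNIV. M $ j $ a * M $ k $ b * (x $ b * w $ a))"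
    by (simp only: assms)
  also have "\<dots> = (\<Sum>b\<in>UNIV. \<Sum>a\<in>UNIV. M $ j $ a * M $ k $ b * (x $ b * w $ a))" by (rule sum.swap)
  also have "\<dots> = (\<Sum>a\<in>UNIV. \<Sum>b\<in>UNIV. M $ k $ a * M $ j $ b * (x $ a * w $ b))"
    by (intro sum.cong refl) (simp add: mult_ac)
  finally show ?thesis unfolding e .
qed

section \<open>Primitive families on a manifold\<close>

context complex_mfd begin

text \<open>This is \<open>local_primitive\<close> read in a chart. It divides families parallel to
  \<open>v\<close>, whereas \<open>primitive\<close> concerns families parallel to
  \<open>\<phi>\<close>. The latter are parallel to \<open>v\<close> where \<open>\<phi>' k0\<close>
  is nonzero, hence everywhere by density.\<close>

lemma exists_primitive:
  assumes N0: "open N0" "p \<in> N0" and v: "\<And>k. holomorphic_fun A N0 (v k)"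
    and dense: "\<And>V. open V \<Longrightarrow> V \<noteq> {} \<Longrightarrow> V \<subseteq> N0 \<Longrightarrow> \<exists>x\<in>V. v k0 x \<noteq> 0"
  obtains N \<phi> where "p \<in> N" "N \<subseteq> N0" "primitive N \<phi>" "\<And>x i j. x \<in> N \<Longrightarrow> \<phi> i x * v j x = \<phi> j x * v i x"
proof -
  obtain c where c: "c \<in> A" "p \<in> fst c" using chart_exists by blast
  define S where "S = snd c ` (fst c \<inter> N0)"
  have oS: "open S" unfolding S_def by (rule open_chart_image[OF c(1) N0(1)])
  define v' where "v' k z = v k (chart_inv c z)" for k z
  have hv': "hol (v' k) S" for k unfolding v'_def S_def by (rule holf_hol[OF v N0(1) c(1)])
  have pS: "snd c p \<in> S" using c(2) N0(2) by (auto simp: S_def)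
  have inv: "chart_inv c (snd c x) = x" if "x \<in> fst c" for x by (rule chart_inv_chart[OF c(1) that])
  have S_iff: "x \<in> N0" if "x \<in> fst c" "snd c x \<in> S" for x
    using that inv unfolding S_def by (metis IntE imageE)
  have pre: "open {x\<in>fst c. snd c x \<in> V}" if "open V" for V by (rule open_chart_preimage[OF c(1) that])
  have vd: "\<exists>x\<in>V. v' k0 x \<noteq> 0" if V: "open V" "V \<noteq> {}" "V \<subseteq> S" for V
  proof -
    have "{x\<in>fst c. snd c x \<in> V} \<noteq> {}" using V(2,3) by (auto simp: S_def)
    moreover have "{x\<in>fst c. snd c x \<in> V} \<subseteq> N0" using V(3) S_iff by blast
    ultimately obtain x where x: "x \<in> fst c" "snd c x \<in> V" "v k0 x \<noteq> 0" using dense[OF pre[OF V(1)]] by blast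
    then show ?thesis by (intro bexI[of _ "snd c x"]) (simp_all add: v'_def inv)
  qed
  obtain \<delta> \<phi>' where d: "0 < \<delta>" "ball (snd c p) \<delta> \<subseteq> S" and h\<phi>': "\<And>i. hol (\<phi>' i) (ball (snd c p) \<delta>)"
    and ne: "\<exists>z\<in>ball (snd c p) \<delta>. \<phi>' k0 z \<noteq> 0"
    and par: "\<And>z i j. z \<in> ball (snd c p) \<delta> \<Longrightarrow> \<phi>' i z * v' j z = \<phi>' j z * v' i z"
    and gen: "local_generator \<phi>' v' (ball (snd c p) \<delta>)"
  proof (rule local_primitive[OF oS hv' pS])
    show "\<exists>x\<in>V. v' k0 x \<noteq> 0" if "open V" "snd c p \<in> V" "V \<subseteq> S" for V
      by (rule vd[OF that(1) _ that(3)]) (use that(2) in blast)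
  qed (rule that)
  let ?B = "ball (snd c p) \<delta>"
  define N where "N = {x\<in>fst c. snd c x \<in> ?B}"
  have oN: "open N" unfolding N_def by (rule pre) simp
  have Nc: "N \<subseteq> fst c" and NB: "snd c ` N \<subseteq> ?B" by (auto simp: N_def)
  have NN0: "N \<subseteq> N0" using d(2) S_iff by (auto simp: N_def)
  have pd: "\<exists>z\<in>V. \<phi>' k0 z \<noteq> 0" if V: "open V" "V \<noteq> {}" "V \<subseteq> ?B" for V
    using ne hol_nonzero_dense[OF open_ball convex_ball h\<phi>' _ _ V] by blast
  define \<phi> where "\<phi> k x = \<phi>' k (snd c x)" for k x
  have oim: "open (snd c ` V)" "snd c ` V \<subseteq> ?B" if "open V" "V \<subseteq> N" for V
  proof -
    have "fst c \<inter> V = V" using that(2) Nc by blast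
    then show "open (snd c ` V)" using open_chart_image[OF c(1) that(1)] by simp
    show "snd c ` V \<subseteq> ?B" using that(2) NB by blast
  qed
  have "primitive N \<phi>"
  proof (rule primitiveI[OF oN])
    show "holomorphic_fun A N (\<phi> k)" for k
      unfolding \<phi>_def by (rule holf_from_chart[OF c(1) oN Nc h\<phi>' open_ball NB])
    show "\<exists>x\<in>V. \<exists>k. \<phi> k x \<noteq> 0" if V: "open V" "V \<noteq> {}" "V \<subseteq> N" for V
      using pd[OF oim(1)[OF V(1,3)] _ oim(2)[OF V(1,3)]] V(2) by (auto simp: \<phi>_def)
    fix V \<psi> x assume V: "open V" "V \<subseteq> N" and \<psi>: "\<forall>k. holomorphic_fun A V (\<psi> k)"
      and p\<psi>: "\<forall>y\<in>V. \<forall>j k. \<psi> j y * \<phi> k y = \<psi> k y * \<phi> j y" and x: "x \<in> V"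
    have Vc: "V \<subseteq> fst c" using V(2) Nc by blast
    have cV: "fst c \<inter> V = V" using Vc by blast
    define V' where "V' = snd c ` V"
    have oV': "open V'" and V'B: "V' \<subseteq> ?B" using oim[OF V] by (simp_all add: V'_def)
    define \<psi>' where "\<psi>' k z = \<psi> k (chart_inv c z)" for k z
    have h\<psi>': "hol (\<psi>' k) V'" for k
      using holf_hol[OF _ V(1) c(1), of "\<psi> k"] \<psi> unfolding \<psi>'_def V'_def cV by blast
    have p1: "\<psi>' j z * \<phi>' k z = \<psi>' k z * \<phi>' j z" if z: "z \<in> V'" for z j k
    proof -
      obtain y where y: "y \<in> V" "z = snd c y" using z by (auto simp: V'_def)
      then have "chart_inv c z = y" using inv Vc by blast
      then show ?thesis using p\<psi>[rule_format, OF y(1), of j k] y(2) by (simp add: \<psi>'_def \<phi>_def)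
    qed
    have "\<psi>' j z * v' k z - \<psi>' k z * v' j z = 0" if z: "z \<in> V'" for z j k
    proof (rule hol_eq_zero_dense[OF oV' _ _ z])
      have "V' \<subseteq> S" using V'B d(2) by blast
      then show "hol (\<lambda>z. \<psi>' j z * v' k z - \<psi>' k z * v' j z) V'"
        by (intro hol_diff hol_mult h\<psi>' hol_subset[OF hv'])
      fix U assume U: "open U" "U \<noteq> {}" "U \<subseteq> V'"
      then obtain y where y: "y \<in> U" "\<phi>' k0 y \<noteq> 0" using pd[of U] V'B by blast
      have yV: "y \<in> V'" and yB: "y \<in> ?B" using y(1) U(3) V'B by blast+
      have "\<phi>' k0 y * (\<psi>' j y * v' k y - \<psi>' k y * v' j y) =
         (\<psi>' j y * \<phi>' k0 y) * v' k y - (\<psi>' k y * \<phi>' k0 y) * v' j y" by (simp add: algebra_simps)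
      also have "\<dots> = \<psi>' k0 y * (\<phi>' j y * v' k y) - \<psi>' k0 y * (\<phi>' k y * v' j y)"
        unfolding p1[OF yV, of j k0] p1[OF yV, of k k0] by (simp add: algebra_simps)
      also have "\<dots> = 0" by (simp add: par[OF yB, of j k])
      finally have "\<psi>' j y * v' k y - \<psi>' k y * v' j y = 0" using y(2) by simp
      then show "\<exists>y\<in>U. \<psi>' j y * v' k y - \<psi>' k y * v' j y = 0" using y(1) by blast
    qed
    then have "\<forall>y\<in>V'. \<forall>j k. \<psi>' j y * v' k y = \<psi>' k y * v' j y" by simp
    moreover have "snd c x \<in> V'" using x by (simp add: V'_def)
    ultimately have "\<exists>W g. open W \<and> snd c x \<in> W \<and> W \<subseteq> V' \<and> hol g W \<and> (\<forall>y\<in>W. \<forall>k. \<psi>' k y = g y * \<phi>' k y)"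
      using gen[unfolded local_generator_def, rule_format, of V' \<psi>' "snd c x"] oV' V'B h\<psi>' by blast
    then obtain W g where W: "open W" "snd c x \<in> W" "W \<subseteq> V'" "hol g W" "\<forall>y\<in>W. \<forall>k. \<psi>' k y = g y * \<phi>' k y" by blast
    define M where "M = {y\<in>fst c. snd c y \<in> W}"
    have oM: "open M" unfolding M_def by (rule pre[OF W(1)])
    have MV: "M \<subseteq> V"
    proof
      fix y assume "y \<in> M"
      then have y: "y \<in> fst c" "snd c y \<in> V'" using W(3) by (auto simp: M_def)
      then obtain y' where "y' \<in> V" "snd c y = snd c y'" by (auto simp: V'_def)
      then show "y \<in> V" using inv[OF y(1)] inv[of y'] Vc by auto
    qed
    have "holomorphic_fun A M (\<lambda>y. g (snd c y))"
      by (rule holf_from_chart[OF c(1) oM _ W(4,1)]) (auto simp: M_def)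
    moreover have "\<psi> k y = g (snd c y) * \<phi> k y" if "y \<in> M" for y k
      using W(5) that inv[of y] by (auto simp: M_def \<psi>'_def \<phi>_def)
    moreover have "x \<in> M" using x Vc W(2) by (auto simp: M_def)
    ultimately show "\<exists>W g. open W \<and> x \<in> W \<and> W \<subseteq> V \<and> holomorphic_fun A W g \<and> (\<forall>y\<in>W. \<forall>k. \<psi> k y = g y * \<phi> k y)"
      using oM MV by (intro exI[of _ M] exI[of _ "\<lambda>y. g (snd c y)"]) simp
  qed
  moreover have "\<phi> i x * v j x = \<phi> j x * v i x" if "x \<in> N" for x i j
    using par[of "snd c x" i j] that inv[of x] by (auto simp: N_def \<phi>_def v'_def)
  moreover have "p \<in> N" using c(2) d(1) by (simp add: N_def)
  ultimately show ?thesis using that NN0 by blast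
qed

text \<open>If the common zeros met all discs over some open set of parameters,
  \<open>regular_point_on_lines\<close> would yield a regular point of codimension one. So the discs
  without common zeros are dense, and on such a disc \<open>\<psi> j0\<close> is divisible by
  \<open>\<phi> j0\<close>: near a point where \<open>\<phi> k\<close> is nonzero the quotient is
  \<open>\<psi> k / \<phi> k\<close>.\<close>

lemma codim_two_primitive:
  assumes N: "open N" and \<phi>: "\<And>k. holomorphic_fun A N (\<phi> k)"
    and dense: "\<And>V. open V \<Longrightarrow> V \<noteq> {} \<Longrightarrow> V \<subseteq> N \<Longrightarrow> \<exists>x\<in>V. \<exists>k. \<phi> k x \<noteq> 0"
    and Z: "Z \<inter> N = {x\<in>N. \<forall>k. \<phi> k x = 0}" and noreg: "\<And>q. \<not> regular_point A Z 1 q"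
  shows "primitive N \<phi>"
proof (rule primitiveI[OF N \<phi> dense])
  fix V \<psi> p assume V: "open V" "V \<subseteq> N" and \<psi>: "\<forall>k. holomorphic_fun A V (\<psi> k)"
      and p\<psi>: "\<forall>y\<in>V. \<forall>j k. \<psi> j y * \<phi> k y = \<psi> k y * \<phi> j y" and p: "p \<in> V"
  obtain N1 j0 where N1: "open N1" "p \<in> N1" "N1 \<subseteq> V" "\<And>U. open U \<Longrightarrow> U \<noteq> {} \<Longrightarrow> U \<subseteq> N1 \<Longrightarrow> \<exists>x\<in>U. \<phi> j0 x \<noteq> 0"
  proof (rule nonzero_dense_near[OF V(1) p holf_subset[OF \<phi> V(2)]])
    show "\<exists>x\<in>U. \<exists>j. \<phi> j x \<noteq> 0" if "open U" "p \<in> U" "U \<subseteq> V" for U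
      by (rule dense[OF that(1)]) (use that V(2) in auto)
  qed (rule that)
  obtain c where c: "c \<in> A" "p \<in> fst c" using chart_exists by blast
  have inv: "chart_inv c (snd c x) = x" if "x \<in> fst c" for x by (rule chart_inv_chart[OF c(1) that])
  have pre: "open {x\<in>fst c. snd c x \<in> U}" if "open U" for U by (rule open_chart_preimage[OF c(1) that])
  define S where "S = snd c ` (fst c \<inter> N1)"
  have oS: "open S" unfolding S_def by (rule open_chart_image[OF c(1) N1(1)])
  have pS: "snd c p \<in> S" using c(2) N1(2) by (auto simp: S_def)
  have S_iff: "x \<in> N1" if "x \<in> fst c" "snd c x \<in> S" for x
    using that inv unfolding S_def by (metis IntE imageE)
  have S_inv: "chart_inv c z \<in> fst c" "chart_inv c z \<in> N1" "snd c (chart_inv c z) = z" if "z \<in> S" for z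
    using that inv unfolding S_def by auto
  have N1N: "N1 \<subseteq> N" using N1(3) V(2) by blast
  define \<phi>' where "\<phi>' k z = \<phi> k (chart_inv c z)" for k z
  define \<psi>' where "\<psi>' k z = \<psi> k (chart_inv c z)" for k z
  have h\<phi>': "hol (\<phi>' k) S" for k unfolding \<phi>'_def S_def by (rule holf_hol[OF holf_subset[OF \<phi> N1N] N1(1) c(1)])
  have h\<psi>': "hol (\<psi>' k) S" for k unfolding \<psi>'_def S_def
    by (rule holf_hol[OF holf_subset[OF \<psi>[rule_format] N1(3)] N1(1) c(1)])
  have par: "\<psi>' j z * \<phi>' k z = \<psi>' k z * \<phi>' j z" if "z \<in> S" for z j k
    using p\<psi> S_inv(2)[OF that] N1(3) unfolding \<psi>'_def \<phi>'_def by blast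
  have pd: "\<exists>x\<in>U. \<phi>' j0 x \<noteq> 0" if U: "open U" "U \<noteq> {}" "U \<subseteq> S" for U
  proof -
    have "{x\<in>fst c. snd c x \<in> U} \<noteq> {}" using U(2,3) by (auto simp: S_def)
    moreover have "{x\<in>fst c. snd c x \<in> U} \<subseteq> N1" using U(3) S_iff by blast
    ultimately obtain x where x: "x \<in> fst c" "snd c x \<in> U" "\<phi> j0 x \<noteq> 0" using N1(4)[OF pre[OF U(1)]] by blast
    then show ?thesis by (intro bexI[of _ "snd c x"]) (simp_all add: \<phi>'_def inv)
  qed
  obtain \<rho> e where e: "0 < \<rho>" "\<And>t. cmod t \<le> \<rho> \<Longrightarrow> snd c p + t *s e \<in> S"
      "\<And>t. 0 < cmod t \<Longrightarrow> cmod t \<le> \<rho> \<Longrightarrow> \<phi>' j0 (snd c p + t *s e) \<noteq> 0"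
  proof (rule exists_nonzero_direction[OF oS h\<phi>' pS])
    show "\<exists>x\<in>U. \<phi>' j0 x \<noteq> 0" if "open U" "snd c p \<in> U" "U \<subseteq> S" for U
      by (rule pd[OF that(1) _ that(3)]) (use that(2) in blast)
  qed (rule that)
  obtain \<delta> where d: "\<delta> > 0" "\<And>y t. y \<in> ball (snd c p) \<delta> \<Longrightarrow> cmod t \<le> \<rho> \<Longrightarrow> y + t *s e \<in> S"
    "\<And>y t. y \<in> ball (snd c p) \<delta> \<Longrightarrow> \<rho> / 2 \<le> cmod t \<Longrightarrow> cmod t \<le> \<rho> \<Longrightarrow> \<phi>' j0 (y + t *s e) \<noteq> 0"
    by (rule line_box[OF oS h\<phi>' e]) (assumption+, rule that)
  let ?B = "ball (snd c p) \<delta>"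
  have dS: "y + t *s e \<in> S" if "y \<in> ?B" "t \<in> ball 0 \<rho>" for y t using d(2)[OF that(1), of t] that(2) by simp
  have BS: "?B \<subseteq> S"
  proof
    fix y assume "y \<in> ?B"
    then show "y \<in> S" using dS[of y 0] e(1) by simp
  qed
  define Z' where "Z' = {z\<in>S. \<forall>k. \<phi>' k z = 0}"
  have Z'o: "open (S - Z')"
  proof -
    have "S - Z' = (\<Union>k. {z\<in>S. \<phi>' k z \<noteq> 0})" by (auto simp: Z'_def)
    moreover have "open (\<Union>k. {z\<in>S. \<phi>' k z \<noteq> 0})" by (intro open_UN ballI open_nonzero[OF oS h\<phi>'])
    ultimately show ?thesis by simp
  qed
  have avoid: "\<exists>z\<in>U. \<forall>t\<in>ball 0 \<rho>. z + t *s e \<notin> Z'" if U: "open U" "U \<noteq> {}" "U \<subseteq> ?B" for U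
  proof (rule ccontr)
    assume no: "\<not> ?thesis"
    obtain q h U' where q: "open U'" "q \<in> U'" "U' \<subseteq> S" "q \<in> Z'" "hol h U'" "dirD e h q \<noteq> 0" "Z' \<inter> U' = {x\<in>U'. h x = 0}"
    proof (rule regular_point_on_lines[OF oS h\<phi>', of Z' j0 U "\<rho>/2" \<rho> e])
      show "Z' \<subseteq> S" by (auto simp: Z'_def)
      show "\<phi>' j0 x = 0" if "x \<in> Z'" for x using that by (simp add: Z'_def)
      show "0 < \<rho>/2" "\<rho>/2 < \<rho>" using e(1) by auto
      show "y + t *s e \<in> S" if "y \<in> U" "t \<in> ball 0 \<rho>" for y t using dS that U(3) by blast
      show "\<exists>t\<in>ball 0 \<rho>. \<phi>' j0 (y + t *s e) \<noteq> 0" if "y \<in> U" for y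
        using d(3)[of y "of_real (\<rho>/2)"] that U(3) e(1) by (intro bexI[of _ "of_real (\<rho>/2)"]) auto
      \<comment> \<open>Common zeros are zeros of \<open>\<phi>' j0\<close>, and on these discs
        those lie inside radius \<open>\<rho> / 2\<close>.\<close>
      show "\<exists>t\<in>cball 0 (\<rho>/2). y + t *s e \<in> Z'" if y: "y \<in> U" for y
      proof -
        obtain t where t: "t \<in> ball 0 \<rho>" "y + t *s e \<in> Z'" using no y by blast
        have "\<not> \<rho>/2 \<le> cmod t" using d(3)[of y t] t y U(3) by (auto simp: Z'_def)
        then show ?thesis using t(2) by (intro bexI[of _ t]) auto
      qed
    qed (use Z'o U that in auto)
    define x0 where "x0 = chart_inv c q"
    have qS: "q \<in> S" using q by blast
    have x0: "x0 \<in> fst c" "x0 \<in> N1" "snd c x0 = q" using S_inv[OF qS] by (simp_all add: x0_def)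
    define W where "W = {x\<in>fst c. snd c x \<in> U'}"
    have oW: "open W" unfolding W_def by (rule pre[OF q(1)])
    have WN: "W \<subseteq> N1" using q(3) S_iff by (auto simp: W_def)
    have Z'Z: "snd c x \<in> Z' \<longleftrightarrow> x \<in> Z" if x: "x \<in> W" for x
    proof -
      have xN: "x \<in> N" using x WN N1N by blast
      have "snd c x \<in> S" using x q(3) by (auto simp: W_def)
      then have "snd c x \<in> Z' \<longleftrightarrow> (\<forall>k. \<phi> k x = 0)" using inv[of x] x by (simp add: Z'_def \<phi>'_def W_def)
      also have "\<dots> \<longleftrightarrow> x \<in> Z" using Z xN by blast
      finally show ?thesis .
    qed
    have x0W: "x0 \<in> W" using x0 q(2) by (simp add: W_def)
    \<comment> \<open>The single equation is \<open>h\<close> read in the chart; its differential is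
      nonzero because its value on \<open>e\<close> is.\<close>
    have "regular_point A Z 1 x0"
      unfolding regular_point_def
    proof (intro conjI exI[of _ W] exI[of _ "\<lambda>_ x. h (snd c x)"] bexI[of _ c] allI impI)
      show "x0 \<in> Z" using Z'Z[OF x0W] x0(3) q(4) by simp
      show "open W" "x0 \<in> W" by (fact oW, fact x0W)
      show "holomorphic_fun A W (\<lambda>x. h (snd c x))"
        by (rule holf_from_chart[OF c(1) oW _ q(5,1)]) (auto simp: W_def)
      have "snd c x \<in> Z' \<longleftrightarrow> h (snd c x) = 0" if "x \<in> W" for x
        using q(7) that by (auto simp: W_def)
      then show "Z \<inter> W = {x\<in>W. \<forall>j<1::nat. h (snd c x) = 0}" using Z'Z by (auto dest: spec[of _ "0::nat"])
      show "c \<in> A" "x0 \<in> fst c" by (fact c(1), fact x0(1))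
      fix a :: "nat \<Rightarrow> complex" and j :: nat
      assume a: "\<forall>v. (\<Sum>j<1. a j * frechet_derivative (\<lambda>z. h (snd c (chart_inv c z))) (at (snd c x0)) v) = 0" and j: "j < 1"
      have "((\<lambda>z. h (snd c (chart_inv c z))) has_derivative (\<lambda>v. dirD v h q)) (at q)"
      proof (rule has_derivative_transform_within_open[OF hol_has_derivative[OF q(1,5,2)] q(1,2)])
        show "h z = h (snd c (chart_inv c z))" if "z \<in> U'" for z using S_inv(3)[of z] q(3) that by auto
      qed
      then have "frechet_derivative (\<lambda>z. h (snd c (chart_inv c z))) (at q) = (\<lambda>v. dirD v h q)"
        by (rule frechet_derivative_at[symmetric])
      then have "a 0 * dirD e h q = 0" using a[rule_format, of e] x0(3) by simp
      then show "a j = 0" using q(6) j by simp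
    qed
    then show False using noreg by blast
  qed
  have "\<exists>q. hol q ?B \<and> (\<forall>z\<in>?B. \<psi>' j0 z = q z * \<phi>' j0 z)"
  proof (rule division_along_lines[OF open_ball, of "\<rho>/2" \<rho> "\<psi>' j0" S "\<phi>' j0" "snd c p" \<delta> e])
    show "\<phi>' j0 (z + t *s e) \<noteq> 0" if "z \<in> ?B" "t \<in> sphere 0 (\<rho>/2)" for z t
      using d(3)[OF that(1), of t] that(2) e(1) by simp
    fix U assume U: "open U" "U \<noteq> {}" "U \<subseteq> ?B"
    obtain z where z: "z \<in> U" "\<forall>t\<in>ball 0 \<rho>. z + t *s e \<notin> Z'" using avoid[OF U] by blast
    have zB: "z \<in> ?B" using z(1) U(3) by blast
    have l: "(\<lambda>t. \<phi>' k (z + t *s e)) holomorphic_on ball 0 \<rho>" "(\<lambda>t. \<psi>' k (z + t *s e)) holomorphic_on ball 0 \<rho>" for k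
      using dS[OF zB] by (auto intro!: hol_line[OF h\<phi>'] hol_line[OF h\<psi>'])
    have "\<exists>g. g holomorphic_on ball 0 \<rho> \<and> (\<forall>t\<in>ball 0 \<rho>. \<psi>' j0 (z + t *s e) = g t * \<phi>' j0 (z + t *s e))"
    proof (rule divides_glue[of "ball 0 \<rho>" "\<lambda>t. \<phi>' j0 (z + t *s e)" "of_real (\<rho>/2)"])
      show "\<phi>' j0 (z + of_real (\<rho>/2) *s e) \<noteq> 0" using d(3)[OF zB, of "of_real (\<rho>/2)"] e(1) by simp
      show "of_real (\<rho>/2) \<in> ball (0::complex) \<rho>" using e(1) by simp
      fix \<alpha> assume a: "\<alpha> \<in> ball (0::complex) \<rho>"
      obtain k where k: "\<phi>' k (z + \<alpha> *s e) \<noteq> 0" using z(2) a dS[OF zB a] by (auto simp: Z'_def)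
      let ?M = "ball 0 \<rho> \<inter> (\<lambda>t. \<phi>' k (z + t *s e)) -` (-{0})"
      show "\<exists>M g. open M \<and> \<alpha> \<in> M \<and> M \<subseteq> ball 0 \<rho> \<and> g holomorphic_on M \<and> (\<forall>t\<in>M. \<psi>' j0 (z + t *s e) = g t * \<phi>' j0 (z + t *s e))"
      proof (intro exI conjI ballI)
        show "open ?M" by (rule continuous_open_preimage[OF holomorphic_on_imp_continuous_on[OF l(1)]]) auto
        show "\<alpha> \<in> ?M" using a k by simp
        show "(\<lambda>t. \<psi>' k (z + t *s e) / \<phi>' k (z + t *s e)) holomorphic_on ?M"
          by (intro holomorphic_intros holomorphic_on_subset[OF l(1)] holomorphic_on_subset[OF l(2)]) auto
        fix t assume t: "t \<in> ?M"
        then have "z + t *s e \<in> S" using dS[OF zB] by blast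
        from par[OF this, of j0 k] show "\<psi>' j0 (z + t *s e) = \<psi>' k (z + t *s e) / \<phi>' k (z + t *s e) * \<phi>' j0 (z + t *s e)"
          using t by (simp add: nonzero_eq_divide_eq)
      qed blast
    qed (use l in auto)
    then show "\<exists>z\<in>U. \<exists>g. g holomorphic_on ball 0 \<rho> \<and> (\<forall>t\<in>ball 0 \<rho>. \<psi>' j0 (z + t *s e) = g t * \<phi>' j0 (z + t *s e))"
      using z(1) by blast
  qed (use e(1) h\<phi>' h\<psi>' dS in auto)
  then obtain q where q: "hol q ?B" "\<And>z. z \<in> ?B \<Longrightarrow> \<psi>' j0 z = q z * \<phi>' j0 z" by blast
  have qk: "\<psi>' k z - q z * \<phi>' k z = 0" if z: "z \<in> ?B" for z k
  proof (rule hol_eq_zero_dense[OF open_ball _ _ z])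
    show "hol (\<lambda>z. \<psi>' k z - q z * \<phi>' k z) ?B"
      by (intro hol_diff hol_mult q(1) hol_subset[OF h\<phi>' BS] hol_subset[OF h\<psi>' BS])
    fix U assume U: "open U" "U \<noteq> {}" "U \<subseteq> ?B"
    then obtain y where y: "y \<in> U" "\<phi>' j0 y \<noteq> 0" using pd[of U] BS by blast
    have yB: "y \<in> ?B" using y U by blast
    have "\<phi>' j0 y * (\<psi>' k y - q y * \<phi>' k y) = \<psi>' k y * \<phi>' j0 y - (q y * \<phi>' j0 y) * \<phi>' k y" by (simp add: algebra_simps)
    also have "\<dots> = 0" using par[of y k j0] q(2)[OF yB] yB BS by auto
    finally show "\<exists>y\<in>U. \<psi>' k y - q y * \<phi>' k y = 0" using y by auto
  qed
  define M where "M = {x\<in>fst c. snd c x \<in> ?B}"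
  have oM: "open M" unfolding M_def by (rule pre) simp
  have MV: "M \<subseteq> V" 
  proof
    fix x assume "x \<in> M"
    then have "x \<in> fst c" "snd c x \<in> S" using BS unfolding M_def by blast+
    then show "x \<in> V" using S_iff N1(3) by blast
  qed
  have "holomorphic_fun A M (\<lambda>y. q (snd c y))"
    by (rule holf_from_chart[OF c(1) oM _ q(1)]) (auto simp: M_def)
  moreover have "\<psi> k y = q (snd c y) * \<phi> k y" if "y \<in> M" for y k
    using qk[of "snd c y" k] that inv[of y] by (simp add: M_def \<psi>'_def \<phi>'_def)
  moreover have "p \<in> M" using c(2) d(1) by (simp add: M_def)
  ultimately show "\<exists>W g. open W \<and> p \<in> W \<and> W \<subseteq> V \<and> holomorphic_fun A W g \<and> (\<forall>y\<in>W. \<forall>k. \<psi> k y = g y * \<phi> k y)"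
    using oM MV by (intro exI[of _ M] exI[of _ "\<lambda>y. q (snd c y)"]) simp
qed

text \<open>The two families divide each other, and the product of the multipliers is 1 wherever
  \<open>\<phi>\<close> is nonzero, hence everywhere.\<close>

lemma primitive_unit:
  assumes \<phi>: "primitive V \<phi>" and \<psi>: "primitive V \<psi>" and par: "\<And>y j k. y \<in> V \<Longrightarrow> \<psi> j y * \<phi> k y = \<psi> k y * \<phi> j y"
  shows "\<exists>g. holomorphic_fun A V g \<and> (\<forall>y\<in>V. g y \<noteq> 0) \<and> (\<forall>y\<in>V. \<forall>k. \<psi> k y = g y * \<phi> k y)"
proof -
  have V: "open V" by (rule primitive_holf(2)[OF \<phi>])
  obtain g where g: "holomorphic_fun A V g" "\<And>y k. y \<in> V \<Longrightarrow> \<psi> k y = g y * \<phi> k y"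
    by (rule primitive_divides[OF \<phi> V order_refl primitive_holf(1)[OF \<psi>] par]) (assumption, rule that)
  obtain g' where g': "holomorphic_fun A V g'" "\<And>y k. y \<in> V \<Longrightarrow> \<phi> k y = g' y * \<psi> k y"
    by (rule primitive_divides[OF \<psi> V order_refl, of \<phi>])
      (use primitive_holf(1)[OF \<phi>] par that in \<open>simp_all add: mult.commute\<close>)
  have "g' y * g y - 1 = 0" if y: "y \<in> V" for y
  proof (rule holf_zero_dense[OF V _ _ y])
    show "holomorphic_fun A V (\<lambda>y. g' y * g y - 1)" by (intro holf_diff holf_mult holf_const V g(1) g'(1))
    fix U assume U: "open U" "U \<noteq> {}" "U \<subseteq> V"
    then obtain x k where x: "x \<in> U" "\<phi> k x \<noteq> 0" using primitive_dense[OF \<phi> U] by blast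
    then have "x \<in> V" using U(3) by blast
    from g'(2)[OF this, of k] have "\<phi> k x = g' x * (g x * \<phi> k x)" unfolding g(2)[OF \<open>x \<in> V\<close>] .
    then have "(g' x * g x - 1) * \<phi> k x = 0" by (simp add: algebra_simps)
    then show "\<exists>x\<in>U. g' x * g x - 1 = 0" using x by auto
  qed
  then have "g y \<noteq> 0" if "y \<in> V" for y using that by force
  then show ?thesis using g by blast
qed

text \<open>For a change of frame of the ambient bundle: a family parallel to the transformed one is
  pulled back by \<open>T'\<close>, divided by \<open>\<phi>\<close>, and mapped forward again by
  \<open>T\<close>.\<close>

lemma primitive_transport:
  fixes \<phi> :: "'k::finite \<Rightarrow> 'a \<Rightarrow> complex" and T T' :: "'a \<Rightarrow> complex^'k^'k"
  assumes \<phi>: "primitive V \<phi>"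
    and T: "\<And>a b. holomorphic_fun A V (\<lambda>x. T x $ a $ b)" and T': "\<And>a b. holomorphic_fun A V (\<lambda>x. T' x $ a $ b)"
    and inv: "\<And>x. x \<in> V \<Longrightarrow> T x ** T' x = mat 1" "\<And>x. x \<in> V \<Longrightarrow> T' x ** T x = mat 1"
  shows "primitive V (\<lambda>k x. (T x *v (\<chi> q. \<phi> q x)) $ k)"
proof -
  have V: "open V" by (rule primitive_holf(2)[OF \<phi>])
  note h\<phi> = primitive_holf(1)[OF \<phi>]
  have T'T: "T' x *v (T x *v w) = w" if "x \<in> V" for x w
    using inv(2)[OF that] by (simp add: matrix_vector_mul_assoc)
  have TT': "T x *v (T' x *v w) = w" if "x \<in> V" for x w
    using inv(1)[OF that] by (simp add: matrix_vector_mul_assoc)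
  let ?\<phi> = "\<lambda>k x. (T x *v (\<chi> q. \<phi> q x)) $ k"
  show ?thesis
  proof (rule primitiveI[OF V])
    show "holomorphic_fun A V (?\<phi> k)" for k
      unfolding matrix_vector_mult_def vec_lambda_beta by (intro holf_sum holf_mult V T h\<phi>)
    show "\<exists>x\<in>U. \<exists>k. ?\<phi> k x \<noteq> 0" if U: "open U" "U \<noteq> {}" "U \<subseteq> V" for U
    proof -
      obtain x k where x: "x \<in> U" "\<phi> k x \<noteq> 0" using primitive_dense[OF \<phi> U] by blast
      have "T x *v (\<chi> q. \<phi> q x) \<noteq> 0"
      proof
        assume "T x *v (\<chi> q. \<phi> q x) = 0"
        then have "(\<chi> q. \<phi> q x) = T' x *v 0" using T'T[of x] x(1) U(3) by (metis subsetD)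
        then have "(\<chi> q. \<phi> q x) $ k = 0" by simp
        then show False using x(2) by simp
      qed
      then show ?thesis using x(1) by (auto simp: vec_eq_iff)
    qed
    fix U \<psi> p assume U: "open U" "U \<subseteq> V" and \<psi>: "\<forall>k. holomorphic_fun A U (\<psi> k)"
      and par: "\<forall>y\<in>U. \<forall>j k. \<psi> j y * ?\<phi> k y = \<psi> k y * ?\<phi> j y" and p: "p \<in> U"
    let ?\<psi> = "\<lambda>k x. (T' x *v (\<chi> q. \<psi> q x)) $ k"
    obtain g where g: "holomorphic_fun A U g" "\<And>y k. y \<in> U \<Longrightarrow> ?\<psi> k y = g y * \<phi> k y"
    proof (rule primitive_divides[OF \<phi> U, of ?\<psi>])
      show "holomorphic_fun A U (?\<psi> k)" for k
        unfolding matrix_vector_mult_def vec_lambda_beta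
        by (intro holf_sum holf_mult U holf_subset[OF T' U(2)] \<psi>[rule_format])
      fix y j k assume y: "y \<in> U"
      have \<phi>y: "\<phi> k y = (T' y *v (\<chi> q. ?\<phi> q y)) $ k" for k
      proof -
        have "(\<chi> q. ?\<phi> q y) = T y *v (\<chi> q. \<phi> q y)" by (simp add: vec_eq_iff)
        then show ?thesis using T'T[of y] y U(2) by auto
      qed
      have "(T' y *v (\<chi> q. \<psi> q y)) $ j * (T' y *v (\<chi> q. ?\<phi> q y)) $ k =
          (T' y *v (\<chi> q. \<psi> q y)) $ k * (T' y *v (\<chi> q. ?\<phi> q y)) $ j"
        by (rule matrix_vector_mult_parallel) (use par[rule_format, OF y] in simp)
      then show "?\<psi> j y * \<phi> k y = ?\<psi> k y * \<phi> j y" unfolding \<phi>y[symmetric] .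
    qed (rule that)
    have "\<psi> k y = g y * ?\<phi> k y" if y: "y \<in> U" for y k
    proof -
      have "T' y *v (\<chi> q. \<psi> q y) = g y *s (\<chi> q. \<phi> q y)" using g(2)[OF y] by (simp add: vec_eq_iff)
      then have "(\<chi> q. \<psi> q y) = T y *v (g y *s (\<chi> q. \<phi> q y))" using TT'[of y] y U(2) by (metis subsetD)
      also have "\<dots> = g y *s (T y *v (\<chi> q. \<phi> q y))" by (simp add: vector_scalar_commute)
      finally have "(\<chi> q. \<psi> q y) $ k = (g y *s (T y *v (\<chi> q. \<phi> q y))) $ k" by simp
      then show ?thesis by simp
    qed
    then show "\<exists>W g. open W \<and> p \<in> W \<and> W \<subseteq> U \<and> holomorphic_fun A W g \<and> (\<forall>y\<in>W. \<forall>k. \<psi> k y = g y * ?\<phi> k y)"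
      using U(1) p g(1) by blast
  qed
qed

text \<open>The interior of \<open>Z\<close> is also closed: near a point outside it one of the
  local equations is nonzero on a dense set, so a whole neighbourhood misses the interior.
  Connectedness then leaves only the empty set.\<close>

lemma locally_analytic_complement_dense:
  fixes f :: "'a \<Rightarrow> 'j \<Rightarrow> 'a \<Rightarrow> complex"
  assumes conn: "connected (UNIV :: 'a set)" and Z: "Z \<noteq> UNIV"
    and loc: "\<And>p. open (N p) \<and> p \<in> N p \<and> (\<forall>j. holomorphic_fun A (N p) (f p j)) \<and> Z \<inter> N p = {x\<in>N p. \<forall>j. f p j x = 0}"
    and V: "open V" "V \<noteq> {}"
  shows "\<exists>x\<in>V. x \<notin> Z"
proof -
  have "open (- interior Z)"
    unfolding open_subopen[of "- interior Z"]
  proof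
    fix p assume p: "p \<in> - interior Z"
    note l = loc[of p]
    obtain N1 j where N1: "open N1" "p \<in> N1" "N1 \<subseteq> N p" "\<And>V. open V \<Longrightarrow> V \<noteq> {} \<Longrightarrow> V \<subseteq> N1 \<Longrightarrow> \<exists>x\<in>V. f p j x \<noteq> 0"
    proof (rule nonzero_dense_near[of "N p" p "f p"])
      fix V assume V: "open V" "p \<in> V" "V \<subseteq> N p"
      then have "\<not> V \<subseteq> Z" using p interiorI by blast
      then show "\<exists>x\<in>V. \<exists>j. f p j x \<noteq> 0" using l V(3) by blast
    qed (use l that in auto)
    have "N1 \<inter> interior Z = {}"
    proof (rule ccontr)
      assume "N1 \<inter> interior Z \<noteq> {}"
      then obtain x where "x \<in> N1 \<inter> interior Z" "f p j x \<noteq> 0"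
        using N1(4)[of "N1 \<inter> interior Z"] N1(1) by blast
      then show False using l N1(3) interior_subset by blast
    qed
    then show "\<exists>T. open T \<and> p \<in> T \<and> T \<subseteq> - interior Z" using N1 by blast
  qed
  then have "closed (interior Z)" by (simp add: closed_def)
  then have "interior Z = {} \<or> interior Z = UNIV"
    using conn connected_clopen[of "UNIV :: 'a set"] by simp
  then have "interior Z = {}" using Z interior_subset by blast
  then show ?thesis using V interiorI by blast
qed

text \<open>The maximum principle on lines in a chart makes \<open>f\<close> constant near a point
  of maximal modulus; \<open>locally_analytic_complement_dense\<close>, applied to the level set,
  spreads this over the manifold.\<close>

lemma holomorphic_constant:
  assumes conn: "connected (UNIV :: 'a set)" and comp: "compact (UNIV :: 'a set)" and f: "holomorphic_fun A UNIV f"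
  shows "\<exists>t. \<forall>x. f x = t"
proof -
  have "continuous_on UNIV (\<lambda>x. cmod (f x))" by (intro continuous_intros holf_continuous[OF f]) simp
  then obtain p where p: "\<And>x. cmod (f x) \<le> cmod (f p)"
    using continuous_attains_sup[OF comp, of "\<lambda>x. cmod (f x)"] by auto
  obtain c \<delta> where c: "c \<in> A" "p \<in> fst c" "0 < \<delta>" "ball (snd c p) \<delta> \<subseteq> snd c ` (fst c \<inter> UNIV)"
    by (rule chart_ball[OF open_UNIV UNIV_I]) (rule that)
  let ?B = "ball (snd c p) \<delta>"
  have hf: "hol (\<lambda>z. f (chart_inv c z)) ?B" by (rule hol_subset[OF holf_hol[OF f open_UNIV c(1)] c(4)])
  have const: "f (chart_inv c z) = f p" if z: "z \<in> ?B" for z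
  proof -
    let ?T = "{t. snd c p + t *s (z - snd c p) \<in> ?B}"
    let ?g = "\<lambda>t. f (chart_inv c (snd c p + t *s (z - snd c p)))"
    have "?g holomorphic_on ?T" by (rule hol_line[OF hf]) simp
    moreover have T0: "0 \<in> ?T" using c(3) by simp
    moreover have g0: "?g 0 = f p" using chart_inv_chart[OF c(1,2)] by simp
    moreover have oT: "open ?T" by (rule open_line) simp
    moreover have "connected ?T" by (rule convex_connected[OF convex_line]) simp
    moreover have "cmod (?g t) \<le> cmod (?g 0)" for t unfolding g0 by (rule p)
    ultimately have "?g constant_on ?T"
      by (intro maximum_modulus_principle[of ?g ?T ?T 0]) (blast | assumption)+
    moreover have "1 \<in> ?T" using z by simp
    ultimately have "?g 1 = ?g 0" using T0 unfolding constant_on_def by metis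
    then show ?thesis using g0 by simp
  qed
  let ?V = "{x\<in>fst c. snd c x \<in> ?B}"
  have "\<exists>x\<in>?V. x \<notin> {x. f x = f p}" if "{x. f x = f p} \<noteq> UNIV"
  proof (rule locally_analytic_complement_dense[OF conn that, of "\<lambda>_. UNIV" "\<lambda>_ (_::unit) x. f x - f p"])
    show "open ?V" by (rule open_chart_preimage[OF c(1) open_ball])
    show "?V \<noteq> {}" using c by auto
  qed (auto intro: holf_diff[OF open_UNIV f holf_const[OF open_UNIV]])
  moreover have "f x = f p" if "x \<in> ?V" for x using const[of "snd c x"] chart_inv_chart[OF c(1), of x] that by auto
  ultimately have "{x. f x = f p} = UNIV" by blast
  then show ?thesis by blast
qed

end

section \<open>Trace-free co-Higgs bundles of rank two\<close>

lemma sum_UNIV_prod: "(\<Sum>m\<in>(UNIV :: ('b::finite \<times> 'c::finite) set). f m) = (\<Sum>a\<in>UNIV. \<Sum>b\<in>UNIV. f (a, b))"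
  by (simp add: sum.cartesian_product flip: UNIV_Times_UNIV)

text \<open>In the three free entries of trace-free matrices the commutator is, up to scaling its
  entries, a cross product: the entry (1,1) is a minor of the pair, and (1,2) and (2,1) are twice
  minors. The factor two is cancelled for \<open>r2\<close> and \<open>r3\<close>.\<close>

lemma tracefree_commuting_parallel:
  fixes M N :: "complex^2^2"
  assumes "trace M = 0" "trace N = 0" "M ** N = N ** M"
  shows "M $ a $ b * N $ c $ d = M $ c $ d * N $ a $ b"
proof -
  have t: "M $ 2 $ 2 = - (M $ 1 $ 1)" "N $ 2 $ 2 = - (N $ 1 $ 1)"
    using assms(1,2) by (simp_all add: trace_def sum_2 eq_neg_iff_add_eq_0 add.commute)
  have e: "(M ** N) $ i $ j = M $ i $ 1 * N $ 1 $ j + M $ i $ 2 * N $ 2 $ j"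
    "(N ** M) $ i $ j = N $ i $ 1 * M $ 1 $ j + N $ i $ 2 * M $ 2 $ j" for i j
    by (simp_all add: matrix_matrix_mult_def sum_2)
  have eq: "M $ i $ 1 * N $ 1 $ j + M $ i $ 2 * N $ 2 $ j = N $ i $ 1 * M $ 1 $ j + N $ i $ 2 * M $ 2 $ j" for i j
    using e[of i j] assms(3) by simp
  have r1: "M $ 1 $ 2 * N $ 2 $ 1 = M $ 2 $ 1 * N $ 1 $ 2" using eq[of 1 1] by (simp add: mult.commute)
  have "2 * (M $ 1 $ 1 * N $ 1 $ 2) = 2 * (M $ 1 $ 2 * N $ 1 $ 1)" using eq[of 1 2] by (simp add: t algebra_simps)
  then have r2: "M $ 1 $ 1 * N $ 1 $ 2 = M $ 1 $ 2 * N $ 1 $ 1" by simp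
  have "2 * (M $ 1 $ 1 * N $ 2 $ 1) = 2 * (M $ 2 $ 1 * N $ 1 $ 1)" using eq[of 2 1] by (simp add: t algebra_simps)
  then have r3: "M $ 1 $ 1 * N $ 2 $ 1 = M $ 2 $ 1 * N $ 1 $ 1" by simp
  show ?thesis
    using exhaust_2[of a] exhaust_2[of b] exhaust_2[of c] exhaust_2[of d] r1 r2 r3
    by (elim disjE) (simp_all add: t mult.commute)
qed

lemma H0_trans: "s \<in> H0 A V \<Longrightarrow> i \<in> vb_index V \<Longrightarrow> j \<in> vb_index V \<Longrightarrow> x \<in> vb_open V i \<Longrightarrow> x \<in> vb_open V j \<Longrightarrow>
    s i x = vb_trans V i j x *v s j x"
  and H0_holf: "s \<in> H0 A V \<Longrightarrow> i \<in> vb_index V \<Longrightarrow> holomorphic_fun A (vb_open V i) (\<lambda>x. s i x $ a)"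
  unfolding H0_def by blast+

lemma zero_set_iff:
  assumes "s \<in> H0 A V" "i \<in> vb_index V" "x \<in> vb_open V i"
  shows "x \<in> zero_set V s \<longleftrightarrow> s i x = 0"
proof
  show "s i x = 0" if "x \<in> zero_set V s" using that assms by (simp add: zero_set_def)
  assume z: "s i x = 0"
  show "x \<in> zero_set V s"
    unfolding zero_set_def
  proof (intro CollectI ballI impI)
    fix j assume "j \<in> vb_index V" "x \<in> vb_open V j"
    then have "s j x = vb_trans V j i x *v s i x" using H0_trans[OF assms(1) _ assms(2) _ assms(3)] by blast
    then show "s j x = 0" by (simp add: z)
  qed
qed

section \<open>Frame changes for endomorphisms and tangent vectors\<close>

locale vbundle_on = complex_mfd A for A :: "('a::t2_space, 'n::finite) chart set" +
  fixes E :: "('i, 'a, 'r::finite) vbundle"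
  assumes vb: "vector_bundle A E"
begin

lemma vb_cover: "\<exists>i\<in>vb_index E. p \<in> vb_open E i"
  and vb_open: "i \<in> vb_index E \<Longrightarrow> open (vb_open E i)"
  and vb_holf: "i \<in> vb_index E \<Longrightarrow> j \<in> vb_index E \<Longrightarrow> holomorphic_fun A (vb_open E i \<inter> vb_open E j) (\<lambda>x. vb_trans E i j x $ a $ b)"
  and vb_self: "i \<in> vb_index E \<Longrightarrow> x \<in> vb_open E i \<Longrightarrow> vb_trans E i i x = mat 1"
  and vb_cocycle: "i \<in> vb_index E \<Longrightarrow> j \<in> vb_index E \<Longrightarrow> k \<in> vb_index E \<Longrightarrow>
     x \<in> vb_open E i \<inter> vb_open E j \<inter> vb_open E k \<Longrightarrow> vb_trans E i j x ** vb_trans E j k x = vb_trans E i k x"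
  using vb unfolding vector_bundle_def by blast+

abbreviation T :: "'i \<Rightarrow> 'i \<Rightarrow> 'a \<Rightarrow> complex^('r \<times> 'r)^('r \<times> 'r)" where
  "T \<equiv> vb_trans (End_bundle E)"

lemma T_nth: "T i j x $ p $ q = vb_trans E i j x $ fst p $ fst q * vb_trans E j i x $ snd q $ snd p"
  by (simp add: End_bundle_def)

lemma T_holf:
  assumes "i \<in> vb_index E" "j \<in> vb_index E"
  shows "holomorphic_fun A (vb_open E i \<inter> vb_open E j) (\<lambda>x. T i j x $ p $ q)"
  unfolding T_nth
proof (rule holf_mult)
  show "open (vb_open E i \<inter> vb_open E j)" using vb_open assms by blast
  show "holomorphic_fun A (vb_open E i \<inter> vb_open E j) (\<lambda>x. vb_trans E j i x $ snd q $ snd p)"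
    using vb_holf[OF assms(2,1)] by (simp add: Int_commute)
qed (rule vb_holf[OF assms])

lemma T_cocycle:
  assumes "i \<in> vb_index E" "j \<in> vb_index E" "k \<in> vb_index E" "x \<in> vb_open E i" "x \<in> vb_open E j" "x \<in> vb_open E k"
  shows "T i j x ** T j k x = T i k x"
proof -
  let ?g = "vb_trans E"
  have c1: "?g i k x $ a $ b = (\<Sum>m\<in>UNIV. ?g i j x $ a $ m * ?g j k x $ m $ b)" for a b
    using vb_cocycle[of i j k x] assms by (simp add: matrix_matrix_mult_def vec_eq_iff)
  have c2: "?g k i x $ a $ b = (\<Sum>m\<in>UNIV. ?g k j x $ a $ m * ?g j i x $ m $ b)" for a b
    using vb_cocycle[of k j i x] assms by (simp add: matrix_matrix_mult_def vec_eq_iff)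
  have "(T i j x ** T j k x) $ p $ q = T i k x $ p $ q" for p q
  proof -
    have "(T i j x ** T j k x) $ p $ q = (\<Sum>m\<in>UNIV. T i j x $ p $ m * T j k x $ m $ q)"
      by (simp add: matrix_matrix_mult_def)
    also have "\<dots> = (\<Sum>a\<in>UNIV. \<Sum>b\<in>UNIV. (?g i j x $ fst p $ a * ?g j k x $ a $ fst q) * (?g k j x $ snd q $ b * ?g j i x $ b $ snd p))"
      unfolding sum_UNIV_prod T_nth fst_conv snd_conv by (intro sum.cong refl) (simp add: mult_ac)
    also have "\<dots> = T i k x $ p $ q" unfolding T_nth c1 c2 by (simp only: sum_product)
    finally show ?thesis .
  qed
  then show ?thesis by (simp add: vec_eq_iff)
qed

lemma T_self:
  assumes "i \<in> vb_index E" "x \<in> vb_open E i"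
  shows "T i i x = mat 1"
  using vb_self[OF assms] by (auto simp: vec_eq_iff T_nth mat_def prod_eq_iff)

text \<open>\<open>T\<close> is conjugation by a transition matrix, which does not change the
  trace.\<close>

lemma T_trace:
  assumes "i \<in> vb_index E" "j \<in> vb_index E" "x \<in> vb_open E i" "x \<in> vb_open E j"
  shows "(\<Sum>a\<in>UNIV. (T i j x *v w) $ (a, a)) = (\<Sum>a\<in>UNIV. w $ (a, a))"
proof -
  let ?g = "vb_trans E"
  have "?g j i x ** ?g i j x = mat 1" using vb_cocycle[of j i j x] vb_self[of j x] assms by simp
  then have c: "(\<Sum>a\<in>UNIV. ?g j i x $ d $ a * ?g i j x $ a $ c) = (if d = c then 1 else 0)" for c d
    by (simp add: matrix_matrix_mult_def vec_eq_iff mat_def)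
  have "(\<Sum>a\<in>UNIV. (T i j x *v w) $ (a, a)) = (\<Sum>a\<in>UNIV. \<Sum>c\<in>UNIV. \<Sum>d\<in>UNIV. (?g j i x $ d $ a * ?g i j x $ a $ c) * w $ (c, d))"
    unfolding matrix_vector_mult_def vec_lambda_beta sum_UNIV_prod T_nth fst_conv snd_conv
    by (intro sum.cong refl) (simp add: mult_ac)
  also have "\<dots> = (\<Sum>c\<in>UNIV. \<Sum>a\<in>UNIV. \<Sum>d\<in>UNIV. (?g j i x $ d $ a * ?g i j x $ a $ c) * w $ (c, d))" by (rule sum.swap)
  also have "\<dots> = (\<Sum>c\<in>UNIV. \<Sum>d\<in>UNIV. \<Sum>a\<in>UNIV. (?g j i x $ d $ a * ?g i j x $ a $ c) * w $ (c, d))"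
    by (intro sum.cong refl sum.swap)
  also have "\<dots> = (\<Sum>c\<in>UNIV. \<Sum>d\<in>UNIV. (if d = c then 1 else 0) * w $ (c, d))"
    by (simp only: sum_distrib_right[symmetric] c)
  also have "\<dots> = (\<Sum>c\<in>UNIV. w $ (c, c))" by (simp add: if_distrib if_distribR cong: if_cong)
  finally show ?thesis .
qed

abbreviation J :: "('a, 'n) chart \<Rightarrow> ('a, 'n) chart \<Rightarrow> 'a \<Rightarrow> complex^'n^'n" where
  "J \<equiv> vb_trans (tangent_bundle A)"

text \<open>The columns of the Jacobian are the derivatives of the coordinate change in the
  coordinate directions, and these are holomorphic by \<open>hol_dirD\<close>.\<close>

lemma J_holf:
  assumes c: "c \<in> A" and d: "d \<in> A"
  shows "holomorphic_fun A (fst c \<inter> fst d) (\<lambda>x. J c d x $ m $ k)"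
proof -
  let ?S = "snd d ` (fst d \<inter> fst c)"
  have oS: "open ?S" by (rule open_chart_image[OF d chart_open(1)[OF c]])
  have h: "hol (\<lambda>z. snd c (chart_inv d z) $ m) ?S" for m
  proof -
    have "holomorphic_Cn (\<lambda>z. snd c (chart_inv d z) $ m) ?S"
      using mfd c d unfolding complex_manifold_def by (simp add: Int_commute)
    then show ?thesis using holomorphic_Cn_iff_hol[OF oS] by blast
  qed
  have oN: "open (fst c \<inter> fst d)" using chart_open(1) c d by blast
  have "holomorphic_fun A (fst c \<inter> fst d) (\<lambda>x. dirD (axis k 1) (\<lambda>z. snd c (chart_inv d z) $ m) (snd d x))"
    by (rule holf_from_chart[OF d oN _ hol_dirD[OF oS h] oS]) auto
  then show ?thesis
  proof (rule holf_cong[OF oN])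
    fix x assume "x \<in> fst c \<inter> fst d"
    then have z: "snd d x \<in> ?S" by blast
    have "((\<lambda>z. snd c (chart_inv d z)) has_derivative (\<lambda>v. \<chi> m. dirD v (\<lambda>z. snd c (chart_inv d z) $ m) (snd d x))) (at (snd d x))"
      by (rule has_derivative_vec_componentwise[OF hol_has_derivative[OF oS h z]])
    from frechet_derivative_at[OF this, symmetric]
    show "dirD (axis k 1) (\<lambda>z. snd c (chart_inv d z) $ m) (snd d x) = J c d x $ m $ k"
      by (simp add: tangent_bundle_def jacobian_def matrix_def)
  qed
qed

lemma J_self:
  assumes c: "c \<in> A" and x: "x \<in> fst c"
  shows "J c c x = mat 1"
proof -
  have "((\<lambda>z. snd c (chart_inv c z)) has_derivative (\<lambda>v. v)) (at (snd c x))"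
  proof (rule has_derivative_transform_within_open[OF has_derivative_ident chart_open(2)[OF c]])
    show "z = snd c (chart_inv c z)" if "z \<in> snd c ` fst c" for z using chart_chart_inv[OF c that] by simp
  qed (use x in auto)
  from frechet_derivative_at[OF this, symmetric] show ?thesis
    by (simp add: tangent_bundle_def jacobian_def matrix_id_mat_1[unfolded id_def])
qed

end

section \<open>The co-Higgs field has rank at most one\<close>

locale tracefree_co_Higgs = vbundle_on A E
  for A :: "('a::t2_space, 'n::finite) chart set" and E :: "('i, 'a, 2) vbundle" +
  fixes \<Phi> :: "'i \<times> ('a, 'n) chart \<Rightarrow> 'a \<Rightarrow> complex^((2 \<times> 2) \<times> 'n)"
  assumes tf: "tracefree_co_Higgs_bundle A E \<Phi>"
begin

abbreviation ET where "ET \<equiv> tensor_bundle (End_bundle E) (tangent_bundle A)"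

lemma ET_simps: "vb_index ET = vb_index E \<times> A" "vb_open ET (i, c) = vb_open E i \<inter> fst c"
  "vb_trans ET (i, c) (j, d) x $ p $ q = T i j x $ fst p $ fst q * J c d x $ snd p $ snd q"
  by (simp_all add: tensor_bundle_def End_bundle_def tangent_bundle_def)

lemma \<Phi>_H0: "\<Phi> \<in> H0 A ET"
  using tf unfolding tracefree_co_Higgs_bundle_def co_Higgs_bundle_def by blast

lemma \<Phi>_holf: "i \<in> vb_index E \<Longrightarrow> c \<in> A \<Longrightarrow> holomorphic_fun A (vb_open E i \<inter> fst c) (\<lambda>x. \<Phi> (i, c) x $ p)"
  using H0_holf[OF \<Phi>_H0, of "(i, c)" p] by (simp add: ET_simps)

lemma \<Phi>_trans:
  assumes "i \<in> vb_index E" "c \<in> A" "j \<in> vb_index E" "d \<in> A" "x \<in> vb_open E i" "x \<in> fst c" "x \<in> vb_open E j" "x \<in> fst d"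
  shows "\<Phi> (i, c) x $ (p, m) = (\<Sum>k\<in>UNIV. J c d x $ m $ k * (T i j x *v (\<chi> q. \<Phi> (j, d) x $ (q, k))) $ p)"
proof -
  have "\<Phi> (i, c) x = vb_trans ET (i, c) (j, d) x *v \<Phi> (j, d) x"
    by (rule H0_trans[OF \<Phi>_H0]) (use assms in \<open>simp_all add: ET_simps(1,2)\<close>)
  then have "\<Phi> (i, c) x $ (p, m) = (\<Sum>q\<in>UNIV. \<Sum>k\<in>UNIV. T i j x $ p $ q * J c d x $ m $ k * \<Phi> (j, d) x $ (q, k))"
    unfolding matrix_vector_mult_def vec_lambda_beta
    by (subst (asm) sum_UNIV_prod) (simp add: ET_simps(3))
  also have "\<dots> = (\<Sum>k\<in>UNIV. \<Sum>q\<in>UNIV. T i j x $ p $ q * J c d x $ m $ k * \<Phi> (j, d) x $ (q, k))" by (rule sum.swap)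
  also have "\<dots> = (\<Sum>k\<in>UNIV. J c d x $ m $ k * (T i j x *v (\<chi> q. \<Phi> (j, d) x $ (q, k))) $ p)"
    unfolding matrix_vector_mult_def vec_lambda_beta sum_distrib_left
    by (intro sum.cong refl) (simp only: mult_ac)
  finally show ?thesis .
qed

lemma \<Phi>_trace: "i \<in> vb_index E \<Longrightarrow> c \<in> A \<Longrightarrow> x \<in> vb_open E i \<Longrightarrow> x \<in> fst c \<Longrightarrow> (\<Sum>a\<in>UNIV. \<Phi> (i, c) x $ ((a, a), m)) = 0"
proof -
  assume a: "i \<in> vb_index E" "c \<in> A" "x \<in> vb_open E i" "x \<in> fst c"
  have "\<forall>k\<in>vb_index ET. \<forall>x\<in>vb_open ET k. \<forall>m. trace (end_coeff (\<Phi> k x) m) = 0"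
    using tf unfolding tracefree_co_Higgs_bundle_def H0_tracefree_def by blast
  moreover have "(i, c) \<in> vb_index ET" "x \<in> vb_open ET (i, c)" using a by (simp_all add: ET_simps(1,2))
  ultimately have "trace (end_coeff (\<Phi> (i, c) x) m) = 0" by blast
  then show ?thesis by (simp add: trace_def end_coeff_def)
qed

text \<open>For equal arguments the wedge coefficient is twice the commutator of two component
  matrices, so these commute. By \<open>tracefree_commuting_parallel\<close>, \<open>\<Phi>\<close>
  viewed as a matrix with rows in \<open>End(E)\<close> and columns in the tangent directions has
  rank at most one.\<close>

lemma \<Phi>_parallel:
  assumes "i \<in> vb_index E" "c \<in> A" "x \<in> vb_open E i" "x \<in> fst c"
  shows "\<Phi> (i, c) x $ (p, m) * \<Phi> (i, c) x $ (q, k) = \<Phi> (i, c) x $ (q, m) * \<Phi> (i, c) x $ (p, k)"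
proof -
  let ?M = "\<lambda>k. end_coeff (\<Phi> (i, c) x) k"
  have tr: "trace (?M k) = 0" for k using \<Phi>_trace[OF assms, of k] by (simp add: trace_def end_coeff_def)
  have "wedge_coeff (\<Phi> (i, c) x) (\<Phi> (i, c) x) m k = 0"
    using tf assms unfolding tracefree_co_Higgs_bundle_def co_Higgs_bundle_def by blast
  then have w: "(?M m ** ?M k - ?M k ** ?M m) - (?M k ** ?M m - ?M m ** ?M k) = 0"
    by (simp add: wedge_coeff_def commutator_def)
  have "?M m ** ?M k = ?M k ** ?M m"
  proof -
    have "(?M m ** ?M k) $ a $ b = (?M k ** ?M m) $ a $ b" for a b
    proof -
      have "2 * ((?M m ** ?M k) $ a $ b - (?M k ** ?M m) $ a $ b) = ((?M m ** ?M k - ?M k ** ?M m) - (?M k ** ?M m - ?M m ** ?M k)) $ a $ b"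
        by simp
      also have "\<dots> = 0" unfolding w by simp
      finally show ?thesis by simp
    qed
    then show ?thesis by (simp add: vec_eq_iff)
  qed
  from tracefree_commuting_parallel[OF tr tr this, of "fst p" "snd p" "fst q" "snd q"]
  show ?thesis by (simp add: end_coeff_def)
qed

abbreviation Zr where "Zr \<equiv> zero_set ET \<Phi>"

lemma Zr_iff: "i \<in> vb_index E \<Longrightarrow> c \<in> A \<Longrightarrow> x \<in> vb_open E i \<Longrightarrow> x \<in> fst c \<Longrightarrow> x \<in> Zr \<longleftrightarrow> \<Phi> (i, c) x = 0"
  using zero_set_iff[OF \<Phi>_H0, of "(i, c)" x] by (simp add: ET_simps(1,2))

text \<open>In the new frames the columns of \<open>\<Phi>\<close> are combinations, with
  coefficients from \<open>J\<close>, of the old columns moved by \<open>T\<close>. Being parallel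
  to all columns is therefore independent of the frames.\<close>

lemma trans_parallel:
  assumes "i \<in> vb_index E" "c \<in> A" "j \<in> vb_index E" "d \<in> A" "x \<in> vb_open E i" "x \<in> fst c" "x \<in> vb_open E j" "x \<in> fst d"
    and par: "\<And>p q k. w $ p * \<Phi> (j, d) x $ (q, k) = w $ q * \<Phi> (j, d) x $ (p, k)"
  shows "(T i j x *v w) $ p * \<Phi> (i, c) x $ (q, m) = (T i j x *v w) $ q * \<Phi> (i, c) x $ (p, m)"
proof -
  have e: "(T i j x *v w) $ p * (T i j x *v (\<chi> q. \<Phi> (j, d) x $ (q, k))) $ q = (T i j x *v w) $ q * (T i j x *v (\<chi> q. \<Phi> (j, d) x $ (q, k))) $ p" for p q k
    by (rule matrix_vector_mult_parallel) (simp add: par)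
  have s: "(T i j x *v w) $ p * \<Phi> (i, c) x $ (q, m) = (\<Sum>k\<in>UNIV. J c d x $ m $ k * ((T i j x *v w) $ p * (T i j x *v (\<chi> q. \<Phi> (j, d) x $ (q, k))) $ q))" for p q
    unfolding \<Phi>_trans[OF assms(1-8)] sum_distrib_left by (intro sum.cong refl) (simp only: mult_ac)
  show ?thesis unfolding s by (simp only: e[of p _ q])
qed

text \<open>If \<open>\<Phi>\<close> vanishes near \<open>p\<close>, the zero family is chosen.
  Otherwise some entry with index \<open>(k0, m0)\<close> is nonzero on a dense set, and
  \<open>\<phi>\<close> is a primitive family parallel to the column \<open>m0\<close>. Trace zero
  and parallelism to all columns in all charts hold where that entry is nonzero, hence throughout
  \<open>N\<close>.\<close>

lemma local_data:
  obtains N i \<phi> where "open N" "p \<in> N" "i \<in> vb_index E" "N \<subseteq> vb_open E i" "\<And>k. holomorphic_fun A N (\<phi> k)"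
    "\<And>x. x \<in> N \<Longrightarrow> (\<Sum>a\<in>UNIV. \<phi> (a, a) x) = 0"
    "N \<subseteq> Zr \<and> (\<forall>x\<in>N. \<forall>k. \<phi> k x = 0) \<or>
     primitive N \<phi> \<and> (\<forall>c\<in>A. \<forall>x\<in>N \<inter> fst c. \<forall>p q m. \<phi> p x * \<Phi> (i, c) x $ (q, m) = \<phi> q x * \<Phi> (i, c) x $ (p, m)) \<and>
       (\<forall>V. open V \<longrightarrow> V \<noteq> {} \<longrightarrow> V \<subseteq> N \<longrightarrow> (\<exists>x\<in>V. x \<notin> Zr))"
proof -
  obtain i where i: "i \<in> vb_index E" "p \<in> vb_open E i" using vb_cover by blast
  obtain c where c: "c \<in> A" "p \<in> fst c" using chart_exists by blast
  let ?N0 = "vb_open E i \<inter> fst c"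
  have oN0: "open ?N0" using vb_open[OF i(1)] chart_open(1)[OF c(1)] by blast
  have pN0: "p \<in> ?N0" using i c by blast
  show ?thesis
  proof (cases "\<exists>V. open V \<and> p \<in> V \<and> V \<subseteq> ?N0 \<and> V \<subseteq> Zr")
    case True
    then obtain V where V: "open V" "p \<in> V" "V \<subseteq> ?N0" "V \<subseteq> Zr" by blast
    show ?thesis
      by (rule that[of V i "\<lambda>_ _. 0"]) (use V i holf_const[OF V(1)] in auto)
  next
    case False
    obtain N1 j where N1: "open N1" "p \<in> N1" "N1 \<subseteq> ?N0" and d1: "\<And>V. open V \<Longrightarrow> V \<noteq> {} \<Longrightarrow> V \<subseteq> N1 \<Longrightarrow> \<exists>x\<in>V. \<Phi> (i, c) x $ j \<noteq> 0"
    proof (rule nonzero_dense_near[OF oN0 pN0 \<Phi>_holf[OF i(1) c(1)]])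
      fix V assume V: "open V" "p \<in> V" "V \<subseteq> ?N0"
      then obtain x where x: "x \<in> V" "x \<notin> Zr" using False by blast
      then have "\<Phi> (i, c) x \<noteq> 0" using Zr_iff[OF i(1) c(1), of x] V(3) by blast
      then show "\<exists>x\<in>V. \<exists>j. \<Phi> (i, c) x $ j \<noteq> 0" using x(1) by (auto simp: vec_eq_iff)
    qed (rule that)
    obtain k0 m0 where j: "j = (k0, m0)" by (cases j)
    define v where "v k x = \<Phi> (i, c) x $ (k, m0)" for k x
    have vN: "holomorphic_fun A N1 (v k)" for k unfolding v_def by (rule holf_subset[OF \<Phi>_holf[OF i(1) c(1)] N1(3)])
    have dv: "\<exists>x\<in>V. v k0 x \<noteq> 0" if "open V" "V \<noteq> {}" "V \<subseteq> N1" for V using d1[OF that] by (simp add: v_def j)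
    obtain N \<phi> where N: "p \<in> N" "N \<subseteq> N1" and prim: "primitive N \<phi>" and par: "\<And>x i j. x \<in> N \<Longrightarrow> \<phi> i x * v j x = \<phi> j x * v i x"
      by (rule exists_primitive[OF N1(1,2), of v k0]) (use vN dv that in auto)
    note oN = primitive_holf(2)[OF prim]
    have NU: "N \<subseteq> vb_open E i" and Nc: "N \<subseteq> fst c" using N(2) N1(3) by blast+
    have zero: "f x = 0" if W: "open W" "W \<subseteq> N" "holomorphic_fun A W f" "\<And>x. x \<in> W \<Longrightarrow> v k0 x \<noteq> 0 \<Longrightarrow> f x = 0" "x \<in> W" for f W x
    proof (rule holf_zero_dense[OF W(1,3) _ W(5)])
      fix V assume V: "open V" "V \<noteq> {}" "V \<subseteq> W"
      then obtain y where "y \<in> V" "v k0 y \<noteq> 0" using dv[of V] W(2) N(2) by blast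
      then show "\<exists>x\<in>V. f x = 0" using W(4) V(3) by blast
    qed
    show ?thesis
    proof (rule that[OF oN N(1) i(1) NU primitive_holf(1)[OF prim]])
      show "(\<Sum>a\<in>UNIV. \<phi> (a, a) x) = 0" if x: "x \<in> N" for x
      proof (rule zero[OF oN order_refl _ _ x])
        show "holomorphic_fun A N (\<lambda>x. \<Sum>a\<in>UNIV. \<phi> (a, a) x)" by (intro holf_sum oN primitive_holf(1)[OF prim])
        fix x assume x: "x \<in> N" "v k0 x \<noteq> 0"
        have "(\<Sum>a\<in>UNIV. \<phi> (a, a) x) * v k0 x = (\<Sum>a\<in>UNIV. \<phi> k0 x * v (a, a) x)"
          unfolding sum_distrib_right by (intro sum.cong refl par x(1))
        also have "\<dots> = \<phi> k0 x * (\<Sum>a\<in>UNIV. v (a, a) x)" by (rule sum_distrib_left[symmetric])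
        also have "\<dots> = 0" using \<Phi>_trace[OF i(1) c(1), of x m0] x(1) NU Nc by (auto simp: v_def)
        finally show "(\<Sum>a\<in>UNIV. \<phi> (a, a) x) = 0" using x(2) by simp
      qed
      have "\<phi> p x * \<Phi> (i, d) x $ (q, m) - \<phi> q x * \<Phi> (i, d) x $ (p, m) = 0" if d: "d \<in> A" and x: "x \<in> N \<inter> fst d" for d x p q m
      proof -
        have o: "open (N \<inter> fst d)" using oN chart_open(1)[OF d] by blast
        have h: "holomorphic_fun A (N \<inter> fst d) (\<lambda>x. \<Phi> (i, d) x $ p)" for p
          by (rule holf_subset[OF \<Phi>_holf[OF i(1) d]]) (use NU in blast)
        show ?thesis
        proof (rule zero[OF o _ _ _ x])
          show "holomorphic_fun A (N \<inter> fst d) (\<lambda>x. \<phi> p x * \<Phi> (i, d) x $ (q, m) - \<phi> q x * \<Phi> (i, d) x $ (p, m))"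
            by (intro holf_diff holf_mult o h holf_subset[OF primitive_holf(1)[OF prim]]) auto
          fix x assume x: "x \<in> N \<inter> fst d" "v k0 x \<noteq> 0"
          have xi: "x \<in> vb_open E i" "x \<in> fst c" "x \<in> fst d" using x NU Nc by blast+
          have w: "v p x * \<Phi> (i, d) x $ (q, m) = v q x * \<Phi> (i, d) x $ (p, m)" for p q
            using trans_parallel[OF i(1) d i(1) c(1) xi(1,3) xi(1,2), of "\<chi> p. v p x"] \<Phi>_parallel[OF i(1) c(1) xi(1,2)]
            by (simp add: T_self[OF i(1) xi(1)] v_def)
          have xN: "x \<in> N" using x(1) by blast
          have "v k0 x * (\<phi> p x * \<Phi> (i, d) x $ (q, m) - \<phi> q x * \<Phi> (i, d) x $ (p, m)) =
            (\<phi> p x * v k0 x) * \<Phi> (i, d) x $ (q, m) - (\<phi> q x * v k0 x) * \<Phi> (i, d) x $ (p, m)" by (simp add: algebra_simps)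
          also have "\<dots> = \<phi> k0 x * (v p x * \<Phi> (i, d) x $ (q, m)) - \<phi> k0 x * (v q x * \<Phi> (i, d) x $ (p, m))"
            unfolding par[OF xN, of p k0] par[OF xN, of q k0] by (simp add: mult.assoc)
          also have "\<dots> = 0" by (simp add: w[of p q])
          finally show "\<phi> p x * \<Phi> (i, d) x $ (q, m) - \<phi> q x * \<Phi> (i, d) x $ (p, m) = 0" using x(2) by simp
        qed auto
      qed
      moreover have "\<exists>x\<in>V. x \<notin> Zr" if V: "open V" "V \<noteq> {}" "V \<subseteq> N" for V
      proof -
        obtain y where y: "y \<in> V" "v k0 y \<noteq> 0" using dv[of V] V N(2) by blast
        then have "\<Phi> (i, c) y \<noteq> 0" by (auto simp: v_def)
        then show ?thesis using y(1) Zr_iff[OF i(1) c(1), of y] V(3) NU Nc by blast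
      qed
      ultimately show "N \<subseteq> Zr \<and> (\<forall>x\<in>N. \<forall>k. \<phi> k x = 0) \<or>
        primitive N \<phi> \<and> (\<forall>c\<in>A. \<forall>x\<in>N \<inter> fst c. \<forall>p q m. \<phi> p x * \<Phi> (i, c) x $ (q, m) = \<phi> q x * \<Phi> (i, c) x $ (p, m)) \<and>
         (\<forall>V. open V \<longrightarrow> V \<noteq> {} \<longrightarrow> V \<subseteq> N \<longrightarrow> (\<exists>x\<in>V. x \<notin> Zr))"
        using prim by simp
    qed
  qed
qed

end

lemma matrix_vector_mult_prod_1:
  fixes M :: "complex^('k::finite \<times> 1)^('k \<times> 1)"
  shows "(M *v w) $ p = (\<Sum>q\<in>UNIV. M $ p $ (q, 1) * w $ (q, 1))"
  unfolding matrix_vector_mult_def vec_lambda_beta by (subst sum_UNIV_prod) simp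

section \<open>The line bundle and its two sections\<close>

context tracefree_co_Higgs begin

definition good :: "'a set \<Rightarrow> 'i \<Rightarrow> (2 \<times> 2 \<Rightarrow> 'a \<Rightarrow> complex) \<Rightarrow> bool" where
  "good N i \<phi> \<longleftrightarrow> open N \<and> i \<in> vb_index E \<and> N \<subseteq> vb_open E i \<and> (\<forall>k. holomorphic_fun A N (\<phi> k)) \<and>
    (\<forall>x\<in>N. (\<Sum>a\<in>UNIV. \<phi> (a, a) x) = 0) \<and>
    (N \<subseteq> Zr \<and> (\<forall>x\<in>N. \<forall>k. \<phi> k x = 0) \<or>
     primitive N \<phi> \<and> (\<forall>c\<in>A. \<forall>x\<in>N \<inter> fst c. \<forall>p q m. \<phi> p x * \<Phi> (i, c) x $ (q, m) = \<phi> q x * \<Phi> (i, c) x $ (p, m)) \<and>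
       (\<forall>V. open V \<longrightarrow> V \<noteq> {} \<longrightarrow> V \<subseteq> N \<longrightarrow> (\<exists>x\<in>V. x \<notin> Zr)))"

lemma exists_good: "\<exists>N i \<phi>. p \<in> N \<and> good N i \<phi>"
proof (rule local_data[of p])
  fix N i \<phi>
  assume a: "open N" "p \<in> N" "i \<in> vb_index E" "N \<subseteq> vb_open E i" and b: "\<And>k. holomorphic_fun A N (\<phi> k)"
    and c: "\<And>x. x \<in> N \<Longrightarrow> (\<Sum>a\<in>UNIV. \<phi> (a, a) x) = 0"
    and d: "N \<subseteq> Zr \<and> (\<forall>x\<in>N. \<forall>k. \<phi> k x = 0) \<or>
     primitive N \<phi> \<and> (\<forall>c\<in>A. \<forall>x\<in>N \<inter> fst c. \<forall>p q m. \<phi> p x * \<Phi> (i, c) x $ (q, m) = \<phi> q x * \<Phi> (i, c) x $ (p, m)) \<and>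
       (\<forall>V. open V \<longrightarrow> V \<noteq> {} \<longrightarrow> V \<subseteq> N \<longrightarrow> (\<exists>x\<in>V. x \<notin> Zr))"
  have "\<forall>k. holomorphic_fun A N (\<phi> k)" "\<forall>x\<in>N. (\<Sum>a\<in>UNIV. \<phi> (a, a) x) = 0" using b c by simp_all
  with a d have "good N i \<phi>" unfolding good_def by (intro conjI)
  then show ?thesis using a(2) by (intro exI conjI)
qed

lemma goodD:
  assumes "good N i \<phi>"
  shows "open N" "i \<in> vb_index E" "N \<subseteq> vb_open E i" "holomorphic_fun A N (\<phi> k)"
    "x \<in> N \<Longrightarrow> (\<Sum>a\<in>UNIV. \<phi> (a, a) x) = 0"
  using assms unfolding good_def by blast+

lemma good_zero:
  assumes "good N i \<phi>" "N \<subseteq> Zr" "x \<in> N"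
  shows "\<phi> k x = 0"
  using assms unfolding good_def by blast

lemma good_nonzero:
  assumes "good N i \<phi>" "\<not> N \<subseteq> Zr"
  shows "primitive N \<phi>"
    "c \<in> A \<Longrightarrow> x \<in> N \<Longrightarrow> x \<in> fst c \<Longrightarrow> \<phi> p x * \<Phi> (i, c) x $ (q, m) = \<phi> q x * \<Phi> (i, c) x $ (p, m)"
    "open V \<Longrightarrow> V \<noteq> {} \<Longrightarrow> V \<subseteq> N \<Longrightarrow> \<exists>x\<in>V. x \<notin> Zr"
  using assms unfolding good_def by blast+

text \<open>Trivial and primitive data never meet: otherwise their overlap, a nonempty open set,
  would contain a point outside \<open>Zr\<close>.\<close>

lemma good_Zr_overlap:
  assumes "good N i \<phi>" "good N' i' \<phi>'" "N \<inter> N' \<noteq> {}"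
  shows "N \<subseteq> Zr \<longleftrightarrow> N' \<subseteq> Zr"
proof -
  have *: "N' \<subseteq> Zr" if g: "good N i \<phi>" "good N' i' \<phi>'" "N \<inter> N' \<noteq> {}" "N \<subseteq> Zr" for N N' i i' \<phi> \<phi>'
  proof (rule ccontr)
    assume "\<not> N' \<subseteq> Zr"
    then have "\<exists>x\<in>N \<inter> N'. x \<notin> Zr"
      by (rule good_nonzero(3)[OF g(2)]) (use goodD(1)[OF g(1)] goodD(1)[OF g(2)] g(3) in auto)
    then show False using g(4) by blast
  qed
  show ?thesis using *[OF assms(1,2,3)] *[OF assms(2,1)] assms(3) by (auto simp: Int_commute)
qed

lemma T_vec:
  assumes "i \<in> vb_index E" "j \<in> vb_index E" "k \<in> vb_index E" "x \<in> vb_open E i" "x \<in> vb_open E j" "x \<in> vb_open E k"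
  shows "T i j x *v (T j k x *v w) = T i k x *v w"
  using T_cocycle[OF assms] by (simp add: matrix_vector_mul_assoc)

lemma T_self_vec: "i \<in> vb_index E \<Longrightarrow> x \<in> vb_open E i \<Longrightarrow> T i i x *v w = w"
  by (simp add: T_self)

text \<open>Where \<open>\<Phi>\<close> vanishes on \<open>N\<close>, the equation between the
  families reads \<open>0 = 0\<close> and leaves \<open>u\<close> free; fixing \<open>u = 1\<close>
  there makes the cocycle identity hold.\<close>

definition unit_rel where
  "unit_rel N i \<phi> N' i' \<phi>' u \<longleftrightarrow> holomorphic_fun A (N \<inter> N') u \<and>
     (\<forall>x\<in>N \<inter> N'. u x \<noteq> 0 \<and> (\<chi> p. \<phi> p x) = u x *s (T i i' x *v (\<chi> q. \<phi>' q x))) \<and>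
     (N \<subseteq> Zr \<longrightarrow> (\<forall>x\<in>N \<inter> N'. u x = 1))"

text \<open>On a dense set both families are parallel to a nonzero column of \<open>\<Phi>\<close>,
  hence to each other once they are in a common frame, and parallel primitive families differ by a
  unit.\<close>

lemma exists_unit:
  assumes g: "good N i \<phi>" and g': "good N' i' \<phi>'"
  shows "\<exists>u. unit_rel N i \<phi> N' i' \<phi>' u"
proof (cases "N \<inter> N' = {} \<or> N \<subseteq> Zr")
  case True
  have o: "open (N \<inter> N')" using goodD(1)[OF g] goodD(1)[OF g'] by blast
  have "(\<chi> p. \<phi> p x) = 1 *s (T i i' x *v (\<chi> q. \<phi>' q x))" if x: "x \<in> N \<inter> N'" for x
  proof -
    have N: "N \<subseteq> Zr" using True x by blast
    then have N': "N' \<subseteq> Zr" using good_Zr_overlap[OF g g'] x by blast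
    have "(\<chi> p. \<phi> p x) = 0" using good_zero[OF g N] x by (simp add: vec_eq_iff)
    moreover have "(\<chi> p. \<phi>' p x) = 0" using good_zero[OF g' N'] x by (simp add: vec_eq_iff)
    ultimately show ?thesis by simp
  qed
  then show ?thesis unfolding unit_rel_def by (intro exI[of _ "\<lambda>_. 1"]) (auto intro: holf_const[OF o])
next
  case False
  then have nz: "\<not> N \<subseteq> Zr" "\<not> N' \<subseteq> Zr" using good_Zr_overlap[OF g g'] by blast+
  let ?V = "N \<inter> N'"
  have o: "open ?V" using goodD(1)[OF g] goodD(1)[OF g'] by blast
  note i = goodD(2)[OF g] and i' = goodD(2)[OF g']
  have VU: "x \<in> vb_open E i" "x \<in> vb_open E i'" if "x \<in> ?V" for x using goodD(3)[OF g] goodD(3)[OF g'] that by blast+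
  have Vs: "?V \<subseteq> vb_open E i \<inter> vb_open E i'" "?V \<subseteq> vb_open E i' \<inter> vb_open E i" using VU by blast+
  let ?\<psi> = "\<lambda>k x. (T i i' x *v (\<chi> q. \<phi>' q x)) $ k"
  have p1: "primitive ?V \<phi>" by (rule primitive_subset[OF good_nonzero(1)[OF g nz(1)] o]) blast
  have p0: "primitive ?V \<phi>'" by (rule primitive_subset[OF good_nonzero(1)[OF g' nz(2)] o]) blast
  have p2: "primitive ?V ?\<psi>"
  proof (rule primitive_transport[OF p0, of "T i i'" "T i' i"])
    show "holomorphic_fun A ?V (\<lambda>x. T i i' x $ a $ b)" for a b by (rule holf_subset[OF T_holf[OF i i'] Vs(1)])
    show "holomorphic_fun A ?V (\<lambda>x. T i' i x $ a $ b)" for a b by (rule holf_subset[OF T_holf[OF i' i] Vs(2)])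
    show "T i i' x ** T i' i x = mat 1" "T i' i x ** T i i' x = mat 1" if "x \<in> ?V" for x
      using T_cocycle[of i i' i x] T_cocycle[of i' i i' x] T_self[of i x] T_self[of i' x] i i' VU[OF that] by simp_all
  qed
  have par: "\<phi> p x * ?\<psi> q x - \<phi> q x * ?\<psi> p x = 0" if x: "x \<in> ?V" for x p q
  proof (rule holf_zero_dense[OF o _ _ x])
    show "holomorphic_fun A ?V (\<lambda>x. \<phi> p x * ?\<psi> q x - \<phi> q x * ?\<psi> p x)"
      by (intro holf_diff holf_mult o primitive_holf(1)[OF p1] primitive_holf(1)[OF p2])
    fix W assume W: "open W" "W \<noteq> {}" "W \<subseteq> ?V"
    then obtain y where y: "y \<in> W" "y \<notin> Zr" using good_nonzero(3)[OF g nz(1), of W] by blast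
    have yV: "y \<in> ?V" using y(1) W(3) by blast
    obtain c where c: "c \<in> A" "y \<in> fst c" using chart_exists by blast
    have "\<Phi> (i, c) y \<noteq> 0" using Zr_iff[OF i c(1) VU(1)[OF yV] c(2)] y(2) by blast
    then obtain r m where w0: "\<Phi> (i, c) y $ (r, m) \<noteq> 0" by (auto simp: vec_eq_iff)
    let ?w = "\<lambda>p. \<Phi> (i, c) y $ (p, m)"
    have a: "\<phi> p y * ?w q = \<phi> q y * ?w p" for p q
      using good_nonzero(2)[OF g nz(1) c(1) _ c(2)] yV by blast
    have b: "?\<psi> p y * ?w q = ?\<psi> q y * ?w p" for p q
      by (rule trans_parallel[OF i c(1) i' c(1) VU(1)[OF yV] c(2) VU(2)[OF yV] c(2)])
        (use good_nonzero(2)[OF g' nz(2) c(1) _ c(2)] yV in simp)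
    have "(\<phi> p y * ?w r) * (?\<psi> q y * ?w r) = (\<phi> q y * ?w r) * (?\<psi> p y * ?w r)"
      unfolding a[of p r] a[of q r] b[of q r] b[of p r] by (simp add: mult_ac)
    then have "(?w r * ?w r) * (\<phi> p y * ?\<psi> q y - \<phi> q y * ?\<psi> p y) = 0" by (simp add: algebra_simps)
    then show "\<exists>x\<in>W. \<phi> p x * ?\<psi> q x - \<phi> q x * ?\<psi> p x = 0" using w0 y(1) by auto
  qed
  have "\<exists>u. holomorphic_fun A ?V u \<and> (\<forall>y\<in>?V. u y \<noteq> 0) \<and> (\<forall>y\<in>?V. \<forall>k. \<phi> k y = u y * ?\<psi> k y)"
    by (rule primitive_unit[OF p2 p1]) (use par in simp)
  then obtain u where "holomorphic_fun A ?V u" "\<forall>y\<in>?V. u y \<noteq> 0" "\<forall>y\<in>?V. \<forall>k. \<phi> k y = u y * ?\<psi> k y" by blast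
  then show ?thesis unfolding unit_rel_def using nz(1) by (intro exI[of _ u]) (simp add: vec_eq_iff)
qed

text \<open>As in \<open>unit_rel\<close>, the last clause fixes a value that the equation leaves
  free, so that the pieces of \<open>\<xi>\<close> fit together.\<close>

definition \<xi>_rel where
  "\<xi>_rel N i \<phi> c \<xi> \<longleftrightarrow> (\<forall>m. holomorphic_fun A (N \<inter> fst c) (\<xi> m)) \<and>
     (\<forall>x\<in>N \<inter> fst c. \<forall>p m. \<Phi> (i, c) x $ (p, m) = \<xi> m x * \<phi> p x) \<and>
     (N \<subseteq> Zr \<longrightarrow> (\<forall>x\<in>N \<inter> fst c. \<forall>m. \<xi> m x = 0))"

text \<open>Each column of \<open>\<Phi>\<close> is a family parallel to the primitive
  \<open>\<phi>\<close>, hence a multiple of it; the multipliers are the components of the vector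
  field.\<close>

lemma exists_\<xi>:
  assumes g: "good N i \<phi>" and c: "c \<in> A"
  shows "\<exists>\<xi>. \<xi>_rel N i \<phi> c \<xi>"
proof -
  let ?V = "N \<inter> fst c"
  have o: "open ?V" using goodD(1)[OF g] chart_open(1)[OF c] by blast
  note i = goodD(2)[OF g] and NU = goodD(3)[OF g]
  show ?thesis
  proof (cases "N \<subseteq> Zr")
    case True
    have "\<Phi> (i, c) x = 0" if "x \<in> ?V" for x using Zr_iff[OF i c] that True NU by blast
    then show ?thesis unfolding \<xi>_rel_def by (intro exI[of _ "\<lambda>_ _. 0"]) (auto intro: holf_const[OF o])
  next
    case False
    have "\<exists>f. holomorphic_fun A ?V f \<and> (\<forall>x\<in>?V. \<forall>p. \<Phi> (i, c) x $ (p, m) = f x * \<phi> p x)" for m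
    proof (rule primitive_divides[OF good_nonzero(1)[OF g False] o, of "\<lambda>p x. \<Phi> (i, c) x $ (p, m)"])
      show "holomorphic_fun A ?V (\<lambda>x. \<Phi> (i, c) x $ (p, m))" for p
        by (rule holf_subset[OF \<Phi>_holf[OF i c]]) (use NU in blast)
      show "\<Phi> (i, c) y $ (j, m) * \<phi> k y = \<Phi> (i, c) y $ (k, m) * \<phi> j y" if "y \<in> ?V" for y j k
        using good_nonzero(2)[OF g False c, of y k j m] that by (simp add: mult.commute)
    qed blast+
    then obtain f where "\<And>m. holomorphic_fun A ?V (f m)" "\<And>m. \<forall>x\<in>?V. \<forall>p. \<Phi> (i, c) x $ (p, m) = f m x * \<phi> p x" by metis
    then show ?thesis unfolding \<xi>_rel_def using False by (intro exI[of _ f]) blast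
  qed
qed

lemma \<xi>_relD: "\<xi>_rel N i \<phi> c \<xi> \<Longrightarrow> x \<in> N \<Longrightarrow> x \<in> fst c \<Longrightarrow> \<Phi> (i, c) x $ (p, m) = \<xi> m x * \<phi> p x"
  unfolding \<xi>_rel_def by blast

text \<open>The units between the chosen families are the transition functions of \<open>L\<close>.
  Compactness provides a finite cover, which is why natural numbers can index the frames.\<close>

theorem exists_decomposition:
  assumes comp: "compact (UNIV :: 'a set)"
  shows "\<exists>(L :: (nat, 'a, 1) vbundle) \<phi> \<xi>. decomposition A E \<Phi> L \<phi> \<xi>"
proof -
  obtain N0 i0 \<phi>0 where d0: "\<And>p. p \<in> N0 p" "\<And>p. good (N0 p) (i0 p) (\<phi>0 p)" using exists_good by metis
  have "(UNIV :: 'a set) \<subseteq> (\<Union>p\<in>UNIV. N0 p)" using d0(1) by blast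
  then obtain F where F: "finite F" "UNIV \<subseteq> (\<Union>p\<in>F. N0 p)"
    using compactE_image[OF comp, of UNIV N0] goodD(1)[OF d0(2)] by metis
  obtain h where h: "bij_betw h {0..<card F} F" using ex_bij_betw_nat_finite[OF F(1)] by blast
  define K where "K = card F"
  define N where "N k = N0 (h k)" for k
  define ii where "ii k = i0 (h k)" for k
  define ff where "ff k = \<phi>0 (h k)" for k
  define V where "V k x = (\<chi> p. ff k p x)" for k x
  have g: "good (N k) (ii k) (ff k)" for k unfolding N_def ii_def ff_def by (rule d0(2))
  have cov: "(\<Union>k\<in>{0..<K}. N k) = UNIV"
  proof -
    have "(\<Union>k\<in>{0..<K}. N k) = (\<Union>p\<in>h ` {0..<K}. N0 p)" by (simp add: N_def)
    also have "h ` {0..<K} = F" using h by (simp add: bij_betw_def K_def)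
    also have "(\<Union>p\<in>F. N0 p) = UNIV" by (rule subset_antisym[OF subset_UNIV F(2)])
    finally show ?thesis .
  qed
  define u where "u k l = (SOME u. unit_rel (N k) (ii k) (ff k) (N l) (ii l) (ff l) u)" for k l
  have ur: "unit_rel (N k) (ii k) (ff k) (N l) (ii l) (ff l) (u k l)" for k l
    unfolding u_def by (rule someI_ex[OF exists_unit[OF g g]])
  have uh: "holomorphic_fun A (N k \<inter> N l) (u k l)" for k l using ur unfolding unit_rel_def by blast
  have uV: "V k x = u k l x *s (T (ii k) (ii l) x *v V l x)" if "x \<in> N k" "x \<in> N l" for k l x
    using ur[of k l] that unfolding unit_rel_def V_def by blast
  have u1: "u k l x = 1" if "N k \<subseteq> Zr" "x \<in> N k" "x \<in> N l" for k l x using ur[of k l] that unfolding unit_rel_def by blast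
  define xi where "xi c k = (SOME \<xi>. \<xi>_rel (N k) (ii k) (ff k) c \<xi>)" for c k
  have xr: "\<xi>_rel (N k) (ii k) (ff k) c (xi c k)" if "c \<in> A" for c k
    unfolding xi_def by (rule someI_ex[OF exists_\<xi>[OF g that]])
  have xh: "holomorphic_fun A (N k \<inter> fst c) (xi c k m)" if "c \<in> A" for c k m using xr[OF that] unfolding \<xi>_rel_def by blast
  have x\<Phi>: "\<Phi> (ii k, c) x $ (p, m) = xi c k m x * V k x $ p" if "c \<in> A" "x \<in> N k" "x \<in> fst c" for c k x p m
    unfolding V_def vec_lambda_beta by (rule \<xi>_relD[OF xr[OF that(1)] that(2,3)])
  have x0: "xi c k m x = 0" if "N k \<subseteq> Zr" "c \<in> A" "x \<in> N k" "x \<in> fst c" for c k m x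
    using xr[OF that(2), of k] that unfolding \<xi>_rel_def by blast
  have oN: "open (N k)" and iE: "ii k \<in> vb_index E" and NU: "N k \<subseteq> vb_open E (ii k)" for k
    using goodD[OF g] by blast+
  have Vh: "holomorphic_fun A (N k) (\<lambda>x. V k x $ p)" for k p using goodD(4)[OF g] by (simp add: V_def)
  have Vdense: "\<exists>x\<in>W. \<exists>p. V k x $ p \<noteq> 0" if "\<not> N k \<subseteq> Zr" "open W" "W \<noteq> {}" "W \<subseteq> N k" for k W
    using primitive_dense[OF good_nonzero(1)[OF g that(1)] that(2-4)] by (simp add: V_def)
  \<comment> \<open>Two expressions for \<open>V k\<close> in terms of \<open>V m\<close> are
    compared at points where \<open>V k\<close> is nonzero. These are dense unless
    \<open>N k \<subseteq> Zr\<close>, in which case all the units are 1.\<close>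
  have uu: "u k l x * u l m x - u k m x = 0" if x: "x \<in> N k \<inter> N l \<inter> N m" for k l m x
  proof (cases "N k \<subseteq> Zr")
    case True
    then have "N l \<subseteq> Zr" using good_Zr_overlap[OF g g, of k l] x by blast
    then show ?thesis using True u1 x by simp
  next
    case False
    let ?W = "N k \<inter> N l \<inter> N m"
    have oW: "open ?W" using oN by blast
    show ?thesis
    proof (rule holf_zero_dense[OF oW _ _ x])
      show "holomorphic_fun A ?W (\<lambda>x. u k l x * u l m x - u k m x)"
        by (intro holf_diff holf_mult oW holf_subset[OF uh]) auto
      fix W assume W: "open W" "W \<noteq> {}" "W \<subseteq> ?W"
      then obtain y p where y: "y \<in> W" "V k y $ p \<noteq> 0" using Vdense[OF False W(1,2)] by blast
      have yN: "y \<in> N k" "y \<in> N l" "y \<in> N m" using y(1) W(3) by blast+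
      let ?w = "T (ii k) (ii m) y *v V m y"
      have "V k y = u k l y *s (T (ii k) (ii l) y *v (u l m y *s (T (ii l) (ii m) y *v V m y)))"
        using uV[of y k l] uV[of y l m] yN by simp
      also have "\<dots> = (u k l y * u l m y) *s ?w"
        using T_vec[OF iE iE iE, of y k l m "V m y"] NU yN by (simp add: vector_scalar_commute subset_iff)
      finally have "V k y = (u k l y * u l m y) *s ?w" .
      note e = trans[OF sym[OF this] uV[OF yN(1,3)]]
      from arg_cong[OF e, of "\<lambda>w. w $ p"] have "(u k l y * u l m y) * ?w $ p = u k m y * ?w $ p"
        by (simp only: vector_smult_component)
      moreover have "?w $ p \<noteq> 0" using y(2) uV[of y k m] yN by auto
      ultimately have "u k l y * u l m y - u k m y = 0" by simp
      then show "\<exists>x\<in>W. u k l x * u l m x - u k m x = 0" using y(1) by blast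
    qed
  qed
  have unz: "u k l x \<noteq> 0" if "x \<in> N k" "x \<in> N l" for k l x using ur[of k l] that unfolding unit_rel_def by blast
  \<comment> \<open>\<open>u k k\<close> equals its own square and is nonzero.\<close>
  have ukk: "u k k x = 1" if "x \<in> N k" for k x using uu[of x k k k] unz[of x k k] that by simp
  have ulk: "u l k x * u k l x = 1" if "x \<in> N k" "x \<in> N l" for k l x
    using uu[of x l k l] ukk[of x l] that by simp
  define L :: "(nat, 'a, 1) vbundle" where
    "L = \<lparr>vb_index = {0..<K}, vb_open = N, vb_trans = (\<lambda>k l x. \<chi> a b. u k l x)\<rparr>"
  have Ls: "vb_index L = {0..<K}" "vb_open L = N" "vb_trans L k l x $ a $ b = u k l x" for k l x a b by (simp_all add: L_def)
  have vL: "vector_bundle A L"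
    unfolding vector_bundle_def Ls
  proof (intro conjI ballI allI)
    show "\<Union> (N ` {0..<K}) = UNIV" by (rule cov)
    show "open (N k)" for k by (rule oN)
    show "holomorphic_fun A (N k \<inter> N l) (u k l)" for k l by (rule uh)
    show "vb_trans L k k x = mat 1" if "x \<in> N k" for k x
      using ukk[OF that] by (simp add: vec_eq_iff Ls mat_def)
    show "vb_trans L k l x ** vb_trans L l m x = vb_trans L k m x" if "x \<in> N k \<inter> N l \<inter> N m" for k l m x
      using uu[OF that] by (simp add: vec_eq_iff Ls matrix_matrix_mult_def)
  qed
  \<comment> \<open>Each \<open>V k\<close> is given in its own frame \<open>ii k\<close> of
    \<open>E\<close>; its transform to the frame \<open>i\<close> is the local expression of the
    section.\<close>
  define \<phi> :: "'i \<times> nat \<Rightarrow> 'a \<Rightarrow> complex^((2 \<times> 2) \<times> 1)" where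
    "\<phi> = (\<lambda>(i, k) x. \<chi> p. (T i (ii k) x *v V k x) $ fst p)"
  define \<xi> :: "('a, 'n) chart \<times> nat \<Rightarrow> 'a \<Rightarrow> complex^('n \<times> 1)" where
    "\<xi> = (\<lambda>(c, k) x. \<chi> p. xi c k (fst p) x)"
  let ?EL = "tensor_bundle (End_bundle E) L"
  have EL: "vb_index ?EL = vb_index E \<times> {0..<K}" "vb_open ?EL (i, k) = vb_open E i \<inter> N k"
    "vb_trans ?EL (i, k) (j, l) x $ p $ q = T i j x $ fst p $ fst q * u k l x" for i j k l x p q
    by (simp_all add: tensor_bundle_def End_bundle_def Ls)
  have \<phi>H: "\<phi> \<in> H0 A ?EL"
    unfolding H0_def EL(1)
  proof (rule CollectI, intro conjI ballI allI)
    fix s and p :: "(2 \<times> 2) \<times> 1" assume "s \<in> vb_index E \<times> {0..<K}"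
    then obtain i k where s: "s = (i, k)" and i: "i \<in> vb_index E" by auto
    have o: "open (vb_open E i \<inter> N k)" using vb_open[OF i] oN by blast
    have "holomorphic_fun A (vb_open E i \<inter> N k) (\<lambda>x. (T i (ii k) x *v V k x) $ fst p)"
      unfolding matrix_vector_mult_def vec_lambda_beta
      by (intro holf_sum holf_mult o holf_subset[OF T_holf[OF i iE]] holf_subset[OF Vh]) (use NU in auto)
    then show "holomorphic_fun A (vb_open ?EL s) (\<lambda>x. \<phi> s x $ p)" by (simp add: s EL \<phi>_def)
  next
    fix s t x assume "s \<in> vb_index E \<times> {0..<K}" "t \<in> vb_index E \<times> {0..<K}" and x: "x \<in> vb_open ?EL s \<inter> vb_open ?EL t"
    then obtain i k j l where s: "s = (i, k)" "t = (j, l)" and ij: "i \<in> vb_index E" "j \<in> vb_index E" by auto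
    have xs: "x \<in> vb_open E i" "x \<in> vb_open E j" "x \<in> N k" "x \<in> N l" using x by (auto simp: s EL)
    have xk: "x \<in> vb_open E (ii k)" "x \<in> vb_open E (ii l)" using xs NU by blast+
    have "\<phi> s x $ p = (vb_trans ?EL s t x *v \<phi> t x) $ p" for p
    proof -
      have "(vb_trans ?EL s t x *v \<phi> t x) $ p = (\<Sum>q\<in>UNIV. T i j x $ fst p $ q * u k l x * (T j (ii l) x *v V l x) $ q)"
        unfolding matrix_vector_mult_prod_1 s EL(3) by (simp add: \<phi>_def)
      also have "\<dots> = (\<Sum>q\<in>UNIV. u k l x * (T i j x $ fst p $ q * (T j (ii l) x *v V l x) $ q))"
        by (intro sum.cong refl) (simp add: mult_ac)
      also have "\<dots> = u k l x * (T i j x *v (T j (ii l) x *v V l x)) $ fst p"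
        unfolding sum_distrib_left[symmetric] by (simp add: matrix_vector_mult_def[of "T i j x"])
      also have "\<dots> = u k l x * (T i (ii l) x *v V l x) $ fst p" using T_vec[OF ij iE xs(1,2) xk(2)] by simp
      also have "T i (ii l) x *v V l x = T i (ii k) x *v (T (ii k) (ii l) x *v V l x)" by (rule T_vec[OF ij(1) iE iE xs(1) xk, symmetric])
      also have "u k l x * (T i (ii k) x *v (T (ii k) (ii l) x *v V l x)) $ fst p = (T i (ii k) x *v V k x) $ fst p"
        unfolding uV[OF xs(3,4)] by (simp add: vector_scalar_commute)
      finally show ?thesis by (simp add: s \<phi>_def)
    qed
    then show "\<phi> s x = vb_trans ?EL s t x *v \<phi> t x" by (simp add: vec_eq_iff)
  qed
  have \<phi>T: "\<phi> \<in> H0_tracefree A ?EL"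
    unfolding H0_tracefree_def EL(1)
  proof (rule CollectI, intro conjI ballI allI)
    show "\<phi> \<in> H0 A ?EL" by (rule \<phi>H)
    fix s x m assume "s \<in> vb_index E \<times> {0..<K}" and x: "x \<in> vb_open ?EL s"
    then obtain i k where s: "s = (i, k)" and i: "i \<in> vb_index E" by auto
    have xs: "x \<in> vb_open E i" "x \<in> N k" using x by (auto simp: s EL)
    have xk: "x \<in> vb_open E (ii k)" using xs NU by blast
    have "trace (end_coeff (\<phi> s x) m) = (\<Sum>a\<in>UNIV. (T i (ii k) x *v V k x) $ (a, a))"
      by (simp add: trace_def end_coeff_def s \<phi>_def)
    also have "\<dots> = (\<Sum>a\<in>UNIV. V k x $ (a, a))" by (rule T_trace[OF i iE xs(1) xk])
    also have "\<dots> = 0" using goodD(5)[OF g xs(2)] by (simp add: V_def)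
    finally show "trace (end_coeff (\<phi> s x) m) = 0" .
  qed
  let ?TL = "tensor_bundle (tangent_bundle A) (dual_bundle L)"
  have TL: "vb_index ?TL = A \<times> {0..<K}" "vb_open ?TL (c, k) = fst c \<inter> N k"
    "vb_trans ?TL (c, k) (d, l) x $ p $ q = J c d x $ fst p $ fst q * u l k x" for c d k l x p q
    by (simp_all add: tensor_bundle_def tangent_bundle_def dual_bundle_def Ls transpose_def)
  \<comment> \<open>The factor is \<open>u l k\<close> rather than \<open>u k l\<close> because
    \<open>\<xi>\<close> takes values in the dual of \<open>L\<close>. It results from comparing
    \<open>\<Phi>\<close> in two frames and cancelling a nonzero component of
    \<open>V k\<close>.\<close>
  have key: "xi c k m x - u l k x * (\<Sum>n\<in>UNIV. J c d x $ m $ n * xi d l n x) = 0"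
    if c: "c \<in> A" and d: "d \<in> A" and x: "x \<in> N k \<inter> N l \<inter> (fst c \<inter> fst d)" for c d k l m x
  proof (cases "N k \<subseteq> Zr")
    case True
    then have "N l \<subseteq> Zr" using good_Zr_overlap[OF g g, of k l] x by blast
    then show ?thesis using True x0 c d x by simp
  next
    case False
    let ?W = "N k \<inter> N l \<inter> (fst c \<inter> fst d)"
    have oW: "open ?W" using oN chart_open(1) c d by blast
    show ?thesis
    proof (rule holf_zero_dense[OF oW _ _ x])
      show "holomorphic_fun A ?W (\<lambda>x. xi c k m x - u l k x * (\<Sum>n\<in>UNIV. J c d x $ m $ n * xi d l n x))"
        by (intro holf_diff holf_mult holf_sum oW holf_subset[OF uh] holf_subset[OF xh[OF c]] holf_subset[OF xh[OF d]] holf_subset[OF J_holf[OF c d]]) auto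
      fix W assume W: "open W" "W \<noteq> {}" "W \<subseteq> ?W"
      then obtain y p where y: "y \<in> W" "V k y $ p \<noteq> 0" using Vdense[OF False W(1,2)] by blast
      have yN: "y \<in> N k" "y \<in> N l" "y \<in> fst c" "y \<in> fst d" using y(1) W(3) by blast+
      have yk: "y \<in> vb_open E (ii k)" "y \<in> vb_open E (ii l)" using yN NU by blast+
      let ?t = "(T (ii k) (ii l) y *v V l y) $ p"
      have Tl: "(\<chi> q. \<Phi> (ii l, d) y $ (q, n)) = xi d l n y *s V l y" for n
        using x\<Phi>[OF d yN(2,4)] by (simp add: vec_eq_iff)
      have "xi c k m y * V k y $ p = \<Phi> (ii k, c) y $ (p, m)" using x\<Phi>[OF c yN(1,3)] by simp
      also have "\<dots> = (\<Sum>n\<in>UNIV. J c d y $ m $ n * (T (ii k) (ii l) y *v (\<chi> q. \<Phi> (ii l, d) y $ (q, n))) $ p)"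
        by (rule \<Phi>_trans[OF iE c iE d yk(1) yN(3) yk(2) yN(4)])
      also have "\<dots> = (\<Sum>n\<in>UNIV. J c d y $ m $ n * xi d l n y) * ?t"
        unfolding Tl sum_distrib_right by (intro sum.cong refl) (simp add: vector_scalar_commute mult_ac)
      also have "?t = u l k y * V k y $ p"
      proof -
        have "V k y $ p = u k l y * ?t" using uV[OF yN(1,2)] by simp
        then have "u l k y * V k y $ p = (u l k y * u k l y) * ?t" by simp
        then show ?thesis using ulk[OF yN(1,2)] by simp
      qed
      finally have "(xi c k m y - u l k y * (\<Sum>n\<in>UNIV. J c d y $ m $ n * xi d l n y)) * V k y $ p = 0"
        by (simp add: algebra_simps)
      then have "xi c k m y - u l k y * (\<Sum>n\<in>UNIV. J c d y $ m $ n * xi d l n y) = 0" using y(2) by simp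
      then show "\<exists>x\<in>W. xi c k m x - u l k x * (\<Sum>n\<in>UNIV. J c d x $ m $ n * xi d l n x) = 0" using y(1) by blast
    qed
  qed
  have \<xi>H: "\<xi> \<in> H0 A ?TL"
    unfolding H0_def TL(1)
  proof (rule CollectI, intro conjI ballI allI)
    fix s and p :: "'n \<times> 1" assume "s \<in> A \<times> {0..<K}"
    then obtain c k where s: "s = (c, k)" and c: "c \<in> A" by (cases s) blast
    show "holomorphic_fun A (vb_open ?TL s) (\<lambda>x. \<xi> s x $ p)" using xh[OF c, of k "fst p"] by (simp add: s TL \<xi>_def Int_commute)
  next
    fix s t x assume "s \<in> A \<times> {0..<K}" "t \<in> A \<times> {0..<K}" and x: "x \<in> vb_open ?TL s \<inter> vb_open ?TL t"
    then obtain c k d l where s: "s = (c, k)" "t = (d, l)" and cd: "c \<in> A" "d \<in> A" by (cases s; cases t) blast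
    have xs: "x \<in> N k \<inter> N l \<inter> (fst c \<inter> fst d)" using x unfolding s TL by blast
    have "\<xi> s x $ p = (vb_trans ?TL s t x *v \<xi> t x) $ p" for p
    proof -
      have "(vb_trans ?TL s t x *v \<xi> t x) $ p = (\<Sum>n\<in>UNIV. J c d x $ fst p $ n * u l k x * xi d l n x)"
        unfolding matrix_vector_mult_prod_1 s TL(3) by (simp add: \<xi>_def)
      also have "\<dots> = u l k x * (\<Sum>n\<in>UNIV. J c d x $ fst p $ n * xi d l n x)"
        unfolding sum_distrib_left by (intro sum.cong refl) (simp add: mult_ac)
      finally show ?thesis using key[OF cd xs, of "fst p"] by (simp add: s \<xi>_def)
    qed
    then show "\<xi> s x = vb_trans ?TL s t x *v \<xi> t x" by (simp add: vec_eq_iff)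
  qed
  have "\<Phi> (i, c) x = contract_tensor (\<phi> (i, k) x) (\<xi> (c, k) x)"
    if i: "i \<in> vb_index E" and c: "c \<in> A" and x: "x \<in> vb_open E i" "x \<in> fst c" "x \<in> N k" for i c k x
  proof -
    have xk: "x \<in> vb_open E (ii k)" using x NU by blast
    have Tk: "(\<chi> q. \<Phi> (ii k, c) x $ (q, n)) = xi c k n x *s V k x" for n
      using x\<Phi>[OF c x(3,2)] by (simp add: vec_eq_iff)
    have "\<Phi> (i, c) x $ (p, m) = contract_tensor (\<phi> (i, k) x) (\<xi> (c, k) x) $ (p, m)" for p m
    proof -
      \<comment> \<open>Only the frame of \<open>E\<close> changes here; the chart stays, so the
        Jacobian is the identity.\<close>
      have "\<Phi> (i, c) x $ (p, m) = (\<Sum>n\<in>UNIV. J c c x $ m $ n * (T i (ii k) x *v (\<chi> q. \<Phi> (ii k, c) x $ (q, n))) $ p)"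
        by (rule \<Phi>_trans[OF i c iE c x(1,2) xk x(2)])
      also have "\<dots> = (T i (ii k) x *v (\<chi> q. \<Phi> (ii k, c) x $ (q, m))) $ p"
        by (simp add: J_self[OF c x(2)] mat_def mult_delta_left)
      also have "\<dots> = xi c k m x * (T i (ii k) x *v V k x) $ p" unfolding Tk by (simp add: vector_scalar_commute)
      finally show ?thesis by (simp add: contract_tensor_def \<phi>_def \<xi>_def mult.commute)
    qed
    then show ?thesis by (simp add: vec_eq_iff split_paired_All)
  qed
  then have "decomposition A E \<Phi> L \<phi> \<xi>"
    unfolding decomposition_def Ls using vL \<phi>T \<xi>H by blast
  then show ?thesis by blast
qed

end

section \<open>Uniqueness of the decomposition\<close>

context tracefree_co_Higgs begin

lemma Zr_complement_dense:
  assumes conn: "connected (UNIV :: 'a set)" and Z: "Zr \<noteq> UNIV" and V: "open V" "V \<noteq> {}"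
  shows "\<exists>x\<in>V. x \<notin> Zr"
proof -
  obtain i where i: "\<And>p. i p \<in> vb_index E" "\<And>p. p \<in> vb_open E (i p)" using vb_cover by metis
  obtain c where c: "\<And>p. c p \<in> A" "\<And>p. p \<in> fst (c p)" using chart_exists by metis
  show ?thesis
  proof (rule locally_analytic_complement_dense[OF conn Z _ V, of "\<lambda>p. vb_open E (i p) \<inter> fst (c p)" "\<lambda>p j x. \<Phi> (i p, c p) x $ j"], intro conjI allI)
    fix p
    show "open (vb_open E (i p) \<inter> fst (c p))" using vb_open[OF i(1)] chart_open(1)[OF c(1)] by blast
    show "p \<in> vb_open E (i p) \<inter> fst (c p)" using i(2) c(2) by blast
    show "holomorphic_fun A (vb_open E (i p) \<inter> fst (c p)) (\<lambda>x. \<Phi> (i p, c p) x $ j)" for j by (rule \<Phi>_holf[OF i(1) c(1)])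
    have "x \<in> Zr \<longleftrightarrow> (\<forall>j. \<Phi> (i p, c p) x $ j = 0)" if "x \<in> vb_open E (i p) \<inter> fst (c p)" for x
      using Zr_iff[OF i(1) c(1), of x p p] that by (simp add: vec_eq_iff)
    then show "Zr \<inter> (vb_open E (i p) \<inter> fst (c p)) = {x \<in> vb_open E (i p) \<inter> fst (c p). \<forall>j. \<Phi> (i p, c p) x $ j = 0}"
      by blast
  qed
qed

definition vec1 :: "complex^((2 \<times> 2) \<times> 1) \<Rightarrow> complex^(2 \<times> 2)" where
  "vec1 w = (\<chi> p. w $ (p, 1))"

lemma vec1_nth [simp]: "vec1 w $ p = w $ (p, 1)"
  by (simp add: vec1_def)

lemma vec1_eq_iff: "vec1 w = vec1 w' \<longleftrightarrow> w = w'"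
  unfolding vec_eq_iff vec1_nth by (metis num1_eq1 surj_pair)

lemma vec1_eq_0_iff: "vec1 w = 0 \<longleftrightarrow> w = 0"
  unfolding vec1_eq_iff[of w 0, symmetric] by (simp add: vec1_def vec_eq_iff)

lemma vec1_scale: "vec1 (a *s w) = a *s vec1 w"
  by (simp add: vec_eq_iff)

end

section \<open>Decompositions whose first factor vanishes in codimension two\<close>

locale co_Higgs_decomposition = tracefree_co_Higgs A E \<Phi>
  for A :: "('a::t2_space, 'n::finite) chart set" and E :: "('i, 'a, 2) vbundle"
    and \<Phi> :: "'i \<times> ('a, 'n) chart \<Rightarrow> 'a \<Rightarrow> complex^((2 \<times> 2) \<times> 'n)" +
  fixes L :: "('l, 'a, 1) vbundle" and \<phi> :: "'i \<times> 'l \<Rightarrow> 'a \<Rightarrow> complex^((2 \<times> 2) \<times> 1)"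
    and \<xi> :: "('a, 'n) chart \<times> 'l \<Rightarrow> 'a \<Rightarrow> complex^('n \<times> 1)"
  assumes dec: "decomposition A E \<Phi> L \<phi> \<xi>"
    and codim: "codim_at_least A 2 (zero_set (tensor_bundle (End_bundle E) L) \<phi>)"
    and conn: "connected (UNIV :: 'a set)" and nonzero: "Zr \<noteq> UNIV"
begin

sublocale L: vbundle_on A L
  by unfold_locales (use dec in \<open>simp add: decomposition_def\<close>)

abbreviation EL where "EL \<equiv> tensor_bundle (End_bundle E) L"

lemma EL_simps: "vb_index EL = vb_index E \<times> vb_index L" "vb_open EL (i, l) = vb_open E i \<inter> vb_open L l"
  "vb_trans EL (i, l) (j, k) x $ p $ q = T i j x $ fst p $ fst q * vb_trans L l k x $ snd p $ snd q"
  by (simp_all add: tensor_bundle_def End_bundle_def)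

lemma \<phi>_H0: "\<phi> \<in> H0 A EL"
  using dec by (simp add: decomposition_def H0_tracefree_def)

lemma \<phi>_holf: "i \<in> vb_index E \<Longrightarrow> l \<in> vb_index L \<Longrightarrow> holomorphic_fun A (vb_open E i \<inter> vb_open L l) (\<lambda>x. \<phi> (i, l) x $ p)"
  using H0_holf[OF \<phi>_H0, of "(i, l)" p] by (simp add: EL_simps)

lemma \<phi>_trans:
  assumes "i \<in> vb_index E" "l \<in> vb_index L" "j \<in> vb_index E" "k \<in> vb_index L" "x \<in> vb_open E i" "x \<in> vb_open L l" "x \<in> vb_open E j" "x \<in> vb_open L k"
  shows "vec1 (\<phi> (i, l) x) = vb_trans L l k x $ 1 $ 1 *s (T i j x *v vec1 (\<phi> (j, k) x))"
proof -
  have e: "\<phi> (i, l) x = vb_trans EL (i, l) (j, k) x *v \<phi> (j, k) x"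
    by (rule H0_trans[OF \<phi>_H0]) (use assms in \<open>simp_all add: EL_simps(1,2)\<close>)
  have "\<phi> (i, l) x $ (p, 1) = vb_trans L l k x $ 1 $ 1 * (T i j x *v vec1 (\<phi> (j, k) x)) $ p" for p
    unfolding e matrix_vector_mult_prod_1 EL_simps(3)
    by (simp add: matrix_vector_mult_def sum_distrib_left mult_ac)
  then show ?thesis by (simp add: vec_eq_iff)
qed

lemma \<phi>_frame:
  assumes "i \<in> vb_index E" "l \<in> vb_index L" "j \<in> vb_index E" "x \<in> vb_open E i" "x \<in> vb_open L l" "x \<in> vb_open E j"
  shows "vec1 (\<phi> (i, l) x) = T i j x *v vec1 (\<phi> (j, l) x)"
  using \<phi>_trans[OF assms(1-3) assms(2) assms(4-6) assms(5)] L.vb_self[OF assms(2,5)] by (simp add: mat_def)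

lemma \<phi>_line:
  assumes "i \<in> vb_index E" "l \<in> vb_index L" "k \<in> vb_index L" "x \<in> vb_open E i" "x \<in> vb_open L l" "x \<in> vb_open L k"
  shows "vec1 (\<phi> (i, l) x) = vb_trans L l k x $ 1 $ 1 *s vec1 (\<phi> (i, k) x)"
  using \<phi>_trans[OF assms(1,2,1,3,4,5,4,6)] T_self_vec[OF assms(1,4)] by simp

lemma \<xi>_holf:
  assumes "c \<in> A" "l \<in> vb_index L"
  shows "holomorphic_fun A (fst c \<inter> vb_open L l) (\<lambda>x. \<xi> (c, l) x $ p)"
proof -
  have "\<xi> \<in> H0 A (tensor_bundle (tangent_bundle A) (dual_bundle L))" using dec by (simp add: decomposition_def)
  from H0_holf[OF this, of "(c, l)" p] show ?thesis
    using assms by (simp add: tensor_bundle_def tangent_bundle_def dual_bundle_def)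
qed

lemma \<Phi>_eq:
  assumes "i \<in> vb_index E" "c \<in> A" "l \<in> vb_index L" "x \<in> vb_open E i" "x \<in> fst c" "x \<in> vb_open L l"
  shows "\<Phi> (i, c) x $ (p, m) = \<phi> (i, l) x $ (p, 1) * \<xi> (c, l) x $ (m, 1)"
proof -
  have "\<Phi> (i, c) x = contract_tensor (\<phi> (i, l) x) (\<xi> (c, l) x)"
    using dec assms unfolding decomposition_def by blast
  then show ?thesis by (simp add: contract_tensor_def)
qed

lemma \<phi>_nonzero:
  assumes "i \<in> vb_index E" "l \<in> vb_index L" "x \<in> vb_open E i" "x \<in> vb_open L l" "x \<notin> Zr"
  shows "\<exists>p. \<phi> (i, l) x $ (p, 1) \<noteq> 0"
proof -
  obtain c where c: "c \<in> A" "x \<in> fst c" using chart_exists by blast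
  have "\<Phi> (i, c) x \<noteq> 0" using Zr_iff[OF assms(1) c(1) assms(3) c(2)] assms(5) by blast
  then obtain p m where pm: "\<Phi> (i, c) x $ (p, m) \<noteq> 0" by (auto simp: vec_eq_iff)
  have "\<phi> (i, l) x $ (p, 1) \<noteq> 0"
  proof
    assume "\<phi> (i, l) x $ (p, 1) = 0"
    with \<Phi>_eq[OF assms(1) c(1) assms(2,3) c(2) assms(4), of p m] pm show False by simp
  qed
  then show ?thesis by (rule exI)
qed

lemma \<phi>_primitive:
  assumes i: "i \<in> vb_index E" and l: "l \<in> vb_index L"
  shows "primitive (vb_open E i \<inter> vb_open L l) (\<lambda>p x. \<phi> (i, l) x $ (p, 1))"
proof (rule codim_two_primitive)
  show "open (vb_open E i \<inter> vb_open L l)" using vb_open[OF i] L.vb_open[OF l] by blast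
  show "holomorphic_fun A (vb_open E i \<inter> vb_open L l) (\<lambda>x. \<phi> (i, l) x $ (k, 1))" for k by (rule \<phi>_holf[OF i l])
  show "\<exists>x\<in>V. \<exists>k. \<phi> (i, l) x $ (k, 1) \<noteq> 0" if V: "open V" "V \<noteq> {}" "V \<subseteq> vb_open E i \<inter> vb_open L l" for V
  proof -
    obtain x where "x \<in> V" "x \<notin> Zr" using Zr_complement_dense[OF conn nonzero V(1,2)] by blast
    then show ?thesis using \<phi>_nonzero[OF i l, of x] V(3) by blast
  qed
  have "x \<in> zero_set EL \<phi> \<longleftrightarrow> (\<forall>k. \<phi> (i, l) x $ (k, 1) = 0)" if "x \<in> vb_open E i \<inter> vb_open L l" for x
  proof -
    have "x \<in> zero_set EL \<phi> \<longleftrightarrow> \<phi> (i, l) x = 0"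
      by (rule zero_set_iff[OF \<phi>_H0]) (use i l that in \<open>simp_all add: EL_simps(1,2)\<close>)
    also have "\<dots> \<longleftrightarrow> vec1 (\<phi> (i, l) x) = 0" by (simp add: vec1_eq_0_iff)
    finally show ?thesis by (simp add: vec_eq_iff)
  qed
  then show "zero_set EL \<phi> \<inter> (vb_open E i \<inter> vb_open L l) = {x \<in> vb_open E i \<inter> vb_open L l. \<forall>k. \<phi> (i, l) x $ (k, 1) = 0}"
    by blast
  \<comment> \<open>Every regular point of the zero set has codimension at least 2, which rules out
    1.\<close>
  show "\<not> regular_point A (zero_set EL \<phi>) 1 q" for q
    using codim unfolding codim_at_least_def by fastforce
qed

end

section \<open>Comparison of two decompositions\<close>

locale two_decompositions = D: co_Higgs_decomposition A E \<Phi> L \<phi> \<xi> + D': co_Higgs_decomposition A E \<Phi> L' \<phi>' \<xi>'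
  for A :: "('a::t2_space, 'n::finite) chart set" and E :: "('i, 'a, 2) vbundle"
    and \<Phi> :: "'i \<times> ('a, 'n) chart \<Rightarrow> 'a \<Rightarrow> complex^((2 \<times> 2) \<times> 'n)"
    and L :: "('l, 'a, 1) vbundle" and \<phi> :: "'i \<times> 'l \<Rightarrow> 'a \<Rightarrow> complex^((2 \<times> 2) \<times> 1)"
    and \<xi> :: "('a, 'n) chart \<times> 'l \<Rightarrow> 'a \<Rightarrow> complex^('n \<times> 1)"
    and L' :: "('m, 'a, 1) vbundle" and \<phi>' :: "'i \<times> 'm \<Rightarrow> 'a \<Rightarrow> complex^((2 \<times> 2) \<times> 1)"
    and \<xi>' :: "('a, 'n) chart \<times> 'm \<Rightarrow> 'a \<Rightarrow> complex^('n \<times> 1)"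
begin

lemma dense: "open V \<Longrightarrow> V \<noteq> {} \<Longrightarrow> \<exists>x\<in>V. x \<notin> D.Zr"
  by (rule D.Zr_complement_dense[OF D.conn D.nonzero])

text \<open>Where \<open>\<Phi>\<close> is nonzero, \<open>\<phi>\<close> and \<open>\<phi>'\<close>
  are both proportional to one of its nonzero columns, hence parallel to each other. Both are
  primitive, so their ratio is a unit.\<close>

lemma ratio_in_frame:
  assumes i: "i \<in> vb_index E" and l: "l \<in> vb_index L" and m: "m \<in> vb_index L'"
  shows "\<exists>g. holomorphic_fun A (vb_open E i \<inter> vb_open L l \<inter> vb_open L' m) g \<and>
    (\<forall>x\<in>vb_open E i \<inter> vb_open L l \<inter> vb_open L' m. g x \<noteq> 0 \<and> D.vec1 (\<phi>' (i, m) x) = g x *s D.vec1 (\<phi> (i, l) x))"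
proof -
  let ?V = "vb_open E i \<inter> vb_open L l \<inter> vb_open L' m"
  have o: "open ?V" using D.vb_open[OF i] D.L.vb_open[OF l] D'.L.vb_open[OF m] by blast
  have p1: "D.primitive ?V (\<lambda>p x. \<phi> (i, l) x $ (p, 1))" by (rule D.primitive_subset[OF D.\<phi>_primitive[OF i l] o]) blast
  have p2: "D.primitive ?V (\<lambda>p x. \<phi>' (i, m) x $ (p, 1))" by (rule D.primitive_subset[OF D'.\<phi>_primitive[OF i m] o]) blast
  have "\<phi>' (i, m) x $ (p, 1) * \<phi> (i, l) x $ (q, 1) - \<phi>' (i, m) x $ (q, 1) * \<phi> (i, l) x $ (p, 1) = 0" if x: "x \<in> ?V" for x p q
  proof (rule D.holf_zero_dense[OF o _ _ x])
    show "holomorphic_fun A ?V (\<lambda>x. \<phi>' (i, m) x $ (p, 1) * \<phi> (i, l) x $ (q, 1) - \<phi>' (i, m) x $ (q, 1) * \<phi> (i, l) x $ (p, 1))"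
      by (intro D.holf_diff D.holf_mult o D.primitive_holf(1)[OF p1] D.primitive_holf(1)[OF p2])
    fix W assume W: "open W" "W \<noteq> {}" "W \<subseteq> ?V"
    then obtain y where y: "y \<in> W" "y \<notin> D.Zr" using dense by blast
    have yV: "y \<in> vb_open E i" "y \<in> vb_open L l" "y \<in> vb_open L' m" using y(1) W(3) by blast+
    obtain c where c: "c \<in> A" "y \<in> fst c" using D.chart_exists by blast
    have "\<Phi> (i, c) y \<noteq> 0" using D.Zr_iff[OF i c(1) yV(1) c(2)] y(2) by blast
    then obtain r b where rb: "\<Phi> (i, c) y $ (r, b) \<noteq> 0" by (auto simp: vec_eq_iff)
    let ?s = "\<xi> (c, l) y $ (b, 1)" and ?s' = "\<xi>' (c, m) y $ (b, 1)"
    have a: "\<Phi> (i, c) y $ (p, b) = \<phi> (i, l) y $ (p, 1) * ?s" for p by (rule D.\<Phi>_eq[OF i c(1) l yV(1) c(2) yV(2)])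
    have a': "\<Phi> (i, c) y $ (p, b) = \<phi>' (i, m) y $ (p, 1) * ?s'" for p by (rule D'.\<Phi>_eq[OF i c(1) m yV(1) c(2) yV(3)])
    have s0: "?s \<noteq> 0" "?s' \<noteq> 0" using rb a[of r] a'[of r] by auto
    have "(\<phi>' (i, m) y $ (p, 1) * ?s') * (\<phi> (i, l) y $ (q, 1) * ?s) = (\<phi>' (i, m) y $ (q, 1) * ?s') * (\<phi> (i, l) y $ (p, 1) * ?s)"
      unfolding a[symmetric] a'[symmetric] by (rule mult.commute)
    then have "(?s * ?s') * (\<phi>' (i, m) y $ (p, 1) * \<phi> (i, l) y $ (q, 1) - \<phi>' (i, m) y $ (q, 1) * \<phi> (i, l) y $ (p, 1)) = 0"
      by (simp add: algebra_simps)
    then show "\<exists>x\<in>W. \<phi>' (i, m) x $ (p, 1) * \<phi> (i, l) x $ (q, 1) - \<phi>' (i, m) x $ (q, 1) * \<phi> (i, l) x $ (p, 1) = 0"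
      using s0 y(1) by (intro bexI[of _ y]) simp_all
  qed
  then have "\<exists>g. holomorphic_fun A ?V g \<and> (\<forall>y\<in>?V. g y \<noteq> 0) \<and> (\<forall>y\<in>?V. \<forall>k. \<phi>' (i, m) y $ (k, 1) = g y * \<phi> (i, l) y $ (k, 1))"
    by (intro D.primitive_unit[OF p1 p2]) simp
  then show ?thesis by (simp add: vec_eq_iff) blast
qed

lemma scalar_eq:
  assumes "a *s D.vec1 w = b *s D.vec1 w" "w $ (p, 1) \<noteq> 0"
  shows "a = b"
  using arg_cong[OF assms(1), of "\<lambda>v. v $ p"] assms(2) by simp

text \<open>A frame change of \<open>E\<close> acts on both sections by the same linear map, so the
  ratio does not depend on the frame of \<open>E\<close> and only the frames of \<open>L\<close> and
  \<open>L'\<close> remain.\<close>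

lemma ratio:
  obtains G where "\<And>l m. l \<in> vb_index L \<Longrightarrow> m \<in> vb_index L' \<Longrightarrow> holomorphic_fun A (vb_open L l \<inter> vb_open L' m) (G m l)"
    "\<And>l m x. l \<in> vb_index L \<Longrightarrow> m \<in> vb_index L' \<Longrightarrow> x \<in> vb_open L l \<Longrightarrow> x \<in> vb_open L' m \<Longrightarrow> G m l x \<noteq> 0"
    "\<And>i l m x. i \<in> vb_index E \<Longrightarrow> l \<in> vb_index L \<Longrightarrow> m \<in> vb_index L' \<Longrightarrow> x \<in> vb_open E i \<Longrightarrow> x \<in> vb_open L l \<Longrightarrow> x \<in> vb_open L' m \<Longrightarrow>
       D.vec1 (\<phi>' (i, m) x) = G m l x *s D.vec1 (\<phi> (i, l) x)"
proof -
  define P where "P i l m g \<longleftrightarrow> holomorphic_fun A (vb_open E i \<inter> vb_open L l \<inter> vb_open L' m) g \<and>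
    (\<forall>x\<in>vb_open E i \<inter> vb_open L l \<inter> vb_open L' m. g x \<noteq> 0 \<and> D.vec1 (\<phi>' (i, m) x) = g x *s D.vec1 (\<phi> (i, l) x))" for i l m g
  define g where "g i l m = (SOME g. P i l m g)" for i l m
  have Pg: "P i l m (g i l m)" if "i \<in> vb_index E" "l \<in> vb_index L" "m \<in> vb_index L'" for i l m
  proof -
    have "\<exists>g. P i l m g" unfolding P_def by (rule ratio_in_frame[OF that])
    from someI_ex[OF this] show ?thesis by (simp only: g_def)
  qed
  have gh: "holomorphic_fun A (vb_open E i \<inter> vb_open L l \<inter> vb_open L' m) (g i l m)"
    if "i \<in> vb_index E" "l \<in> vb_index L" "m \<in> vb_index L'" for i l m using Pg[OF that] by (simp add: P_def)
  have g0: "g i l m x \<noteq> 0" and ge: "D.vec1 (\<phi>' (i, m) x) = g i l m x *s D.vec1 (\<phi> (i, l) x)"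
    if "i \<in> vb_index E" "l \<in> vb_index L" "m \<in> vb_index L'" "x \<in> vb_open E i" "x \<in> vb_open L l" "x \<in> vb_open L' m" for i l m x
    using Pg[OF that(1-3)] that(4-6) by (simp_all add: P_def)
  obtain ix where ix: "\<And>x. ix x \<in> vb_index E" "\<And>x. x \<in> vb_open E (ix x)" using D.vb_cover by metis
  \<comment> \<open>A frame of \<open>E\<close> is chosen around each point separately;
    \<open>Gg\<close> shows that the choice is immaterial, which also yields holomorphy.\<close>
  define G where "G m l x = g (ix x) l m x" for m l x
  have indep: "g i l m x - g j l m x = 0"
    if i: "i \<in> vb_index E" and j: "j \<in> vb_index E" and l: "l \<in> vb_index L" and m: "m \<in> vb_index L'"
      and x: "x \<in> (vb_open E i \<inter> vb_open L l \<inter> vb_open L' m) \<inter> (vb_open E j \<inter> vb_open L l \<inter> vb_open L' m)" for i j l m x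
  proof -
    let ?V = "(vb_open E i \<inter> vb_open L l \<inter> vb_open L' m) \<inter> (vb_open E j \<inter> vb_open L l \<inter> vb_open L' m)"
    have o: "open ?V" using D.vb_open[OF i] D.vb_open[OF j] D.L.vb_open[OF l] D'.L.vb_open[OF m] by blast
    show ?thesis
    proof (rule D.holf_zero_dense[OF o _ _ x])
      show "holomorphic_fun A ?V (\<lambda>x. g i l m x - g j l m x)"
        by (intro D.holf_diff o D.holf_subset[OF gh[OF i l m]] D.holf_subset[OF gh[OF j l m]]) auto
      fix W assume W: "open W" "W \<noteq> {}" "W \<subseteq> ?V"
      then obtain y where y: "y \<in> W" "y \<notin> D.Zr" using dense by blast
      have yV: "y \<in> vb_open E i" "y \<in> vb_open E j" "y \<in> vb_open L l" "y \<in> vb_open L' m" using y(1) W(3) by blast+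
      obtain p where p: "\<phi> (i, l) y $ (p, 1) \<noteq> 0" using D.\<phi>_nonzero[OF i l yV(1,3) y(2)] by blast
      have "g i l m y *s D.vec1 (\<phi> (i, l) y) = D.vec1 (\<phi>' (i, m) y)" using ge[OF i l m yV(1,3,4)] by simp
      also have "\<dots> = D.T i j y *v (g j l m y *s D.vec1 (\<phi> (j, l) y))"
        unfolding D'.\<phi>_frame[OF i m j yV(1,4,2)] ge[OF j l m yV(2,3,4)] ..
      also have "\<dots> = g j l m y *s D.vec1 (\<phi> (i, l) y)"
        unfolding D.\<phi>_frame[OF i l j yV(1,3,2)] by (simp add: vector_scalar_commute)
      finally have "g i l m y = g j l m y" by (rule scalar_eq[OF _ p])
      then show "\<exists>x\<in>W. g i l m x - g j l m x = 0" using y(1) by (intro bexI[of _ y]) simp_all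
    qed
  qed
  have Gg: "G m l x = g i l m x" if "i \<in> vb_index E" "l \<in> vb_index L" "m \<in> vb_index L'" "x \<in> vb_open E i" "x \<in> vb_open L l" "x \<in> vb_open L' m" for i l m x
    using indep[OF ix(1)[of x] that(1-3), of x] ix(2)[of x] that unfolding G_def by simp
  show ?thesis
  proof (rule that[of G])
    fix l m assume l: "l \<in> vb_index L" and m: "m \<in> vb_index L'"
    have o: "open (vb_open L l \<inter> vb_open L' m)" using D.L.vb_open[OF l] D'.L.vb_open[OF m] by blast
    show "holomorphic_fun A (vb_open L l \<inter> vb_open L' m) (G m l)"
    proof (rule D.holf_local[OF o])
      fix p assume p: "p \<in> vb_open L l \<inter> vb_open L' m"
      let ?N = "vb_open E (ix p) \<inter> vb_open L l \<inter> vb_open L' m"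
      show "\<exists>N h. open N \<and> p \<in> N \<and> N \<subseteq> vb_open L l \<inter> vb_open L' m \<and> holomorphic_fun A N h \<and> (\<forall>x\<in>N. G m l x = h x)"
      proof (intro exI conjI ballI)
        show "open ?N" using D.vb_open[OF ix(1)] o by (simp add: Int_assoc open_Int)
        show "p \<in> ?N" using p ix(2) by blast
        show "holomorphic_fun A ?N (g (ix p) l m)" by (rule gh[OF ix(1) l m])
        show "G m l x = g (ix p) l m x" if "x \<in> ?N" for x by (rule Gg[OF ix(1) l m]) (use that in auto)
      qed blast
    qed
    show "G m l x \<noteq> 0" if "x \<in> vb_open L l" "x \<in> vb_open L' m" for x
      unfolding G_def by (rule g0[OF ix(1) l m ix(2) that])
    show "D.vec1 (\<phi>' (i, m) x) = G m l x *s D.vec1 (\<phi> (i, l) x)"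
      if "i \<in> vb_index E" "x \<in> vb_open E i" "x \<in> vb_open L l" "x \<in> vb_open L' m" for i x
      unfolding Gg[OF that(1) l m that(2-4)] by (rule ge[OF that(1) l m that(2-4)])
  qed
qed

lemma matrix_1_mult: "(M ** N) $ a $ b = M $ 1 $ 1 * N $ 1 $ 1" for M N :: "complex^1^1"
  by (simp add: matrix_matrix_mult_def num1_eq1[of a] num1_eq1[of b])

lemma invertible_1_iff: "invertible M \<longleftrightarrow> M $ 1 $ 1 \<noteq> 0" for M :: "complex^1^1"
proof
  assume "invertible M"
  then obtain N where "M ** N = mat 1" unfolding invertible_def by blast
  then have "(M ** N) $ 1 $ 1 = (1::complex)" by (simp add: mat_def)
  then show "M $ 1 $ 1 \<noteq> 0" unfolding matrix_1_mult by auto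
next
  assume "M $ 1 $ 1 \<noteq> 0"
  then show "invertible M"
    unfolding invertible_def by (intro exI[of _ "\<chi> a b. inverse (M $ 1 $ 1)"]) (simp add: vec_eq_iff matrix_1_mult mat_def num1_eq1)
qed

text \<open>The ratio \<open>G\<close> of \<open>\<phi>'\<close> and \<open>\<phi>\<close> is itself
  an isomorphism from \<open>L\<close> to \<open>L'\<close>. Its quotient by any other isomorphism
  \<open>\<psi>\<close> is a global holomorphic function, hence a constant \<open>t\<close>, and the
  relation between \<open>\<xi>\<close> and \<open>\<xi>'\<close> is forced by the equality of both
  products with \<open>\<Phi>\<close>.\<close>

theorem unique_decomposition:
  assumes comp: "compact (UNIV :: 'a set)"
  shows "(\<exists>\<psi>. bundle_iso A L L' \<psi>) \<and> (\<forall>\<psi>. bundle_iso A L L' \<psi> \<longrightarrow>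
    (\<exists>t. t \<noteq> 0 \<and> related_by_scaling A E L \<phi> \<xi> L' \<phi>' \<xi>' \<psi> t))"
proof -
  obtain G where Gh: "\<And>l m. l \<in> vb_index L \<Longrightarrow> m \<in> vb_index L' \<Longrightarrow> holomorphic_fun A (vb_open L l \<inter> vb_open L' m) (G m l)"
    and G0: "\<And>l m x. l \<in> vb_index L \<Longrightarrow> m \<in> vb_index L' \<Longrightarrow> x \<in> vb_open L l \<Longrightarrow> x \<in> vb_open L' m \<Longrightarrow> G m l x \<noteq> 0"
    and Ge: "\<And>i l m x. i \<in> vb_index E \<Longrightarrow> l \<in> vb_index L \<Longrightarrow> m \<in> vb_index L' \<Longrightarrow> x \<in> vb_open E i \<Longrightarrow> x \<in> vb_open L l \<Longrightarrow> x \<in> vb_open L' m \<Longrightarrow>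
       D.vec1 (\<phi>' (i, m) x) = G m l x *s D.vec1 (\<phi> (i, l) x)"
    by (rule ratio) (rule that)
  \<comment> \<open>The transition rules of \<open>\<phi>\<close> and \<open>\<phi>'\<close> force
    the one of \<open>G\<close>, first where \<open>\<phi>\<close> is nonzero and then by
    density.\<close>
  have Gt: "G m l x - vb_trans L' m m' x $ 1 $ 1 * G m' l' x * vb_trans L l' l x $ 1 $ 1 = 0"
    if l: "l \<in> vb_index L" and l': "l' \<in> vb_index L" and m: "m \<in> vb_index L'" and m': "m' \<in> vb_index L'"
      and x: "x \<in> (vb_open L l \<inter> vb_open L' m) \<inter> (vb_open L l' \<inter> vb_open L' m')" for l l' m m' x
  proof -
    let ?V = "(vb_open L l \<inter> vb_open L' m) \<inter> (vb_open L l' \<inter> vb_open L' m')"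
    have o: "open ?V" using D.L.vb_open l l' D'.L.vb_open m m' by blast
    show ?thesis
    proof (rule D.holf_zero_dense[OF o _ _ x])
      show "holomorphic_fun A ?V (\<lambda>x. G m l x - vb_trans L' m m' x $ 1 $ 1 * G m' l' x * vb_trans L l' l x $ 1 $ 1)"
        by (intro D.holf_diff D.holf_mult o D.holf_subset[OF Gh[OF l m]] D.holf_subset[OF Gh[OF l' m']]
            D.holf_subset[OF D'.L.vb_holf[OF m m']] D.holf_subset[OF D.L.vb_holf[OF l' l]]) auto
      fix W assume W: "open W" "W \<noteq> {}" "W \<subseteq> ?V"
      then obtain y where y: "y \<in> W" "y \<notin> D.Zr" using dense by blast
      have yV: "y \<in> vb_open L l" "y \<in> vb_open L' m" "y \<in> vb_open L l'" "y \<in> vb_open L' m'" using y(1) W(3) by blast+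
      obtain i where i: "i \<in> vb_index E" "y \<in> vb_open E i" using D.vb_cover by blast
      obtain p where p: "\<phi> (i, l) y $ (p, 1) \<noteq> 0" using D.\<phi>_nonzero[OF i(1) l i(2) yV(1) y(2)] by blast
      let ?w = "D.vec1 (\<phi> (i, l) y)"
      have "G m l y *s ?w = D.vec1 (\<phi>' (i, m) y)" using Ge[OF i(1) l m i(2) yV(1,2)] by simp
      also have "\<dots> = vb_trans L' m m' y $ 1 $ 1 *s (G m' l' y *s (vb_trans L l' l y $ 1 $ 1 *s ?w))"
        unfolding D'.\<phi>_line[OF i(1) m m' i(2) yV(2,4)] Ge[OF i(1) l' m' i(2) yV(3,4)] D.\<phi>_line[OF i(1) l' l i(2) yV(3,1)] ..
      also have "\<dots> = (vb_trans L' m m' y $ 1 $ 1 * G m' l' y * vb_trans L l' l y $ 1 $ 1) *s ?w" by (simp add: mult.assoc)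
      finally have "G m l y = vb_trans L' m m' y $ 1 $ 1 * G m' l' y * vb_trans L l' l y $ 1 $ 1"
        by (rule scalar_eq[OF _ p])
      then show "\<exists>x\<in>W. G m l x - vb_trans L' m m' x $ 1 $ 1 * G m' l' x * vb_trans L l' l x $ 1 $ 1 = 0"
        using y(1) by (intro bexI[of _ y]) simp_all
    qed
  qed
  have "bundle_iso A L L' (\<lambda>m l x. \<chi> a b. G m l x)"
    unfolding bundle_iso_def
  proof (intro conjI ballI allI)
    fix l m assume l: "l \<in> vb_index L" and m: "m \<in> vb_index L'"
    show "holomorphic_fun A (vb_open L l \<inter> vb_open L' m) (\<lambda>x. (\<chi> a b. G m l x) $ a $ b)" for a b :: 1
      using Gh[OF l m] by simp
    show "invertible ((\<chi> a b. G m l x) :: complex^1^1)" if "x \<in> vb_open L l \<inter> vb_open L' m" for x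
      using G0[OF l m] that by (simp add: invertible_1_iff)
  next
    fix l l' m m' x assume a: "l \<in> vb_index L" "l' \<in> vb_index L" "m \<in> vb_index L'" "m' \<in> vb_index L'"
      and x: "x \<in> vb_open L l \<inter> vb_open L l' \<inter> vb_open L' m \<inter> vb_open L' m'"
    have "x \<in> (vb_open L l \<inter> vb_open L' m) \<inter> (vb_open L l' \<inter> vb_open L' m')" using x by blast
    from Gt[OF a this] show "(\<chi> a b. G m l x) = vb_trans L' m m' x ** (\<chi> a b. G m' l' x) ** vb_trans L l' l x"
      by (simp add: vec_eq_iff matrix_1_mult)
  qed
  moreover have "\<exists>t. t \<noteq> 0 \<and> related_by_scaling A E L \<phi> \<xi> L' \<phi>' \<xi>' \<psi> t" if iso: "bundle_iso A L L' \<psi>" for \<psi>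
  proof -
    have \<psi>h: "holomorphic_fun A (vb_open L l \<inter> vb_open L' m) (\<lambda>x. \<psi> m l x $ 1 $ 1)" if "l \<in> vb_index L" "m \<in> vb_index L'" for l m
      using iso that unfolding bundle_iso_def by blast
    have \<psi>0: "\<psi> m l x $ 1 $ 1 \<noteq> 0" if "l \<in> vb_index L" "m \<in> vb_index L'" "x \<in> vb_open L l" "x \<in> vb_open L' m" for l m x
      using iso that unfolding bundle_iso_def invertible_1_iff by blast
    have \<psi>t: "\<psi> m l x $ 1 $ 1 = vb_trans L' m m' x $ 1 $ 1 * \<psi> m' l' x $ 1 $ 1 * vb_trans L l' l x $ 1 $ 1"
      if "l \<in> vb_index L" "l' \<in> vb_index L" "m \<in> vb_index L'" "m' \<in> vb_index L'"
        "x \<in> vb_open L l \<inter> vb_open L l' \<inter> vb_open L' m \<inter> vb_open L' m'" for l l' m m' x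
    proof -
      have "\<psi> m l x = vb_trans L' m m' x ** \<psi> m' l' x ** vb_trans L l' l x"
        using iso that unfolding bundle_iso_def by blast
      then show ?thesis by (simp add: matrix_1_mult)
    qed
    obtain lx where lx: "\<And>x. lx x \<in> vb_index L" "\<And>x. x \<in> vb_open L (lx x)" using D.L.vb_cover by metis
    obtain mx where mx: "\<And>x. mx x \<in> vb_index L'" "\<And>x. x \<in> vb_open L' (mx x)" using D'.L.vb_cover by metis
    \<comment> \<open>The frames are chosen pointwise. As \<open>G\<close> and \<open>\<psi>\<close>
      transform with the same factors, their quotient is the same in all frames.\<close>
    define \<tau> where "\<tau> x = G (mx x) (lx x) x / \<psi> (mx x) (lx x) x $ 1 $ 1" for x
    have \<tau>: "\<tau> x = G m l x / \<psi> m l x $ 1 $ 1"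
      if l: "l \<in> vb_index L" and m: "m \<in> vb_index L'" and x: "x \<in> vb_open L l" "x \<in> vb_open L' m" for l m x
    proof -
      have "vb_trans L' (mx x) m x $ 1 $ 1 * \<psi> m l x $ 1 $ 1 * vb_trans L l (lx x) x $ 1 $ 1 \<noteq> 0"
        using \<psi>0[OF lx(1) mx(1) lx(2) mx(2), of x] \<psi>t[OF lx(1) l mx(1) m, of x x x] lx(2) mx(2) x by simp
      moreover have "G (mx x) (lx x) x = vb_trans L' (mx x) m x $ 1 $ 1 * G m l x * vb_trans L l (lx x) x $ 1 $ 1"
        using Gt[OF lx(1) l mx(1) m, of x x x] lx(2) mx(2) x by simp
      moreover have "\<psi> (mx x) (lx x) x $ 1 $ 1 = vb_trans L' (mx x) m x $ 1 $ 1 * \<psi> m l x $ 1 $ 1 * vb_trans L l (lx x) x $ 1 $ 1"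
        by (rule \<psi>t[OF lx(1) l mx(1) m]) (use lx(2) mx(2) x in blast)
      ultimately show ?thesis by (simp add: \<tau>_def)
    qed
    have "holomorphic_fun A UNIV \<tau>"
    proof (rule D.holf_local[OF open_UNIV])
      fix p
      let ?N = "vb_open L (lx p) \<inter> vb_open L' (mx p)"
      have o: "open ?N" using D.L.vb_open[OF lx(1)] D'.L.vb_open[OF mx(1)] by blast
      show "\<exists>N g. open N \<and> p \<in> N \<and> N \<subseteq> UNIV \<and> holomorphic_fun A N g \<and> (\<forall>x\<in>N. \<tau> x = g x)"
      proof (intro exI conjI ballI)
        show "open ?N" "p \<in> ?N" using o lx(2) mx(2) by auto
        show "holomorphic_fun A ?N (\<lambda>x. G (mx p) (lx p) x / \<psi> (mx p) (lx p) x $ 1 $ 1)"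
          by (intro D.holf_divide o Gh \<psi>h lx(1) mx(1)) (use \<psi>0[OF lx(1) mx(1)] in blast)
        show "\<tau> x = G (mx p) (lx p) x / \<psi> (mx p) (lx p) x $ 1 $ 1" if "x \<in> ?N" for x
          by (rule \<tau>[OF lx(1) mx(1)]) (use that in auto)
      qed simp
    qed
    from D.holomorphic_constant[OF D.conn comp this] obtain t where t: "\<And>x. \<tau> x = t" by blast
    have G\<psi>: "G m l x = t * \<psi> m l x $ 1 $ 1" if "l \<in> vb_index L" "m \<in> vb_index L'" "x \<in> vb_open L l" "x \<in> vb_open L' m" for l m x
      using \<tau>[OF that] \<psi>0[OF that] t[of x] by (simp add: field_simps)
    \<comment> \<open>Some point is needed at which \<open>t\<close> is seen to be nonzero.\<close>
    obtain x0 :: 'a where True by blast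
    have t0: "t \<noteq> 0" using G\<psi>[OF lx(1) mx(1) lx(2) mx(2), of x0] G0[OF lx(1) mx(1) lx(2) mx(2), of x0] by auto
    have "related_by_scaling A E L \<phi> \<xi> L' \<phi>' \<xi>' \<psi> t"
      unfolding related_by_scaling_def
    proof (intro ballI conjI)
      fix l m i x assume l: "l \<in> vb_index L" and m: "m \<in> vb_index L'" and i: "i \<in> vb_index E"
        and x: "x \<in> vb_open E i \<inter> vb_open L l \<inter> vb_open L' m"
      have "D.vec1 (\<phi>' (i, m) x) = D.vec1 ((t * \<psi> m l x $ 1 $ 1) *s \<phi> (i, l) x)"
        using Ge[OF i l m, of x] G\<psi>[OF l m, of x] x by (simp add: D.vec1_scale)
      then show "\<phi>' (i, m) x = (t * \<psi> m l x $ 1 $ 1) *s \<phi> (i, l) x" by (simp only: D.vec1_eq_iff)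
    next
      fix l m c x assume l: "l \<in> vb_index L" and m: "m \<in> vb_index L'" and c: "c \<in> A"
        and x: "x \<in> fst c \<inter> vb_open L l \<inter> vb_open L' m"
      let ?V = "fst c \<inter> vb_open L l \<inter> vb_open L' m"
      have o: "open ?V" using D.chart_open(1)[OF c] D.L.vb_open[OF l] D'.L.vb_open[OF m] by blast
      \<comment> \<open>Outside \<open>Zr\<close> a nonzero component of \<open>\<phi>\<close> can
        be cancelled from the two expressions for \<open>\<Phi>\<close>; the rest is
        density.\<close>
      have "G m l x * \<xi>' (c, m) x $ (b, 1) - \<xi> (c, l) x $ (b, 1) = 0" for b
      proof (rule D.holf_zero_dense[OF o _ _ x])
        show "holomorphic_fun A ?V (\<lambda>x. G m l x * \<xi>' (c, m) x $ (b, 1) - \<xi> (c, l) x $ (b, 1))"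
          by (intro D.holf_diff D.holf_mult o D.holf_subset[OF Gh[OF l m]] D.holf_subset[OF D.\<xi>_holf[OF c l]]
              D.holf_subset[OF D'.\<xi>_holf[OF c m]]) auto
        fix W assume W: "open W" "W \<noteq> {}" "W \<subseteq> ?V"
        then obtain y where y: "y \<in> W" "y \<notin> D.Zr" using dense by blast
        have yV: "y \<in> fst c" "y \<in> vb_open L l" "y \<in> vb_open L' m" using y(1) W(3) by blast+
        obtain i where i: "i \<in> vb_index E" "y \<in> vb_open E i" using D.vb_cover by blast
        obtain p where p: "\<phi> (i, l) y $ (p, 1) \<noteq> 0" using D.\<phi>_nonzero[OF i(1) l i(2) yV(2) y(2)] by blast
        have "\<phi> (i, l) y $ (p, 1) * \<xi> (c, l) y $ (b, 1) = \<phi>' (i, m) y $ (p, 1) * \<xi>' (c, m) y $ (b, 1)"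
          using D.\<Phi>_eq[OF i(1) c l i(2) yV(1,2), of p b] D'.\<Phi>_eq[OF i(1) c m i(2) yV(1,3), of p b] by simp
        also have "\<phi>' (i, m) y $ (p, 1) = G m l y * \<phi> (i, l) y $ (p, 1)"
          using arg_cong[OF Ge[OF i(1) l m i(2) yV(2,3)], of "\<lambda>v. v $ p"] by simp
        finally have eq: "\<phi> (i, l) y $ (p, 1) * \<xi> (c, l) y $ (b, 1) = G m l y * \<phi> (i, l) y $ (p, 1) * \<xi>' (c, m) y $ (b, 1)" .
        have "\<phi> (i, l) y $ (p, 1) * (G m l y * \<xi>' (c, m) y $ (b, 1) - \<xi> (c, l) y $ (b, 1)) =
            G m l y * \<phi> (i, l) y $ (p, 1) * \<xi>' (c, m) y $ (b, 1) - \<phi> (i, l) y $ (p, 1) * \<xi> (c, l) y $ (b, 1)"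
          by (simp add: algebra_simps)
        also have "\<dots> = 0" by (simp only: eq diff_self)
        finally have "\<phi> (i, l) y $ (p, 1) * (G m l y * \<xi>' (c, m) y $ (b, 1) - \<xi> (c, l) y $ (b, 1)) = 0" .
        then show "\<exists>x\<in>W. G m l x * \<xi>' (c, m) x $ (b, 1) - \<xi> (c, l) x $ (b, 1) = 0" using p y(1) by auto
      qed
      then have "\<xi>' (c, m) x $ (b, 1) = inverse (G m l x) * \<xi> (c, l) x $ (b, 1)" for b
        using G0[OF l m, of x] x by (simp add: field_simps)
      then have "\<xi>' (c, m) x $ q = inverse (G m l x) * \<xi> (c, l) x $ q" for q
        by (cases q) (metis num1_eq1)
      then show "\<xi>' (c, m) x = (inverse t * inverse (\<psi> m l x $ 1 $ 1)) *s \<xi> (c, l) x"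
        using G\<psi>[OF l m, of x] x by (simp add: vec_eq_iff inverse_mult_distrib)
    qed
    then show ?thesis using t0 by blast
  qed
  ultimately show ?thesis by blast
qed

end

text \<open>Connectedness and \<open>\<Phi> \<noteq> 0\<close> are what uniqueness rests on: for
  \<open>\<Phi> = 0\<close> the choice \<open>\<xi> = 0\<close> would put no condition on the line
  bundle, and on several components the constant could vary from one to the next. The pair is
  compared along every isomorphism of the line bundles, since sections of different bundles can be
  compared only through one.\<close>

theorem lemma2p1:
  fixes A :: "('a::t2_space, 'n::finite) chart set"
    and E :: "('i, 'a, 2) vbundle"
    and \<Phi> :: "'i \<times> ('a, 'n) chart \<Rightarrow> 'a \<Rightarrow> complex^((2 \<times> 2) \<times> 'n)"
  assumes "complex_manifold A"
    and "compact (UNIV :: 'a set)"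
    and "tracefree_co_Higgs_bundle A E \<Phi>"
  shows "(\<exists>(L :: (nat, 'a, 1) vbundle) \<phi> \<xi>. decomposition A E \<Phi> L \<phi> \<xi>) \<and>
    (connected (UNIV :: 'a set) \<and>
     zero_set (tensor_bundle (End_bundle E) (tangent_bundle A)) \<Phi> \<noteq> UNIV \<longrightarrow>
       (\<forall>(L :: ('l, 'a, 1) vbundle) \<phi> \<xi> (L' :: ('m, 'a, 1) vbundle) \<phi>' \<xi>'.
          decomposition A E \<Phi> L \<phi> \<xi> \<and>
          codim_at_least A 2 (zero_set (tensor_bundle (End_bundle E) L) \<phi>) \<and>
          decomposition A E \<Phi> L' \<phi>' \<xi>' \<and>
          codim_at_least A 2 (zero_set (tensor_bundle (End_bundle E) L') \<phi>') \<longrightarrow>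
            (\<exists>\<psi>. bundle_iso A L L' \<psi>) \<and>
            (\<forall>\<psi>. bundle_iso A L L' \<psi> \<longrightarrow>
               (\<exists>t. t \<noteq> 0 \<and> related_by_scaling A E L \<phi> \<xi> L' \<phi>' \<xi>' \<psi> t))))"
proof -
  have "vector_bundle A E"
    using assms(3) unfolding tracefree_co_Higgs_bundle_def co_Higgs_bundle_def by blast
  then interpret tracefree_co_Higgs A E \<Phi>
    using assms(1,3) by unfold_locales
  have "(\<exists>\<psi>. bundle_iso A L L' \<psi>) \<and>
      (\<forall>\<psi>. bundle_iso A L L' \<psi> \<longrightarrow> (\<exists>t. t \<noteq> 0 \<and> related_by_scaling A E L \<phi> \<xi> L' \<phi>' \<xi>' \<psi> t))"
    if base: "connected (UNIV :: 'a set)" "zero_set ET \<Phi> \<noteq> UNIV"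
      and dec: "decomposition A E \<Phi> L \<phi> \<xi>" "decomposition A E \<Phi> L' \<phi>' \<xi>'"
      and codim: "codim_at_least A 2 (zero_set (tensor_bundle (End_bundle E) L) \<phi>)"
        "codim_at_least A 2 (zero_set (tensor_bundle (End_bundle E) L') \<phi>')"
    for L :: "('l, 'a, 1) vbundle" and \<phi> \<xi> and L' :: "('m, 'a, 1) vbundle" and \<phi>' \<xi>'
  proof -
    interpret two_decompositions A E \<Phi> L \<phi> \<xi> L' \<phi>' \<xi>'
      using base dec codim by unfold_locales
    show ?thesis by (rule unique_decomposition[OF assms(2)])
  qed
  with exists_decomposition[OF assms(2)] show ?thesis by blast
qed

end
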